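(* For any symplectic $\mathbb{C}^*$-manifold $Y$ with contracting $\mathbb{C}^*$-action, $$H^*(Y)\cong H^*_{AS}(\mathrm{Core}(Y))\cong\check{H}^*(\mathrm{Core}(Y)),$$ where $H^*_{AS}$ denotes Alexander–Spanier cohomology and $\check{H}^*$ Čech cohomology. If $\mathrm{Core}(Y)$ is HLC, then these are isomorphic to the singular cohomology $H^*(\mathrm{Core}(Y))$. Moreover, $\mathrm{Core}(Y)$ is HLC if and only if each connected component $\mathfrak{F}_\alpha$ of the fixed locus admits an HLC neighbourhood in $\mathrm{Core}(Y)$.
   Context: A symplectic $\mathbb{C}^*$-manifold $(Y,\omega,I,\varphi)$ is a connected symplectic manifold $(Y,\omega)$ with an $\omega$-compatible almost complex structure $I$ and an $I$-pseudoholomorphic $\mathbb{C}^*$-action $\varphi$ (write $t\cdot y$) whose $S^1$-part is Hamiltonian, with moment map $H:Y\to\mathbb{R}$; the vector field of the subgroup $\mathbb{R}_+\subset\mathbb{C}^*$ is $X_{\mathbb{R}_+}=\nabla H$ for the metric $\omega(\cdot,I\cdot)$. The action is *contracting* if there is a compact subdomain $Y^{\mathrm{in}}\subset Y$ such that the $-X_{\mathbb{R}_+}$-flow from any point of $Y$ eventually enters and stays in $Y^{\mathrm{in}}$. The fixed locus $\mathfrak{F}=\mathrm{Crit}(H)=\sqcup_\alpha\mathfrak{F}_\alpha$ is decomposed into connected components. The core is $\mathrm{Core}(Y):=\{y\in Y:\lim_{\mathbb{C}^*\ni t\to\infty}t\cdot y\text{ exists}\}$. Manifolds are second countable. A space $C$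 is *HLC* (homologically locally connected) if for each neighbourhood $U\subset C$ of any $c\in C$, $c$ has a neighbourhood $V\subset U$ such that $\widetilde{H}_*(V)\to\widetilde{H}_*(U)$ vanishes in reduced singular homology. *)

theory Defs
  imports "HOL-Analysis.Analysis" "HOL-Homology.Homology"
begin

section \<open>Smooth manifolds\<close>

text \<open>The model spaces below are finite-dimensional, so that being smooth amounts to having
  iterated directional derivatives of all orders, all of them differentiable.\<close>

fun Ck_on :: "nat \<Rightarrow> 'e::real_normed_vector set \<Rightarrow> ('e \<Rightarrow> 'f::real_normed_vector) \<Rightarrow> bool" where
  "Ck_on 0 S f \<longleftrightarrow> continuous_on S f"
| "Ck_on (Suc k) S f \<longleftrightarrow> (\<forall>x\<in>S. f differentiable (at x)) \<and>
     (\<forall>v. Ck_on k S (\<lambda>x. frechet_derivative f (at x) v))"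

definition smooth_on :: "'e::real_normed_vector set \<Rightarrow> ('e \<Rightarrow> 'f::real_normed_vector) \<Rightarrow> bool" where
  "smooth_on S f \<longleftrightarrow> (\<forall>k. Ck_on k S f)"

text \<open>A chart is a pair \<open>(U, \<phi>)\<close>; the values of \<open>\<phi>\<close> outside \<open>U\<close> are irrelevant.\<close>

type_synonym ('a, 'e) chart = "'a set \<times> ('a \<Rightarrow> 'e)"

definition chart_inv :: "('a, 'e) chart \<Rightarrow> 'e \<Rightarrow> 'a" where
  "chart_inv c = inv_into (fst c) (snd c)"

definition transition :: "('a, 'e) chart \<Rightarrow> ('a, 'e) chart \<Rightarrow> 'e \<Rightarrow> 'e" where
  "transition c d = snd d \<circ> chart_inv c"

definition jacobian ::
    "('a, 'e::real_normed_vector) chart \<Rightarrow> ('a, 'e) chart \<Rightarrow> 'a \<Rightarrow> 'e \<Rightarrow> 'e" where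
  "jacobian c d y = frechet_derivative (transition c d) (at (snd c y))"

text \<open>The model space is an arbitrary finite-dimensional normed space rather than one of class
  \<open>euclidean_space\<close>, because the latter excludes dimension 0.\<close>

definition smooth_manifold :: "'a topology \<Rightarrow> ('a, 'e::real_normed_vector) chart set \<Rightarrow> bool" where
  "smooth_manifold X A \<longleftrightarrow>
     (\<exists>B::'e set. finite B \<and> span B = UNIV) \<and>
     Hausdorff_space X \<and> second_countable X \<and>
     topspace X = (\<Union>c\<in>A. fst c) \<and>
     (\<forall>c\<in>A. openin X (fst c) \<and> open (snd c ` fst c) \<and>
        homeomorphic_map (subtopology X (fst c)) (top_of_set (snd c ` fst c)) (snd c)) \<and>
     (\<forall>c\<in>A. \<forall>d\<in>A. smooth_on (snd c ` (fst c \<inter> fst d)) (transition c d))"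

definition smooth_function_on ::
    "('a, 'e::real_normed_vector) chart set \<Rightarrow> 'a set \<Rightarrow> ('a \<Rightarrow> real) \<Rightarrow> bool" where
  "smooth_function_on A W f \<longleftrightarrow> (\<forall>c\<in>A. smooth_on (snd c ` (fst c \<inter> W)) (f \<circ> chart_inv c))"

definition differential ::
    "('a \<Rightarrow> real) \<Rightarrow> ('a, 'e::real_normed_vector) chart \<Rightarrow> 'a \<Rightarrow> 'e \<Rightarrow> real" where
  "differential f c y = frechet_derivative (f \<circ> chart_inv c) (at (snd c y))"

text \<open>A compact codimension 0 submanifold with (possibly empty) smooth boundary.\<close>

definition compact_subdomain ::
    "'a topology \<Rightarrow> ('a, 'e::real_normed_vector) chart set \<Rightarrow> 'a set \<Rightarrow> bool" where
  "compact_subdomain X A D \<longleftrightarrow> compactin X D \<and>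
     (\<forall>p\<in>D. p \<in> X interior_of D \<or>
        (\<exists>W f. openin X W \<and> p \<in> W \<and> smooth_function_on A W f \<and>
           (\<forall>c\<in>A. p \<in> fst c \<longrightarrow> (\<exists>v. differential f c p v \<noteq> 0)) \<and>
           D \<inter> W = {y \<in> W. f y \<le> 0}))"


section \<open>Symplectic forms and almost complex structures\<close>

text \<open>A tensor field is given by its components in the charts of the atlas, subject to the usual
  transformation law: \<open>\<omega> c y v w\<close> is the value at \<open>y\<close> of the 2-form on the two tangent vectors
  which have coordinates \<open>v\<close> and \<open>w\<close> in the chart \<open>c\<close>, and \<open>J c y v\<close> is the coordinate vector
  in \<open>c\<close> of the image of the tangent vector with coordinates \<open>v\<close>. Only the values for \<open>c\<close> in the
  atlas and \<open>y\<close> in the domain of \<open>c\<close> matter.\<close>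

type_synonym ('a, 'e) two_form = "('a, 'e) chart \<Rightarrow> 'a \<Rightarrow> 'e \<Rightarrow> 'e \<Rightarrow> real"
type_synonym ('a, 'e) endo_field = "('a, 'e) chart \<Rightarrow> 'a \<Rightarrow> 'e \<Rightarrow> 'e"

definition is_two_form ::
    "('a, 'e::real_normed_vector) chart set \<Rightarrow> ('a, 'e) two_form \<Rightarrow> bool" where
  "is_two_form A \<omega> \<longleftrightarrow>
     (\<forall>c\<in>A. \<forall>y\<in>fst c. bilinear (\<omega> c y) \<and> (\<forall>v. \<omega> c y v v = 0)) \<and>
     (\<forall>c\<in>A. \<forall>v w. smooth_on (snd c ` fst c) (\<lambda>x. \<omega> c (chart_inv c x) v w)) \<and>
     (\<forall>c\<in>A. \<forall>d\<in>A. \<forall>y\<in>fst c \<inter> fst d. \<forall>v w.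
        \<omega> c y v w = \<omega> d y (jacobian c d y v) (jacobian c d y w))"

text \<open>For vector fields \<open>u, v, w\<close> which are constant in a chart, \<open>d\<omega>(u,v,w)\<close> is the cyclic sum of
  \<open>u(\<omega>(v,w))\<close>, since their Lie brackets vanish.\<close>

definition closed_form ::
    "('a, 'e::real_normed_vector) chart set \<Rightarrow> ('a, 'e) two_form \<Rightarrow> bool" where
  "closed_form A \<omega> \<longleftrightarrow>
     (\<forall>c\<in>A. \<forall>y\<in>fst c. \<forall>u v w.
        differential (\<lambda>z. \<omega> c z v w) c y u +
        differential (\<lambda>z. \<omega> c z w u) c y v +
        differential (\<lambda>z. \<omega> c z u v) c y w = 0)"

definition symplectic_form ::
    "('a, 'e::real_normed_vector) chart set \<Rightarrow> ('a, 'e) two_form \<Rightarrow> bool" where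
  "symplectic_form A \<omega> \<longleftrightarrow> is_two_form A \<omega> \<and> closed_form A \<omega> \<and>
     (\<forall>c\<in>A. \<forall>y\<in>fst c. \<forall>v. v \<noteq> 0 \<longrightarrow> (\<exists>w. \<omega> c y v w \<noteq> 0))"

definition almost_complex_structure ::
    "('a, 'e::real_normed_vector) chart set \<Rightarrow> ('a, 'e) endo_field \<Rightarrow> bool" where
  "almost_complex_structure A J \<longleftrightarrow>
     (\<forall>c\<in>A. \<forall>y\<in>fst c. linear (J c y) \<and> (\<forall>v. J c y (J c y v) = - v)) \<and>
     (\<forall>c\<in>A. \<forall>v. smooth_on (snd c ` fst c) (\<lambda>x. J c (chart_inv c x) v)) \<and>
     (\<forall>c\<in>A. \<forall>d\<in>A. \<forall>y\<in>fst c \<inter> fst d. \<forall>v.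
        jacobian c d y (J c y v) = J d y (jacobian c d y v))"

definition compatible_metric ::
    "('a, 'e) two_form \<Rightarrow> ('a, 'e) endo_field \<Rightarrow> ('a, 'e) two_form" where
  "compatible_metric \<omega> J c y v w = \<omega> c y v (J c y w)"

text \<open>\<open>J\<close> is compatible with \<open>\<omega>\<close> if \<open>\<omega>(\<cdot>, J\<cdot>)\<close> is a Riemannian metric.\<close>

definition compatible ::
    "('a, 'e::real_normed_vector) chart set \<Rightarrow> ('a, 'e) two_form \<Rightarrow> ('a, 'e) endo_field \<Rightarrow> bool" where
  "compatible A \<omega> J \<longleftrightarrow>
     (\<forall>c\<in>A. \<forall>y\<in>fst c.
        (\<forall>v w. compatible_metric \<omega> J c y v w = compatible_metric \<omega> J c y w v) \<and>
        (\<forall>v. v \<noteq> 0 \<longrightarrow> compatible_metric \<omega> J c y v v > 0))"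


section \<open>Symplectic \<open>\<complex>\<^sup>*\<close>-manifolds\<close>

text \<open>An action of \<open>\<complex>\<^sup>*\<close> is a function on \<open>complex\<close> whose value at 0 is irrelevant.\<close>

type_synonym 'a Cstar_action = "complex \<Rightarrow> 'a \<Rightarrow> 'a"

text \<open>The action map \<open>\<complex>\<^sup>* \<times> Y \<rightarrow> Y\<close> in a chart \<open>c\<close> of the source and a chart \<open>d\<close> of the target.\<close>

definition action_chart_dom ::
    "'a Cstar_action \<Rightarrow> ('a, 'e) chart \<Rightarrow> ('a, 'e) chart \<Rightarrow> (complex \<times> 'e) set" where
  "action_chart_dom act c d =
     {(t, x). t \<noteq> 0 \<and> x \<in> snd c ` fst c \<and> act t (chart_inv c x) \<in> fst d}"

definition action_chart ::
    "'a Cstar_action \<Rightarrow> ('a, 'e) chart \<Rightarrow> ('a, 'e) chart \<Rightarrow> complex \<times> 'e \<Rightarrow> 'e" where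
  "action_chart act c d = (\<lambda>(t, x). snd d (act t (chart_inv c x)))"

definition smooth_Cstar_action ::
    "'a topology \<Rightarrow> ('a, 'e::real_normed_vector) chart set \<Rightarrow> 'a Cstar_action \<Rightarrow> bool" where
  "smooth_Cstar_action X A act \<longleftrightarrow>
     (\<forall>y\<in>topspace X. act 1 y = y) \<and>
     (\<forall>s t. s \<noteq> 0 \<and> t \<noteq> 0 \<longrightarrow> (\<forall>y\<in>topspace X. act s (act t y) = act (s * t) y)) \<and>
     continuous_map (prod_topology (top_of_set (- {0})) X) X (\<lambda>(t, y). act t y) \<and>
     (\<forall>c\<in>A. \<forall>d\<in>A. smooth_on (action_chart_dom act c d) (action_chart act c d))"

text \<open>The action map \<open>\<complex>\<^sup>* \<times> Y \<rightarrow> Y\<close> is pseudoholomorphic for the product almost complex structure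
  on its source.\<close>

definition pseudoholomorphic_action ::
    "('a, 'e::real_normed_vector) chart set \<Rightarrow> ('a, 'e) endo_field \<Rightarrow> 'a Cstar_action \<Rightarrow> bool" where
  "pseudoholomorphic_action A J act \<longleftrightarrow>
     (\<forall>c\<in>A. \<forall>d\<in>A. \<forall>(t, x) \<in> action_chart_dom act c d. \<forall>\<tau> v.
        frechet_derivative (action_chart act c d) (at (t, x)) (\<i> * \<tau>, J c (chart_inv c x) v) =
        J d (act t (chart_inv c x)) (frechet_derivative (action_chart act c d) (at (t, x)) (\<tau>, v)))"

definition S1_field ::
    "'a Cstar_action \<Rightarrow> ('a, 'e::real_normed_vector) chart \<Rightarrow> 'a \<Rightarrow> 'e" where
  "S1_field act c y = vector_derivative (\<lambda>\<theta>. snd c (act (cis \<theta>) y)) (at 0)"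

definition Rplus_field ::
    "'a Cstar_action \<Rightarrow> ('a, 'e::real_normed_vector) chart \<Rightarrow> 'a \<Rightarrow> 'e" where
  "Rplus_field act c y = vector_derivative (\<lambda>s. snd c (act (of_real (exp s)) y)) (at 0)"

text \<open>The sign in \<open>dH = \<omega>(\<cdot>, X)\<close>, with \<open>X\<close> the vector field of the circle action, is the one for
  which the vector field of \<open>\<real>\<^sub>+\<close> is the gradient of \<open>H\<close>; see \<open>Rplus_field_gradient\<close> below.\<close>

definition moment_map ::
    "'a topology \<Rightarrow> ('a, 'e::real_normed_vector) chart set \<Rightarrow> ('a, 'e) two_form \<Rightarrow>
     'a Cstar_action \<Rightarrow> ('a \<Rightarrow> real) \<Rightarrow> bool" where
  "moment_map X A \<omega> act H \<longleftrightarrow> smooth_function_on A (topspace X) H \<and>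
     (\<forall>c\<in>A. \<forall>y\<in>fst c. \<forall>v. differential H c y v = \<omega> c y v (S1_field act c y))"

definition symplectic_Cstar_manifold ::
    "'a topology \<Rightarrow> ('a, 'e::real_normed_vector) chart set \<Rightarrow> ('a, 'e) two_form \<Rightarrow>
     ('a, 'e) endo_field \<Rightarrow> 'a Cstar_action \<Rightarrow> bool" where
  "symplectic_Cstar_manifold X A \<omega> J act \<longleftrightarrow>
     smooth_manifold X A \<and> connected_space X \<and> symplectic_form A \<omega> \<and>
     almost_complex_structure A J \<and> compatible A \<omega> J \<and>
     smooth_Cstar_action X A act \<and> pseudoholomorphic_action A J act \<and>
     (\<exists>H. moment_map X A \<omega> act H)"

text \<open>The flow of \<open>- X\<close>, for \<open>X\<close> the vector field of \<open>\<real>\<^sub>+\<close>, is the action of \<open>exp (- s)\<close>.\<close>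

definition contracting ::
    "'a topology \<Rightarrow> ('a, 'e::real_normed_vector) chart set \<Rightarrow> 'a Cstar_action \<Rightarrow> bool" where
  "contracting X A act \<longleftrightarrow>
     (\<exists>D. compact_subdomain X A D \<and>
        (\<forall>y\<in>topspace X. \<forall>\<^sub>F s in at_top. act (of_real (exp (- s))) y \<in> D))"

definition fixed_locus :: "'a topology \<Rightarrow> 'a Cstar_action \<Rightarrow> 'a set" where
  "fixed_locus X act = {y \<in> topspace X. \<forall>t. t \<noteq> 0 \<longrightarrow> act t y = y}"

definition core :: "'a topology \<Rightarrow> 'a Cstar_action \<Rightarrow> 'a set" where
  "core X act = {y \<in> topspace X. \<exists>z. limitin X (\<lambda>t. act t y) z at_infinity}"

lemma Rplus_field_gradient:
  assumes Y: "symplectic_Cstar_manifold X A \<omega> J act" and H: "moment_map X A \<omega> act H"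
    and c: "c \<in> A" and y: "y \<in> fst c"
  shows "compatible_metric \<omega> J c y (Rplus_field act c y) v = differential H c y v"
proof -
  let ?F = "action_chart act c c" and ?x = "snd c y"
  let ?D = "frechet_derivative ?F (at (1, ?x))"
  have man: "smooth_manifold X A" and act: "smooth_Cstar_action X A act"
    and hol: "pseudoholomorphic_action A J act" and comp: "compatible A \<omega> J"
    and acs: "almost_complex_structure A J"
    using Y by (auto simp: symplectic_Cstar_manifold_def)
  have U: "openin X (fst c)"
    and "homeomorphic_map (subtopology X (fst c)) (top_of_set (snd c ` fst c)) (snd c)"
    using man c by (auto simp: smooth_manifold_def)
  then have "inj_on (snd c) (topspace (subtopology X (fst c)))"
    by (simp add: homeomorphic_eq_everything_map)
  moreover have "topspace (subtopology X (fst c)) = fst c"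
    using openin_subset[OF U] by auto
  ultimately have inv: "chart_inv c ?x = y"
    using y by (simp add: chart_inv_def)
  have yX: "y \<in> topspace X"
    using U y openin_subset by blast
  then have one: "act 1 y = y"
    using act by (auto simp: smooth_Cstar_action_def)
  have dom: "(1, ?x) \<in> action_chart_dom act c c"
    using y one inv by (auto simp: action_chart_dom_def)
  have "Ck_on (Suc 0) (action_chart_dom act c c) ?F"
    using act c by (auto simp: smooth_Cstar_action_def smooth_on_def simp del: Ck_on.simps)
  then have "?F differentiable at (1, ?x)"
    using dom by auto
  then have D: "(?F has_derivative ?D) (at (1, ?x))"
    using frechet_derivative_works by blast
  have curve: "vector_derivative (\<lambda>s. snd c (act (g s) y)) (at 0) = ?D (g', 0)"
    if g: "(g has_vector_derivative g') (at 0)" and g1: "g 0 = 1" for g g'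
  proof -
    have "((\<lambda>s. (g s, ?x)) has_derivative (\<lambda>h. (h *\<^sub>R g', 0))) (at 0)"
      using g by (auto intro!: derivative_eq_intros simp: has_vector_derivative_def)
    then have "((?F \<circ> (\<lambda>s. (g s, ?x))) has_derivative (?D \<circ> (\<lambda>h. (h *\<^sub>R g', 0)))) (at 0)"
      by (rule diff_chain_at) (use D g1 in simp)
    moreover have "?D \<circ> (\<lambda>h. (h *\<^sub>R g', 0)) = (\<lambda>h. h *\<^sub>R ?D (g', 0))"
    proof
      fix h :: real
      have "?D (h *\<^sub>R (g', 0)) = h *\<^sub>R ?D (g', 0)"
        using has_derivative_linear[OF D] linear_cmul by blast
      then show "(?D \<circ> (\<lambda>h. (h *\<^sub>R g', 0))) h = h *\<^sub>R ?D (g', 0)" by simp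
    qed
    moreover have "?F \<circ> (\<lambda>s. (g s, ?x)) = (\<lambda>s. snd c (act (g s) y))"
      by (auto simp: action_chart_def inv)
    ultimately show ?thesis
      by (auto intro!: vector_derivative_at simp: has_vector_derivative_def)
  qed
  have "(cis has_vector_derivative \<i>) (at 0)"
    unfolding has_vector_derivative_def
    by (auto intro!: derivative_eq_intros simp: mult.commute scaleR_conv_of_real)
  then have S: "S1_field act c y = ?D (\<i>, 0)"
    unfolding S1_field_def by (rule curve) simp
  have "((\<lambda>s. complex_of_real (exp s)) has_vector_derivative 1) (at 0)"
    unfolding has_vector_derivative_def
    by (auto intro!: derivative_eq_intros simp: scaleR_conv_of_real)
  then have R: "Rplus_field act c y = ?D (1, 0)"
    unfolding Rplus_field_def by (rule curve) simp
  have "linear (J c y)"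
    using acs c y by (auto simp: almost_complex_structure_def)
  then have J0: "J c y 0 = 0"
    using linear_0 by blast
  have "?D (\<i> * 1, J c (chart_inv c ?x) 0) = J c (act 1 (chart_inv c ?x)) (?D (1, 0))"
    using hol c dom unfolding pseudoholomorphic_action_def by fastforce
  then have "S1_field act c y = J c y (Rplus_field act c y)"
    by (simp add: S R inv one J0)
  then have "differential H c y v = compatible_metric \<omega> J c y v (Rplus_field act c y)"
    using H c y by (simp add: moment_map_def compatible_metric_def)
  then show ?thesis
    using comp c y by (simp add: compatible_def)
qed


section \<open>Cohomology theories\<close>

text \<open>Throughout, \<open>G\<close> is a (multiplicatively written) abelian group of coefficients, and degrees
  are natural numbers, all groups being zero in negative degrees.\<close>

definition coboundaries ::
    "(nat \<Rightarrow> ('c, 'm) monoid_scheme) \<Rightarrow> (nat \<Rightarrow> 'c \<Rightarrow> 'c) \<Rightarrow> nat \<Rightarrow> 'c set" where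
  "coboundaries C \<delta> p = (case p of 0 \<Rightarrow> {\<one>\<^bsub>C 0\<^esub>} | Suc q \<Rightarrow> \<delta> q ` carrier (C q))"

definition cohomology_group ::
    "(nat \<Rightarrow> ('c, 'm) monoid_scheme) \<Rightarrow> (nat \<Rightarrow> 'c \<Rightarrow> 'c) \<Rightarrow> nat \<Rightarrow> 'c set monoid" where
  "cohomology_group C \<delta> p =
     subgroup_generated (C p) (kernel (C p) (C (Suc p)) (\<delta> p)) Mod coboundaries C \<delta> p"

subsection \<open>Singular cohomology\<close>

definition singular_cochain_group ::
    "'a topology \<Rightarrow> ('g, 'm) monoid_scheme \<Rightarrow> nat \<Rightarrow> ('a chain \<Rightarrow> 'g) monoid" where
  "singular_cochain_group X G p =
     \<lparr>carrier = hom (chain_group p X) G \<inter> extensional (carrier (chain_group p X)),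
      monoid.mult = (\<lambda>f g. \<lambda>c\<in>carrier (chain_group p X). f c \<otimes>\<^bsub>G\<^esub> g c),
      one = (\<lambda>c\<in>carrier (chain_group p X). \<one>\<^bsub>G\<^esub>)\<rparr>"

definition singular_coboundary :: "'a topology \<Rightarrow> nat \<Rightarrow> ('a chain \<Rightarrow> 'g) \<Rightarrow> 'a chain \<Rightarrow> 'g" where
  "singular_coboundary X p f =
     (\<lambda>c\<in>carrier (chain_group (Suc p) X). f (chain_boundary (Suc p) c))"

definition singular_cohomology_group ::
    "nat \<Rightarrow> 'a topology \<Rightarrow> ('g, 'm) monoid_scheme \<Rightarrow> ('a chain \<Rightarrow> 'g) set monoid" where
  "singular_cohomology_group p X G =
     cohomology_group (singular_cochain_group X G) (singular_coboundary X) p"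

subsection \<open>Cochains on tuples\<close>

text \<open>\<open>S p\<close> is a set of lists of length \<open>Suc p\<close>, the ordered \<open>p\<close>-simplices.\<close>

definition omit :: "nat \<Rightarrow> 's list \<Rightarrow> 's list" where
  "omit k xs = take k xs @ drop (Suc k) xs"

definition tuple_cochain_group ::
    "(nat \<Rightarrow> 's list set) \<Rightarrow> ('g, 'm) monoid_scheme \<Rightarrow> nat \<Rightarrow> ('s list \<Rightarrow> 'g) monoid" where
  "tuple_cochain_group S G p = product_group (S p) (\<lambda>_. G)"

definition tuple_coboundary ::
    "(nat \<Rightarrow> 's list set) \<Rightarrow> ('g, 'm) monoid_scheme \<Rightarrow> nat \<Rightarrow> ('s list \<Rightarrow> 'g) \<Rightarrow> 's list \<Rightarrow> 'g" where
  "tuple_coboundary S G p f =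
     (\<lambda>xs\<in>S (Suc p). finprod G (\<lambda>k. f (omit k xs) [^]\<^bsub>G\<^esub> ((- 1) ^ k :: int)) {..Suc p})"

definition open_cover :: "'a topology \<Rightarrow> 'a set set \<Rightarrow> bool" where
  "open_cover X \<U> \<longleftrightarrow> (\<forall>U\<in>\<U>. openin X U) \<and> \<Union>\<U> = topspace X"

subsection \<open>Alexander--Spanier cohomology\<close>

definition point_tuples :: "'a topology \<Rightarrow> nat \<Rightarrow> 'a list set" where
  "point_tuples X p = {xs. length xs = Suc p \<and> set xs \<subseteq> topspace X}"

definition locally_zero_cochains ::
    "'a topology \<Rightarrow> ('g, 'm) monoid_scheme \<Rightarrow> nat \<Rightarrow> ('a list \<Rightarrow> 'g) set" where
  "locally_zero_cochains X G p =
     {f \<in> carrier (tuple_cochain_group (point_tuples X) G p).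
        \<exists>\<U>. open_cover X \<U> \<and>
          (\<forall>U\<in>\<U>. \<forall>xs\<in>point_tuples X p. set xs \<subseteq> U \<longrightarrow> f xs = \<one>\<^bsub>G\<^esub>)}"

definition AS_cochain_group ::
    "'a topology \<Rightarrow> ('g, 'm) monoid_scheme \<Rightarrow> nat \<Rightarrow> ('a list \<Rightarrow> 'g) set monoid" where
  "AS_cochain_group X G p =
     tuple_cochain_group (point_tuples X) G p Mod locally_zero_cochains X G p"

text \<open>The coset of \<open>f\<close> is sent to the coset of \<open>\<delta> f\<close>.\<close>

definition AS_coboundary ::
    "'a topology \<Rightarrow> ('g, 'm) monoid_scheme \<Rightarrow> nat \<Rightarrow> ('a list \<Rightarrow> 'g) set \<Rightarrow> ('a list \<Rightarrow> 'g) set" where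
  "AS_coboundary X G p K =
     (tuple_coboundary (point_tuples X) G p ` K)
       <#>\<^bsub>tuple_cochain_group (point_tuples X) G (Suc p)\<^esub> locally_zero_cochains X G (Suc p)"

definition AS_cohomology_group ::
    "nat \<Rightarrow> 'a topology \<Rightarrow> ('g, 'm) monoid_scheme \<Rightarrow> ('a list \<Rightarrow> 'g) set set monoid" where
  "AS_cohomology_group p X G = cohomology_group (AS_cochain_group X G) (AS_coboundary X G) p"

subsection \<open>Cech cohomology\<close>

text \<open>The direct limit of a direct system of groups \<open>D i\<close>, \<open>i \<in> I\<close>, with maps
  \<open>f i j : D i \<rightarrow> D j\<close> for \<open>R i j\<close>: elements are the classes of pairs \<open>(i, x)\<close> with
  \<open>x \<in> D i\<close>, where two pairs are identified if they have the same image in some \<open>D k\<close>.\<close>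

definition direct_limit_rel ::
    "'i set \<Rightarrow> ('i \<Rightarrow> 'i \<Rightarrow> bool) \<Rightarrow> ('i \<Rightarrow> ('x, 'm) monoid_scheme) \<Rightarrow> ('i \<Rightarrow> 'i \<Rightarrow> 'x \<Rightarrow> 'x) \<Rightarrow>
     (('i \<times> 'x) \<times> ('i \<times> 'x)) set" where
  "direct_limit_rel I R D f =
     {((i, x), (j, y)). i \<in> I \<and> x \<in> carrier (D i) \<and> j \<in> I \<and> y \<in> carrier (D j) \<and>
        (\<exists>k\<in>I. R i k \<and> R j k \<and> f i k x = f j k y)}"

definition direct_limit ::
    "'i set \<Rightarrow> ('i \<Rightarrow> 'i \<Rightarrow> bool) \<Rightarrow> ('i \<Rightarrow> ('x, 'm) monoid_scheme) \<Rightarrow> ('i \<Rightarrow> 'i \<Rightarrow> 'x \<Rightarrow> 'x) \<Rightarrow>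
     ('i \<times> 'x) set monoid" where
  "direct_limit I R D f =
     \<lparr>carrier = Sigma I (\<lambda>i. carrier (D i)) // direct_limit_rel I R D f,
      monoid.mult = (\<lambda>K L. direct_limit_rel I R D f ``
        {(k, f i k x \<otimes>\<^bsub>D k\<^esub> f j k y) | i x j y k.
           (i, x) \<in> K \<and> (j, y) \<in> L \<and> k \<in> I \<and> R i k \<and> R j k}),
      one = direct_limit_rel I R D f `` {(i, \<one>\<^bsub>D i\<^esub>) | i. i \<in> I}\<rparr>"

definition nerve_simplices :: "'a set set \<Rightarrow> nat \<Rightarrow> 'a set list set" where
  "nerve_simplices \<U> p = {Us. length Us = Suc p \<and> set Us \<subseteq> \<U> \<and> \<Inter>(set Us) \<noteq> {}}"

definition nerve_cohomology_group ::
    "nat \<Rightarrow> ('g, 'm) monoid_scheme \<Rightarrow> 'a set set \<Rightarrow> ('a set list \<Rightarrow> 'g) set monoid" where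
  "nerve_cohomology_group p G \<U> =
     cohomology_group (tuple_cochain_group (nerve_simplices \<U>) G)
       (tuple_coboundary (nerve_simplices \<U>) G) p"

definition refinement_map :: "'a set set \<Rightarrow> 'a set set \<Rightarrow> ('a set \<Rightarrow> 'a set) \<Rightarrow> bool" where
  "refinement_map \<U> \<V> r \<longleftrightarrow> (\<forall>V\<in>\<V>. r V \<in> \<U> \<and> V \<subseteq> r V)"

definition refined_by :: "'a set set \<Rightarrow> 'a set set \<Rightarrow> bool" where
  "refined_by \<U> \<V> \<longleftrightarrow> (\<exists>r. refinement_map \<U> \<V> r)"

text \<open>The map induced on cohomology by a refinement map does not depend on the chosen
  refinement map. It sends the class of a cocycle \<open>a\<close> to the class of the pullback of \<open>a\<close>.\<close>

definition refinement_induced ::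
    "nat \<Rightarrow> ('g, 'm) monoid_scheme \<Rightarrow> 'a set set \<Rightarrow> 'a set set \<Rightarrow>
     ('a set list \<Rightarrow> 'g) set \<Rightarrow> ('a set list \<Rightarrow> 'g) set" where
  "refinement_induced p G \<U> \<V> K =
     (let r = (SOME r. refinement_map \<U> \<V> r) in
      (\<lambda>a. \<lambda>Vs\<in>nerve_simplices \<V> p. a (map r Vs)) ` K
        <#>\<^bsub>tuple_cochain_group (nerve_simplices \<V>) G p\<^esub>
      coboundaries (tuple_cochain_group (nerve_simplices \<V>) G)
        (tuple_coboundary (nerve_simplices \<V>) G) p)"

definition Cech_cohomology_group ::
    "nat \<Rightarrow> 'a topology \<Rightarrow> ('g, 'm) monoid_scheme \<Rightarrow>
     ('a set set \<times> ('a set list \<Rightarrow> 'g) set) set monoid" where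
  "Cech_cohomology_group p X G =
     direct_limit {\<U>. open_cover X \<U>} refined_by (nerve_cohomology_group p G)
       (refinement_induced p G)"


section \<open>Homological local connectedness\<close>

text \<open>Neighbourhoods are not required to be open.\<close>

definition neighbourhood_of :: "'a topology \<Rightarrow> 'a set \<Rightarrow> 'a set \<Rightarrow> bool" where
  "neighbourhood_of X S N \<longleftrightarrow> N \<subseteq> topspace X \<and> (\<exists>W. openin X W \<and> S \<subseteq> W \<and> W \<subseteq> N)"

definition HLC :: "'a topology \<Rightarrow> bool" where
  "HLC C \<longleftrightarrow>
     (\<forall>c\<in>topspace C. \<forall>U. neighbourhood_of C {c} U \<longrightarrow>
        (\<exists>V. neighbourhood_of C {c} V \<and> V \<subseteq> U \<and>
           (\<forall>p. trivial_homomorphism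
              (reduced_homology_group p (subtopology C V))
              (reduced_homology_group p (subtopology C U))
              (hom_induced p (subtopology C V) {} (subtopology C U) {} id))))"

end

theory Submission
  imports Defs
begin

text \<open>The reversed \<open>\<real>\<^sub>+\<close>-flow attracts every compact set to the core. Hence every neighbourhood of
  the core contains an open one which the reversed flow preserves, and pushing chains along the flow
  shows that \<open>Y\<close> has no homology relative to it. Since \<open>Y\<close> is metrizable and HLC, tuples of nearby
  points of the core span singular chains of \<open>Y\<close> close to the core, uniquely up to small homotopies,
  and conversely a small simplex near the core is approximated by the tuple of points of the core next
  to its vertices. This identifies the singular cohomology of \<open>Y\<close> with the Alexander--Spanier
  cohomology of the core; with an HLC core in place of \<open>Y\<close> it gives the singular cohomology of the
  core. A small open cover of the core is compared with tuples of points by choosing a point in each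
  of its members, which treats Cech cohomology.

  The analytic point is that \<open>t \<cdot> y\<close> converges as soon as its \<open>\<real>\<^sub>+\<close>-orbit is bounded, so that the core
  consists of the points with bounded orbits. A cluster point \<open>z\<close> of the orbit is fixed, because the
  moment map \<open>H\<close> increases along orbits. In a chart at \<open>z\<close>, the circle through the orbit at time \<open>s\<close> is
  a loop \<open>u(s, \<cdot>)\<close> with \<open>u\<^sub>s = - J(u) u\<^sub>\<theta>\<close>. As \<open>u\<^sub>\<theta>\<close> has mean zero, the mean of the loop moves with
  speed \<open>O(\<bar>u\<^sub>\<theta>\<bar>\<^sup>2)\<close>, that is, at most a multiple of \<open>dH/ds\<close>, whereas the orbit is \<open>O(\<bar>u\<^sub>\<theta>\<bar>)\<close> away
  from the mean, which tends to 0. So the orbit is eventually trapped near \<open>z\<close>.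

  Finally, the action moves a given point of the core, by homeomorphisms of the core, as close as
  desired to its limit, a fixed point; so local homology of the core can be tested there.\<close>

section \<open>Cochains on free abelian groups\<close>

text \<open>A gradient line of finite energy need not converge: the energy bounds the integral of
  its squared speed, not its length. Averaging over the circle repairs this, since the average moves
  with a speed quadratic in that of the orbit, which is integrable in time. On the topological side
  the obstacle is one of scales. Filling a cycle by means of HLC needs a larger ball each time, so
  chains over tuples are built only up to a prescribed degree \<open>N\<close>, with radii chosen
  from the top down. A cochain that is defined on all chains through small ones can moreover be
  computed only on chains that are smaller still; this is why surjectivity uses a coarse and a fine
  approximation. The two basic isomorphisms arise in the same way: a group of cocycles is mapped
  onto two cohomology groups with the same kernel. Degree 0 is treated uniformly through the empty
  tuple: a cochain \<open>u\<close> with \<open>u [] = \<one>\<close> has trivial coboundary on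
  one-point tuples, so that being a coboundary reads the same in every degree.\<close>

definition trunc :: "('g, 'm) monoid_scheme \<Rightarrow> 'g \<Rightarrow> 'g" where
  "trunc G x = (if x \<in> carrier G then x else \<one>\<^bsub>G\<^esub>)"

text \<open>Values outside the carrier are replaced by the unit, so that \<open>ev G f\<close> is a homomorphism
  on all formal combinations, whatever \<open>f\<close> is.\<close>

definition ev :: "('g, 'm) monoid_scheme \<Rightarrow> ('s \<Rightarrow> 'g) \<Rightarrow> ('s \<Rightarrow>\<^sub>0 int) \<Rightarrow> 'g" where
  "ev G f c = finprod G (\<lambda>s. trunc G (f s) [^]\<^bsub>G\<^esub> Poly_Mapping.lookup c s) (Poly_Mapping.keys c)"

lemma frag_extend_frag_extend:
  "frag_extend f (frag_extend g c) = frag_extend (\<lambda>s. frag_extend f (g s)) c"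
proof -
  have "Poly_Mapping.keys c \<subseteq> UNIV" by simp
  then show ?thesis
    by (induction rule: frag_induction) (auto simp: frag_extend_diff)
qed

lemma frag_extend_fun_diff:
  "frag_extend (\<lambda>s. f s - g s) c = frag_extend f c - frag_extend g c"
proof -
  have "Poly_Mapping.keys c \<subseteq> UNIV" by simp
  then show ?thesis
    by (induction rule: frag_induction) (auto simp: frag_extend_diff)
qed

lemma frag_extend_frag_of [simp]: "frag_extend frag_of c = c"
  by (metis frag_expansion)

lemma frag_extend_zero [simp]: "frag_extend (\<lambda>s. 0) c = 0"
  by (simp add: frag_extend_def)

lemma keys_frag_extend_subset:
  "(\<And>s. s \<in> Poly_Mapping.keys c \<Longrightarrow> Poly_Mapping.keys (f s) \<subseteq> S) \<Longrightarrow>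
    Poly_Mapping.keys (frag_extend f c) \<subseteq> S"
  using keys_frag_extend[of f c] by blast

lemma keys_diff_subset:
  "Poly_Mapping.keys a \<subseteq> S \<Longrightarrow> Poly_Mapping.keys b \<subseteq> S \<Longrightarrow> Poly_Mapping.keys (a - b) \<subseteq> S"
  using keys_diff[of a b] by blast

context comm_group
begin

lemma trunc_closed [simp]: "trunc G x \<in> carrier G"
  by (simp add: trunc_def)

lemma trunc_carrier [simp]: "x \<in> carrier G \<Longrightarrow> trunc G x = x"
  by (simp add: trunc_def)

lemma ev_superset:
  assumes "finite A" "Poly_Mapping.keys c \<subseteq> A"
  shows "ev G f c = finprod G (\<lambda>s. trunc G (f s) [^] Poly_Mapping.lookup c s) A"
  unfolding ev_def
  by (rule finprod_mono_neutral_cong_left) (use assms in \<open>auto simp: not_in_keys_iff_lookup_eq_zero\<close>)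

lemma ev_closed [simp]: "ev G f c \<in> carrier G"
  unfolding ev_def by (rule finprod_closed) auto

lemma ev_0 [simp]: "ev G f 0 = \<one>"
  by (simp add: ev_def)

lemma ev_of [simp]: "ev G f (frag_of s) = trunc G (f s)"
  by (simp add: ev_def)

lemma ev_add: "ev G f (a + b) = ev G f a \<otimes> ev G f b"
proof -
  let ?A = "Poly_Mapping.keys a \<union> Poly_Mapping.keys b"
  have A: "finite ?A" "Poly_Mapping.keys (a + b) \<subseteq> ?A"
    using keys_add[of a b] by auto
  show ?thesis
    unfolding ev_superset[OF A] ev_superset[of ?A a, OF A(1) Un_upper1]
      ev_superset[of ?A b, OF A(1) Un_upper2]
    by (subst finprod_multf[symmetric]) (auto simp: lookup_add int_pow_mult)
qed

lemma ev_minus: "ev G f (- a) = inv (ev G f a)"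
  using ev_add[of f "- a" a] by (simp add: inv_equality[symmetric])

lemma ev_diff: "ev G f (a - b) = ev G f a \<otimes> inv (ev G f b)"
  using ev_add[of f a "- b"] by (simp add: ev_minus)

lemma ev_cmul: "ev G f (frag_cmul n a) = ev G f a [^] n"
proof (induction n rule: int_induct[where k = 0])
  case (step1 i)
  then show ?case
    by (simp add: frag_cmul_distrib ev_add int_pow_mult)
next
  case (step2 i)
  then show ?case
    by (simp add: frag_cmul_diff_distrib ev_diff int_pow_diff)
qed simp

lemma ev_extend: "ev G f (frag_extend h c) = ev G (\<lambda>s. ev G f (h s)) c"
proof -
  have "Poly_Mapping.keys c \<subseteq> UNIV" by simp
  then show ?thesis
    by (induction rule: frag_induction) (auto simp: frag_extend_diff ev_diff)
qed

lemma ev_cong: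
  assumes "\<And>s. s \<in> Poly_Mapping.keys c \<Longrightarrow> trunc G (f s) = trunc G (g s)"
  shows "ev G f c = ev G g c"
  unfolding ev_def by (rule finprod_cong') (auto simp: assms)

lemma ev_trivial:
  assumes "\<And>s. s \<in> Poly_Mapping.keys c \<Longrightarrow> trunc G (f s) = \<one>"
  shows "ev G f c = \<one>"
  unfolding ev_def using assms by (intro finprod_one_eqI) auto

text \<open>The values must lie in the carrier, because \<open>trunc\<close> is not multiplicative
  outside it.\<close>

lemma ev_mult:
  assumes "\<And>s. s \<in> Poly_Mapping.keys c \<Longrightarrow> f s \<in> carrier G \<and> g s \<in> carrier G"
  shows "ev G (\<lambda>s. f s \<otimes> g s) c = ev G f c \<otimes> ev G g c"
proof -
  have "ev G (\<lambda>s. f s \<otimes> g s) c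
      = finprod G (\<lambda>s. trunc G (f s) [^] Poly_Mapping.lookup c s \<otimes>
          trunc G (g s) [^] Poly_Mapping.lookup c s) (Poly_Mapping.keys c)"
    unfolding ev_def by (rule finprod_cong') (auto simp: assms int_pow_distrib)
  also have "\<dots> = ev G f c \<otimes> ev G g c"
    unfolding ev_def by (rule finprod_multf) auto
  finally show ?thesis .
qed

lemma ev_sum: "finite I \<Longrightarrow> ev G f (sum x I) = finprod G (\<lambda>i. ev G f (x i)) I"
  by (induction rule: finite_induct) (auto simp: ev_add)

lemma hom_diff_free_Abelian_group:
  assumes h: "h \<in> hom (free_Abelian_group S) G"
    and a: "Poly_Mapping.keys a \<subseteq> S" and b: "Poly_Mapping.keys b \<subseteq> S"
  shows "h (a - b) = h a \<otimes> inv (h b)"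
proof -
  have "h ((a - b) + b) = h (a - b) \<otimes> h b"
    using hom_mult[OF h, of "a - b" b] keys_diff_subset[OF a b] b by simp
  moreover have "h (a - b) \<in> carrier G" "h b \<in> carrier G" "h a \<in> carrier G"
    using hom_in_carrier[OF h] keys_diff_subset[OF a b] a b by simp_all
  ultimately show ?thesis
    by (simp add: inv_solve_right)
qed

text \<open>Reduces a cochain that is a homomorphism on chains to \<open>ev\<close> of its values on
  generators, so that singular and tuple cochains can be computed with side by side.\<close>

lemma hom_frag_extend:
  assumes h: "h \<in> hom (free_Abelian_group S) G"
    and "\<And>s. s \<in> Poly_Mapping.keys c \<Longrightarrow> Poly_Mapping.keys (\<phi> s) \<subseteq> S"
  shows "h (frag_extend \<phi> c) = ev G (\<lambda>s. h (\<phi> s)) c"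
proof -
  have h0: "h 0 = \<one>"
    using hom_one[OF h] by simp
  have "Poly_Mapping.keys c \<subseteq> {s. Poly_Mapping.keys (\<phi> s) \<subseteq> S}"
    using assms(2) by blast
  then show ?thesis
  proof (induction rule: free_Abelian_group_induct[consumes 1])
    case (2 a b)
    have "Poly_Mapping.keys (frag_extend \<phi> a) \<subseteq> S" "Poly_Mapping.keys (frag_extend \<phi> b) \<subseteq> S"
      using 2(1,2) by (auto intro!: keys_frag_extend_subset)
    then have "h (frag_extend \<phi> a - frag_extend \<phi> b) =
        h (frag_extend \<phi> a) \<otimes> inv h (frag_extend \<phi> b)"
      by (intro hom_diff_free_Abelian_group[OF h])
    then show ?case
      by (simp add: 2 frag_extend_diff ev_diff)
  next
    case (3 s)
    then show ?case
      using hom_in_carrier[OF h, of "\<phi> s"] by simp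
  qed (simp add: h0)
qed

end

section \<open>Ordered tuples\<close>

text \<open>The boundary is the augmented one: a tuple of length one has boundary \<open>frag_of []\<close>, which
  makes cones contract all degrees. A tuple of length \<open>n\<close> is thus a simplex of dimension
  \<open>n - 1\<close>.\<close>

definition tuple_boundary :: "'s list \<Rightarrow> 's list \<Rightarrow>\<^sub>0 int" where
  "tuple_boundary xs = (\<Sum>k<length xs. frag_cmul ((- 1) ^ k) (frag_of (omit k xs)))"

definition tuple_cone :: "'s \<Rightarrow> ('s list \<Rightarrow>\<^sub>0 int) \<Rightarrow> 's list \<Rightarrow>\<^sub>0 int" where
  "tuple_cone a = frag_extend (\<lambda>ys. frag_of (a # ys))"

lemma omit_Cons_0 [simp]: "omit 0 (x # xs) = xs"
  by (simp add: omit_def)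

lemma omit_Cons_Suc [simp]: "omit (Suc k) (x # xs) = x # omit k xs"
  by (simp add: omit_def)

lemma omit_map: "omit k (map r xs) = map r (omit k xs)"
  by (simp add: omit_def take_map drop_map)

lemma length_omit: "k < length xs \<Longrightarrow> length (omit k xs) = length xs - 1"
  by (simp add: omit_def)

lemma set_omit: "set (omit k xs) \<subseteq> set xs"
  by (auto simp: omit_def dest: in_set_takeD in_set_dropD)

lemma tuple_boundary_Nil [simp]: "tuple_boundary [] = 0"
  by (simp add: tuple_boundary_def)

lemma tuple_boundary_Cons:
  "tuple_boundary (x # xs) = frag_of xs - tuple_cone x (tuple_boundary xs)"
proof -
  have "tuple_boundary (x # xs)
      = frag_of xs + (\<Sum>k<length xs. frag_cmul ((- 1) ^ Suc k) (frag_of (x # omit k xs)))"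
    unfolding tuple_boundary_def length_Cons by (subst sum.lessThan_Suc_shift) simp
  also have "(\<Sum>k<length xs. frag_cmul ((- 1) ^ Suc k) (frag_of (x # omit k xs)))
      = - tuple_cone x (tuple_boundary xs)"
    unfolding tuple_boundary_def tuple_cone_def
    by (simp add: frag_extend_sum frag_extend_cmul o_def sum_negf[symmetric])
  finally show ?thesis by simp
qed

lemma tuple_boundary_cone:
  "frag_extend tuple_boundary (tuple_cone a c) = c - tuple_cone a (frag_extend tuple_boundary c)"
proof -
  have "Poly_Mapping.keys c \<subseteq> UNIV" by simp
  then show ?thesis
    by (induction rule: frag_induction)
      (auto simp: tuple_cone_def frag_extend_diff tuple_boundary_Cons)
qed

text \<open>By the cone formula the two boundaries of \<open>x # xs\<close> cancel up to the cone
  over the double boundary of \<open>xs\<close>.\<close>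

lemma tuple_boundary_boundary: "frag_extend tuple_boundary (tuple_boundary xs) = 0"
  by (induction xs)
    (simp_all add: tuple_boundary_Cons frag_extend_diff tuple_boundary_cone, simp add: tuple_cone_def)

lemma keys_tuple_boundary:
  "Poly_Mapping.keys (tuple_boundary xs) \<subseteq> (\<lambda>k. omit k xs) ` {..<length xs}"
proof -
  have "Poly_Mapping.keys (tuple_boundary xs) \<subseteq>
     (\<Union>k<length xs. Poly_Mapping.keys (frag_cmul ((- 1) ^ k) (frag_of (omit k xs))))"
    unfolding tuple_boundary_def by (rule keys_sum)
  also have "\<dots> \<subseteq> (\<lambda>k. omit k xs) ` {..<length xs}"
    by (auto simp: keys_cmul_iff)
  finally show ?thesis .
qed

lemma tuple_boundary_map:
  "frag_extend (\<lambda>ys. frag_of (map r ys)) (tuple_boundary xs) = tuple_boundary (map r xs)"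
  unfolding tuple_boundary_def
  by (simp add: frag_extend_sum frag_extend_cmul o_def omit_map)

definition omit_closed :: "'s list set \<Rightarrow> bool" where
  "omit_closed S \<longleftrightarrow> (\<forall>xs\<in>S. \<forall>k<length xs. omit k xs \<in> S)"

text \<open>Acyclic carriers: everything over \<open>xs\<close> lives in the full simplex on \<open>A xs\<close>, which is
  contracted by a cone.\<close>

lemma tuple_homotopy:
  fixes \<phi> \<psi> :: "'s list \<Rightarrow> 't list \<Rightarrow>\<^sub>0 int" and A :: "'s list \<Rightarrow> 't set"
  assumes S: "omit_closed S"
    and \<phi>: "\<And>xs. xs \<in> S \<Longrightarrow> frag_extend tuple_boundary (\<phi> xs) = frag_extend \<phi> (tuple_boundary xs)"
    and \<psi>: "\<And>xs. xs \<in> S \<Longrightarrow> frag_extend tuple_boundary (\<psi> xs) = frag_extend \<psi> (tuple_boundary xs)"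
    and Nil: "\<phi> [] = \<psi> []"
    and \<phi>A: "\<And>xs. xs \<in> S \<Longrightarrow> Poly_Mapping.keys (\<phi> xs) \<subseteq> {ys. length ys = length xs \<and> set ys \<subseteq> A xs}"
    and \<psi>A: "\<And>xs. xs \<in> S \<Longrightarrow> Poly_Mapping.keys (\<psi> xs) \<subseteq> {ys. length ys = length xs \<and> set ys \<subseteq> A xs}"
    and A: "\<And>xs. xs \<in> S \<Longrightarrow> xs \<noteq> [] \<Longrightarrow> A xs \<noteq> {}"
    and mono: "\<And>xs k. xs \<in> S \<Longrightarrow> k < length xs \<Longrightarrow> A (omit k xs) \<subseteq> A xs"
  shows "\<exists>T. T [] = 0 \<and> (\<forall>xs\<in>S.
    Poly_Mapping.keys (T xs) \<subseteq> {ys. length ys = Suc (length xs) \<and> set ys \<subseteq> A xs} \<and>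
    frag_extend tuple_boundary (T xs) = \<phi> xs - \<psi> xs - frag_extend T (tuple_boundary xs))"
proof -
  define a where "a xs = (SOME x. x \<in> A xs)" for xs
  \<comment> \<open>The recursion runs over the length. \<open>T xs\<close> is a cone, with apex in
    \<open>A xs\<close>, over the chain that the homotopy formula prescribes as its boundary; that
    chain involves \<open>T\<close> only on tuples that are one entry shorter.\<close>
  define TT where "TT = rec_nat (\<lambda>_. 0) (\<lambda>n TTn xs. tuple_cone (a xs) (\<phi> xs - \<psi> xs - frag_extend TTn (tuple_boundary xs)))"
  define T where "T xs = TT (length xs) xs" for xs
  have T0: "T [] = 0"
    by (simp add: T_def TT_def)
  have T: "T xs = tuple_cone (a xs) (\<phi> xs - \<psi> xs - frag_extend T (tuple_boundary xs))"
    if "xs \<noteq> []" for xs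
  proof -
    obtain n where n: "length xs = Suc n"
      using \<open>xs \<noteq> []\<close> by (cases xs) auto
    have "frag_extend (TT n) (tuple_boundary xs) = frag_extend T (tuple_boundary xs)"
    proof (rule frag_extend_eq)
      fix ys assume "ys \<in> Poly_Mapping.keys (tuple_boundary xs)"
      then have "length ys = n"
        using keys_tuple_boundary[of xs] by (auto simp: length_omit n)
      then show "TT n ys = T ys" by (simp add: T_def)
    qed
    then show ?thesis
      by (simp add: T_def n) (simp add: TT_def)
  qed
  have main: "Poly_Mapping.keys (T xs) \<subseteq> {ys. length ys = Suc (length xs) \<and> set ys \<subseteq> A xs} \<and>
    frag_extend tuple_boundary (T xs) = \<phi> xs - \<psi> xs - frag_extend T (tuple_boundary xs)"
    if "xs \<in> S" for xs
    using that
  proof (induction "length xs" arbitrary: xs)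
    case 0
    then show ?case by (simp add: T0 Nil)
  next
    case (Suc n)
    then have ne: "xs \<noteq> []" by auto
    have bd: "ys \<in> S \<and> length ys = n \<and> A ys \<subseteq> A xs" if ys: "ys \<in> Poly_Mapping.keys (tuple_boundary xs)" for ys
    proof -
      obtain k where "k < length xs" "ys = omit k xs"
        using ys keys_tuple_boundary[of xs] by auto
      then show ?thesis
        using S Suc.prems Suc.hyps(2) mono by (auto simp: omit_closed_def length_omit)
    qed
    let ?z = "\<phi> xs - \<psi> xs - frag_extend T (tuple_boundary xs)"
    have ax: "a xs \<in> A xs"
      unfolding a_def using A[OF Suc.prems ne] by (simp add: some_in_eq)
    have "Poly_Mapping.keys (frag_extend T (tuple_boundary xs)) \<subseteq>
        {ys. length ys = length xs \<and> set ys \<subseteq> A xs}"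
    proof (rule keys_frag_extend_subset)
      fix ys assume "ys \<in> Poly_Mapping.keys (tuple_boundary xs)"
      then show "Poly_Mapping.keys (T ys) \<subseteq> {ys. length ys = length xs \<and> set ys \<subseteq> A xs}"
        using bd[of ys] Suc.hyps(1)[of ys] Suc.hyps(2) by fastforce
    qed
    then have zk: "Poly_Mapping.keys ?z \<subseteq> {ys. length ys = length xs \<and> set ys \<subseteq> A xs}"
      using \<phi>A \<psi>A Suc.prems by (intro keys_diff_subset) auto
    have k: "Poly_Mapping.keys (T xs) \<subseteq> {ys. length ys = Suc (length xs) \<and> set ys \<subseteq> A xs}"
      unfolding T[OF ne] tuple_cone_def
      by (rule keys_frag_extend_subset) (use zk ax in auto)
    have "frag_extend tuple_boundary (frag_extend T (tuple_boundary xs)) =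
        frag_extend (\<lambda>ys. \<phi> ys - \<psi> ys - frag_extend T (tuple_boundary ys)) (tuple_boundary xs)"
      unfolding frag_extend_frag_extend
      by (rule frag_extend_eq) (use bd Suc.hyps in auto)
    also have "\<dots> = frag_extend \<phi> (tuple_boundary xs) - frag_extend \<psi> (tuple_boundary xs)"
      by (simp add: frag_extend_fun_diff tuple_boundary_boundary frag_extend_frag_extend[symmetric])
    finally have z0: "frag_extend tuple_boundary ?z = 0"
      by (simp add: frag_extend_diff \<phi> \<psi> Suc.prems)
    have "frag_extend tuple_boundary (T xs) = ?z"
      unfolding T[OF ne] tuple_boundary_cone z0 by (simp add: tuple_cone_def)
    with k show ?case by simp
  qed
  show ?thesis
    using T0 main by (intro exI[of _ T]) blast
qed

text \<open>The vertex maps \<open>r\<close> and \<open>r'\<close> are joined by chains in the full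
  simplex on both images, where \<open>f\<close> is a cocycle; \<open>u\<close> is \<open>f\<close>
  evaluated on this homotopy. The value at the empty tuple is recorded because it is the coboundary
  of \<open>u\<close> on one-point tuples.\<close>

lemma (in comm_group) contiguous_cochains:
  fixes r r' :: "'s \<Rightarrow> 't"
  assumes S: "omit_closed S"
    and f: "\<And>xs ys. xs \<in> S \<Longrightarrow> length xs = Suc p \<Longrightarrow> length ys = Suc (Suc p) \<Longrightarrow>
       set ys \<subseteq> r ` set xs \<union> r' ` set xs \<Longrightarrow> ev G f (tuple_boundary ys) = \<one>"
  shows "\<exists>u. u [] = \<one> \<and> u \<in> UNIV \<rightarrow> carrier G \<and> (\<forall>xs\<in>S. length xs = Suc p \<longrightarrow>
      ev G f (frag_of (map r xs)) = ev G f (frag_of (map r' xs)) \<otimes> ev G u (tuple_boundary xs))"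
proof -
  let ?A = "\<lambda>xs. r ` set xs \<union> r' ` set xs"
  have "\<exists>T. T [] = 0 \<and> (\<forall>xs\<in>S.
    Poly_Mapping.keys (T xs) \<subseteq> {ys. length ys = Suc (length xs) \<and> set ys \<subseteq> ?A xs} \<and>
    frag_extend tuple_boundary (T xs) = frag_of (map r xs) - frag_of (map r' xs) - frag_extend T (tuple_boundary xs))"
  proof (rule tuple_homotopy)
    show "?A (omit k xs) \<subseteq> ?A xs" for k xs
      using set_omit[of k xs] by blast
  qed (use S in \<open>auto simp: tuple_boundary_map\<close>)
  then obtain T where T0: "T [] = 0" and T: "\<forall>xs\<in>S.
    Poly_Mapping.keys (T xs) \<subseteq> {ys. length ys = Suc (length xs) \<and> set ys \<subseteq> ?A xs} \<and>
    frag_extend tuple_boundary (T xs) = frag_of (map r xs) - frag_of (map r' xs) - frag_extend T (tuple_boundary xs)"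
    by (elim exE conjE)
  define u where "u xs = ev G f (T xs)" for xs
  show ?thesis
  proof (intro exI[of _ u] conjI ballI impI)
    fix xs assume xs: "xs \<in> S" "length xs = Suc p"
    have "ev G f (frag_extend tuple_boundary (T xs)) = \<one>"
      unfolding ev_extend by (rule ev_trivial) (use bspec[OF T xs(1)] xs f[OF xs] in fastforce)
    moreover have "frag_of (map r xs) = frag_of (map r' xs) +
        (frag_extend T (tuple_boundary xs) + frag_extend tuple_boundary (T xs))"
      by (simp add: bspec[OF T xs(1)])
    ultimately show "ev G f (frag_of (map r xs)) =
        ev G f (frag_of (map r' xs)) \<otimes> ev G u (tuple_boundary xs)"
      by (simp add: ev_add ev_extend u_def[abs_def])
  qed (auto simp: u_def T0)
qed

section \<open>Cohomology groups\<close>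

text \<open>Both groups are quotients of \<open>A\<close> by the same normal subgroup. Cohomology
  theories can thus be compared on cocycles, without first constructing a map between the cohomology
  groups.\<close>

lemma iso_of_common_kernel:
  assumes "group A" "group P" "group Q"
    and a: "a \<in> hom A P" "a ` carrier A = carrier P"
    and b: "b \<in> hom A Q" "b ` carrier A = carrier Q"
    and k: "\<And>x. x \<in> carrier A \<Longrightarrow> a x = \<one>\<^bsub>P\<^esub> \<longleftrightarrow> b x = \<one>\<^bsub>Q\<^esub>"
  shows "P \<cong> Q"
proof -
  interpret a: group_hom A P a
    by (simp add: group_hom_def group_hom_axioms_def assms)
  interpret b: group_hom A Q b
    by (simp add: group_hom_def group_hom_axioms_def assms)
  have eq: "kernel A P a = kernel A Q b"
    using k by (auto simp: kernel_def)
  have P: "A Mod kernel A P a \<cong> P"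
    by (rule a.FactGroup_iso[OF a(2)])
  have "group (A Mod kernel A P a)"
    by (simp add: a.normal_kernel normal.factorgroup_is_group)
  then have "P \<cong> A Mod kernel A P a"
    using P group.iso_sym by blast
  moreover have "A Mod kernel A P a \<cong> Q"
    unfolding eq by (rule b.FactGroup_iso[OF b(2)])
  ultimately show ?thesis
    by (rule iso_trans)
qed

section \<open>Classes of cocycles in a cochain complex\<close>

lemma coboundaries_0: "coboundaries C \<delta> 0 = {\<one>\<^bsub>C 0\<^esub>}"
  by (simp add: coboundaries_def)

lemma coboundaries_Suc: "coboundaries C \<delta> (Suc q) = \<delta> q ` carrier (C q)"
  by (simp add: coboundaries_def)

locale cochain_complex =
  fixes C :: "nat \<Rightarrow> ('c, 'm) monoid_scheme" and \<delta> :: "nat \<Rightarrow> 'c \<Rightarrow> 'c"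
  assumes comm_group: "\<And>p. comm_group (C p)"
    and hom: "\<And>p. \<delta> p \<in> hom (C p) (C (Suc p))"
    and square: "\<And>p x. x \<in> carrier (C p) \<Longrightarrow> \<delta> (Suc p) (\<delta> p x) = \<one>\<^bsub>C (Suc (Suc p))\<^esub>"
begin

lemma group: "group (C p)"
  using comm_group comm_group.axioms(2) by blast

lemma group_hom: "group_hom (C p) (C (Suc p)) (\<delta> p)"
  by (simp add: group_hom_def group_hom_axioms_def group hom)

abbreviation cocycles where "cocycles p \<equiv> kernel (C p) (C (Suc p)) (\<delta> p)"

abbreviation cocycle_group where "cocycle_group p \<equiv> subgroup_generated (C p) (cocycles p)"

lemma subgroup_cocycles: "subgroup (cocycles p) (C p)"
  by (rule group_hom.subgroup_kernel[OF group_hom])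

lemma carrier_cocycle_group [simp]: "carrier (cocycle_group p) = cocycles p"
  by (simp add: subgroup.carrier_subgroup_generated_subgroup[OF subgroup_cocycles])

lemma coboundaries_subset: "coboundaries C \<delta> p \<subseteq> cocycles p"
proof (cases p)
  case 0
  then show ?thesis
    using subgroup.one_closed[OF subgroup_cocycles[of 0]] by (simp add: coboundaries_0)
next
  case (Suc q)
  then show ?thesis
    using hom_in_carrier[OF hom] square by (auto simp: coboundaries_Suc kernel_def)
qed

lemma subgroup_coboundaries: "subgroup (coboundaries C \<delta> p) (C p)"
proof (cases p)
  case 0
  then show ?thesis
    by (simp add: coboundaries_0 group.triv_subgroup group)
next
  case (Suc q)
  then show ?thesis
    using group_hom.img_is_subgroup[OF group_hom[of q]] by (simp add: coboundaries_Suc)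
qed

lemma group_cocycle_group: "group (cocycle_group p)"
  by (simp add: group.group_subgroup_generated group)

lemma normal_coboundaries: "coboundaries C \<delta> p \<lhd> cocycle_group p"
proof -
  have "comm_group (cocycle_group p)"
    using comm_group group.abelian_subgroup_generated group by blast
  moreover have "subgroup (coboundaries C \<delta> p) (cocycle_group p)"
    using coboundaries_subset group subgroup_coboundaries
    by (simp add: group.subgroup_of_subgroup_generated)
  ultimately show ?thesis
    by (simp add: comm_group.subgroup_imp_normal)
qed

lemma group_cohomology: "group (cohomology_group C \<delta> p)"
  unfolding cohomology_group_def by (rule normal.factorgroup_is_group[OF normal_coboundaries])

definition cls where "cls p x = coboundaries C \<delta> p #>\<^bsub>C p\<^esub> x"

lemma r_coset_cocycle_group: "S #>\<^bsub>cocycle_group p\<^esub> x = S #>\<^bsub>C p\<^esub> x"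
  by (simp add: r_coset_def)

lemma cls_hom: "cls p \<in> hom (cocycle_group p) (cohomology_group C \<delta> p)"
proof -
  have "(\<lambda>x. coboundaries C \<delta> p #>\<^bsub>cocycle_group p\<^esub> x)
      \<in> hom (cocycle_group p) (cohomology_group C \<delta> p)"
    unfolding cohomology_group_def by (rule normal.r_coset_hom_Mod[OF normal_coboundaries])
  then show ?thesis
    by (simp add: r_coset_cocycle_group cls_def[abs_def])
qed

lemma cls_surj: "cls p ` cocycles p = carrier (cohomology_group C \<delta> p)"
  by (auto simp: cohomology_group_def carrier_FactGroup r_coset_cocycle_group cls_def)

lemma one_cohomology: "\<one>\<^bsub>cohomology_group C \<delta> p\<^esub> = coboundaries C \<delta> p"
  by (simp add: cohomology_group_def)

lemma cls_eq_one_iff: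
  assumes "x \<in> cocycles p"
  shows "cls p x = \<one>\<^bsub>cohomology_group C \<delta> p\<^esub> \<longleftrightarrow> x \<in> coboundaries C \<delta> p"
proof -
  have "x \<in> carrier (C p)"
    using assms by (simp add: kernel_def)
  then show ?thesis
    unfolding one_cohomology cls_def
    by (metis group group.coset_join1 group.coset_join2 subgroup_coboundaries)
qed

lemma cls_eq_iff:
  assumes "x \<in> cocycles p" "y \<in> cocycles p"
  shows "cls p x = cls p y \<longleftrightarrow> x \<otimes>\<^bsub>C p\<^esub> inv\<^bsub>C p\<^esub> y \<in> coboundaries C \<delta> p"
proof -
  have xy: "x \<in> carrier (C p)" "y \<in> carrier (C p)"
    using assms by (simp_all add: kernel_def)
  interpret C: comm_group "C p" by (rule comm_group)
  interpret B: subgroup "coboundaries C \<delta> p" "C p" by (rule subgroup_coboundaries)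
  show ?thesis
    unfolding cls_def using xy
    by (metis C.coset_mult_inv1 C.coset_mult_inv2 C.coset_join1 C.coset_join2 B.subset B.subgroup_axioms
        C.inv_closed C.m_closed)
qed

end

text \<open>The cohomology of the quotient of a complex \<open>T\<close> by a subcomplex \<open>L\<close>, presented by cochains
  of \<open>T\<close> rather than by cosets of cosets.\<close>

locale cochain_pair = cochain_complex T \<delta>
  for T :: "nat \<Rightarrow> ('c, 'm) monoid_scheme" and \<delta> :: "nat \<Rightarrow> 'c \<Rightarrow> 'c" +
  fixes L :: "nat \<Rightarrow> 'c set"
  assumes sub: "\<And>p. subgroup (L p) (T p)" and stable: "\<And>p. \<delta> p ` L p \<subseteq> L (Suc p)"
begin

abbreviation Q where "Q p \<equiv> T p Mod L p"

definition \<delta>Q where "\<delta>Q p K = (\<delta> p ` K) <#>\<^bsub>T (Suc p)\<^esub> L (Suc p)"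

lemma normal_L: "L p \<lhd> T p"
  by (simp add: comm_group comm_group.subgroup_imp_normal sub)

text \<open>\<open>\<delta>\<close> maps the coset into a single coset of \<open>L (Suc p)\<close>,
  and multiplication by all of \<open>L (Suc p)\<close> fills that coset.\<close>

lemma \<delta>Q_coset:
  assumes f: "f \<in> carrier (T p)"
  shows "\<delta>Q p (L p #>\<^bsub>T p\<^esub> f) = L (Suc p) #>\<^bsub>T (Suc p)\<^esub> \<delta> p f"
proof -
  interpret T: comm_group "T (Suc p)" by (rule comm_group)
  interpret L: subgroup "L (Suc p)" "T (Suc p)" by (rule sub)
  interpret L0: subgroup "L p" "T p" by (rule sub)
  note df = hom_in_carrier[OF hom f]
  have mult: "\<delta> p (l \<otimes>\<^bsub>T p\<^esub> f) = \<delta> p l \<otimes>\<^bsub>T (Suc p)\<^esub> \<delta> p f" if "l \<in> L p" for l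
    using hom_mult[OF hom] f L0.mem_carrier[OF that] by blast
  show ?thesis
  proof
    show "\<delta>Q p (L p #>\<^bsub>T p\<^esub> f) \<subseteq> L (Suc p) #>\<^bsub>T (Suc p)\<^esub> \<delta> p f"
    proof
      fix x assume "x \<in> \<delta>Q p (L p #>\<^bsub>T p\<^esub> f)"
      then obtain l m where lm: "l \<in> L p" "m \<in> L (Suc p)"
        "x = (\<delta> p l \<otimes>\<^bsub>T (Suc p)\<^esub> \<delta> p f) \<otimes>\<^bsub>T (Suc p)\<^esub> m"
        by (auto simp: \<delta>Q_def set_mult_def r_coset_def mult)
      have dl: "\<delta> p l \<in> L (Suc p)" using stable lm by blast
      then have "x = (\<delta> p l \<otimes>\<^bsub>T (Suc p)\<^esub> m) \<otimes>\<^bsub>T (Suc p)\<^esub> \<delta> p f"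
        using lm df by (simp add: T.m_ac)
      then show "x \<in> L (Suc p) #>\<^bsub>T (Suc p)\<^esub> \<delta> p f"
        using dl lm by (auto simp: r_coset_def)
    qed
    show "L (Suc p) #>\<^bsub>T (Suc p)\<^esub> \<delta> p f \<subseteq> \<delta>Q p (L p #>\<^bsub>T p\<^esub> f)"
    proof
      fix x assume "x \<in> L (Suc p) #>\<^bsub>T (Suc p)\<^esub> \<delta> p f"
      then obtain m where m: "m \<in> L (Suc p)" "x = m \<otimes>\<^bsub>T (Suc p)\<^esub> \<delta> p f"
        by (auto simp: r_coset_def)
      then have "x = \<delta> p f \<otimes>\<^bsub>T (Suc p)\<^esub> m"
        using df by (simp add: T.m_comm)
      moreover have "f \<in> L p #>\<^bsub>T p\<^esub> f"
        by (simp add: f group group.rcos_self sub)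
      ultimately show "x \<in> \<delta>Q p (L p #>\<^bsub>T p\<^esub> f)"
        using m by (auto simp: \<delta>Q_def set_mult_def)
    qed
  qed
qed

lemma coset_hom: "(\<lambda>f. L p #>\<^bsub>T p\<^esub> f) \<in> hom (T p) (Q p)"
  by (rule normal.r_coset_hom_Mod[OF normal_L])

lemma coset_eq_one_iff: "f \<in> carrier (T p) \<Longrightarrow> L p #>\<^bsub>T p\<^esub> f = L p \<longleftrightarrow> f \<in> L p"
  using group.coset_join1[OF group _ _ sub] group.coset_join2[OF group _ sub]
    subgroup.subset[OF sub] by metis

sublocale Q: cochain_complex Q \<delta>Q
proof (rule cochain_complex.intro)
  fix p
  show "comm_group (Q p)"
    by (simp add: comm_group comm_group.abelian_FactGroup sub)
  show "\<delta>Q p \<in> hom (Q p) (Q (Suc p))"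
  proof (rule homI)
    fix K assume "K \<in> carrier (Q p)"
    then obtain f where f: "f \<in> carrier (T p)" "K = L p #>\<^bsub>T p\<^esub> f"
      by (auto simp: carrier_FactGroup)
    then show "\<delta>Q p K \<in> carrier (Q (Suc p))"
      using hom_in_carrier[OF hom f(1)] by (auto simp: \<delta>Q_coset carrier_FactGroup)
    fix K' assume "K' \<in> carrier (Q p)"
    then obtain f' where f': "f' \<in> carrier (T p)" "K' = L p #>\<^bsub>T p\<^esub> f'"
      by (auto simp: carrier_FactGroup)
    have "f \<otimes>\<^bsub>T p\<^esub> f' \<in> carrier (T p)"
      by (meson f(1) f'(1) group group.is_monoid monoid.m_closed)
    then show "\<delta>Q p (K \<otimes>\<^bsub>Q p\<^esub> K') = \<delta>Q p K \<otimes>\<^bsub>Q (Suc p)\<^esub> \<delta>Q p K'"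
      using f f' hom_mult[OF coset_hom f(1) f'(1)] hom_mult[OF hom f(1) f'(1)]
        hom_mult[OF coset_hom hom_in_carrier[OF hom f(1)] hom_in_carrier[OF hom f'(1)]]
      by (metis \<delta>Q_coset)
  qed
  fix K assume "K \<in> carrier (Q p)"
  then obtain f where f: "f \<in> carrier (T p)" "K = L p #>\<^bsub>T p\<^esub> f"
    by (auto simp: carrier_FactGroup)
  have "\<one>\<^bsub>T (Suc (Suc p))\<^esub> \<in> carrier (T (Suc (Suc p)))"
    by (meson group group.is_monoid monoid.one_closed)
  then show "\<delta>Q (Suc p) (\<delta>Q p K) = \<one>\<^bsub>Q (Suc (Suc p))\<^esub>"
    using f hom_in_carrier[OF hom f(1)] square[OF f(1)]
    by (simp add: \<delta>Q_coset coset_eq_one_iff subgroup.one_closed[OF sub])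
qed

definition rel_cocycles where "rel_cocycles p = {f \<in> carrier (T p). \<delta> p f \<in> L (Suc p)}"

definition rel_cls where "rel_cls p f = Q.cls p (L p #>\<^bsub>T p\<^esub> f)"

lemma coset_in_cocycles_iff:
  "f \<in> carrier (T p) \<Longrightarrow> L p #>\<^bsub>T p\<^esub> f \<in> Q.cocycles p \<longleftrightarrow> f \<in> rel_cocycles p"
  using hom_in_carrier[OF hom, of f p] hom_in_carrier[OF coset_hom, of f p]
  by (auto simp: kernel_def rel_cocycles_def \<delta>Q_coset coset_eq_one_iff)

lemma subgroup_rel_cocycles: "subgroup (rel_cocycles p) (T p)"
proof -
  interpret g: group_hom "T p" "T (Suc p)" "\<delta> p" by (rule group_hom)
  interpret L: subgroup "L (Suc p)" "T (Suc p)" by (rule sub)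
  show ?thesis
    by standard (auto simp: rel_cocycles_def)
qed

abbreviation rel_cocycle_group where
  "rel_cocycle_group p \<equiv> subgroup_generated (T p) (rel_cocycles p)"

lemma carrier_rel_cocycle_group [simp]: "carrier (rel_cocycle_group p) = rel_cocycles p"
  by (simp add: subgroup.carrier_subgroup_generated_subgroup[OF subgroup_rel_cocycles])

lemma rel_cls_hom: "rel_cls p \<in> hom (rel_cocycle_group p) (cohomology_group Q \<delta>Q p)"
proof (rule homI)
  fix f assume "f \<in> carrier (rel_cocycle_group p)"
  then have f: "f \<in> rel_cocycles p" "f \<in> carrier (T p)"
    unfolding carrier_rel_cocycle_group by (simp_all add: rel_cocycles_def)
  then have fQ: "L p #>\<^bsub>T p\<^esub> f \<in> Q.cocycles p"
    by (simp add: coset_in_cocycles_iff)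
  then show "rel_cls p f \<in> carrier (cohomology_group Q \<delta>Q p)"
    using Q.cls_surj by (auto simp: rel_cls_def)
  fix f' assume "f' \<in> carrier (rel_cocycle_group p)"
  then have f': "f' \<in> rel_cocycles p" "f' \<in> carrier (T p)"
    unfolding carrier_rel_cocycle_group by (simp_all add: rel_cocycles_def)
  then have fQ': "L p #>\<^bsub>T p\<^esub> f' \<in> Q.cocycles p"
    by (simp add: coset_in_cocycles_iff)
  show "rel_cls p (f \<otimes>\<^bsub>rel_cocycle_group p\<^esub> f') =
      rel_cls p f \<otimes>\<^bsub>cohomology_group Q \<delta>Q p\<^esub> rel_cls p f'"
    using hom_mult[OF Q.cls_hom[of p], of "L p #>\<^bsub>T p\<^esub> f" "L p #>\<^bsub>T p\<^esub> f'"] fQ fQ'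
      hom_mult[OF coset_hom f(2) f'(2)] by (simp add: rel_cls_def)
qed

lemma rel_cls_surj: "rel_cls p ` rel_cocycles p = carrier (cohomology_group Q \<delta>Q p)"
proof -
  have "Q.cocycles p = (\<lambda>f. L p #>\<^bsub>T p\<^esub> f) ` rel_cocycles p"
  proof
    show "Q.cocycles p \<subseteq> (\<lambda>f. L p #>\<^bsub>T p\<^esub> f) ` rel_cocycles p"
    proof
      fix K assume K: "K \<in> Q.cocycles p"
      then obtain f where f: "f \<in> carrier (T p)" "K = L p #>\<^bsub>T p\<^esub> f"
        by (auto simp: kernel_def carrier_FactGroup)
      with K show "K \<in> (\<lambda>f. L p #>\<^bsub>T p\<^esub> f) ` rel_cocycles p"
        by (simp add: coset_in_cocycles_iff)
    qed
    show "(\<lambda>f. L p #>\<^bsub>T p\<^esub> f) ` rel_cocycles p \<subseteq> Q.cocycles p"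
      using coset_in_cocycles_iff by (auto simp: rel_cocycles_def)
  qed
  then show ?thesis
    by (simp add: Q.cls_surj[symmetric] rel_cls_def[abs_def] image_image)
qed

lemma coset_eq_iff:
  assumes "f \<in> carrier (T p)" "g \<in> carrier (T p)"
  shows "L p #>\<^bsub>T p\<^esub> f = L p #>\<^bsub>T p\<^esub> g \<longleftrightarrow> f \<otimes>\<^bsub>T p\<^esub> inv\<^bsub>T p\<^esub> g \<in> L p"
proof -
  interpret C: comm_group "T p" by (rule comm_group)
  interpret B: subgroup "L p" "T p" by (rule sub)
  show ?thesis
    using assms
    by (metis C.coset_mult_inv1 C.coset_mult_inv2 C.coset_join1 C.coset_join2 B.subset B.subgroup_axioms
        C.inv_closed C.m_closed)
qed

text \<open>Coboundaries of the quotient complex are the cosets of coboundaries of \<open>T\<close>;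
  in degree 0 this is the coset of the unit, which is \<open>L p\<close> itself.\<close>

lemma rel_cls_eq_one_iff:
  assumes f: "f \<in> rel_cocycles p"
  shows "rel_cls p f = \<one>\<^bsub>cohomology_group Q \<delta>Q p\<^esub> \<longleftrightarrow>
     (\<exists>b\<in>coboundaries T \<delta> p. f \<otimes>\<^bsub>T p\<^esub> inv\<^bsub>T p\<^esub> b \<in> L p)"
proof -
  have fT: "f \<in> carrier (T p)" using f by (simp add: rel_cocycles_def)
  have "L p #>\<^bsub>T p\<^esub> f \<in> coboundaries Q \<delta>Q p \<longleftrightarrow>
      (\<exists>b\<in>coboundaries T \<delta> p. L p #>\<^bsub>T p\<^esub> f = L p #>\<^bsub>T p\<^esub> b)"
  proof (cases p)
    case 0
    have "\<one>\<^bsub>T p\<^esub> \<in> carrier (T p)"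
      by (meson group group.is_monoid monoid.one_closed)
    then have "L p #>\<^bsub>T p\<^esub> \<one>\<^bsub>T p\<^esub> = L p"
      by (simp add: coset_eq_one_iff subgroup.one_closed[OF sub])
    then show ?thesis
      using 0 by (simp add: coboundaries_0)
  next
    case (Suc q)
    then show ?thesis
      by (auto simp: coboundaries_Suc carrier_FactGroup image_image \<delta>Q_coset)
  qed
  moreover have "b \<in> carrier (T p)" if "b \<in> coboundaries T \<delta> p" for b
    using that subgroup.subset[OF subgroup_coboundaries] by blast
  ultimately show ?thesis
    using f fT unfolding rel_cls_def
    by (simp add: Q.cls_eq_one_iff coset_in_cocycles_iff coset_eq_iff)
qed

end

section \<open>Complexes of functions on ordered tuples\<close>

locale tuple_complex = comm_group G for G :: "('g, 'm) monoid_scheme" (structure) +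
  fixes S :: "nat \<Rightarrow> 's list set"
  assumes S_length: "\<And>p xs. xs \<in> S p \<Longrightarrow> length xs = Suc p"
    and S_omit: "\<And>p xs k. xs \<in> S (Suc p) \<Longrightarrow> k \<le> Suc p \<Longrightarrow> omit k xs \<in> S p"
begin

lemma keys_boundary_S: "xs \<in> S (Suc p) \<Longrightarrow> Poly_Mapping.keys (tuple_boundary xs) \<subseteq> S p"
  using keys_tuple_boundary[of xs] S_length S_omit by (auto simp: less_Suc_eq_le)

text \<open>Tuples in \<open>S (Suc p)\<close> have at least two entries, so no empty tuple occurs
  in their augmented boundary, which is then the usual alternating sum of faces.\<close>

lemma coboundary_eq_ev:
  assumes "f \<in> carrier (tuple_cochain_group S G p)"
  shows "tuple_coboundary S G p f = (\<lambda>xs\<in>S (Suc p). ev G f (tuple_boundary xs))"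
  unfolding tuple_coboundary_def
proof (rule restrict_ext)
  fix xs assume xs: "xs \<in> S (Suc p)"
  have f: "f (omit k xs) \<in> carrier G" if "k \<le> Suc p" for k
    using assms S_omit[OF xs that] by (auto simp: tuple_cochain_group_def)
  have "ev G f (tuple_boundary xs) =
      finprod G (\<lambda>k. ev G f (frag_cmul ((- 1) ^ k) (frag_of (omit k xs)))) {..<length xs}"
    unfolding tuple_boundary_def by (rule ev_sum) simp
  also have "{..<length xs} = {..Suc p}"
    using S_length[OF xs] by auto
  also have "finprod G (\<lambda>k. ev G f (frag_cmul ((- 1) ^ k) (frag_of (omit k xs)))) {..Suc p} =
      finprod G (\<lambda>k. f (omit k xs) [^] ((- 1) ^ k :: int)) {..Suc p}"
    using f by (intro finprod_cong') (auto simp: ev_cmul)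
  finally show "finprod G (\<lambda>k. f (omit k xs) [^] ((- 1) ^ k :: int)) {..Suc p} =
      ev G f (tuple_boundary xs)" by simp
qed

lemma carrier_cochains: "carrier (tuple_cochain_group S G p) = S p \<rightarrow>\<^sub>E carrier G"
  by (simp add: tuple_cochain_group_def)

lemma mult_cochains: "f \<otimes>\<^bsub>tuple_cochain_group S G p\<^esub> g = (\<lambda>xs\<in>S p. f xs \<otimes> g xs)"
  by (simp add: tuple_cochain_group_def)

lemma one_cochains: "\<one>\<^bsub>tuple_cochain_group S G p\<^esub> = (\<lambda>xs\<in>S p. \<one>)"
  by (simp add: tuple_cochain_group_def)

lemma inv_cochains:
  "f \<in> S p \<rightarrow>\<^sub>E carrier G \<Longrightarrow> inv\<^bsub>tuple_cochain_group S G p\<^esub> f = (\<lambda>xs\<in>S p. inv f xs)"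
  unfolding tuple_cochain_group_def by (subst inv_product_group) auto

lemma ev_coboundary:
  assumes f: "f \<in> S p \<rightarrow>\<^sub>E carrier G" and c: "Poly_Mapping.keys c \<subseteq> S (Suc p)"
  shows "ev G (tuple_coboundary S G p f) c = ev G f (frag_extend tuple_boundary c)"
proof -
  have "tuple_coboundary S G p f = (\<lambda>xs\<in>S (Suc p). ev G f (tuple_boundary xs))"
    by (rule coboundary_eq_ev) (simp add: carrier_cochains f)
  then show ?thesis
    unfolding ev_extend using c by (intro ev_cong) auto
qed

sublocale complex: cochain_complex "tuple_cochain_group S G" "tuple_coboundary S G"
proof (rule cochain_complex.intro)
  fix p
  show "comm_group (tuple_cochain_group S G p)"
  proof (rule group.group_comm_groupI)
    show "Group.group (tuple_cochain_group S G p)"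
      by (simp add: tuple_cochain_group_def)
  qed (auto simp: carrier_cochains mult_cochains m_comm PiE_def Pi_def intro!: restrict_ext)
  show "tuple_coboundary S G p \<in> hom (tuple_cochain_group S G p) (tuple_cochain_group S G (Suc p))"
  proof (rule homI)
    fix f assume f: "f \<in> carrier (tuple_cochain_group S G p)"
    show "tuple_coboundary S G p f \<in> carrier (tuple_cochain_group S G (Suc p))"
      unfolding coboundary_eq_ev[OF f] by (simp add: carrier_cochains)
    fix g assume g: "g \<in> carrier (tuple_cochain_group S G p)"
    then have fg: "f \<otimes>\<^bsub>tuple_cochain_group S G p\<^esub> g \<in> carrier (tuple_cochain_group S G p)"
      using f by (auto simp: carrier_cochains mult_cochains)
    show "tuple_coboundary S G p (f \<otimes>\<^bsub>tuple_cochain_group S G p\<^esub> g) =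
      tuple_coboundary S G p f \<otimes>\<^bsub>tuple_cochain_group S G (Suc p)\<^esub> tuple_coboundary S G p g"
      unfolding coboundary_eq_ev[OF f] coboundary_eq_ev[OF g] coboundary_eq_ev[OF fg]
      unfolding mult_cochains
    proof (rule restrict_ext)
      fix xs assume xs: "xs \<in> S (Suc p)"
      have "ev G (\<lambda>xs\<in>S p. f xs \<otimes> g xs) (tuple_boundary xs) =
          ev G (\<lambda>xs. f xs \<otimes> g xs) (tuple_boundary xs)"
        using keys_boundary_S[OF xs] by (intro ev_cong) auto
      also have "\<dots> = ev G f (tuple_boundary xs) \<otimes> ev G g (tuple_boundary xs)"
        using keys_boundary_S[OF xs] f g by (intro ev_mult) (auto simp: carrier_cochains)
      finally show "ev G (\<lambda>xs\<in>S p. f xs \<otimes> g xs) (tuple_boundary xs) =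
        (\<lambda>xs\<in>S (Suc p). ev G f (tuple_boundary xs)) xs \<otimes>
        (\<lambda>xs\<in>S (Suc p). ev G g (tuple_boundary xs)) xs"
        using xs by simp
    qed
  qed
  fix f assume f: "f \<in> carrier (tuple_cochain_group S G p)"
  have df: "tuple_coboundary S G p f \<in> carrier (tuple_cochain_group S G (Suc p))"
    unfolding coboundary_eq_ev[OF f] by (simp add: carrier_cochains)
  show "tuple_coboundary S G (Suc p) (tuple_coboundary S G p f) =
      \<one>\<^bsub>tuple_cochain_group S G (Suc (Suc p))\<^esub>"
    unfolding coboundary_eq_ev[OF df] one_cochains
    using f keys_boundary_S
    by (intro restrict_ext) (simp add: carrier_cochains ev_coboundary tuple_boundary_boundary)
qed

end

section \<open>Alexander-Spanier cohomology in terms of representing cochains\<close>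

lemma open_cover_inter:
  assumes "open_cover X \<U>" "open_cover X \<V>"
  obtains \<W> where "open_cover X \<W>" "\<And>W. W \<in> \<W> \<Longrightarrow> \<exists>U\<in>\<U>. W \<subseteq> U" "\<And>W. W \<in> \<W> \<Longrightarrow> \<exists>V\<in>\<V>. W \<subseteq> V"
proof
  let ?W = "{U \<inter> V | U V. U \<in> \<U> \<and> V \<in> \<V>}"
  have "\<Union> ?W = \<Union>\<U> \<inter> \<Union>\<V>" by auto
  then show "open_cover X ?W"
    using assms by (auto simp: open_cover_def)
qed auto

lemma open_cover_topspace: "open_cover X {topspace X}"
  by (simp add: open_cover_def)

locale AS_complex = comm_group G for G :: "('g, 'm) monoid_scheme" (structure) +
  fixes X :: "'a topology"
begin

sublocale tuple_complex G "point_tuples X"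
proof
  show "omit k xs \<in> point_tuples X p" if "xs \<in> point_tuples X (Suc p)" "k \<le> Suc p" for p xs k
    using that set_omit[of k xs] by (auto simp: point_tuples_def length_omit)
qed (simp add: point_tuples_def)

lemma locally_zero_iff:
  "f \<in> locally_zero_cochains X G p \<longleftrightarrow> f \<in> point_tuples X p \<rightarrow>\<^sub>E carrier G \<and>
     (\<exists>\<U>. open_cover X \<U> \<and> (\<forall>U\<in>\<U>. \<forall>xs\<in>point_tuples X p. set xs \<subseteq> U \<longrightarrow> f xs = \<one>))"
  by (simp add: locally_zero_cochains_def carrier_cochains)

sublocale pair: cochain_pair "tuple_cochain_group (point_tuples X) G"
    "tuple_coboundary (point_tuples X) G" "locally_zero_cochains X G"
proof (rule cochain_pair.intro[OF complex.cochain_complex_axioms cochain_pair_axioms.intro])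
  fix p
  show "subgroup (locally_zero_cochains X G p) (tuple_cochain_group (point_tuples X) G p)"
  proof
    show "\<one>\<^bsub>tuple_cochain_group (point_tuples X) G p\<^esub> \<in> locally_zero_cochains X G p"
      using open_cover_topspace by (fastforce simp: locally_zero_iff one_cochains)
    fix f assume f: "f \<in> locally_zero_cochains X G p"
    then show "inv\<^bsub>tuple_cochain_group (point_tuples X) G p\<^esub> f \<in> locally_zero_cochains X G p"
      by (auto simp: locally_zero_iff inv_cochains)
    fix g assume g: "g \<in> locally_zero_cochains X G p"
    obtain \<U> where U: "open_cover X \<U>" "\<And>U xs. U \<in> \<U> \<Longrightarrow> xs \<in> point_tuples X p \<Longrightarrow> set xs \<subseteq> U \<Longrightarrow> f xs = \<one>"
      using f by (auto simp: locally_zero_iff)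
    obtain \<V> where V: "open_cover X \<V>" "\<And>U xs. U \<in> \<V> \<Longrightarrow> xs \<in> point_tuples X p \<Longrightarrow> set xs \<subseteq> U \<Longrightarrow> g xs = \<one>"
      using g by (auto simp: locally_zero_iff)
    obtain \<W> where W: "open_cover X \<W>" "\<And>W. W \<in> \<W> \<Longrightarrow> \<exists>U\<in>\<U>. W \<subseteq> U" "\<And>W. W \<in> \<W> \<Longrightarrow> \<exists>V\<in>\<V>. W \<subseteq> V"
      using open_cover_inter[OF U(1) V(1)] by metis
    have "f xs \<otimes> g xs = \<one>" if "W \<in> \<W>" "xs \<in> point_tuples X p" "set xs \<subseteq> W" for W xs
      using W(2,3)[OF that(1)] U(2)[OF _ that(2)] V(2)[OF _ that(2)] that(3) by fastforce
    then show "f \<otimes>\<^bsub>tuple_cochain_group (point_tuples X) G p\<^esub> g \<in> locally_zero_cochains X G p"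
      using f g W(1) unfolding locally_zero_iff mult_cochains
      by (intro conjI exI[of _ \<W>]) auto
  qed (auto simp: locally_zero_iff carrier_cochains)
  show "tuple_coboundary (point_tuples X) G p ` locally_zero_cochains X G p
      \<subseteq> locally_zero_cochains X G (Suc p)"
  proof clarify
    fix f assume f: "f \<in> locally_zero_cochains X G p"
    obtain \<U> where U: "open_cover X \<U>" "\<And>U xs. U \<in> \<U> \<Longrightarrow> xs \<in> point_tuples X p \<Longrightarrow> set xs \<subseteq> U \<Longrightarrow> f xs = \<one>"
      using f by (auto simp: locally_zero_iff)
    have fc: "f \<in> carrier (tuple_cochain_group (point_tuples X) G p)"
      using f by (simp add: locally_zero_iff carrier_cochains)
    have "ev G f (tuple_boundary xs) = \<one>"
      if "U \<in> \<U>" "xs \<in> point_tuples X (Suc p)" "set xs \<subseteq> U" for U xs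
    proof (rule ev_trivial)
      fix ys assume ys: "ys \<in> Poly_Mapping.keys (tuple_boundary xs)"
      then have "set ys \<subseteq> U"
        using keys_tuple_boundary[of xs] set_omit[of _ xs] that(3) by blast
      then show "trunc G (f ys) = \<one>"
        using U(2)[OF that(1)] keys_boundary_S[OF that(2)] ys by (auto simp: trunc_def)
    qed
    then show "tuple_coboundary (point_tuples X) G p f \<in> locally_zero_cochains X G (Suc p)"
      unfolding coboundary_eq_ev[OF fc] locally_zero_iff using U(1) by (auto intro!: exI[of _ \<U>])
  qed
qed

definition AS_cocycles where
  "AS_cocycles p = {f \<in> point_tuples X p \<rightarrow>\<^sub>E carrier G. \<exists>\<U>. open_cover X \<U> \<and>
     (\<forall>U\<in>\<U>. \<forall>xs\<in>point_tuples X (Suc p). set xs \<subseteq> U \<longrightarrow> ev G f (tuple_boundary xs) = \<one>)}"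

lemma AS_cocycles_eq: "AS_cocycles p = pair.rel_cocycles p"
proof -
  have "f \<in> AS_cocycles p \<longleftrightarrow> tuple_coboundary (point_tuples X) G p f \<in> locally_zero_cochains X G (Suc p)"
    if "f \<in> carrier (tuple_cochain_group (point_tuples X) G p)" for f
    using that unfolding coboundary_eq_ev[OF that]
    by (simp add: AS_cocycles_def locally_zero_iff carrier_cochains)
  then show ?thesis
    by (auto simp: pair.rel_cocycles_def carrier_cochains AS_cocycles_def)
qed

abbreviation AS_cocycle_group where "AS_cocycle_group \<equiv> pair.rel_cocycle_group"

definition AS_class where "AS_class = pair.rel_cls"

lemma AS_cohomology_group_eq: "AS_cohomology_group p X G = cohomology_group pair.Q pair.\<delta>Q p"
  by (simp add: AS_cohomology_group_def AS_cochain_group_def[abs_def] AS_coboundary_def[abs_def]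
      pair.\<delta>Q_def[abs_def])

lemma AS_class_hom: "AS_class p \<in> hom (AS_cocycle_group p) (AS_cohomology_group p X G)"
  by (simp add: AS_cohomology_group_eq AS_class_def pair.rel_cls_hom)

lemma AS_class_surj: "AS_class p ` AS_cocycles p = carrier (AS_cohomology_group p X G)"
  by (simp add: AS_cohomology_group_eq AS_class_def pair.rel_cls_surj AS_cocycles_eq)

lemma group_AS: "group (AS_cohomology_group p X G)"
  by (simp add: AS_cohomology_group_eq pair.Q.group_cohomology)

text \<open>Equality with the coboundary of \<open>u\<close> near the diagonal. On one-point tuples
  that coboundary is \<open>u []\<close>, so the side condition makes it trivial in degree 0. The
  values of \<open>u\<close> are unrestricted since \<open>ev\<close> truncates them.\<close>

definition cobounds where
  "cobounds p f u \<longleftrightarrow> (p = 0 \<longrightarrow> u [] = \<one>) \<and> (\<exists>\<U>. open_cover X \<U> \<and>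
      (\<forall>U\<in>\<U>. \<forall>xs\<in>point_tuples X p. set xs \<subseteq> U \<longrightarrow> f xs = ev G u (tuple_boundary xs)))"

lemma AS_class_eq_one_iff:
  assumes f: "f \<in> AS_cocycles p"
  shows "AS_class p f = \<one>\<^bsub>AS_cohomology_group p X G\<^esub> \<longleftrightarrow> (\<exists>u. cobounds p f u)"
proof -
  let ?T = "tuple_cochain_group (point_tuples X) G"
  have fc: "f \<in> point_tuples X p \<rightarrow>\<^sub>E carrier G" using f by (simp add: AS_cocycles_def)
  have diff: "f \<otimes>\<^bsub>?T p\<^esub> inv\<^bsub>?T p\<^esub> b \<in> locally_zero_cochains X G p \<longleftrightarrow>
      (\<exists>\<U>. open_cover X \<U> \<and> (\<forall>U\<in>\<U>. \<forall>xs\<in>point_tuples X p. set xs \<subseteq> U \<longrightarrow> f xs = b xs))"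
    if b: "b \<in> point_tuples X p \<rightarrow>\<^sub>E carrier G" for b
  proof -
    have "f xs \<otimes> inv (b xs) = \<one> \<longleftrightarrow> f xs = b xs" if "xs \<in> point_tuples X p" for xs
    proof -
      have "f xs \<in> carrier G" "b xs \<in> carrier G" using that fc b by auto
      then show ?thesis
        using inv_solve_right'[of \<one> "f xs" "b xs"] by auto
    qed
    then show ?thesis
      using PiE_mem[OF fc] PiE_mem[OF b] by (auto simp: b locally_zero_iff mult_cochains inv_cochains)
  qed
  have "(\<exists>b\<in>coboundaries ?T (tuple_coboundary (point_tuples X) G) p.
      f \<otimes>\<^bsub>?T p\<^esub> inv\<^bsub>?T p\<^esub> b \<in> locally_zero_cochains X G p) \<longleftrightarrow> (\<exists>u. cobounds p f u)" (is "?l \<longleftrightarrow> ?r")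
  proof (cases p)
    case 0
    have "(\<lambda>xs\<in>point_tuples X 0. \<one>) \<in> point_tuples X 0 \<rightarrow>\<^sub>E carrier G" by auto
    moreover have bd: "tuple_boundary xs = frag_of []" if "xs \<in> point_tuples X 0" for xs
      using that by (cases xs) (auto simp: point_tuples_def tuple_boundary_Cons tuple_cone_def)
    ultimately have "?l \<longleftrightarrow> (\<exists>\<U>. open_cover X \<U> \<and>
        (\<forall>U\<in>\<U>. \<forall>xs\<in>point_tuples X p. set xs \<subseteq> U \<longrightarrow> f xs = \<one>))"
      using diff[of "\<lambda>xs\<in>point_tuples X 0. \<one>"] unfolding 0 coboundaries_0 one_cochains by auto
    also have "\<dots> \<longleftrightarrow> cobounds p f (\<lambda>_. \<one>)"
      using bd by (simp add: cobounds_def 0)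
    also have "\<dots> \<longleftrightarrow> ?r"
    proof
      show ?r if "cobounds p f (\<lambda>_. \<one>)" using that by blast
      show "cobounds p f (\<lambda>_. \<one>)" if ?r using that bd by (auto simp: cobounds_def 0)
    qed
    finally show ?thesis .
  next
    case (Suc q)
    have c: "(\<lambda>xs\<in>point_tuples X (Suc q). ev G u (tuple_boundary xs))
        \<in> point_tuples X (Suc q) \<rightarrow>\<^sub>E carrier G" for u by auto
    show ?thesis
    proof
      assume ?l
      then obtain u where u: "u \<in> carrier (?T q)"
        "f \<otimes>\<^bsub>?T p\<^esub> inv\<^bsub>?T p\<^esub> (tuple_coboundary (point_tuples X) G q u) \<in> locally_zero_cochains X G p"
        by (auto simp: Suc coboundaries_Suc)
      then have "cobounds p f u"
        using diff[of "tuple_coboundary (point_tuples X) G q u"] c[of u] unfolding coboundary_eq_ev[OF u(1)] Suc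
        by (fastforce simp: cobounds_def)
      then show ?r by blast
    next
      assume ?r
      then obtain u where u: "cobounds p f u" by blast
      \<comment> \<open>\<open>u\<close> is an arbitrary function, but \<open>ev\<close> sees only
        its truncated values on the faces of \<open>xs\<close>, so it can be replaced by a genuine
        cochain.\<close>
      define u' where "u' = (\<lambda>xs\<in>point_tuples X q. trunc G (u xs))"
      have u': "u' \<in> carrier (?T q)"
        by (simp add: u'_def carrier_cochains)
      have eq: "ev G u' (tuple_boundary xs) = ev G u (tuple_boundary xs)"
        if "xs \<in> point_tuples X (Suc q)" for xs
        using keys_boundary_S[OF that] by (intro ev_cong) (auto simp: u'_def)
      have "f \<otimes>\<^bsub>?T p\<^esub> inv\<^bsub>?T p\<^esub> (tuple_coboundary (point_tuples X) G q u') \<in> locally_zero_cochains X G p"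
        using u diff[of "tuple_coboundary (point_tuples X) G q u'"] c[of u'] eq
        unfolding coboundary_eq_ev[OF u'] Suc by (fastforce simp: cobounds_def)
      then show ?l
        using u' by (auto simp: Suc coboundaries_Suc)
    qed
  qed
  then show ?thesis
    using f by (simp add: AS_class_def AS_cohomology_group_eq AS_cocycles_eq pair.rel_cls_eq_one_iff)
qed

lemma AS_class_eqI:
  assumes f: "f \<in> AS_cocycles p" "f' \<in> AS_cocycles p" and u: "p = 0 \<Longrightarrow> u [] = \<one>"
    and \<U>: "\<exists>\<U>. open_cover X \<U> \<and> (\<forall>U\<in>\<U>. \<forall>xs\<in>point_tuples X p. set xs \<subseteq> U \<longrightarrow>
       f xs = f' xs \<otimes> ev G u (tuple_boundary xs))"
  shows "AS_class p f = AS_class p f'"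
proof -
  let ?T = "tuple_cochain_group (point_tuples X) G p" and ?H = "AS_cohomology_group p X G"
  interpret A: group_hom "AS_cocycle_group p" ?H "AS_class p"
    by (simp add: group_hom_def group_hom_axioms_def AS_class_hom group_AS
        group.group_subgroup_generated complex.group)
  have fA: "f \<in> carrier (AS_cocycle_group p)" "f' \<in> carrier (AS_cocycle_group p)"
    using f by (simp_all add: AS_cocycles_eq)
  have fc: "f \<in> point_tuples X p \<rightarrow>\<^sub>E carrier G" "f' \<in> point_tuples X p \<rightarrow>\<^sub>E carrier G"
    using f by (simp_all add: AS_cocycles_def)
  have inv: "inv\<^bsub>AS_cocycle_group p\<^esub> f' = (\<lambda>xs\<in>point_tuples X p. inv (f' xs))"
    using fA(2) by (simp add: group.inv_subgroup_generated[OF complex.group] inv_cochains[OF fc(2)])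
  let ?q = "f \<otimes>\<^bsub>AS_cocycle_group p\<^esub> inv\<^bsub>AS_cocycle_group p\<^esub> f'"
  have q: "?q = (\<lambda>xs\<in>point_tuples X p. f xs \<otimes> inv (f' xs))"
    unfolding inv by (simp add: mult_cochains cong: restrict_cong)
  have qA: "?q \<in> AS_cocycles p"
    using fA A.G.m_closed A.G.inv_closed by (metis pair.carrier_rel_cocycle_group AS_cocycles_eq)
  have "cobounds p ?q u"
    unfolding cobounds_def q
  proof (intro conjI impI)
    obtain \<U> where \<U>: "open_cover X \<U>" "\<And>U xs. U \<in> \<U> \<Longrightarrow> xs \<in> point_tuples X p \<Longrightarrow> set xs \<subseteq> U \<Longrightarrow>
       f xs = f' xs \<otimes> ev G u (tuple_boundary xs)"
      using \<U> by blast
    have "f xs \<otimes> inv (f' xs) = ev G u (tuple_boundary xs)"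
      if "U \<in> \<U>" "xs \<in> point_tuples X p" "set xs \<subseteq> U" for U xs
      using \<U>(2)[OF that] PiE_mem[OF fc(2) that(2)] 
      by (simp add: m_comm[of "f' xs" "ev G u (tuple_boundary xs)"] m_assoc)
    then show "\<exists>\<U>. open_cover X \<U> \<and> (\<forall>U\<in>\<U>. \<forall>xs\<in>point_tuples X p. set xs \<subseteq> U \<longrightarrow>
        (\<lambda>xs\<in>point_tuples X p. f xs \<otimes> inv (f' xs)) xs = ev G u (tuple_boundary xs))"
      using \<U>(1) by (intro exI[of _ \<U>]) simp
  qed (rule u)
  then have "AS_class p ?q = \<one>\<^bsub>?H\<^esub>"
    using AS_class_eq_one_iff[OF qA] by blast
  then have "AS_class p f \<otimes>\<^bsub>?H\<^esub> inv\<^bsub>?H\<^esub> AS_class p f' = \<one>\<^bsub>?H\<^esub>"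
    using fA by (simp only: A.hom_mult A.hom_inv A.G.inv_closed)
  then show ?thesis
    using fA by (metis A.H.inv_closed A.H.inv_equality A.H.inv_inv A.hom_closed)
qed

end

section \<open>Singular chains\<close>

text \<open>In degree 0 the boundary is replaced by the augmentation: the sum of the coefficients is
  recorded as a multiple of the single generator \<open>()\<close>.\<close>

definition reduced_cycle :: "nat \<Rightarrow> 'a topology \<Rightarrow> 'a chain \<Rightarrow> bool" where
  "reduced_cycle p X c \<longleftrightarrow> singular_chain p X c \<and>
     (if p = 0 then frag_extend (\<lambda>_. frag_of ()) c = 0 else chain_boundary p c = 0)"

definition null_in :: "'a topology \<Rightarrow> 'a set \<Rightarrow> 'a set \<Rightarrow> bool" where
  "null_in X V U \<longleftrightarrow> (\<forall>p c. reduced_cycle p (subtopology X V) c \<longrightarrow>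
     (\<exists>d. singular_chain (Suc p) (subtopology X U) d \<and> chain_boundary (Suc p) d = c))"

text \<open>Either side says that the coefficients of \<open>c\<close> add up to 0, whichever
  generator records the sum.\<close>

lemma frag_extend_const_eq_0_iff:
  "frag_extend (\<lambda>_. frag_of a) c = 0 \<longleftrightarrow> frag_extend (\<lambda>_. frag_of b) c = 0"
proof -
  have "frag_extend (\<lambda>_. frag_of b) c = frag_extend (\<lambda>_. frag_of b) (frag_extend (\<lambda>_. frag_of a) c)"
    "frag_extend (\<lambda>_. frag_of a) c = frag_extend (\<lambda>_. frag_of a) (frag_extend (\<lambda>_. frag_of b) c)"
    by (simp_all add: frag_extend_frag_extend)
  then show ?thesis
    by (metis frag_extend_0)
qed

text \<open>The reduced group is the kernel of the map to the homology of a point. Over a point,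
  boundaries in degree 0 vanish, so the kernel condition is the augmentation; in positive degrees
  every cycle is a boundary and the condition is void.\<close>

lemma carrier_reduced_homology_group_chains:
  "carrier (reduced_homology_group (int n) X) =
     homologous_rel_set n X {} ` {c. reduced_cycle n X c}"
proof -
  let ?P = "discrete_topology {()}"
  have top: "topspace ?P = {()}" by simp
  have cont: "continuous_map X ?P (\<lambda>x. ())" by simp
  have "hom_induced (int n) X {} ?P {} (\<lambda>x. ()) (homologous_rel_set n X {} c) =
      \<one>\<^bsub>homology_group (int n) ?P\<^esub> \<longleftrightarrow> reduced_cycle n X c"
    if c: "singular_relcycle n X {} c" for c
  proof -
    have "hom_induced (int n) X {} ?P {} (\<lambda>x. ()) (homologous_rel_set n X {} c) =
      \<one>\<^bsub>homology_group (int n) ?P\<^esub> \<longleftrightarrow> singular_relboundary n ?P {} (chain_map n (\<lambda>x. ()) c)"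
      using hom_induced_chain_map[OF cont _ c, of "{}"] by (simp add: homologous_rel_set_eq_relboundary)
    also have "\<dots> \<longleftrightarrow> reduced_cycle n X c"
    proof (cases n)
      case 0
      have sc: "singular_chain n X c"
        using c by (simp add: singular_cycle)
      then have "singular_chain n ?P (chain_map n (\<lambda>x. ()) c)"
        using cont by (rule singular_chain_chain_map)
      then have "singular_relboundary n ?P {} (chain_map n (\<lambda>x. ()) c) \<longleftrightarrow> chain_map n (\<lambda>x. ()) c = 0"
        using 0 by (simp add: singular_boundary_singleton[OF top])
      also have "\<dots> \<longleftrightarrow> frag_extend (\<lambda>_. frag_of ()) c = 0"
        unfolding chain_map_def simplex_map_def o_def
        by (rule frag_extend_const_eq_0_iff)
      finally show ?thesis
        using 0 sc by (simp add: reduced_cycle_def)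
    next
      case (Suc m)
      have "singular_relcycle n ?P {} (chain_map n (\<lambda>x. ()) c)"
        by (rule singular_relcycle_chain_map[OF c cont]) simp
      then show ?thesis
        using c Suc singular_boundary_eq_cycle_singleton[OF top, of n]
        by (simp add: reduced_cycle_def singular_cycle)
    qed
    finally show ?thesis .
  qed
  moreover have "singular_relcycle n X {} c" if "reduced_cycle n X c" for c
    using that by (cases "n = 0") (auto simp: reduced_cycle_def singular_cycle chain_boundary_def)
  ultimately show ?thesis
    unfolding carrier_reduced_homology_group kernel_def carrier_relative_homology_group
    by auto
qed

lemma trivial_homomorphism_iff_null_in:
  assumes "V \<subseteq> U"
  shows "(\<forall>p. trivial_homomorphism (reduced_homology_group p (subtopology X V))
            (reduced_homology_group p (subtopology X U))
            (hom_induced p (subtopology X V) {} (subtopology X U) {} id)) \<longleftrightarrow> null_in X V U"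
    (is "(\<forall>p. ?t p) \<longleftrightarrow> _")
proof -
  let ?V = "subtopology X V" and ?U = "subtopology X U"
  have cont: "continuous_map ?V ?U id"
    using assms by (simp add: continuous_map_in_subtopology continuous_map_from_subtopology)
      (auto simp: topspace_subtopology)
  have neg: "?t p" if "p < 0" for p
    unfolding trivial_homomorphism_def
  proof (intro conjI ballI)
    show "hom_induced p ?V {} ?U {} id x = \<one>\<^bsub>reduced_homology_group p ?U\<^esub>"
      if "x \<in> carrier (reduced_homology_group p ?V)" for x
      using hom_induced_reduced[OF that, of ?U id] trivial_reduced_homology_group[OF \<open>p < 0\<close>, of ?U]
      by (auto simp: trivial_group_def)
  qed (rule hom_induced_reduced_hom)
  have nonneg: "?t (int n) \<longleftrightarrow> (\<forall>c. reduced_cycle n ?V c \<longrightarrow>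
     (\<exists>d. singular_chain (Suc n) ?U d \<and> chain_boundary (Suc n) d = c))" for n
  proof -
    have "hom_induced (int n) ?V {} ?U {} id (homologous_rel_set n ?V {} c) =
        \<one>\<^bsub>reduced_homology_group (int n) ?U\<^esub> \<longleftrightarrow>
       (\<exists>d. singular_chain (Suc n) ?U d \<and> chain_boundary (Suc n) d = c)"
      if c: "reduced_cycle n ?V c" for c
    proof -
      have rel: "singular_relcycle n ?V {} c"
        using c by (cases "n = 0") (auto simp: reduced_cycle_def singular_cycle chain_boundary_def)
      have "chain_map n id c = c"
        using c by (auto simp: reduced_cycle_def intro: chain_map_id_gen)
      then show ?thesis
        using hom_induced_chain_map[OF cont _ rel, of "{}"]
        by (simp add: one_reduced_homology_group homologous_rel_set_eq_relboundary singular_boundary)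
    qed
    then show ?thesis
      unfolding trivial_homomorphism_def carrier_reduced_homology_group_chains
      using hom_induced_reduced_hom by auto
  qed
  show ?thesis
    unfolding null_in_def nonneg[symmetric] using neg by (metis int_cases linorder_not_le of_nat_0_le_iff nat_0_le)
qed

lemma HLC_iff_null_in:
  "HLC C \<longleftrightarrow> (\<forall>c\<in>topspace C. \<forall>U. neighbourhood_of C {c} U \<longrightarrow>
     (\<exists>V. neighbourhood_of C {c} V \<and> V \<subseteq> U \<and> null_in C V U))"
  unfolding HLC_def using trivial_homomorphism_iff_null_in by metis

lemma null_in_mono: "null_in X V U \<Longrightarrow> V' \<subseteq> V \<Longrightarrow> U \<subseteq> U' \<Longrightarrow> null_in X V' U'"
  unfolding null_in_def reduced_cycle_def by (meson singular_chain_mono)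

section \<open>Deforming chains into subcomplexes of small simplices\<close>

lemma singular_face_chain_boundary:
  assumes "\<And>k. k \<le> Suc p \<Longrightarrow> singular_face (Suc p) k f \<in> S"
  shows "Poly_Mapping.keys (chain_boundary (Suc p) (frag_of f)) \<subseteq> S"
proof -
  have "Poly_Mapping.keys (chain_boundary (Suc p) (frag_of f)) \<subseteq>
    (\<Union>k\<in>{..Suc p}. Poly_Mapping.keys (frag_cmul ((- 1) ^ k) (frag_of (singular_face (Suc p) k f))))"
    unfolding chain_boundary_of by (simp del: sum.atMost_Suc) (rule keys_sum)
  also have "\<dots> \<subseteq> S"
    using assms by auto
  finally show ?thesis .
qed

lemma chain_boundary_frag_extend:
  "chain_boundary p (frag_extend t c) = frag_extend (\<lambda>f. chain_boundary p (t f)) c"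
  by (cases "p = 0") (simp_all add: chain_boundary_def frag_extend_frag_extend)

lemma chain_boundary_extend:
  "chain_boundary p c = frag_extend (\<lambda>f. chain_boundary p (frag_of f)) c"
  using chain_boundary_frag_extend[of p frag_of c] by simp

text \<open>The map \<open>c \<mapsto> c - \<partial> (T c) - T (\<partial> c)\<close> is a retraction onto the subcomplex spanned by
  \<open>E\<close>.\<close>

lemma deformation_to_subcomplex:
  fixes E :: "nat \<Rightarrow> ((nat \<Rightarrow> real) \<Rightarrow> 'a) set"
  assumes face: "\<And>p f. f \<in> E (Suc p) \<Longrightarrow> Poly_Mapping.keys (chain_boundary (Suc p) (frag_of f)) \<subseteq> E p"
    and acyclic: "\<And>p c. singular_chain p X c \<Longrightarrow> Poly_Mapping.keys (chain_boundary p c) \<subseteq> E (p - 1) \<Longrightarrow>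
      \<exists>d. singular_chain (Suc p) X d \<and> Poly_Mapping.keys (c - chain_boundary (Suc p) d) \<subseteq> E p"
  obtains T where
    "\<And>p a b. T p (a - b) = T p a - T p b"
    "\<And>p. T p 0 = 0"
    "\<And>p c. singular_chain p X c \<Longrightarrow> singular_chain (Suc p) X (T p c)"
    "\<And>p c. Poly_Mapping.keys c \<subseteq> E p \<Longrightarrow> T p c = 0"
    "\<And>p c. singular_chain p X c \<Longrightarrow>
      Poly_Mapping.keys (c - chain_boundary (Suc p) (T p c) - T (p - 1) (chain_boundary p c)) \<subseteq> E p"
proof -
  let ?S = "\<lambda>p. singular_simplex_set p X"
  \<comment> \<open>The third conjunct is what the next degree needs: the boundary \<open>b\<close>
    of a simplex is a cycle, so subtracting \<open>frag_extend t b\<close> from the simplex leaves a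
    chain whose boundary is in \<open>E\<close>, and to this chain \<open>acyclic\<close>
    applies.\<close>
  define P where "P p t \<longleftrightarrow> (\<forall>f\<in>?S p. singular_chain (Suc p) X (t f)) \<and> (\<forall>f\<in>E p. t f = 0) \<and>
     (\<forall>b. singular_chain p X b \<longrightarrow> chain_boundary p b = 0 \<longrightarrow>
        Poly_Mapping.keys (b - chain_boundary (Suc p) (frag_extend t b)) \<subseteq> E p) \<and>
     (p = 0 \<longrightarrow> (\<forall>f\<in>?S p. Poly_Mapping.keys (frag_of f - chain_boundary (Suc p) (t f)) \<subseteq> E p))"
    for p and t :: "((nat \<Rightarrow> real) \<Rightarrow> 'a) \<Rightarrow> 'a chain"
  define Q where "Q p t t' \<longleftrightarrow> (\<forall>f\<in>?S (Suc p). Poly_Mapping.keys (frag_of f -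
      chain_boundary (Suc (Suc p)) (t' f) - frag_extend t (chain_boundary (Suc p) (frag_of f))) \<subseteq> E (Suc p))"
    for p and t t' :: "((nat \<Rightarrow> real) \<Rightarrow> 'a) \<Rightarrow> 'a chain"
  have "\<exists>t. P 0 t"
  proof -
    have "\<exists>d. singular_chain (Suc 0) X d \<and> (f \<in> E 0 \<longrightarrow> d = 0) \<and>
        Poly_Mapping.keys (frag_of f - chain_boundary (Suc 0) d) \<subseteq> E 0" if f: "f \<in> ?S 0" for f
    proof (cases "f \<in> E 0")
      case False
      then show ?thesis
        using acyclic[of 0 "frag_of f"] f by (auto simp: singular_chain_of chain_boundary_def[of 0])
    qed (auto intro: exI[of _ 0])
    then obtain t where t: "\<And>f. f \<in> ?S 0 \<Longrightarrow> singular_chain (Suc 0) X (t f) \<and> (f \<in> E 0 \<longrightarrow> t f = 0) \<and>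
        Poly_Mapping.keys (frag_of f - chain_boundary (Suc 0) (t f)) \<subseteq> E 0"
      by metis
    \<comment> \<open>Nothing says that \<open>E\<close> consists of simplices of \<open>X\<close>,
      while \<open>t\<close> is controlled only on those; so the value 0 on \<open>E\<close> is
      imposed by hand.\<close>
    define t' where "t' f = (if f \<in> E 0 then 0 else t f)" for f
    have t': "Poly_Mapping.keys (frag_of f - chain_boundary (Suc 0) (t' f)) \<subseteq> E 0" if "f \<in> ?S 0" for f
      using t[OF that] by (auto simp: t'_def)
    have "Poly_Mapping.keys (b - chain_boundary (Suc 0) (frag_extend t' b)) \<subseteq> E 0"
      if "singular_chain 0 X b" for b
    proof -
      have "b - chain_boundary (Suc 0) (frag_extend t' b) =
          frag_extend (\<lambda>f. frag_of f - chain_boundary (Suc 0) (t' f)) b"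
        by (simp add: frag_extend_fun_diff chain_boundary_frag_extend)
      then show ?thesis
        using that t' by (auto simp: singular_chain_def intro!: keys_frag_extend_subset)
    qed
    then have "P 0 t'"
      using t t' by (auto simp: P_def t'_def)
    then show "\<exists>t. P 0 t" by blast
  qed
  moreover have "\<exists>t'. P (Suc p) t' \<and> Q p t t'" if P: "P p t" for p t
  proof -
    have tc: "singular_chain (Suc p) X (frag_extend t b)" if "singular_chain p X b" for b
      using that P by (intro singular_chain_extend) (auto simp: P_def singular_chain_def)
    have t0: "frag_extend t b = 0" if "Poly_Mapping.keys b \<subseteq> E p" for b
      using that P by (intro frag_extend_eq_0) (auto simp: P_def)
    have "\<exists>d. singular_chain (Suc (Suc p)) X d \<and> (f \<in> E (Suc p) \<longrightarrow> d = 0) \<and>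
        Poly_Mapping.keys (frag_of f - chain_boundary (Suc (Suc p)) d -
          frag_extend t (chain_boundary (Suc p) (frag_of f))) \<subseteq> E (Suc p)" if f: "f \<in> ?S (Suc p)"  for f
    proof -
      let ?b = "chain_boundary (Suc p) (frag_of f)"
      have fc: "singular_chain (Suc p) X (frag_of f)"
        using f by (simp add: singular_chain_of)
      have b: "singular_chain p X ?b" "chain_boundary p ?b = 0"
        using singular_chain_boundary_alt[OF fc] chain_boundary_boundary[OF fc] by auto
      have bE: "Poly_Mapping.keys (?b - chain_boundary (Suc p) (frag_extend t ?b)) \<subseteq> E p"
        using P b by (auto simp: P_def)
      have zc: "singular_chain (Suc p) X (frag_of f - frag_extend t ?b)"
        using fc tc[OF b(1)] by (rule singular_chain_diff)
      show ?thesis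
      proof (cases "f \<in> E (Suc p)")
        case True
        then show ?thesis
          using t0[OF face[OF True]] by (intro exI[of _ 0]) auto
      next
        case False
        then show ?thesis
          using acyclic[OF zc] bE by (simp add: chain_boundary_diff algebra_simps)
      qed
    qed
    then obtain t1 where t1: "\<And>f. f \<in> ?S (Suc p) \<Longrightarrow> singular_chain (Suc (Suc p)) X (t1 f) \<and>
        (f \<in> E (Suc p) \<longrightarrow> t1 f = 0) \<and> Poly_Mapping.keys (frag_of f - chain_boundary (Suc (Suc p)) (t1 f) -
          frag_extend t (chain_boundary (Suc p) (frag_of f))) \<subseteq> E (Suc p)"
      by metis
    define t' where "t' f = (if f \<in> E (Suc p) then 0 else t1 f)" for f
    have t': "Poly_Mapping.keys (frag_of f - chain_boundary (Suc (Suc p)) (t' f) -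
          frag_extend t (chain_boundary (Suc p) (frag_of f))) \<subseteq> E (Suc p)" if "f \<in> ?S (Suc p)" for f
      using t1[OF that] by (auto simp: t'_def)
    have "Poly_Mapping.keys (b - chain_boundary (Suc (Suc p)) (frag_extend t' b)) \<subseteq> E (Suc p)"
      if b: "singular_chain (Suc p) X b" "chain_boundary (Suc p) b = 0" for b
    proof -
      have "b - chain_boundary (Suc (Suc p)) (frag_extend t' b) =
          b - chain_boundary (Suc (Suc p)) (frag_extend t' b) - frag_extend t (chain_boundary (Suc p) b)"
        by (simp add: b(2))
      also have "\<dots> = frag_extend (\<lambda>f. frag_of f - chain_boundary (Suc (Suc p)) (t' f) -
          frag_extend t (chain_boundary (Suc p) (frag_of f))) b"
        by (simp add: frag_extend_fun_diff chain_boundary_frag_extend frag_extend_frag_extend[symmetric]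
          chain_boundary_extend[symmetric])
      finally show ?thesis
        using b(1) t' by (auto simp: singular_chain_def intro!: keys_frag_extend_subset)
    qed
    then have "P (Suc p) t'"
      using t1 by (auto simp: P_def t'_def)
    moreover have "Q p t t'"
      using t' by (auto simp: Q_def)
    ultimately show ?thesis by blast
  qed
  ultimately obtain t where t: "\<And>p. P p (t p)" "\<And>p. Q p (t p) (t (Suc p))"
    using dependent_nat_choice[of P Q] by metis
  show ?thesis
  proof (rule that[of "\<lambda>p. frag_extend (t p)"])
    fix p c
    show "singular_chain (Suc p) X (frag_extend (t p) c)" if "singular_chain p X c"
      using that t(1)[of p] by (intro singular_chain_extend) (auto simp: P_def singular_chain_def)
    show "frag_extend (t p) c = 0" if "Poly_Mapping.keys c \<subseteq> E p"
      using that t(1)[of p] by (intro frag_extend_eq_0) (auto simp: P_def)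
    have *: "Poly_Mapping.keys (frag_of f - chain_boundary (Suc p) (t p f) -
        frag_extend (t (p - 1)) (chain_boundary p (frag_of f))) \<subseteq> E p" if "f \<in> ?S p" for f
    proof (cases p)
      case 0
      then show ?thesis
        using t(1)[of 0] that by (auto simp: P_def chain_boundary_def[of 0])
    next
      case (Suc q)
      then show ?thesis
        using t(2)[of q] that by (auto simp: Q_def)
    qed
    show "Poly_Mapping.keys (c - chain_boundary (Suc p) (frag_extend (t p) c) -
        frag_extend (t (p - 1)) (chain_boundary p c)) \<subseteq> E p" if "singular_chain p X c"
    proof -
      have "c - chain_boundary (Suc p) (frag_extend (t p) c) - frag_extend (t (p - 1)) (chain_boundary p c)
          = frag_extend (\<lambda>f. frag_of f - chain_boundary (Suc p) (t p f) -
              frag_extend (t (p - 1)) (chain_boundary p (frag_of f))) c"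
        by (simp add: frag_extend_fun_diff chain_boundary_frag_extend frag_extend_frag_extend[symmetric]
          chain_boundary_extend[symmetric])
      then show ?thesis
        using that * by (auto simp: singular_chain_def intro!: keys_frag_extend_subset)
    qed
  qed (simp_all add: frag_extend_diff)
qed

definition small_simplices :: "'a topology \<Rightarrow> 'a set set \<Rightarrow> nat \<Rightarrow> ((nat \<Rightarrow> real) \<Rightarrow> 'a) set" where
  "small_simplices X \<V> p = {f. singular_simplex p X f \<and> (\<exists>V\<in>\<V>. f ` standard_simplex p \<subseteq> V)}"

lemma small_simplices_iff:
  "f \<in> small_simplices X \<V> p \<longleftrightarrow> (\<exists>V\<in>\<V>. singular_simplex p (subtopology X V) f)"
  by (auto simp: small_simplices_def singular_simplex_subtopology)

lemma small_simplices_face: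
  assumes "f \<in> small_simplices X \<V> (Suc p)"
  shows "Poly_Mapping.keys (chain_boundary (Suc p) (frag_of f)) \<subseteq> small_simplices X \<V> p"
proof (rule singular_face_chain_boundary)
  show "singular_face (Suc p) k f \<in> small_simplices X \<V> p" if "k \<le> Suc p" for k
    using assms that singular_simplex_singular_face[of "Suc p" _ f k]
    unfolding small_simplices_iff by fastforce
qed

text \<open>A chain with small boundary is a relative cycle modulo the union of the cover, hence a
  boundary plus a chain \<open>a\<close> in the union. Subdividing \<open>a\<close> makes it small,
  and the homotopy between \<open>a\<close> and its subdivision leaves only a term from the boundary
  of \<open>a\<close>, which is that of \<open>c\<close> and thus small.\<close>

lemma small_simplices_acyclic:
  assumes \<V>: "\<And>V. V \<in> \<V> \<Longrightarrow> openin X V"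
    and rel: "\<And>p c. singular_relcycle p X (\<Union>\<V>) c \<Longrightarrow> singular_relboundary p X (\<Union>\<V>) c"
    and c: "singular_chain p X c" "Poly_Mapping.keys (chain_boundary p c) \<subseteq> small_simplices X \<V> (p - 1)"
  shows "\<exists>d. singular_chain (Suc p) X d \<and>
    Poly_Mapping.keys (c - chain_boundary (Suc p) d) \<subseteq> small_simplices X \<V> p"
proof -
  let ?U = "\<Union>\<V>" and ?E = "small_simplices X \<V>"
  have small: "singular_chain q (subtopology X ?U) b" if b: "Poly_Mapping.keys b \<subseteq> ?E q" for q b
    unfolding singular_chain_def
  proof
    fix f assume "f \<in> Poly_Mapping.keys b"
    then obtain V where V: "V \<in> \<V>" "singular_simplex q (subtopology X V) f"
      using subsetD[OF b] small_simplices_iff by metis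
    have "V \<subseteq> ?U" using V(1) by blast
    then show "f \<in> singular_simplex_set q (subtopology X ?U)"
      using singular_simplex_mono[OF V(2)] by blast
  qed
  have "singular_relcycle p X ?U c"
    using c small by (simp add: singular_relcycle)
  then obtain d a where d: "singular_chain (Suc p) X d" and a: "singular_chain p (subtopology X ?U) a"
    and ca: "chain_boundary (Suc p) d + a = c"
    using rel[of p c] by (auto simp: singular_relboundary)
  have ba: "chain_boundary p a = chain_boundary p c"
    using chain_boundary_boundary_alt[OF d] by (simp add: ca[symmetric] chain_boundary_add)
  have UX: "\<And>V. V \<in> \<V> \<Longrightarrow> openin (subtopology X ?U) V"
  proof -
    have "openin X ?U" using \<V> by (intro openin_Union) auto
    then show "\<And>V. V \<in> \<V> \<Longrightarrow> openin (subtopology X ?U) V"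
      using \<V> by (auto simp: openin_open_subtopology)
  qed
  obtain n where n: "\<And>m f. n \<le> m \<Longrightarrow> f \<in> Poly_Mapping.keys ((singular_subdivision p ^^ m) a) \<Longrightarrow>
      \<exists>V\<in>\<V>. f \<in> standard_simplex p \<rightarrow> V"
    using sufficient_iterated_singular_subdivision_exists[OF UX _ a] by (auto simp: topspace_subtopology)
  obtain h where h: "\<And>p. h p 0 = (0 :: 'a chain)"
        "\<And>p c1 c2. h p (c1-c2) = h p c1 - h p c2"
        "\<And>p X c. singular_chain p X c \<Longrightarrow> singular_chain (Suc p) X (h p c)"
        "\<And>p X c. singular_chain p X c
                 \<Longrightarrow> chain_boundary (Suc p) (h p c) + h (p - Suc 0) (chain_boundary p c)
                   = (singular_subdivision p ^^ n) c - c"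
    using chain_homotopic_iterated_singular_subdivision[where n = n and ?'a = 'a] by blast
  \<comment> \<open>The homotopy \<open>h\<close> respects every space at once; applied to a simplex
    inside \<open>V\<close>, it stays inside \<open>V\<close>.\<close>
  have hE: "Poly_Mapping.keys (h q b) \<subseteq> ?E (Suc q)" if "Poly_Mapping.keys b \<subseteq> ?E q" for q b
    using that
  proof (induction rule: frag_induction)
    case (one f)
    then obtain V where "V \<in> \<V>" and V: "singular_chain q (subtopology X V) (frag_of f)"
      by (auto simp: small_simplices_iff singular_chain_of)
    have "singular_chain (Suc q) (subtopology X V) (h q (frag_of f))"
      using V by (rule h(3))
    then have "Poly_Mapping.keys (h q (frag_of f)) \<subseteq> singular_simplex_set (Suc q) (subtopology X V)"
      by (simp add: singular_chain_def)
    also have "\<dots> \<subseteq> ?E (Suc q)"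
      using \<open>V \<in> \<V>\<close> by (auto simp: small_simplices_iff)
    finally show ?case .
  next
    case (diff a b)
    then show ?case
      by (simp add: h(2) keys_diff_subset)
  qed (simp add: h(1))
  have sd: "Poly_Mapping.keys ((singular_subdivision p ^^ n) a) \<subseteq> ?E p"
  proof
    fix f assume f: "f \<in> Poly_Mapping.keys ((singular_subdivision p ^^ n) a)"
    have "singular_chain p (subtopology X ?U) ((singular_subdivision p ^^ m) a)" for m
      by (induction m) (auto simp: a intro: singular_chain_singular_subdivision)
    from this[of n] have "f \<in> singular_simplex_set p (subtopology X ?U)"
      using f unfolding singular_chain_def by blast
    then have "singular_simplex p X f"
      by (simp add: singular_simplex_subtopology)
    then show "f \<in> ?E p"
      using n[OF order_refl f] by (auto simp: small_simplices_def)
  qed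
  have hb: "Poly_Mapping.keys (h (p - Suc 0) (chain_boundary p c)) \<subseteq> ?E p"
  proof (cases p)
    case 0
    then show ?thesis by (simp add: chain_boundary_def h(1))
  next
    case (Suc q)
    then show ?thesis using hE[OF c(2)] by simp
  qed
  have aX: "singular_chain p X a"
    using a by (simp add: singular_chain_subtopology)
  have "c - chain_boundary (Suc p) (d - h p a) =
      (singular_subdivision p ^^ n) a - h (p - Suc 0) (chain_boundary p c)"
    using h(4)[OF aX] by (simp add: ca[symmetric] ba[unfolded ca[symmetric]] chain_boundary_diff algebra_simps)
  then have "Poly_Mapping.keys (c - chain_boundary (Suc p) (d - h p a)) \<subseteq> ?E p"
    using sd hb by (simp add: keys_diff_subset)
  moreover have "singular_chain (Suc p) X (d - h p a)"
    using d h(3)[OF aX] by (rule singular_chain_diff)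
  ultimately show ?thesis by blast
qed

section \<open>Vertices of singular simplices\<close>

definition simplex_vertices :: "nat \<Rightarrow> ((nat \<Rightarrow> real) \<Rightarrow> 'a) \<Rightarrow> 'a list" where
  "simplex_vertices p f = map (\<lambda>i. f (\<lambda>j. if j = i then 1 else 0)) [0..<Suc p]"

lemma length_simplex_vertices [simp]: "length (simplex_vertices p f) = Suc p"
  by (simp add: simplex_vertices_def)

lemma set_simplex_vertices: "set (simplex_vertices p f) \<subseteq> f ` standard_simplex p"
  by (auto simp: simplex_vertices_def less_Suc_eq_le intro!: imageI)

lemma simplex_vertices_face:
  assumes "k \<le> Suc p"
  shows "simplex_vertices p (singular_face (Suc p) k f) = omit k (simplex_vertices (Suc p) f)"
proof (rule nth_equalityI)
  show "length (simplex_vertices p (singular_face (Suc p) k f)) = length (omit k (simplex_vertices (Suc p) f))"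
    using assms by (simp add: length_omit)
  fix i assume "i < length (simplex_vertices p (singular_face (Suc p) k f))"
  then have i: "i \<le> p" by simp
  have "simplical_face k (\<lambda>j. if j = i then 1 else 0) =
      (\<lambda>j. if j = (if i < k then i else Suc i) then 1 else (0::real))"
    by (auto simp: simplical_face_def fun_eq_iff)
  then have "simplex_vertices p (singular_face (Suc p) k f) ! i =
      f (\<lambda>j. if j = (if i < k then i else Suc i) then 1 else 0)"
    using i by (simp add: simplex_vertices_def singular_face_def nth_append del: upt_Suc)
  also have "\<dots> = omit k (simplex_vertices (Suc p) f) ! i"
    using i assms by (simp add: simplex_vertices_def omit_def nth_append min_def del: upt_Suc)
  finally show "simplex_vertices p (singular_face (Suc p) k f) ! i =
      omit k (simplex_vertices (Suc p) f) ! i" .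
qed

lemma tuple_boundary_simplex_vertices:
  "frag_extend (\<lambda>f. frag_of (simplex_vertices p f)) (chain_boundary (Suc p) (frag_of f)) =
     tuple_boundary (simplex_vertices (Suc p) f)"
proof -
  have "{..<length (simplex_vertices (Suc p) f)} = {..Suc p}" by auto
  then show ?thesis
    unfolding tuple_boundary_def chain_boundary_of
    by (simp add: frag_extend_sum frag_extend_cmul simplex_vertices_face[symmetric] del: sum.atMost_Suc)
qed

section \<open>Compact subsets of metric spaces\<close>

locale compact_in_metric = Metric_space M d for M :: "'a set" and d +
  fixes K :: "'a set"
  assumes compact: "compactin mtopology K"
begin

lemma K_subset: "K \<subseteq> M"
  using compact compactin_subset_topspace by fastforce

lemma K_M [simp]: "x \<in> K \<Longrightarrow> x \<in> M"
  using K_subset by blast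

definition small_tuples :: "real \<Rightarrow> 'a list set" where
  "small_tuples \<eta> = {xs. set xs \<subseteq> K \<and> (\<forall>x\<in>set xs. \<forall>y\<in>set xs. d x y < \<eta>)}"

lemma small_tuples_mono: "\<eta> \<le> \<eta>' \<Longrightarrow> small_tuples \<eta> \<subseteq> small_tuples \<eta>'"
  by (fastforce simp: small_tuples_def)

lemma small_tuples_subset: "xs \<in> small_tuples \<eta> \<Longrightarrow> set ys \<subseteq> set xs \<Longrightarrow> ys \<in> small_tuples \<eta>"
  by (auto simp: small_tuples_def)

lemma omit_small_tuples: "xs \<in> small_tuples \<eta> \<Longrightarrow> omit k xs \<in> small_tuples \<eta>"
  using small_tuples_subset[OF _ set_omit] by blast

lemma keys_boundary_small_tuples:
  assumes "xs \<in> small_tuples \<eta>" "length xs = Suc n"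
  shows "Poly_Mapping.keys (tuple_boundary xs) \<subseteq> {ys \<in> small_tuples \<eta>. length ys = n \<and> set ys \<subseteq> set xs}"
proof -
  have "omit k xs \<in> {ys \<in> small_tuples \<eta>. length ys = n \<and> set ys \<subseteq> set xs}" if "k < length xs" for k
    using that assms omit_small_tuples set_omit by (simp add: length_omit)
  then show ?thesis
    using keys_tuple_boundary[of xs] by blast
qed

lemma point_tuples_K: "point_tuples (subtopology mtopology K) p = {xs. length xs = Suc p \<and> set xs \<subseteq> K}"
  using K_subset by (auto simp: point_tuples_def topspace_subtopology)

lemma lebesgue_number_tuples:
  assumes "open_cover (subtopology mtopology K) \<U>"
  obtains \<eta> where "\<eta> > 0" "\<And>x. x \<in> K \<Longrightarrow> \<exists>U\<in>\<U>. K \<inter> mball x \<eta> \<subseteq> U"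
    "\<And>xs. xs \<in> small_tuples \<eta> \<Longrightarrow> xs \<noteq> [] \<Longrightarrow> \<exists>U\<in>\<U>. set xs \<subseteq> U"
proof -
  let ?C = "{W. openin mtopology W \<and> (\<exists>U\<in>\<U>. K \<inter> W \<subseteq> U)}"
  have "K \<subseteq> \<Union>?C"
  proof
    fix x assume x: "x \<in> K"
    then have "x \<in> \<Union>\<U>"
      using assms K_subset by (auto simp: open_cover_def topspace_subtopology)
    then obtain U where U: "U \<in> \<U>" "x \<in> U" "openin (subtopology mtopology K) U"
      using assms by (auto simp: open_cover_def)
    then obtain W where "openin mtopology W" "U = W \<inter> K"
      unfolding openin_subtopology by blast
    then have "W \<in> ?C" "x \<in> W"
      using U by auto
    then show "x \<in> \<Union>?C" by (rule UnionI)
  qed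
  then obtain \<eta> where \<eta>: "\<eta> > 0" "\<forall>x\<in>K. \<exists>W\<in>?C. mball x \<eta> \<subseteq> W"
    using lebesgue_number[OF compact, of ?C] by blast
  have *: "\<exists>U\<in>\<U>. K \<inter> mball x \<eta> \<subseteq> U" if "x \<in> K" for x
  proof -
    obtain W U where "mball x \<eta> \<subseteq> W" "U \<in> \<U>" "K \<inter> W \<subseteq> U"
      using \<eta>(2) \<open>x \<in> K\<close> by blast
    then show ?thesis by blast
  qed
  have "\<exists>U\<in>\<U>. set xs \<subseteq> U" if xs: "xs \<in> small_tuples \<eta>" "xs \<noteq> []" for xs
  proof -
    have hd: "hd xs \<in> set xs" using xs by simp
    then have "set xs \<subseteq> K \<inter> mball (hd xs) \<eta>"
      using xs by (auto simp: small_tuples_def subset_iff)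
    moreover have "hd xs \<in> K" using hd xs by (auto simp: small_tuples_def)
    ultimately show ?thesis using * by (meson order_trans)
  qed
  with \<eta>(1) * show ?thesis
    by (intro that) simp_all
qed

lemma cover_by_small_sets:
  assumes "\<eta> > 0"
  obtains \<U> where "open_cover (subtopology mtopology K) \<U>"
    "\<And>U xs. U \<in> \<U> \<Longrightarrow> set xs \<subseteq> U \<Longrightarrow> xs \<in> small_tuples \<eta>"
proof
  let ?U = "{K \<inter> mball x (\<eta>/2) | x. x \<in> K}"
  show "open_cover (subtopology mtopology K) ?U"
    unfolding open_cover_def
  proof
    have "x \<in> K \<inter> mball x (\<eta>/2)" if "x \<in> K" for x
      using that assms by simp
    then have "\<Union>?U = K" by blast
    then show "\<Union>?U = topspace (subtopology mtopology K)"
      by (simp add: Int_absorb1 K_subset)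
  qed (auto simp: openin_subtopology)
  fix U xs assume "U \<in> ?U" and xs: "set xs \<subseteq> U"
  then obtain z where z: "z \<in> K" "U = K \<inter> mball z (\<eta>/2)" by blast
  have "d x y < \<eta>" if "x \<in> set xs" "y \<in> set xs" for x y
  proof -
    have "d z x < \<eta>/2" "d z y < \<eta>/2" "x \<in> M" "y \<in> M" "z \<in> M"
      using that xs z by auto
    then show ?thesis
      using triangle[of x z y] commute[of x z] by auto
  qed
  then show "xs \<in> small_tuples \<eta>"
    using xs z by (auto simp: small_tuples_def)
qed

text \<open>A Lebesgue number turns the cover into a bound on diameters, and small balls turn the
  bound back into a cover. Germs along the diagonal are from here on handled through a single
  number.\<close>

lemma locally_iff_small_tuples:
  "(\<exists>\<U>. open_cover (subtopology mtopology K) \<U> \<and>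
      (\<forall>U\<in>\<U>. \<forall>xs\<in>point_tuples (subtopology mtopology K) p. set xs \<subseteq> U \<longrightarrow> P xs)) \<longleftrightarrow>
   (\<exists>\<eta>>0. \<forall>xs\<in>small_tuples \<eta>. length xs = Suc p \<longrightarrow> P xs)" (is "?l \<longleftrightarrow> ?r")
proof
  assume ?l
  then obtain \<U> where U: "open_cover (subtopology mtopology K) \<U>"
    "\<And>U xs. U \<in> \<U> \<Longrightarrow> xs \<in> point_tuples (subtopology mtopology K) p \<Longrightarrow> set xs \<subseteq> U \<Longrightarrow> P xs"
    by blast
  obtain \<eta> where "\<eta> > 0" and \<eta>: "\<And>xs. xs \<in> small_tuples \<eta> \<Longrightarrow> xs \<noteq> [] \<Longrightarrow> \<exists>U\<in>\<U>. set xs \<subseteq> U"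
    using lebesgue_number_tuples[OF U(1)] by metis
  have "P xs" if xs: "xs \<in> small_tuples \<eta>" "length xs = Suc p" for xs
  proof -
    have "xs \<noteq> []" using xs(2) by auto
    then obtain V where V: "V \<in> \<U>" "set xs \<subseteq> V" using \<eta>[OF xs(1)] by blast
    have "xs \<in> point_tuples (subtopology mtopology K) p"
      using xs by (simp add: point_tuples_K small_tuples_def)
    then show ?thesis
      using U(2) V by blast
  qed
  with \<open>\<eta> > 0\<close> show ?r by blast
next
  assume ?r
  then obtain \<eta> where "\<eta> > 0" and \<eta>: "\<And>xs. xs \<in> small_tuples \<eta> \<Longrightarrow> length xs = Suc p \<Longrightarrow> P xs"
    by blast
  obtain \<U> where U: "open_cover (subtopology mtopology K) \<U>"
    "\<And>U xs. U \<in> \<U> \<Longrightarrow> set xs \<subseteq> U \<Longrightarrow> xs \<in> small_tuples \<eta>"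
    using cover_by_small_sets[OF \<open>\<eta> > 0\<close>] by metis
  have "P xs" if "U \<in> \<U>" "xs \<in> point_tuples (subtopology mtopology K) p" "set xs \<subseteq> U" for U xs
    using \<eta>[OF U(2)[OF that(1,3)]] that(2) by (simp add: point_tuples_def)
  with U(1) show ?l by blast
qed

section \<open>Simplices near the compact set and their tuples of nearest points\<close>

definition nearest :: "'a \<Rightarrow> 'a" where
  "nearest x = (if x \<in> K then x else SOME k. k \<in> K \<and> (\<forall>k'\<in>K. d x k \<le> d x k'))"

lemma nearest_id [simp]: "x \<in> K \<Longrightarrow> nearest x = x"
  by (simp add: nearest_def)

lemma nearest:
  assumes x: "x \<in> M" and k: "k \<in> K"
  shows "nearest x \<in> K" "d x (nearest x) \<le> d x k"
proof -
  have "continuous_map mtopology euclideanreal (\<lambda>k. d x k)"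
    using continuous_map_mdist[of mtopology "metric (M,d)" "\<lambda>_. x" "\<lambda>k. k"] x by simp
  then have "compactin euclideanreal ((\<lambda>k. d x k) ` K)"
    using compact image_compactin by blast
  then have "compact ((\<lambda>k. d x k) ` K)" by simp
  then obtain k0 where "k0 \<in> K" "\<forall>k'\<in>K. d x k0 \<le> d x k'"
    using compact_attains_inf[of "(\<lambda>k. d x k) ` K"] k by auto
  then have "\<exists>k. k \<in> K \<and> (\<forall>k'\<in>K. d x k \<le> d x k')" by blast
  from someI_ex[OF this] have *: "x \<notin> K \<Longrightarrow> nearest x \<in> K \<and> (\<forall>k'\<in>K. d x (nearest x) \<le> d x k')"
    by (simp add: nearest_def)
  show "nearest x \<in> K" "d x (nearest x) \<le> d x k"
    using * k K_subset x by (cases "x \<in> K"; auto)+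
qed

definition near :: "real \<Rightarrow> nat \<Rightarrow> ((nat \<Rightarrow> real) \<Rightarrow> 'a) set" where
  "near \<epsilon> = small_simplices mtopology {mball k \<epsilon> | k. k \<in> K}"

lemma near_iff: "f \<in> near \<epsilon> p \<longleftrightarrow> (\<exists>k\<in>K. singular_simplex p (subtopology mtopology (mball k \<epsilon>)) f)"
  by (auto simp: near_def small_simplices_iff)

lemma near_mono: "\<epsilon> \<le> \<epsilon>' \<Longrightarrow> near \<epsilon> p \<subseteq> near \<epsilon>' p"
  using mball_subset_concentric singular_simplex_mono unfolding near_iff subset_iff by meson

lemma near_boundary: "f \<in> near \<epsilon> (Suc p) \<Longrightarrow>
   Poly_Mapping.keys (chain_boundary (Suc p) (frag_of f)) \<subseteq> near \<epsilon> p"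
  unfolding near_def by (rule small_simplices_face)

definition vtuple :: "nat \<Rightarrow> ((nat \<Rightarrow> real) \<Rightarrow> 'a) \<Rightarrow> 'a list" where
  "vtuple p f = map nearest (simplex_vertices p f)"

lemma length_vtuple [simp]: "length (vtuple p f) = Suc p"
  by (simp add: vtuple_def)

lemma vtuple_boundary:
  "frag_extend (\<lambda>f. frag_of (vtuple p f)) (chain_boundary (Suc p) (frag_of f)) =
     tuple_boundary (vtuple (Suc p) f)"
proof -
  have "frag_extend (\<lambda>f. frag_of (vtuple p f)) (chain_boundary (Suc p) (frag_of f)) =
     frag_extend (\<lambda>xs. frag_of (map nearest xs))
       (frag_extend (\<lambda>f. frag_of (simplex_vertices p f)) (chain_boundary (Suc p) (frag_of f)))"
    by (simp add: frag_extend_frag_extend vtuple_def)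
  also have "\<dots> = tuple_boundary (vtuple (Suc p) f)"
    by (simp add: tuple_boundary_simplex_vertices tuple_boundary_map vtuple_def)
  finally show ?thesis .
qed

text \<open>A nearest point of \<open>K\<close> is no further from a vertex than the centre
  \<open>k\<close> is, which doubles the radius. The diameter of the tuple is then below four times
  the radius, the origin of the quarters further on.\<close>

lemma vtuple_dist:
  assumes f: "singular_simplex p (subtopology mtopology (mball k \<epsilon>)) f" and k: "k \<in> K"
    and x: "x \<in> set (vtuple p f)"
  shows "x \<in> K" "d k x < 2 * \<epsilon>"
proof -
  obtain v where v: "v \<in> f ` standard_simplex p" "x = nearest v"
    using x set_simplex_vertices[of p f] by (fastforce simp: vtuple_def)
  then have v': "v \<in> mball k \<epsilon>"
    using f by (auto simp: singular_simplex_subtopology)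
  then have "v \<in> M" by simp
  note n = nearest[OF this k]
  show "x \<in> K" using n v by simp
  have "x \<in> M" using \<open>x \<in> K\<close> K_subset by blast
  have "d k x \<le> d k v + d v x"
    using triangle[of k v x] \<open>v \<in> M\<close> \<open>x \<in> M\<close> v' by auto
  also have "d v x \<le> d k v" using n v commute[of v k] by simp
  finally show "d k x < 2 * \<epsilon>" using v' by auto
qed

lemma vtuple_small:
  assumes "f \<in> near \<epsilon> p"
  shows "vtuple p f \<in> small_tuples (4 * \<epsilon>)"
proof -
  obtain k where k: "k \<in> K" "singular_simplex p (subtopology mtopology (mball k \<epsilon>)) f"
    using assms by (auto simp: near_iff)
  have "d x y < 4 * \<epsilon>" if "x \<in> set (vtuple p f)" "y \<in> set (vtuple p f)" for x y
  proof -
    have "d k x < 2 * \<epsilon>" "d k y < 2 * \<epsilon>" "x \<in> K" "y \<in> K"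
      using vtuple_dist[OF k(2,1)] that by auto
    then show ?thesis
      using triangle[of x k y] commute[of x k] k by simp
  qed
  then show ?thesis
    using vtuple_dist[OF k(2,1)] by (auto simp: small_tuples_def)
qed

end

section \<open>Singular chains over small tuples in an HLC space\<close>

locale HLC_pair = compact_in_metric +
  assumes HLC: "HLC mtopology"
begin

text \<open>HLC gives a radius at each point; a Lebesgue number of the resulting balls makes it
  uniform over \<open>K\<close>.\<close>

lemma uniform_null_in:
  assumes "\<epsilon> > 0"
  obtains \<delta> where "\<delta> > 0" "\<delta> \<le> \<epsilon>" "\<And>k. k \<in> K \<Longrightarrow> null_in mtopology (mball k \<delta>) (mball k \<epsilon>)"
proof -
  \<comment> \<open>Half of \<epsilon> is kept in reserve for moving the centre from
    \<open>k0\<close> to a point \<open>k\<close> at distance less than \<open>r k0\<close>.\<close>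
  have "\<exists>r>0. r \<le> \<epsilon>/2 \<and> null_in mtopology (mball k r) (mball k (\<epsilon>/2))" if k: "k \<in> K" for k
  proof -
    have kM: "k \<in> M" using k K_subset by blast
    have "neighbourhood_of mtopology {k} (mball k (\<epsilon>/2))"
      using kM assms by (auto simp: neighbourhood_of_def intro!: exI[of _ "mball k (\<epsilon>/2)"])
    then obtain V where V: "neighbourhood_of mtopology {k} V" "null_in mtopology V (mball k (\<epsilon>/2))"
      using HLC kM unfolding HLC_iff_null_in by (metis topspace_mtopology)
    then obtain W where W: "openin mtopology W" "k \<in> W" "W \<subseteq> V"
      by (auto simp: neighbourhood_of_def)
    then obtain r where r: "r > 0" "mball k r \<subseteq> W"
      by (auto simp: openin_mtopology)
    have "mball k (min r (\<epsilon>/2)) \<subseteq> V"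
      using mball_subset_concentric[of "min r (\<epsilon>/2)" r k] r W by auto
    then have "null_in mtopology (mball k (min r (\<epsilon>/2))) (mball k (\<epsilon>/2))"
      using V(2) null_in_mono by blast
    then show ?thesis
      using r assms by (intro exI[of _ "min r (\<epsilon>/2)"]) auto
  qed
  then obtain r where r: "\<And>k. k \<in> K \<Longrightarrow> r k > 0 \<and> r k \<le> \<epsilon>/2 \<and> null_in mtopology (mball k (r k)) (mball k (\<epsilon>/2))"
    by metis
  have "K \<subseteq> \<Union>((\<lambda>k. mball k (r k)) ` K)"
    using r K_subset by fastforce
  then obtain \<delta> where \<delta>: "\<delta> > 0" "\<forall>x\<in>K. \<exists>U\<in>(\<lambda>k. mball k (r k)) ` K. mball x \<delta> \<subseteq> U"
    using lebesgue_number[OF compact, of "(\<lambda>k. mball k (r k)) ` K"] by auto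
  show ?thesis
  proof (rule that[of "min \<delta> \<epsilon>"])
    fix k assume k: "k \<in> K"
    then obtain k0 where k0: "k0 \<in> K" "mball k \<delta> \<subseteq> mball k0 (r k0)"
      using \<delta> by blast
    have kM: "k \<in> M" "k0 \<in> M" using k k0 K_subset by auto
    have "k \<in> mball k0 (r k0)" using k0 kM \<delta> by blast
    then have "mball k0 (\<epsilon>/2) \<subseteq> mball k \<epsilon>"
      using r[OF k0(1)] kM by (intro mball_subset) auto
    moreover have "mball k (min \<delta> \<epsilon>) \<subseteq> mball k0 (r k0)"
      using k0 mball_subset_concentric[of "min \<delta> \<epsilon>" \<delta> k] by auto
    ultimately show "null_in mtopology (mball k (min \<delta> \<epsilon>)) (mball k \<epsilon>)"
      using r[OF k0(1)] null_in_mono by blast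
  qed (use \<delta> assms in auto)
qed

text \<open>One filling leads from the ball of radius \<open>4 * r i\<close> to that of radius
  \<open>r (Suc i)\<close>, so \<open>N\<close> fillings in a row stay within \<epsilon>. The factor
  4 leaves room for a change of centre between a tuple and its faces. The induction peels off the
  largest radius.\<close>

lemma radii:
  assumes "\<epsilon> > 0"
  shows "\<exists>r. (\<forall>i\<le>N. 0 < r i \<and> r i \<le> \<epsilon> \<and> r 0 \<le> r i) \<and>
     (\<forall>i<N. \<forall>k\<in>K. null_in mtopology (mball k (4 * r i)) (mball k (r (Suc i))))"
  using assms
proof (induction N arbitrary: \<epsilon>)
  case 0
  then show ?case by (intro exI[of _ "\<lambda>_. \<epsilon>"]) auto
next
  case (Suc N)
  obtain \<delta> where \<delta>: "\<delta> > 0" "\<delta> \<le> \<epsilon>" "\<And>k. k \<in> K \<Longrightarrow> null_in mtopology (mball k \<delta>) (mball k \<epsilon>)"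
    using uniform_null_in[OF Suc.prems] by blast
  have "\<delta>/4 > 0" using \<delta> by simp
  from Suc.IH[OF this] obtain r where r: "\<And>i. i \<le> N \<Longrightarrow> 0 < r i \<and> r i \<le> \<delta>/4 \<and> r 0 \<le> r i"
     "\<And>i k. i < N \<Longrightarrow> k \<in> K \<Longrightarrow> null_in mtopology (mball k (4 * r i)) (mball k (r (Suc i)))"
    by blast
  have N: "null_in mtopology (mball k (4 * r N)) (mball k \<epsilon>)" if "k \<in> K" for k
    by (rule null_in_mono[OF \<delta>(3)[OF that]]) (use r(1)[of N] in \<open>auto intro: mball_subset_concentric\<close>)
  show ?case
  proof (intro exI[of _ "\<lambda>i. if i \<le> N then r i else \<epsilon>"] conjI allI impI ballI)
    fix i k assume "i < Suc N" "k \<in> K"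
    then show "null_in mtopology (mball k (4 * (if i \<le> N then r i else \<epsilon>))) (mball k (if Suc i \<le> N then r (Suc i) else \<epsilon>))"
      using r(2)[of i k] N[of k] by (cases "i < N") (auto simp: less_Suc_eq)
  next
    fix i
    show "0 < (if i \<le> N then r i else \<epsilon>)" "(if i \<le> N then r i else \<epsilon>) \<le> \<epsilon>"
      "(if 0 \<le> N then r 0 else \<epsilon>) \<le> (if i \<le> N then r i else \<epsilon>)"
      using r(1)[of i] r(1)[of 0] \<delta> by auto
  qed
qed

end

context compact_in_metric
begin

text \<open>\<open>\<tau>\<close> realises small tuples of points of \<open>K\<close> by singular chains, and \<open>vtuple\<close>, which replaces a
  small simplex by points of \<open>K\<close> near its vertices, is inverse to it up to the chain homotopies
  \<open>L\<close> and \<open>T\<close>.\<close>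

definition approximation where
  "approximation N \<epsilon> \<delta> \<tau> L T \<longleftrightarrow> 0 < \<delta> \<and> \<delta> \<le> \<epsilon> \<and>
    (\<forall>p xs. xs \<in> small_tuples \<delta> \<longrightarrow> length xs = Suc p \<longrightarrow> p \<le> N \<longrightarrow>
       singular_chain p (subtopology mtopology (mball (hd xs) \<epsilon>)) (\<tau> xs)) \<and>
    (\<forall>p xs. xs \<in> small_tuples \<delta> \<longrightarrow> length xs = Suc (Suc p) \<longrightarrow> Suc p \<le> N \<longrightarrow>
       chain_boundary (Suc p) (\<tau> xs) = frag_extend \<tau> (tuple_boundary xs)) \<and>
    (\<forall>p f. f \<in> near (\<delta>/4) p \<longrightarrow> p \<le> N \<longrightarrow> singular_chain (Suc p) mtopology (L p f) \<and>
       chain_boundary (Suc p) (L p f) = \<tau> (vtuple p f) - frag_of f - frag_extend (L (p - 1)) (chain_boundary p (frag_of f))) \<and>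
    T [] = 0 \<and>
    (\<forall>p xs. xs \<in> small_tuples \<delta> \<longrightarrow> length xs = Suc p \<longrightarrow> p \<le> N \<longrightarrow>
       Poly_Mapping.keys (T xs) \<subseteq> {ys \<in> small_tuples (5 * \<epsilon>). length ys = Suc (Suc p)} \<and>
       frag_extend tuple_boundary (T xs) = frag_extend (\<lambda>f. frag_of (vtuple p f)) (\<tau> xs) - frag_of xs -
         frag_extend T (tuple_boundary xs))"

end

context HLC_pair
begin

abbreviation cyc :: "nat \<Rightarrow> 'a chain \<Rightarrow> bool" where
  "cyc n z \<equiv> (if n = 0 then frag_extend (\<lambda>_. frag_of ()) z = 0 else chain_boundary n z = 0)"

abbreviation ball_chain :: "nat \<Rightarrow> 'a \<Rightarrow> real \<Rightarrow> 'a chain \<Rightarrow> bool" where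
  "ball_chain n x r \<equiv> singular_chain n (subtopology mtopology (mball x r))"

lemma ball_chain_mono:
  assumes "ball_chain n y r c" "d y x + r \<le> r'" "x \<in> M"
  shows "ball_chain n x r' c"
  using singular_chain_mono[OF assms(1) mball_subset[OF assms(2,3)]] .

lemma null_in_ball:
  assumes "null_in mtopology (mball k r) (mball k r')" "ball_chain n k r z" "cyc n z"
  shows "\<exists>w. ball_chain (Suc n) k r' w \<and> chain_boundary (Suc n) w = z"
  using assms unfolding null_in_def reduced_cycle_def by blast

text \<open>Skeleton by skeleton: the chains over the faces of \<open>xs\<close> form a cycle in a
  slightly larger ball about the first entry, and this cycle is filled there. For pairs of points
  the cycle is a reduced one, of coefficient sum 0.\<close>

lemma realise_tuples:
  fixes r :: "nat \<Rightarrow> real"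
  assumes r: "\<And>i. i \<le> N \<Longrightarrow> 0 < r i \<and> r 0 \<le> r i"
    and null: "\<And>i k. i < N \<Longrightarrow> k \<in> K \<Longrightarrow> null_in mtopology (mball k (4 * r i)) (mball k (r (Suc i)))"
  obtains \<tau> where
    "\<And>x. \<tau> [x] = frag_of (\<lambda>_\<in>standard_simplex 0. x)"
    "\<And>p xs. xs \<in> small_tuples (r 0) \<Longrightarrow> length xs = Suc p \<Longrightarrow> p \<le> N \<Longrightarrow> ball_chain p (hd xs) (r p) (\<tau> xs)"
    "\<And>p xs. xs \<in> small_tuples (r 0) \<Longrightarrow> length xs = Suc (Suc p) \<Longrightarrow> Suc p \<le> N \<Longrightarrow>
       chain_boundary (Suc p) (\<tau> xs) = frag_extend \<tau> (tuple_boundary xs)"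
proof -
  let ?S = "\<lambda>n. {xs \<in> small_tuples (r 0). length xs = Suc n}"
  \<comment> \<open>The cycle condition is carried along in \<open>P\<close> because it is what
    permits the filling in the next degree. Beyond degree \<open>N\<close> the condition is
    void.\<close>
  define P where "P n t \<longleftrightarrow> (n \<le> N \<longrightarrow> (\<forall>xs\<in>?S n. ball_chain n (hd xs) (r n) (t xs)) \<and>
      (\<forall>xs\<in>?S (Suc n). cyc n (frag_extend t (tuple_boundary xs)))) \<and>
      (n = 0 \<longrightarrow> (\<forall>x. t [x] = frag_of (\<lambda>_\<in>standard_simplex 0. x)))"
    for n and t :: "'a list \<Rightarrow> 'a chain"
  define Q where "Q n t t' \<longleftrightarrow> (Suc n \<le> N \<longrightarrow> (\<forall>xs\<in>?S (Suc n). chain_boundary (Suc n) (t' xs) =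
       frag_extend t (tuple_boundary xs)))" for n and t t' :: "'a list \<Rightarrow> 'a chain"
  have bd: "Poly_Mapping.keys (tuple_boundary xs) \<subseteq> {ys \<in> ?S n. set ys \<subseteq> set xs}" if "xs \<in> ?S (Suc n)" for xs n
    using keys_boundary_small_tuples[of xs "r 0" "Suc n"] that by auto
  have "\<exists>t. P 0 t"
  proof
    let ?t = "\<lambda>xs. frag_of (\<lambda>_\<in>standard_simplex 0. hd xs)"
    have "ball_chain 0 (hd xs) (r 0) (?t xs)" if "xs \<in> ?S 0" for xs
    proof -
      have "xs \<noteq> []" using that by auto
      then have "hd xs \<in> K" using that by (auto simp: small_tuples_def subset_iff)
      then have "hd xs \<in> topspace (subtopology mtopology (mball (hd xs) (r 0)))"
        using r[of 0] by (simp add: topspace_subtopology)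
      then show ?thesis
        using r[of 0] by (simp add: singular_chain_of singular_simplex_def)
    qed
    moreover have "cyc 0 (frag_extend ?t (tuple_boundary xs))" if xs: "xs \<in> ?S (Suc 0)" for xs
    proof -
      obtain x y where "xs = [x, y]"
        using xs by (auto simp: length_Suc_conv)
      then show ?thesis
        by (simp add: tuple_boundary_Cons tuple_cone_def frag_extend_diff)
    qed
    ultimately show "P 0 ?t"
      by (simp add: P_def)
  qed
  moreover have "\<exists>t'. P (Suc n) t' \<and> Q n t t'" if P: "P n t" for n t
  proof (cases "Suc n \<le> N")
    case True
    have n: "n \<le> N" "n < N" using True by auto
    have "\<exists>w. ball_chain (Suc n) (hd xs) (r (Suc n)) w \<and> chain_boundary (Suc n) w = frag_extend t (tuple_boundary xs)"
      if xs: "xs \<in> ?S (Suc n)" for xs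
    proof (rule null_in_ball[OF null[OF n(2)]])
      have "xs \<noteq> []" using xs by auto
      then have hd: "hd xs \<in> set xs" by simp
      then show hK: "hd xs \<in> K" using xs by (auto simp: small_tuples_def subset_iff)
      show "cyc n (frag_extend t (tuple_boundary xs))"
        using P n xs by (simp add: P_def)
      show "ball_chain n (hd xs) (4 * r n) (frag_extend t (tuple_boundary xs))"
      proof (rule singular_chain_extend)
        fix ys assume "ys \<in> Poly_Mapping.keys (tuple_boundary xs)"
        then have ys: "ys \<in> ?S n" "set ys \<subseteq> set xs" using bd[OF xs] by blast+
        have "ys \<noteq> []" using ys by auto
        then have "hd ys \<in> set xs" using ys by (meson hd_in_set subsetD)
        then have dist: "d (hd ys) (hd xs) < r 0"
          using xs hd by (simp add: small_tuples_def)
        have "ball_chain n (hd ys) (r n) (t ys)"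
          using P n(1) ys(1) by (simp add: P_def)
        then show "ball_chain n (hd xs) (4 * r n) (t ys)"
        proof (rule ball_chain_mono)
          show "d (hd ys) (hd xs) + r n \<le> 4 * r n"
            using dist r[of n] n by linarith
        qed (use hK in simp)
      qed
    qed
    then obtain t' where t': "\<And>xs. xs \<in> ?S (Suc n) \<Longrightarrow> ball_chain (Suc n) (hd xs) (r (Suc n)) (t' xs) \<and>
        chain_boundary (Suc n) (t' xs) = frag_extend t (tuple_boundary xs)"
      by metis
    have "chain_boundary (Suc n) (frag_extend t' (tuple_boundary xs)) = 0" if "xs \<in> ?S (Suc (Suc n))" for xs
    proof -
      have "chain_boundary (Suc n) (frag_extend t' (tuple_boundary xs)) =
          frag_extend (\<lambda>ys. frag_extend t (tuple_boundary ys)) (tuple_boundary xs)"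
        unfolding chain_boundary_frag_extend
        by (rule frag_extend_eq) (use t' bd[OF that] in blast)
      then show ?thesis
        by (simp add: frag_extend_frag_extend[symmetric] tuple_boundary_boundary)
    qed
    then have "P (Suc n) t'" "Q n t t'"
      using t' by (simp_all add: P_def Q_def)
    then show ?thesis by blast
  qed (simp add: P_def Q_def)
  ultimately obtain t where t: "\<And>n. P n (t n)" "\<And>n. Q n (t n) (t (Suc n))"
    using dependent_nat_choice[of P Q] by metis
  define \<tau> where "\<tau> xs = t (length xs - 1) xs" for xs
  show ?thesis
  proof (rule that[of \<tau>])
    show "\<tau> [x] = frag_of (\<lambda>_\<in>standard_simplex 0. x)" for x
      using t(1)[of 0] by (simp add: P_def \<tau>_def)
    fix p xs assume xs: "xs \<in> small_tuples (r 0)"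
    show "ball_chain p (hd xs) (r p) (\<tau> xs)" if "length xs = Suc p" "p \<le> N"
      using t(1)[of p] that xs by (simp add: P_def \<tau>_def)
    show "chain_boundary (Suc p) (\<tau> xs) = frag_extend \<tau> (tuple_boundary xs)"
      if "length xs = Suc (Suc p)" "Suc p \<le> N"
    proof -
      have "frag_extend \<tau> (tuple_boundary xs) = frag_extend (t p) (tuple_boundary xs)"
      proof (rule frag_extend_eq)
        fix ys assume "ys \<in> Poly_Mapping.keys (tuple_boundary xs)"
        then have "ys \<in> ?S p" using bd[of xs p] xs that by blast
        then show "\<tau> ys = t p ys" by (simp add: \<tau>_def)
      qed
      then show ?thesis
        using t(2)[of p] that xs by (simp add: Q_def \<tau>_def)
    qed
  qed
qed

lemma vtuple_near:
  assumes f: "f \<in> near \<delta> p"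
  obtains k where "k \<in> K" "singular_simplex p (subtopology mtopology (mball k \<delta>)) f"
    "hd (vtuple p f) \<in> K" "d k (hd (vtuple p f)) < 2 * \<delta>"
proof -
  obtain k where k: "k \<in> K" "singular_simplex p (subtopology mtopology (mball k \<delta>)) f"
    using f by (auto simp: near_iff)
  have "vtuple p f \<noteq> []"
    using length_vtuple[of p f] by force
  then have "hd (vtuple p f) \<in> set (vtuple p f)" by simp
  from vtuple_dist[OF k(2,1) this] k show ?thesis
    by (rule_tac that) auto
qed

text \<open>The filling argument again, now for the cycle that a homotopy between
  \<open>\<tau>\<close> of the vertex tuple and the simplex itself has to bound. The fillings are
  one dimension higher, hence the radii up to \<open>Suc N\<close>.\<close>

lemma homotopy_on_near_simplices:
  fixes r :: "nat \<Rightarrow> real"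
  assumes r: "\<And>i. i \<le> Suc N \<Longrightarrow> 0 < r i \<and> r 0 \<le> r i"
    and null: "\<And>i k. i < Suc N \<Longrightarrow> k \<in> K \<Longrightarrow> null_in mtopology (mball k (4 * r i)) (mball k (r (Suc i)))"
    and \<tau>0: "\<And>x. \<tau> [x] = frag_of (\<lambda>_\<in>standard_simplex 0. x)"
    and \<tau>1: "\<And>p xs. xs \<in> small_tuples (r 0) \<Longrightarrow> length xs = Suc p \<Longrightarrow> p \<le> N \<Longrightarrow> ball_chain p (hd xs) (r p) (\<tau> xs)"
    and \<tau>2: "\<And>p xs. xs \<in> small_tuples (r 0) \<Longrightarrow> length xs = Suc (Suc p) \<Longrightarrow> Suc p \<le> N \<Longrightarrow>
       chain_boundary (Suc p) (\<tau> xs) = frag_extend \<tau> (tuple_boundary xs)"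
  shows "\<exists>L. \<forall>p f. f \<in> near (r 0/4) p \<longrightarrow> p \<le> N \<longrightarrow> singular_chain (Suc p) mtopology (L p f) \<and>
       chain_boundary (Suc p) (L p f) = \<tau> (vtuple p f) - frag_of f - frag_extend (L (p - 1)) (chain_boundary p (frag_of f))"
proof -
  \<comment> \<open>At radius \<open>r 0/4\<close> the vertex tuples have diameter below
    \<open>r 0\<close>, where \<open>\<tau>\<close> is under control.\<close>
  let ?n = "near (r 0/4)"
  let ?z = "\<lambda>n l f. \<tau> (vtuple n f) - frag_of f - frag_extend l (chain_boundary n (frag_of f))"
  define P where "P n l \<longleftrightarrow> (n \<le> N \<longrightarrow> (\<forall>f\<in>?n n. ball_chain (Suc n) (hd (vtuple n f)) (r (Suc n)) (l f)) \<and>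
      (n = 0 \<longrightarrow> (\<forall>f\<in>?n 0. chain_boundary (Suc 0) (l f) = \<tau> (vtuple 0 f) - frag_of f)) \<and>
      (Suc n \<le> N \<longrightarrow> (\<forall>f\<in>?n (Suc n). chain_boundary (Suc n) (?z (Suc n) l f) = 0)))"
    for n and l :: "_ \<Rightarrow> 'a chain"
  define Q where "Q n l l' \<longleftrightarrow> (Suc n \<le> N \<longrightarrow> (\<forall>f\<in>?n (Suc n). chain_boundary (Suc (Suc n)) (l' f) =
       ?z (Suc n) l f))" for n and l l' :: "_ \<Rightarrow> 'a chain"
  have vt: "vtuple n f \<in> small_tuples (r 0)" if "f \<in> ?n n" for n f
    using vtuple_small[OF that] by simp
  have base: "ball_chain n (hd (vtuple n f)) (4 * r n) (\<tau> (vtuple n f) - frag_of f)"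
    if f: "f \<in> ?n n" "n \<le> N" for n f
  proof (rule singular_chain_diff)
    obtain k where k: "k \<in> K" "singular_simplex n (subtopology mtopology (mball k (r 0/4))) f"
      "hd (vtuple n f) \<in> K" "d k (hd (vtuple n f)) < 2 * (r 0/4)"
      by (rule vtuple_near[OF f(1)])
    have "ball_chain n k (r 0/4) (frag_of f)"
      using k(2) by (simp add: singular_chain_of)
    then show "ball_chain n (hd (vtuple n f)) (4 * r n) (frag_of f)"
      by (rule ball_chain_mono) (use k r[of n] f(2) in auto)
    have "ball_chain n (hd (vtuple n f)) (r n) (\<tau> (vtuple n f))"
      by (rule \<tau>1[OF vt[OF f(1)]]) (use f in auto)
    then show "ball_chain n (hd (vtuple n f)) (4 * r n) (\<tau> (vtuple n f))"
      by (rule ball_chain_mono) (use k r[of n] f(2) in auto)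
  qed
  have hdK: "hd (vtuple n f) \<in> K" if "f \<in> ?n n" for n f
    using vtuple_near[OF that] by metis
  \<comment> \<open>The homotopy formula for \<open>l\<close> in degree \<open>n\<close>, with
    \<open>l'\<close> the homotopy one degree below, makes the boundary prescribed in the next
    degree a cycle.\<close>
  have cycle: "chain_boundary (Suc n) (?z (Suc n) l f) = 0"
    if l: "\<And>g. g \<in> ?n n \<Longrightarrow> chain_boundary (Suc n) (l g) = \<tau> (vtuple n g) - frag_of g -
        frag_extend l' (chain_boundary n (frag_of g))" and f: "f \<in> ?n (Suc n)" and n: "Suc n \<le> N" for n l l' f
  proof -
    let ?b = "chain_boundary (Suc n) (frag_of f)"
    have fX: "singular_chain (Suc n) mtopology (frag_of f)"
      using f by (auto simp: near_iff singular_chain_of singular_simplex_subtopology)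
    have "chain_boundary (Suc n) (\<tau> (vtuple (Suc n) f)) = frag_extend \<tau> (tuple_boundary (vtuple (Suc n) f))"
      by (rule \<tau>2[OF vt[OF f]]) (use n in auto)
    also have "\<dots> = frag_extend (\<lambda>g. \<tau> (vtuple n g)) ?b"
      by (simp add: vtuple_boundary[symmetric] frag_extend_frag_extend)
    finally have 1: "chain_boundary (Suc n) (\<tau> (vtuple (Suc n) f)) = frag_extend (\<lambda>g. \<tau> (vtuple n g)) ?b" .
    have "chain_boundary (Suc n) (frag_extend l ?b) =
        frag_extend (\<lambda>g. \<tau> (vtuple n g) - frag_of g - frag_extend l' (chain_boundary n (frag_of g))) ?b"
      unfolding chain_boundary_frag_extend
      by (rule frag_extend_eq) (use l near_boundary[OF f] in blast)
    also have "\<dots> = frag_extend (\<lambda>g. \<tau> (vtuple n g)) ?b - ?b - frag_extend l' (chain_boundary n ?b)"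
      by (simp add: frag_extend_fun_diff frag_extend_frag_extend[symmetric] chain_boundary_extend[symmetric])
    also have "chain_boundary n ?b = 0"
      using chain_boundary_boundary[OF fX] by simp
    finally show ?thesis
      by (simp add: chain_boundary_diff 1)
  qed
  have "\<exists>l. P 0 l"
  proof -
    have "\<exists>w. ball_chain (Suc 0) (hd (vtuple 0 f)) (r (Suc 0)) w \<and> chain_boundary (Suc 0) w = \<tau> (vtuple 0 f) - frag_of f"
      if f: "f \<in> ?n 0" for f
    proof (rule null_in_ball[OF null])
      have "vtuple 0 f = [hd (vtuple 0 f)]"
        by (simp add: vtuple_def simplex_vertices_def)
      then have "\<tau> (vtuple 0 f) = frag_of (\<lambda>_\<in>standard_simplex 0. hd (vtuple 0 f))"
        using \<tau>0 by metis
      then show "cyc 0 (\<tau> (vtuple 0 f) - frag_of f)"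
        by (simp add: frag_extend_diff)
    qed (use base[OF f] hdK[OF f] in auto)
    then obtain l where l: "\<And>f. f \<in> ?n 0 \<Longrightarrow> ball_chain (Suc 0) (hd (vtuple 0 f)) (r (Suc 0)) (l f) \<and>
        chain_boundary (Suc 0) (l f) = \<tau> (vtuple 0 f) - frag_of f" by metis
    have "chain_boundary (Suc 0) (?z (Suc 0) l f) = 0" if "f \<in> ?n (Suc 0)" "Suc 0 \<le> N" for f
      by (rule cycle[of 0 l "\<lambda>_. 0"]) (use l that in auto)
    then have "P 0 l"
      using l by (simp add: P_def)
    then show "\<exists>l. P 0 l" by blast
  qed
  moreover have "\<exists>l'. P (Suc n) l' \<and> Q n l l'" if P: "P n l" for n l
  proof (cases "Suc n \<le> N")
    case True
    have n: "n \<le> N" "Suc n < Suc N" using True by auto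
    have "\<exists>w. ball_chain (Suc (Suc n)) (hd (vtuple (Suc n) f)) (r (Suc (Suc n))) w \<and>
        chain_boundary (Suc (Suc n)) w = ?z (Suc n) l f" if f: "f \<in> ?n (Suc n)" for f
    proof (rule null_in_ball[OF null[OF n(2) hdK[OF f]]])
      show "cyc (Suc n) (?z (Suc n) l f)"
        using P n True f by (simp add: P_def)
      have "ball_chain (Suc n) (hd (vtuple (Suc n) f)) (4 * r (Suc n)) (frag_extend l (chain_boundary (Suc n) (frag_of f)))"
      proof (rule singular_chain_extend)
        fix g assume g: "g \<in> Poly_Mapping.keys (chain_boundary (Suc n) (frag_of f))"
        then have gn: "g \<in> ?n n"
          using near_boundary[OF f] by blast
        have "set (vtuple n g) \<subseteq> set (vtuple (Suc n) f)"
        proof -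
          have "Poly_Mapping.keys (chain_boundary (Suc n) (frag_of f)) \<subseteq> {g. set (vtuple n g) \<subseteq> set (vtuple (Suc n) f)}"
          proof (rule singular_face_chain_boundary)
            show "singular_face (Suc n) k f \<in> {g. set (vtuple n g) \<subseteq> set (vtuple (Suc n) f)}" if "k \<le> Suc n" for k
              using set_omit[of k "simplex_vertices (Suc n) f"]
              by (auto simp: vtuple_def simplex_vertices_face[OF that])
          qed
          then show ?thesis using g by blast
        qed
        moreover have "vtuple n g \<noteq> []" "vtuple (Suc n) f \<noteq> []"
          using length_vtuple[of n g] length_vtuple[of "Suc n" f] by force+
        ultimately have "hd (vtuple n g) \<in> set (vtuple (Suc n) f)" "hd (vtuple (Suc n) f) \<in> set (vtuple (Suc n) f)"
          by (meson hd_in_set subsetD)+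
        then have dist: "d (hd (vtuple n g)) (hd (vtuple (Suc n) f)) < r 0"
          using vt[OF f] by (simp add: small_tuples_def)
        have "ball_chain (Suc n) (hd (vtuple n g)) (r (Suc n)) (l g)"
          using P n(1) gn by (simp add: P_def)
        then show "ball_chain (Suc n) (hd (vtuple (Suc n) f)) (4 * r (Suc n)) (l g)"
        proof (rule ball_chain_mono)
          show "d (hd (vtuple n g)) (hd (vtuple (Suc n) f)) + r (Suc n) \<le> 4 * r (Suc n)"
            using dist r[of "Suc n"] n by linarith
        qed (use hdK[OF f] in simp)
      qed
      with base[OF f True] show "ball_chain (Suc n) (hd (vtuple (Suc n) f)) (4 * r (Suc n)) (?z (Suc n) l f)"
        by (rule singular_chain_diff)
    qed
    then obtain l' where l': "\<And>f. f \<in> ?n (Suc n) \<Longrightarrow> ball_chain (Suc (Suc n)) (hd (vtuple (Suc n) f)) (r (Suc (Suc n))) (l' f) \<and>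
        chain_boundary (Suc (Suc n)) (l' f) = ?z (Suc n) l f" by metis
    have "chain_boundary (Suc (Suc n)) (?z (Suc (Suc n)) l' f) = 0" if "f \<in> ?n (Suc (Suc n))" "Suc (Suc n) \<le> N" for f
      by (rule cycle[of "Suc n" l' l]) (use l' that in auto)
    then have "P (Suc n) l'" "Q n l l'"
      using l' by (simp_all add: P_def Q_def)
    then show ?thesis by blast
  qed (simp add: P_def Q_def)
  ultimately obtain L where L: "\<And>n. P n (L n)" "\<And>n. Q n (L n) (L (Suc n))"
    using dependent_nat_choice[of P Q] by metis
  show ?thesis
  proof (intro exI[of _ L] allI impI)
    fix p f assume f: "f \<in> ?n p" "p \<le> N"
    have "ball_chain (Suc p) (hd (vtuple p f)) (r (Suc p)) (L p f)"
      using L(1)[of p] f by (simp add: P_def)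
    then have "singular_chain (Suc p) mtopology (L p f)"
      by (simp add: singular_chain_subtopology)
    moreover have "chain_boundary (Suc p) (L p f) = ?z p (L (p - 1)) f"
    proof (cases p)
      case 0
      then show ?thesis using L(1)[of 0] f by (simp add: P_def chain_boundary_def[of 0])
    next
      case (Suc q)
      then show ?thesis using L(2)[of q] f by (simp add: Q_def)
    qed
    ultimately show "singular_chain (Suc p) mtopology (L p f) \<and> chain_boundary (Suc p) (L p f) = ?z p (L (p - 1)) f" ..
  qed
qed

lemma approximation_exists:
  assumes "\<epsilon> > 0"
  obtains \<delta> \<tau> L T where "approximation N \<epsilon> \<delta> \<tau> L T"
proof -
  obtain r where r: "\<And>i. i \<le> Suc N \<Longrightarrow> 0 < r i \<and> r i \<le> \<epsilon> \<and> r 0 \<le> r i"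
     "\<And>i k. i < Suc N \<Longrightarrow> k \<in> K \<Longrightarrow> null_in mtopology (mball k (4 * r i)) (mball k (r (Suc i)))"
    using radii[OF assms, of "Suc N"] by blast
  let ?\<delta> = "r 0"
  obtain \<tau> where \<tau>0: "\<And>x. \<tau> [x] = frag_of (\<lambda>_\<in>standard_simplex 0. x)"
    and \<tau>1: "\<And>p xs. xs \<in> small_tuples (r 0) \<Longrightarrow> length xs = Suc p \<Longrightarrow> p \<le> N \<Longrightarrow> ball_chain p (hd xs) (r p) (\<tau> xs)"
    and \<tau>2: "\<And>p xs. xs \<in> small_tuples (r 0) \<Longrightarrow> length xs = Suc (Suc p) \<Longrightarrow> Suc p \<le> N \<Longrightarrow>
       chain_boundary (Suc p) (\<tau> xs) = frag_extend \<tau> (tuple_boundary xs)"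
    using realise_tuples[of N r] r by (metis le_SucI less_SucI)
  obtain L where L: "\<And>p f. f \<in> near (r 0/4) p \<Longrightarrow> p \<le> N \<Longrightarrow> singular_chain (Suc p) mtopology (L p f) \<and>
       chain_boundary (Suc p) (L p f) = \<tau> (vtuple p f) - frag_of f - frag_extend (L (p - 1)) (chain_boundary p (frag_of f))"
  proof -
    have "0 < r i \<and> r 0 \<le> r i" if "i \<le> Suc N" for i
      using r(1)[OF that] by simp
    from homotopy_on_near_simplices[of N r \<tau>, OF this r(2) \<tau>0 \<tau>1 \<tau>2] show ?thesis
      using that by blast
  qed
  have \<delta>: "0 < ?\<delta>" "?\<delta> \<le> \<epsilon>" using r(1)[of 0] by auto
  have \<tau>\<epsilon>: "ball_chain p (hd xs) \<epsilon> (\<tau> xs)" if xs: "xs \<in> small_tuples ?\<delta>" "length xs = Suc p" "p \<le> N" for p xs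
  proof (rule ball_chain_mono[OF \<tau>1[OF xs]])
    have "xs \<noteq> []" using xs by auto
    then have "hd xs \<in> K" using xs(1) by (auto simp: small_tuples_def subset_iff)
    then show "hd xs \<in> M" "d (hd xs) (hd xs) + r p \<le> \<epsilon>" using r(1)[of p] xs by auto
  qed
  define S where "S = {xs \<in> small_tuples ?\<delta>. length xs \<le> Suc N}"
  define \<phi> where "\<phi> xs = (if xs = [] then frag_of [] else frag_extend (\<lambda>f. frag_of (vtuple (length xs - 1) f)) (\<tau> xs))" for xs
  \<comment> \<open>The carrier of the homotopy \<open>T\<close>: simplices of
    \<open>\<tau> xs\<close> lie within \<epsilon> of the first entry of \<open>xs\<close>, so their
    vertex tuples lie within twice that distance.\<close>
  define A where "A xs = {k \<in> K. \<exists>x\<in>set xs. d x k < 2 * \<epsilon>}" for xs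
  have \<phi>Suc: "\<phi> xs = frag_extend (\<lambda>f. frag_of (vtuple p f)) (\<tau> xs)" if "length xs = Suc p" for xs p
    using that by (auto simp: \<phi>_def)
  have "\<exists>T. T [] = 0 \<and> (\<forall>xs\<in>S.
    Poly_Mapping.keys (T xs) \<subseteq> {ys. length ys = Suc (length xs) \<and> set ys \<subseteq> A xs} \<and>
    frag_extend tuple_boundary (T xs) = \<phi> xs - frag_of xs - frag_extend T (tuple_boundary xs))"
  proof (rule tuple_homotopy[of S \<phi> frag_of A])
    show "omit_closed S"
      using omit_small_tuples by (auto simp: omit_closed_def S_def length_omit)
    fix xs assume xs: "xs \<in> S"
    then have xs_small: "xs \<in> small_tuples ?\<delta>" and len: "length xs \<le> Suc N"
      by (simp_all add: S_def)
    show "frag_extend tuple_boundary (\<phi> xs) = frag_extend \<phi> (tuple_boundary xs)"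
    proof (cases "length xs")
      case 0
      then show ?thesis by (simp add: \<phi>_def)
    next
      case (Suc n)
      show ?thesis
      proof (cases n)
        case 0
        \<comment> \<open>One-point tuples test the augmentation: \<open>\<tau> [x]\<close> is the
          constant simplex at \<open>x\<close>, whose vertex tuple is \<open>[x]\<close>
          again.\<close>
        with Suc obtain x where x: "xs = [x]" by (auto simp: length_Suc_conv)
        then have "x \<in> K" using xs_small by (simp add: small_tuples_def)
        then have "vtuple 0 (\<lambda>_\<in>standard_simplex 0. x) = [x]"
          using basis_in_standard_simplex[of 0 0] by (simp add: vtuple_def simplex_vertices_def)
        then show ?thesis
          by (simp add: x \<phi>_def \<tau>0 tuple_boundary_Cons tuple_cone_def)
      next
        case (Suc p)
        then have len2: "length xs = Suc (Suc p)" and p: "Suc p \<le> N"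
          using \<open>length xs = Suc n\<close> len by auto
        have "frag_extend tuple_boundary (\<phi> xs) =
            frag_extend (\<lambda>f. frag_of (vtuple p f)) (chain_boundary (Suc p) (\<tau> xs))"
          unfolding \<phi>Suc[OF len2] frag_extend_frag_extend
          by (subst chain_boundary_extend[of "Suc p" "\<tau> xs"]) (simp add: frag_extend_frag_extend vtuple_boundary)
        also have "\<dots> = frag_extend (\<lambda>ys. frag_extend (\<lambda>f. frag_of (vtuple p f)) (\<tau> ys)) (tuple_boundary xs)"
          by (simp add: \<tau>2[OF xs_small len2 p] frag_extend_frag_extend)
        also have "\<dots> = frag_extend \<phi> (tuple_boundary xs)"
        proof (rule frag_extend_eq)
          fix ys assume "ys \<in> Poly_Mapping.keys (tuple_boundary xs)"
          then have "length ys = Suc p"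
            using keys_boundary_small_tuples[OF xs_small len2] by blast
          then show "frag_extend (\<lambda>f. frag_of (vtuple p f)) (\<tau> ys) = \<phi> ys"
            by (simp add: \<phi>Suc)
        qed
        finally show ?thesis .
      qed
    qed
    show "frag_extend tuple_boundary (frag_of xs) = frag_extend frag_of (tuple_boundary xs)"
      by simp
    have xK: "x \<in> K" if "x \<in> set xs" for x
      using that xs_small by (auto simp: small_tuples_def)
    have sub: "set xs \<subseteq> A xs"
    proof
      fix x assume x: "x \<in> set xs"
      then have "d x x < 2 * \<epsilon>" using xK assms by simp
      then show "x \<in> A xs" unfolding A_def using x xK by blast
    qed
    show "Poly_Mapping.keys (frag_of xs) \<subseteq> {ys. length ys = length xs \<and> set ys \<subseteq> A xs}"
      using sub by simp
    show "A xs \<noteq> {}" if "xs \<noteq> []"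
      using sub that by auto
    show "A (omit k xs) \<subseteq> A xs" for k
      using set_omit[of k xs] by (auto simp: A_def)
    show "Poly_Mapping.keys (\<phi> xs) \<subseteq> {ys. length ys = length xs \<and> set ys \<subseteq> A xs}"
    proof (cases "length xs")
      case 0
      then show ?thesis by (simp add: \<phi>_def)
    next
      case (Suc p)
      then have ne: "xs \<noteq> []" by auto
      have hd: "hd xs \<in> set xs" "hd xs \<in> K" using ne xK by auto
      show ?thesis
        unfolding \<phi>Suc[OF Suc]
      proof (rule keys_frag_extend_subset)
        fix f assume f: "f \<in> Poly_Mapping.keys (\<tau> xs)"
        have "ball_chain p (hd xs) \<epsilon> (\<tau> xs)"
          using \<tau>\<epsilon>[OF xs_small Suc] len Suc by simp
        then have "singular_simplex p (subtopology mtopology (mball (hd xs) \<epsilon>)) f"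
          using f unfolding singular_chain_def by blast
        from vtuple_dist[OF this hd(2)] have "set (vtuple p f) \<subseteq> A xs"
          using hd by (auto simp: A_def)
        then show "Poly_Mapping.keys (frag_of (vtuple p f)) \<subseteq> {ys. length ys = length xs \<and> set ys \<subseteq> A xs}"
          by (simp add: Suc)
      qed
    qed
  qed (simp add: \<phi>_def)
  then obtain T where T0: "T [] = 0" and T: "\<forall>xs\<in>S.
    Poly_Mapping.keys (T xs) \<subseteq> {ys. length ys = Suc (length xs) \<and> set ys \<subseteq> A xs} \<and>
    frag_extend tuple_boundary (T xs) = \<phi> xs - frag_of xs - frag_extend T (tuple_boundary xs)"
    by (elim exE conjE)
  \<comment> \<open>At most \<open>2 * \<epsilon>\<close> from either point to an entry of
    \<open>xs\<close>, and the diameter of \<open>xs\<close>, at most \<epsilon>, in between: hence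
    the factor 5.\<close>
  have A_small: "ys \<in> small_tuples (5 * \<epsilon>)" if ys: "set ys \<subseteq> A xs" and xs: "xs \<in> small_tuples ?\<delta>" for xs ys
    unfolding small_tuples_def
  proof (intro CollectI conjI ballI)
    show "set ys \<subseteq> K" using ys by (auto simp: A_def)
    fix y y' assume "y \<in> set ys" "y' \<in> set ys"
    then have "y \<in> A xs" "y' \<in> A xs" using ys by auto
    then obtain x x' where x: "y \<in> K" "y' \<in> K" "x \<in> set xs" "x' \<in> set xs" "d x y < 2 * \<epsilon>" "d x' y' < 2 * \<epsilon>"
      unfolding A_def by blast
    then have x': "x \<in> K" "x' \<in> K" "d x x' < ?\<delta>" using xs by (auto simp: small_tuples_def)
    have "d y y' \<le> d y x + d x y'" "d x y' \<le> d x x' + d x' y'"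
      using x x' by (simp_all add: triangle)
    then show "d y y' < 5 * \<epsilon>"
      using x x' \<delta> commute[of y x] by linarith
  qed
  have "approximation N \<epsilon> ?\<delta> \<tau> L T"
    unfolding approximation_def
  proof (intro conjI allI impI)
    fix p xs assume xs: "xs \<in> small_tuples ?\<delta>" "length xs = Suc p" "p \<le> N"
    then have S: "xs \<in> S" by (simp add: S_def)
    show "Poly_Mapping.keys (T xs) \<subseteq> {ys \<in> small_tuples (5 * \<epsilon>). length ys = Suc (Suc p)}"
      using bspec[OF T S] A_small[OF _ xs(1)] xs(2) by auto
    show "frag_extend tuple_boundary (T xs) = frag_extend (\<lambda>f. frag_of (vtuple p f)) (\<tau> xs) - frag_of xs -
        frag_extend T (tuple_boundary xs)"
      using bspec[OF T S] by (simp add: \<phi>Suc[OF xs(2)])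
  qed (use \<delta> \<tau>\<epsilon> \<tau>2 L T0 in auto)
  then show ?thesis by (rule that)
qed

end

section \<open>Singular cohomology\<close>

lemma (in comm_group) ev_in_hom: "ev G f \<in> hom (free_Abelian_group S) G"
  by (rule homI) (auto simp: ev_add)

lemma carrier_singular_cochains:
  "carrier (singular_cochain_group X G p) =
     hom (free_Abelian_group (singular_simplex_set p X)) G \<inter> extensional (singular_chain_set p X)"
  by (simp add: singular_cochain_group_def) (simp add: chain_group_def)

lemma one_singular_cochains: "\<one>\<^bsub>singular_cochain_group X G p\<^esub> = (\<lambda>c\<in>singular_chain_set p X. \<one>\<^bsub>G\<^esub>)"
  by (simp add: singular_cochain_group_def)

lemma mult_singular_cochains:
  "f \<otimes>\<^bsub>singular_cochain_group X G p\<^esub> g = (\<lambda>c\<in>singular_chain_set p X. f c \<otimes>\<^bsub>G\<^esub> g c)"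
  by (simp add: singular_cochain_group_def)

lemma (in comm_group) singular_cochain_restrict:
  assumes "\<And>c. singular_chain p X c \<Longrightarrow> h c \<in> carrier G"
    and "\<And>a b. singular_chain p X a \<Longrightarrow> singular_chain p X b \<Longrightarrow> h (a + b) = h a \<otimes> h b"
  shows "(\<lambda>c\<in>singular_chain_set p X. h c) \<in> carrier (singular_cochain_group X G p)"
  unfolding carrier_singular_cochains
proof (intro IntI homI)
  fix a b assume "a \<in> carrier (free_Abelian_group (singular_simplex_set p X))"
    "b \<in> carrier (free_Abelian_group (singular_simplex_set p X))"
  then have "singular_chain p X a" "singular_chain p X b"
    by (simp_all add: singular_chain_def)
  then show "(\<lambda>c\<in>singular_chain_set p X. h c) (a \<otimes>\<^bsub>free_Abelian_group (singular_simplex_set p X)\<^esub> b) =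
     (\<lambda>c\<in>singular_chain_set p X. h c) a \<otimes> (\<lambda>c\<in>singular_chain_set p X. h c) b"
    using assms(2) by (simp add: singular_chain_add)
qed (use assms in \<open>auto simp: singular_chain_def\<close>)

locale singular_cochains = comm_group G for G :: "('g, 'm) monoid_scheme" (structure) +
  fixes X :: "'a topology"
begin

lemma cochain_hom:
  assumes "g \<in> carrier (singular_cochain_group X G p)"
  shows "g \<in> hom (free_Abelian_group (singular_simplex_set p X)) G"
  using assms by (simp add: carrier_singular_cochains)

lemma cochain_closed:
  assumes "g \<in> carrier (singular_cochain_group X G p)" "singular_chain p X c"
  shows "g c \<in> carrier G"
  using hom_in_carrier[OF cochain_hom[OF assms(1)], of c] assms(2) by (simp add: singular_chain_def)

lemma cochain_add:
  assumes "g \<in> carrier (singular_cochain_group X G p)" "singular_chain p X a" "singular_chain p X b"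
  shows "g (a + b) = g a \<otimes> g b"
  using hom_mult[OF cochain_hom[OF assms(1)], of a b] assms(2,3) by (simp add: singular_chain_def)

lemma cochain_diff:
  assumes "g \<in> carrier (singular_cochain_group X G p)" "singular_chain p X a" "singular_chain p X b"
  shows "g (a - b) = g a \<otimes> inv g b"
  using hom_diff_free_Abelian_group[OF cochain_hom[OF assms(1)], of a b] assms(2,3) by (simp add: singular_chain_def)

lemma cochain_0: "g \<in> carrier (singular_cochain_group X G p) \<Longrightarrow> g 0 = \<one>"
  using cochain_diff[of g p 0 0] cochain_closed[of g p 0] by simp

lemma cochain_extend:
  assumes "g \<in> carrier (singular_cochain_group X G p)"
    and "\<And>s. s \<in> Poly_Mapping.keys c \<Longrightarrow> singular_chain p X (\<phi> s)"
  shows "g (frag_extend \<phi> c) = ev G (\<lambda>s. g (\<phi> s)) c"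
  by (rule hom_frag_extend[OF cochain_hom[OF assms(1)]]) (use assms(2) in \<open>simp add: singular_chain_def\<close>)

lemma singular_coboundary_eq: "singular_coboundary X p f = (\<lambda>c\<in>singular_chain_set (Suc p) X. f (chain_boundary (Suc p) c))"
  by (simp add: singular_coboundary_def)

lemma cochain_ext:
  assumes "f \<in> carrier (singular_cochain_group X G p)" "g \<in> carrier (singular_cochain_group X G p)"
    and "\<And>c. singular_chain p X c \<Longrightarrow> f c = g c"
  shows "f = g"
  using assms unfolding carrier_singular_cochains by (intro extensionalityI[of f "singular_chain_set p X" g]) auto

sublocale complex: cochain_complex "singular_cochain_group X G" "singular_coboundary X"
proof (rule cochain_complex.intro)
  fix p
  have mult_closed: "f \<otimes>\<^bsub>singular_cochain_group X G p\<^esub> g \<in> carrier (singular_cochain_group X G p)"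
    if f: "f \<in> carrier (singular_cochain_group X G p)" and g: "g \<in> carrier (singular_cochain_group X G p)" for f g p
    unfolding mult_singular_cochains
  proof (rule singular_cochain_restrict)
    fix a b assume "singular_chain p X a" "singular_chain p X b"
    then show "f (a + b) \<otimes> g (a + b) = f a \<otimes> g a \<otimes> (f b \<otimes> g b)"
      using cochain_closed[OF f] cochain_closed[OF g] by (simp add: cochain_add[OF f] cochain_add[OF g] m_ac)
  qed (use cochain_closed[OF f] cochain_closed[OF g] in simp)
  show "comm_group (singular_cochain_group X G p)"
  proof (rule comm_groupI)
    show one: "\<one>\<^bsub>singular_cochain_group X G p\<^esub> \<in> carrier (singular_cochain_group X G p)"
      unfolding one_singular_cochains by (rule singular_cochain_restrict) auto
    fix f assume f: "f \<in> carrier (singular_cochain_group X G p)"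
    show "\<one>\<^bsub>singular_cochain_group X G p\<^esub> \<otimes>\<^bsub>singular_cochain_group X G p\<^esub> f = f"
      by (rule cochain_ext[OF mult_closed[OF one f] f])
        (use f cochain_closed in \<open>simp add: mult_singular_cochains one_singular_cochains\<close>)
    show "\<exists>y\<in>carrier (singular_cochain_group X G p).
        y \<otimes>\<^bsub>singular_cochain_group X G p\<^esub> f = \<one>\<^bsub>singular_cochain_group X G p\<^esub>"
    proof
      show i: "(\<lambda>c\<in>singular_chain_set p X. inv f c) \<in> carrier (singular_cochain_group X G p)"
        by (rule singular_cochain_restrict)
          (use f cochain_closed in \<open>simp_all add: cochain_add inv_mult\<close>)
      show "(\<lambda>c\<in>singular_chain_set p X. inv f c) \<otimes>\<^bsub>singular_cochain_group X G p\<^esub> f = \<one>\<^bsub>singular_cochain_group X G p\<^esub>"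
        by (rule cochain_ext[OF mult_closed[OF i f] one])
          (use f cochain_closed in \<open>simp add: mult_singular_cochains one_singular_cochains\<close>)
    qed
    fix g assume g: "g \<in> carrier (singular_cochain_group X G p)"
    show "f \<otimes>\<^bsub>singular_cochain_group X G p\<^esub> g \<in> carrier (singular_cochain_group X G p)"
      by (rule mult_closed[OF f g])
    show "f \<otimes>\<^bsub>singular_cochain_group X G p\<^esub> g = g \<otimes>\<^bsub>singular_cochain_group X G p\<^esub> f"
      by (rule cochain_ext[OF mult_closed[OF f g] mult_closed[OF g f]])
        (use f g cochain_closed in \<open>simp add: mult_singular_cochains m_comm\<close>)
    fix h assume h: "h \<in> carrier (singular_cochain_group X G p)"
    show "f \<otimes>\<^bsub>singular_cochain_group X G p\<^esub> g \<otimes>\<^bsub>singular_cochain_group X G p\<^esub> h =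
        f \<otimes>\<^bsub>singular_cochain_group X G p\<^esub> (g \<otimes>\<^bsub>singular_cochain_group X G p\<^esub> h)"
      by (rule cochain_ext[OF mult_closed[OF mult_closed[OF f g] h] mult_closed[OF f mult_closed[OF g h]]])
        (use f g h cochain_closed in \<open>simp add: mult_singular_cochains m_assoc\<close>)
  qed
  show "singular_coboundary X p \<in> hom (singular_cochain_group X G p) (singular_cochain_group X G (Suc p))"
  proof (rule homI)
    fix f assume f: "f \<in> carrier (singular_cochain_group X G p)"
    have closed: "singular_coboundary X p f \<in> carrier (singular_cochain_group X G (Suc p))"
      if f: "f \<in> carrier (singular_cochain_group X G p)" for f
      unfolding singular_coboundary_eq
      by (rule singular_cochain_restrict)
        (simp_all add: cochain_closed[OF f] singular_chain_boundary_alt chain_boundary_add cochain_add[OF f])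
    show "singular_coboundary X p f \<in> carrier (singular_cochain_group X G (Suc p))"
      by (rule closed[OF f])
    fix g assume g: "g \<in> carrier (singular_cochain_group X G p)"
    show "singular_coboundary X p (f \<otimes>\<^bsub>singular_cochain_group X G p\<^esub> g) =
        singular_coboundary X p f \<otimes>\<^bsub>singular_cochain_group X G (Suc p)\<^esub> singular_coboundary X p g"
      by (rule cochain_ext[OF closed[OF mult_closed[OF f g]] mult_closed[OF closed[OF f] closed[OF g]]])
        (simp add: singular_coboundary_eq mult_singular_cochains singular_chain_boundary_alt)
  qed
  fix f assume f: "f \<in> carrier (singular_cochain_group X G p)"
  show "singular_coboundary X (Suc p) (singular_coboundary X p f) = \<one>\<^bsub>singular_cochain_group X G (Suc (Suc p))\<^esub>"
    unfolding singular_coboundary_eq one_singular_cochains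
    using f by (intro restrict_ext)
      (simp add: singular_chain_boundary_alt chain_boundary_boundary_alt cochain_0)
qed

lemma cocycles_iff:
  "g \<in> complex.cocycles p \<longleftrightarrow> g \<in> carrier (singular_cochain_group X G p) \<and>
     (\<forall>c. singular_chain (Suc p) X c \<longrightarrow> g (chain_boundary (Suc p) c) = \<one>)"
proof -
  have "singular_coboundary X p g = \<one>\<^bsub>singular_cochain_group X G (Suc p)\<^esub> \<longleftrightarrow>
     (\<forall>c. singular_chain (Suc p) X c \<longrightarrow> g (chain_boundary (Suc p) c) = \<one>)"
    unfolding singular_coboundary_eq one_singular_cochains
    by (auto simp: fun_eq_iff restrict_def)
  then show ?thesis by (simp add: kernel_def)
qed

lemma coboundaries_0_iff:
  assumes "g \<in> carrier (singular_cochain_group X G 0)"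
  shows "g \<in> coboundaries (singular_cochain_group X G) (singular_coboundary X) 0 \<longleftrightarrow>
     (\<forall>c. singular_chain 0 X c \<longrightarrow> g c = \<one>)"
proof -
  have "\<one>\<^bsub>singular_cochain_group X G 0\<^esub> \<in> carrier (singular_cochain_group X G 0)"
    using complex.group monoid.one_closed group.is_monoid by blast
  then show ?thesis
    using cochain_ext[OF assms, of "\<one>\<^bsub>singular_cochain_group X G 0\<^esub>"]
    unfolding coboundaries_0 by (auto simp: one_singular_cochains)
qed

lemma coboundaries_Suc_iff:
  assumes g: "g \<in> carrier (singular_cochain_group X G (Suc q))"
  shows "g \<in> coboundaries (singular_cochain_group X G) (singular_coboundary X) (Suc q) \<longleftrightarrow>
     (\<exists>h\<in>carrier (singular_cochain_group X G q).
        \<forall>c. singular_chain (Suc q) X c \<longrightarrow> g c = h (chain_boundary (Suc q) c))"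
proof -
  have "g = singular_coboundary X q h \<longleftrightarrow> (\<forall>c. singular_chain (Suc q) X c \<longrightarrow> g c = h (chain_boundary (Suc q) c))"
    if h: "h \<in> carrier (singular_cochain_group X G q)" for h
    using cochain_ext[OF g hom_in_carrier[OF complex.hom h]] by (auto simp: singular_coboundary_eq)
  then show ?thesis
    unfolding coboundaries_Suc by (auto simp: image_iff)
qed

end

section \<open>Retracting chains onto those near the compact set\<close>

context compact_in_metric
begin

text \<open>\<open>R\<close> is a homotopy from the identity to a chain map into the chains spanned
  by \<open>E\<close>, and it vanishes on those. \<open>E\<close> itself is only known to lie
  between two families of simplices near \<open>K\<close>.\<close>

definition retracts where
  "retracts \<epsilon> \<eta> E R \<longleftrightarrow> 0 < \<eta> \<and> (\<forall>p. near \<eta> p \<subseteq> E p \<and> E p \<subseteq> near \<epsilon> p) \<and>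
     (\<forall>p a b. R p (a - b) = R p a - R p b) \<and>
     (\<forall>p c. singular_chain p mtopology c \<longrightarrow> singular_chain (Suc p) mtopology (R p c)) \<and>
     (\<forall>p c. Poly_Mapping.keys c \<subseteq> E p \<longrightarrow> R p c = 0) \<and>
     (\<forall>p c. singular_chain p mtopology c \<longrightarrow>
        Poly_Mapping.keys (c - chain_boundary (Suc p) (R p c) - R (p - 1) (chain_boundary p c)) \<subseteq> E p)"

lemma retractsD:
  assumes "retracts \<epsilon> \<eta> E R"
  shows "0 < \<eta>" "near \<eta> p \<subseteq> E p" "E p \<subseteq> near \<epsilon> p" "R p (a - b) = R p a - R p b"
    "singular_chain p mtopology c \<Longrightarrow> singular_chain (Suc p) mtopology (R p c)"
    "Poly_Mapping.keys c \<subseteq> E p \<Longrightarrow> R p c = 0"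
    "singular_chain p mtopology c \<Longrightarrow>
      Poly_Mapping.keys (c - chain_boundary (Suc p) (R p c) - R (p - 1) (chain_boundary p c)) \<subseteq> E p"
  using assms by (simp_all add: retracts_def)

lemma retracts_exist:
  assumes good: "\<And>U. openin mtopology U \<Longrightarrow> K \<subseteq> U \<Longrightarrow> \<exists>U'. openin mtopology U' \<and> K \<subseteq> U' \<and> U' \<subseteq> U \<and>
      (\<forall>p c. singular_relcycle p mtopology U' c \<longrightarrow> singular_relboundary p mtopology U' c)"
    and "\<epsilon> > 0"
  shows "\<exists>\<eta> E R. retracts \<epsilon> \<eta> E R"
proof -
  let ?W = "\<Union>k\<in>K. mball k \<epsilon>"
  have "K \<subseteq> ?W" using \<open>\<epsilon> > 0\<close> by force
  then obtain U where U: "openin mtopology U" "K \<subseteq> U" "U \<subseteq> ?W"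
    and rel: "\<And>p c. singular_relcycle p mtopology U c \<Longrightarrow> singular_relboundary p mtopology U c"
    using good[of ?W] by (metis (no_types, lifting) imageE openin_Union openin_mball)
  \<comment> \<open>The balls are cut down by \<open>U\<close> because the union of the sets has to
    be a neighbourhood with vanishing relative homology, which is known of \<open>U\<close> but not
    of a union of balls.\<close>
  let ?V = "(\<lambda>k. U \<inter> mball k \<epsilon>) ` K"
  let ?E = "small_simplices mtopology ?V"
  have V: "\<Union>?V = U" using U(3) by blast
  have acyclic: "\<exists>d. singular_chain (Suc p) mtopology d \<and> Poly_Mapping.keys (c - chain_boundary (Suc p) d) \<subseteq> ?E p"
    if "singular_chain p mtopology c" "Poly_Mapping.keys (chain_boundary p c) \<subseteq> ?E (p - 1)" for p c
    by (rule small_simplices_acyclic[OF _ _ that]) (use U rel in \<open>auto simp: V[simplified]\<close>)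
  have "\<exists>R. (\<forall>p a b. R p (a - b) = R p a - R p b) \<and>
     (\<forall>p c. singular_chain p mtopology c \<longrightarrow> singular_chain (Suc p) mtopology (R p c)) \<and>
     (\<forall>p c. Poly_Mapping.keys c \<subseteq> ?E p \<longrightarrow> R p c = 0) \<and>
     (\<forall>p c. singular_chain p mtopology c \<longrightarrow>
        Poly_Mapping.keys (c - chain_boundary (Suc p) (R p c) - R (p - 1) (chain_boundary p c)) \<subseteq> ?E p)"
    by (rule deformation_to_subcomplex[of ?E mtopology, OF small_simplices_face acyclic]) (assumption+, blast)
  then obtain R where R: "(\<forall>p a b. R p (a - b) = R p a - R p b) \<and>
     (\<forall>p c. singular_chain p mtopology c \<longrightarrow> singular_chain (Suc p) mtopology (R p c)) \<and>
     (\<forall>p c. Poly_Mapping.keys c \<subseteq> ?E p \<longrightarrow> R p c = 0) \<and>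
     (\<forall>p c. singular_chain p mtopology c \<longrightarrow>
        Poly_Mapping.keys (c - chain_boundary (Suc p) (R p c) - R (p - 1) (chain_boundary p c)) \<subseteq> ?E p)"
    by (elim exE)
  obtain \<eta>0 where \<eta>0: "\<eta>0 > 0" "\<And>x. x \<in> K \<Longrightarrow> mball x \<eta>0 \<subseteq> U"
    using lebesgue_number[OF compact, of "{U}"] U by auto
  let ?\<eta> = "min \<eta>0 \<epsilon>"
  have "near ?\<eta> p \<subseteq> ?E p" for p
  proof
    fix f assume "f \<in> near ?\<eta> p"
    then obtain k where k: "k \<in> K" "singular_simplex p (subtopology mtopology (mball k ?\<eta>)) f"
      by (auto simp: near_iff)
    have "mball k ?\<eta> \<subseteq> U \<inter> mball k \<epsilon>"
      using \<eta>0(2)[OF k(1)] mball_subset_concentric[of ?\<eta> \<eta>0 k] mball_subset_concentric[of ?\<eta> \<epsilon> k] by auto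
    then show "f \<in> ?E p"
      using singular_simplex_mono[OF k(2)] k(1) unfolding small_simplices_iff by blast
  qed
  moreover have "?E p \<subseteq> near \<epsilon> p" for p
  proof
    fix f assume "f \<in> ?E p"
    then obtain k where k: "k \<in> K" "singular_simplex p (subtopology mtopology (U \<inter> mball k \<epsilon>)) f"
      by (auto simp: small_simplices_iff)
    then show "f \<in> near \<epsilon> p"
      using singular_simplex_mono[OF k(2)] unfolding near_iff by blast
  qed
  ultimately have "retracts \<epsilon> ?\<eta> ?E R"
    using R \<eta>0(1) \<open>\<epsilon> > 0\<close> unfolding retracts_def by (intro conjI) auto
  then show ?thesis by blast
qed

lemma near_chain: "Poly_Mapping.keys c \<subseteq> near \<epsilon> p \<Longrightarrow> singular_chain p mtopology c"
  unfolding singular_chain_def near_def small_simplices_def by blast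

end

section \<open>Comparison of singular and Alexander-Spanier cohomology\<close>

locale AS_comparison = HLC_pair M d K + comm_group G
  for M :: "'a set" and d K and G :: "('g, 'm) monoid_scheme" (structure) +
  assumes good: "\<And>U. openin mtopology U \<Longrightarrow> K \<subseteq> U \<Longrightarrow> \<exists>U'. openin mtopology U' \<and> K \<subseteq> U' \<and> U' \<subseteq> U \<and>
      (\<forall>p c. singular_relcycle p mtopology U' c \<longrightarrow> singular_relboundary p mtopology U' c)"
begin

abbreviation "XK \<equiv> subtopology mtopology K"

sublocale sing: singular_cochains G mtopology ..

sublocale AS: AS_complex G XK ..

lemma AS_cocycles_iff:
  "f \<in> AS.AS_cocycles p \<longleftrightarrow> f \<in> point_tuples XK p \<rightarrow>\<^sub>E carrier G \<and>
     (\<exists>\<eta>>0. \<forall>xs\<in>small_tuples \<eta>. length xs = Suc (Suc p) \<longrightarrow> ev G f (tuple_boundary xs) = \<one>)"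
  unfolding AS.AS_cocycles_def locally_iff_small_tuples by simp

lemma cobounds_iff:
  "AS.cobounds p f u \<longleftrightarrow> (p = 0 \<longrightarrow> u [] = \<one>) \<and>
     (\<exists>\<eta>>0. \<forall>xs\<in>small_tuples \<eta>. length xs = Suc p \<longrightarrow> f xs = ev G u (tuple_boundary xs))"
  unfolding AS.cobounds_def locally_iff_small_tuples by simp

abbreviation C where "C p \<equiv> carrier (singular_cochain_group mtopology G p)"

text \<open>\<open>\<tau>\<close> is under control only on tuples of diameter below \<delta>.
  Classes depend on the germ along the diagonal, so the cochain is continued by the unit.\<close>

definition pull where
  "pull p \<delta> \<tau> g = (\<lambda>xs\<in>point_tuples XK p. if xs \<in> small_tuples \<delta> then g (\<tau> xs) else \<one>)"

lemma small_tuple_point_tuple: "xs \<in> small_tuples \<eta> \<Longrightarrow> length xs = Suc p \<Longrightarrow> xs \<in> point_tuples XK p"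
  by (simp add: point_tuples_K small_tuples_def)

lemma pull_small: "xs \<in> small_tuples \<delta> \<Longrightarrow> length xs = Suc p \<Longrightarrow> pull p \<delta> \<tau> g xs = g (\<tau> xs)"
  using small_tuple_point_tuple by (simp add: pull_def)

context
  fixes N \<epsilon> \<delta> \<tau> L T
  assumes apx: "approximation N \<epsilon> \<delta> \<tau> L T"
begin

lemma apx_pos: "0 < \<delta>" "\<delta> \<le> \<epsilon>"
  using apx by (simp_all add: approximation_def)

lemma apx_near:
  assumes xs: "xs \<in> small_tuples \<delta>" "length xs = Suc p" "p \<le> N"
  shows "Poly_Mapping.keys (\<tau> xs) \<subseteq> near \<epsilon> p"
proof -
  have "xs \<noteq> []" using xs by auto
  then have "hd xs \<in> K" using xs(1) by (auto simp: small_tuples_def subset_iff)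
  moreover have "singular_chain p (subtopology mtopology (mball (hd xs) \<epsilon>)) (\<tau> xs)"
    using apx xs by (simp add: approximation_def)
  ultimately show ?thesis
    unfolding singular_chain_def near_iff subset_iff by blast
qed

lemma apx_chain: "xs \<in> small_tuples \<delta> \<Longrightarrow> length xs = Suc p \<Longrightarrow> p \<le> N \<Longrightarrow> singular_chain p mtopology (\<tau> xs)"
  using near_chain[OF apx_near] .

lemma apx_boundary:
  "xs \<in> small_tuples \<delta> \<Longrightarrow> length xs = Suc (Suc p) \<Longrightarrow> Suc p \<le> N \<Longrightarrow>
     chain_boundary (Suc p) (\<tau> xs) = frag_extend \<tau> (tuple_boundary xs)"
  using apx by (simp add: approximation_def)

lemma apx_L_chain: "f \<in> near (\<delta>/4) p \<Longrightarrow> p \<le> N \<Longrightarrow> singular_chain (Suc p) mtopology (L p f)"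
  using apx by (simp add: approximation_def)

lemma apx_L_extend:
  assumes "Poly_Mapping.keys c \<subseteq> near (\<delta>/4) p" "p \<le> N"
  shows "singular_chain (Suc p) mtopology (frag_extend (L p) c)"
  by (rule singular_chain_extend) (use apx_L_chain assms in blast)

lemma apx_L:
  assumes "Poly_Mapping.keys c \<subseteq> near (\<delta>/4) p" "p \<le> N"
  shows "frag_extend (\<lambda>f. \<tau> (vtuple p f)) c = c + chain_boundary (Suc p) (frag_extend (L p) c) +
     frag_extend (L (p - 1)) (chain_boundary p c)"
proof -
  have "chain_boundary (Suc p) (frag_extend (L p) c) =
      frag_extend (\<lambda>f. \<tau> (vtuple p f) - frag_of f - frag_extend (L (p - 1)) (chain_boundary p (frag_of f))) c"
    unfolding chain_boundary_frag_extend
  proof (rule frag_extend_eq)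
    fix f assume "f \<in> Poly_Mapping.keys c"
    then have "f \<in> near (\<delta>/4) p" using assms by blast
    then show "chain_boundary (Suc p) (L p f) = \<tau> (vtuple p f) - frag_of f - frag_extend (L (p - 1)) (chain_boundary p (frag_of f))"
      using apx assms(2) by (simp add: approximation_def)
  qed
  then show ?thesis
    by (simp add: frag_extend_fun_diff frag_extend_frag_extend[symmetric] chain_boundary_extend[symmetric])
qed

lemma apx_T:
  assumes "xs \<in> small_tuples \<delta>" "length xs = Suc p" "p \<le> N"
  shows "Poly_Mapping.keys (T xs) \<subseteq> {ys \<in> small_tuples (5 * \<epsilon>). length ys = Suc (Suc p)}"
    "frag_extend (\<lambda>f. frag_of (vtuple p f)) (\<tau> xs) =
       frag_of xs + frag_extend tuple_boundary (T xs) + frag_extend T (tuple_boundary xs)"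
  using apx assms by (simp_all add: approximation_def)

lemma apx_extend_chain:
  assumes "Poly_Mapping.keys c \<subseteq> {xs \<in> small_tuples \<delta>. length xs = Suc p}" "p \<le> N"
  shows "singular_chain p mtopology (frag_extend \<tau> c)"
  by (rule singular_chain_extend) (use apx_chain assms in blast)

lemma ev_pull:
  assumes g: "g \<in> C p" and c: "Poly_Mapping.keys c \<subseteq> {xs \<in> small_tuples \<delta>. length xs = Suc p}" and p: "p \<le> N"
  shows "ev G (pull p \<delta> \<tau> g) c = g (frag_extend \<tau> c)"
proof -
  have "g (frag_extend \<tau> c) = ev G (\<lambda>xs. g (\<tau> xs)) c"
    by (rule sing.cochain_extend[OF g]) (use apx_chain c p in blast)
  also have "\<dots> = ev G (pull p \<delta> \<tau> g) c"
  proof (rule ev_cong)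
    fix xs assume "xs \<in> Poly_Mapping.keys c"
    then have "xs \<in> small_tuples \<delta>" "length xs = Suc p" using c by blast+
    then show "trunc G (g (\<tau> xs)) = trunc G (pull p \<delta> \<tau> g xs)"
      by (simp add: pull_small)
  qed
  finally show ?thesis by simp
qed

lemma pull_in: "g \<in> C p \<Longrightarrow> p \<le> N \<Longrightarrow> pull p \<delta> \<tau> g \<in> point_tuples XK p \<rightarrow>\<^sub>E carrier G"
  using sing.cochain_closed[of g p] apx_chain
  by (auto simp: pull_def point_tuples_def)

lemma apx_extend_boundary:
  assumes "Poly_Mapping.keys c \<subseteq> {xs \<in> small_tuples \<delta>. length xs = Suc (Suc p)}" "Suc p \<le> N"
  shows "chain_boundary (Suc p) (frag_extend \<tau> c) = frag_extend \<tau> (frag_extend tuple_boundary c)"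
  unfolding chain_boundary_frag_extend frag_extend_frag_extend
proof (rule frag_extend_eq)
  fix xs assume "xs \<in> Poly_Mapping.keys c"
  then have "xs \<in> small_tuples \<delta>" "length xs = Suc (Suc p)" using assms by blast+
  then show "chain_boundary (Suc p) (\<tau> xs) = frag_extend \<tau> (tuple_boundary xs)"
    using apx_boundary assms(2) by blast
qed

lemma pull_cocycle:
  assumes g: "g \<in> sing.complex.cocycles p" and p: "Suc p \<le> N"
  shows "pull p \<delta> \<tau> g \<in> AS.AS_cocycles p"
  unfolding AS_cocycles_iff
proof (intro conjI exI[of _ \<delta>] ballI impI)
  have gC: "g \<in> C p" using g by (simp add: sing.cocycles_iff)
  show "pull p \<delta> \<tau> g \<in> point_tuples XK p \<rightarrow>\<^sub>E carrier G"
    using pull_in[OF gC] p by simp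
  show "0 < \<delta>" by (rule apx_pos)
  fix xs assume xs: "xs \<in> small_tuples \<delta>" "length xs = Suc (Suc p)"
  have "ev G (pull p \<delta> \<tau> g) (tuple_boundary xs) = g (frag_extend \<tau> (tuple_boundary xs))"
    using keys_boundary_small_tuples[OF xs] p by (intro ev_pull[OF gC]) auto
  also have "\<dots> = g (chain_boundary (Suc p) (\<tau> xs))"
    using apx_boundary[OF xs p] by simp
  also have "\<dots> = \<one>"
    using g apx_chain[OF xs p] by (simp add: sing.cocycles_iff)
  finally show "ev G (pull p \<delta> \<tau> g) (tuple_boundary xs) = \<one>" .
qed

lemma pull_mult:
  assumes "g \<in> C p" "h \<in> C p" "p \<le> N"
  shows "pull p \<delta> \<tau> (g \<otimes>\<^bsub>singular_cochain_group mtopology G p\<^esub> h) =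
    pull p \<delta> \<tau> g \<otimes>\<^bsub>tuple_cochain_group (point_tuples XK) G p\<^esub> pull p \<delta> \<tau> h"
  unfolding AS.mult_cochains
proof
  fix xs show "pull p \<delta> \<tau> (g \<otimes>\<^bsub>singular_cochain_group mtopology G p\<^esub> h) xs =
    (\<lambda>xs\<in>point_tuples XK p. pull p \<delta> \<tau> g xs \<otimes> pull p \<delta> \<tau> h xs) xs"
  proof (cases "xs \<in> point_tuples XK p \<and> xs \<in> small_tuples \<delta>")
    case True
    then have "singular_chain p mtopology (\<tau> xs)"
      using apx_chain assms(3) by (simp add: point_tuples_def)
    with True show ?thesis by (simp add: pull_def mult_singular_cochains)
  qed (auto simp: pull_def)
qed

lemma pull_coboundary:
  assumes g: "g \<in> C p" "g \<in> coboundaries (singular_cochain_group mtopology G) (singular_coboundary mtopology) p"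
    and p: "p \<le> N"
  shows "\<exists>u. AS.cobounds p (pull p \<delta> \<tau> g) u"
proof (cases p)
  case 0
  have "AS.cobounds p (pull p \<delta> \<tau> g) (\<lambda>_. \<one>)"
    unfolding cobounds_iff
  proof (intro conjI exI[of _ \<delta>] ballI impI)
    fix xs assume xs: "xs \<in> small_tuples \<delta>" "length xs = Suc p"
    then show "pull p \<delta> \<tau> g xs = ev G (\<lambda>_. \<one>) (tuple_boundary xs)"
      using g apx_chain[OF xs p] unfolding 0 pull_small[OF xs[unfolded 0]]
      by (simp add: sing.coboundaries_0_iff ev_trivial)
  qed (rule refl apx_pos)+
  then show ?thesis by blast
next
  case (Suc q)
  obtain h where h: "h \<in> C q" "\<And>c. singular_chain p mtopology c \<Longrightarrow> g c = h (chain_boundary p c)"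
    using g unfolding Suc by (auto simp: sing.coboundaries_Suc_iff)
  have "AS.cobounds p (pull p \<delta> \<tau> g) (pull q \<delta> \<tau> h)"
    unfolding cobounds_iff
  proof (intro conjI exI[of _ \<delta>] ballI impI)
    fix xs assume xs: "xs \<in> small_tuples \<delta>" "length xs = Suc p"
    have "pull p \<delta> \<tau> g xs = h (chain_boundary p (\<tau> xs))"
      using h(2)[OF apx_chain[OF xs p]] by (simp add: pull_small[OF xs])
    also have "\<dots> = h (frag_extend \<tau> (tuple_boundary xs))"
      using apx_boundary[of xs q] xs p Suc by simp
    also have "\<dots> = ev G (pull q \<delta> \<tau> h) (tuple_boundary xs)"
      using keys_boundary_small_tuples[OF xs] p Suc by (intro ev_pull[OF h(1), symmetric]) auto
    finally show "pull p \<delta> \<tau> g xs = ev G (pull q \<delta> \<tau> h) (tuple_boundary xs)" .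
  qed (use Suc apx_pos in auto)
  then show ?thesis by blast
qed

text \<open>On chains near \<open>K\<close> the cocycle \<open>g\<close> agrees, up to the homotopy
  \<open>L\<close>, with its values on \<open>\<tau>\<close> of the vertex tuples, where it is the
  coboundary of \<open>u\<close>. The retraction onto such chains carries the primitive over to all
  chains.\<close>

lemma pull_injective:
  assumes g: "g \<in> sing.complex.cocycles p" and u: "AS.cobounds p (pull p \<delta> \<tau> g) u" and p: "p \<le> N"
  shows "g \<in> coboundaries (singular_cochain_group mtopology G) (singular_coboundary mtopology) p"
proof -
  have gC: "g \<in> C p" and gcyc: "\<And>c. singular_chain (Suc p) mtopology c \<Longrightarrow> g (chain_boundary (Suc p) c) = \<one>"
    using g by (simp_all add: sing.cocycles_iff)
  obtain \<eta>0 where \<eta>0: "\<eta>0 > 0" "\<And>xs. xs \<in> small_tuples \<eta>0 \<Longrightarrow> length xs = Suc p \<Longrightarrow>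
      pull p \<delta> \<tau> g xs = ev G u (tuple_boundary xs)" and u0: "p = 0 \<Longrightarrow> u [] = \<one>"
    using u unfolding cobounds_iff by blast
  \<comment> \<open>Vertex tuples of simplices in \<open>near e\<close> have diameter below
    \<open>4 * e\<close>, which is to exceed neither \<eta>0 nor \<delta>.\<close>
  define e where "e = min \<eta>0 \<delta> / 4"
  have e: "e > 0" "4 * e \<le> \<eta>0" "4 * e \<le> \<delta>" "e \<le> \<delta>/4" using \<eta>0(1) apx_pos by (auto simp: e_def)
  obtain \<eta> E R where ret: "retracts e \<eta> E R"
    using retracts_exist[OF good e(1)] by blast
  note E = retractsD(3)[OF ret] and R_diff = retractsD(4)[OF ret] and R_chain = retractsD(5)[OF ret]
    and R = retractsD(7)[OF ret]
  have E': "\<And>p. E p \<subseteq> near (\<delta>/4) p"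
    using E near_mono[OF e(4)] by blast
  define \<rho> where "\<rho> p c = c - chain_boundary (Suc p) (R p c) - R (p - 1) (chain_boundary p c)" for p c
  have R0: "R p 0 = 0" for p using R_diff[of p 0 0] by simp
  have \<theta>: "pull p \<delta> \<tau> g xs = ev G u (tuple_boundary xs)" "xs \<in> small_tuples \<delta>"
    if "f \<in> E p" "xs = vtuple p f" for f xs
  proof -
    have "xs \<in> small_tuples (4 * e)" using that vtuple_small E by blast
    then have "xs \<in> small_tuples \<eta>0" "xs \<in> small_tuples \<delta>"
      using small_tuples_mono[OF e(2)] small_tuples_mono[OF e(3)] by blast+
    then show "pull p \<delta> \<tau> g xs = ev G u (tuple_boundary xs)" "xs \<in> small_tuples \<delta>"
      using \<eta>0(2) that(2) by simp_all
  qed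
  have small: "g c = ev G (\<lambda>f. ev G u (tuple_boundary (vtuple p f))) c \<otimes> inv g (frag_extend (L (p - 1)) (chain_boundary p c))"
    if c: "Poly_Mapping.keys c \<subseteq> E p" and Lc: "singular_chain p mtopology (frag_extend (L (p - 1)) (chain_boundary p c))" for c
  proof -
    have cn: "Poly_Mapping.keys c \<subseteq> near (\<delta>/4) p" using c E' by blast
    have Lch: "singular_chain (Suc p) mtopology (frag_extend (L p) c)"
      by (rule apx_L_extend[OF cn p])
    have sc: "singular_chain p mtopology c" using near_chain[OF cn] .
    have ts: "singular_chain p mtopology (\<tau> (vtuple p f))" if "f \<in> Poly_Mapping.keys c" for f
      using \<theta>(2)[of f "vtuple p f"] that c p by (intro apx_chain) auto
    have "g (frag_extend (\<lambda>f. \<tau> (vtuple p f)) c) = ev G (\<lambda>f. g (\<tau> (vtuple p f))) c"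
      by (rule sing.cochain_extend[OF gC ts])
    also have "\<dots> = ev G (\<lambda>f. ev G u (tuple_boundary (vtuple p f))) c"
    proof (rule ev_cong)
      fix f assume "f \<in> Poly_Mapping.keys c"
      then have "f \<in> E p" using c by blast
      from \<theta>[OF this refl] show "trunc G (g (\<tau> (vtuple p f))) = trunc G (ev G u (tuple_boundary (vtuple p f)))"
        by (simp add: pull_small)
    qed
    finally have 1: "g (frag_extend (\<lambda>f. \<tau> (vtuple p f)) c) = ev G (\<lambda>f. ev G u (tuple_boundary (vtuple p f))) c" .
    have "g (frag_extend (\<lambda>f. \<tau> (vtuple p f)) c) =
        g c \<otimes> g (frag_extend (L (p - 1)) (chain_boundary p c))"
      unfolding apx_L[OF cn p]
      using sing.cochain_add[OF gC] sc Lc Lch gcyc[OF Lch] sing.cochain_closed[OF gC sc]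
      by (simp add: singular_chain_add singular_chain_boundary_alt)
    then show ?thesis
      using 1 sing.cochain_closed[OF gC sc] sing.cochain_closed[OF gC Lc] by (simp add: m_assoc)
  qed
  show ?thesis
  proof (cases p)
    case 0
    have "g c = \<one>" if c: "singular_chain 0 mtopology c" for c
    proof -
      have \<rho>E: "Poly_Mapping.keys (\<rho> p c) \<subseteq> E p" using R[of p c] c by (simp add: \<rho>_def 0)
      have s\<rho>: "singular_chain p mtopology (\<rho> p c)"
        using near_chain[OF order_trans[OF \<rho>E E]] .
      have "c = \<rho> p c + chain_boundary (Suc p) (R p c)"
        by (simp add: \<rho>_def 0 chain_boundary_def[of 0] R0)
      then have "g c = g (\<rho> p c + chain_boundary (Suc p) (R p c))"
        by simp
      also have "\<dots> = g (\<rho> p c) \<otimes> g (chain_boundary (Suc p) (R p c))"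
        by (rule sing.cochain_add[OF gC s\<rho>]) (use R_chain[of p c] c 0 in \<open>simp add: singular_chain_boundary_alt\<close>)
      also have "\<dots> = g (\<rho> p c)"
        using gcyc[OF R_chain[of p c]] c 0 sing.cochain_closed[OF gC s\<rho>] by simp
      also have "\<dots> = ev G (\<lambda>f. ev G u (tuple_boundary (vtuple p f))) (\<rho> p c)"
        using small[OF \<rho>E] by (simp add: 0 chain_boundary_def[of 0] sing.cochain_0[OF gC[unfolded 0]])
      also have "\<dots> = \<one>"
      proof (rule ev_trivial)
        fix f
        have "vtuple 0 f = [hd (vtuple 0 f)]"
          by (simp add: vtuple_def simplex_vertices_def)
        then have "tuple_boundary (vtuple p f) = frag_of []"
          using tuple_boundary_Cons[of "hd (vtuple 0 f)" "[]"] by (simp add: 0 tuple_cone_def)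
        then show "trunc G (ev G u (tuple_boundary (vtuple p f))) = \<one>"
          by (simp add: u0 0)
      qed
      finally show ?thesis .
    qed
    then show ?thesis
      using gC by (simp add: 0 sing.coboundaries_0_iff)
  next
    case (Suc q)
    have \<rho>E: "Poly_Mapping.keys (\<rho> n c) \<subseteq> E n" if "singular_chain n mtopology c" for n c
      using R[OF that] by (simp add: \<rho>_def)
    have \<rho>n: "Poly_Mapping.keys (\<rho> n c) \<subseteq> near (\<delta>/4) n" if "singular_chain n mtopology c" for n c
      using \<rho>E[OF that] E' by blast
    have R_add: "R n (a + b) = R n a + R n b" for n a b
      using R_diff[of n "a + b" b] by simp
    have \<rho>_add: "\<rho> n (a + b) = \<rho> n a + \<rho> n b" for n a b
      by (simp add: \<rho>_def R_add chain_boundary_add)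
    \<comment> \<open>The primitive, read off from
      \<open>c = \<rho> c + \<partial> R c + R \<partial> c\<close>, where \<open>g\<close> kills
      the middle term. With \<open>b\<close> the boundary of \<open>c\<close>, the first two factors
      come from the retracted chain and the last one is the term with \<open>R\<close>.\<close>
    let ?v = "\<lambda>b. ev G u (frag_extend (\<lambda>f. frag_of (vtuple q f)) (\<rho> q b)) \<otimes>
        (inv g (frag_extend (L q) (\<rho> q b)) \<otimes> g (R q b))"
    have Lq: "singular_chain p mtopology (frag_extend (L q) (\<rho> q b))" if "singular_chain q mtopology b" for b
      using apx_L_extend[OF \<rho>n[OF that]] p Suc by simp
    have Rq: "singular_chain p mtopology (R q b)" if "singular_chain q mtopology b" for b
      using R_chain[OF that] Suc by simp
    note closed = sing.cochain_closed[OF gC Lq] sing.cochain_closed[OF gC Rq]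
    have "(\<lambda>c\<in>singular_chain_set q mtopology. ?v c) \<in> C q"
    proof (rule singular_cochain_restrict)
      fix a b assume ab: "singular_chain q mtopology a" "singular_chain q mtopology b"
      show "?v (a + b) = ?v a \<otimes> ?v b"
        using closed[OF ab(1)] closed[OF ab(2)] Lq[OF ab(1)] Lq[OF ab(2)] Rq[OF ab(1)] Rq[OF ab(2)]
        by (simp add: \<rho>_add R_add frag_extend_add ev_add sing.cochain_add[OF gC] inv_mult m_ac)
    qed (use closed in simp)
    moreover have "g c = ?v (chain_boundary p c)" if c: "singular_chain p mtopology c" for c
    proof -
      let ?b = "chain_boundary p c"
      have b: "singular_chain q mtopology ?b" "chain_boundary q ?b = 0"
        using singular_chain_boundary_alt[of q mtopology c] chain_boundary_boundary_alt[of q mtopology c] c Suc by auto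
      have \<rho>b: "\<rho> q ?b = chain_boundary p (\<rho> p c)"
        using chain_boundary_boundary_alt[of p mtopology "R p c"] R_chain[OF c] Suc b
        by (simp add: \<rho>_def R0 chain_boundary_diff)
      have Lb: "frag_extend (L (p - 1)) (chain_boundary p (\<rho> p c)) = frag_extend (L q) (\<rho> q ?b)"
        unfolding \<rho>b by (simp add: Suc)
      have sr: "singular_chain p mtopology (\<rho> p c)" using near_chain[OF \<rho>n[OF c]] .
      have "c = \<rho> p c + (chain_boundary (Suc p) (R p c) + R q ?b)"
        by (simp add: \<rho>_def Suc)
      then have "g c = g (\<rho> p c + (chain_boundary (Suc p) (R p c) + R q ?b))"
        by simp
      also have "\<dots> = g (\<rho> p c) \<otimes> g (R q ?b)"
        using sr R_chain[OF c] Rq[OF b(1)] closed(2)[OF b(1)]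
        by (simp add: sing.cochain_add[OF gC] singular_chain_add singular_chain_boundary_alt gcyc)
      also have "g (\<rho> p c) = ev G (\<lambda>f. ev G u (tuple_boundary (vtuple p f))) (\<rho> p c) \<otimes>
          inv g (frag_extend (L q) (\<rho> q ?b))"
        using small[OF \<rho>E[OF c]] Lq[OF b(1)] unfolding Lb by blast
      also have "ev G (\<lambda>f. ev G u (tuple_boundary (vtuple p f))) (\<rho> p c) =
          ev G u (frag_extend (\<lambda>f. frag_of (vtuple q f)) (\<rho> q ?b))"
        unfolding ev_extend[symmetric] \<rho>b chain_boundary_extend[of p "\<rho> p c"]
        by (simp add: frag_extend_frag_extend vtuple_boundary Suc)
      finally show ?thesis
        using closed[OF b(1)] by (simp add: m_assoc)
    qed
    ultimately show ?thesis
      using gC unfolding Suc sing.coboundaries_Suc_iff[OF gC[unfolded Suc]]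
      by (intro bexI[of _ "\<lambda>c\<in>singular_chain_set q mtopology. ?v c"])
        (auto simp: singular_chain_boundary_alt Suc)
  qed
qed

end

text \<open>The preimage evaluates \<open>f\<close> on the vertex tuples of the retracted chain. Its
  pullback along \<open>\<tau>\<close> is not visibly \<open>f\<close>, as the retraction need not
  fix the chains \<open>\<tau> xs\<close>. It does fix those of a finer realisation
  \<open>\<tau>2\<close>, and \<open>\<tau>\<close> applied to the vertex tuples of
  \<open>\<tau>2 xs\<close> is homotopic both to \<open>\<tau>2 xs\<close>, through
  \<open>L\<close>, and to \<open>\<tau> xs\<close>, through \<open>T2\<close>.\<close>

lemma pull_surjective:
  assumes apx: "approximation (Suc p) \<epsilon> \<delta> \<tau> L T" and f: "f \<in> AS.AS_cocycles p"
  shows "\<exists>g\<in>sing.complex.cocycles p. AS.AS_class p (pull p \<delta> \<tau> g) = AS.AS_class p f"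
proof -
  have fc: "f \<in> point_tuples XK p \<rightarrow>\<^sub>E carrier G" using f by (simp add: AS_cocycles_iff)
  obtain \<eta>0 where \<eta>0: "\<eta>0 > 0" and f_cyc: "\<And>xs. xs \<in> small_tuples \<eta>0 \<Longrightarrow> length xs = Suc (Suc p) \<Longrightarrow>
      ev G f (tuple_boundary xs) = \<one>"
    using f unfolding AS_cocycles_iff by blast
  have "\<eta>0/4 > 0" using \<eta>0 by simp
  then obtain \<eta>1 E R where ret: "retracts (\<eta>0/4) \<eta>1 E R"
    using retracts_exist[OF good] by blast
  note E = retractsD(3)[OF ret] and R_diff = retractsD(4)[OF ret] and R_chain = retractsD(5)[OF ret]
  define \<rho> where "\<rho> p c = c - chain_boundary (Suc p) (R p c) - R (p - 1) (chain_boundary p c)" for p c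
  let ?\<theta> = "\<lambda>p. frag_extend (\<lambda>h. frag_of (vtuple p h))"
  have R0: "R n 0 = 0" for n using R_diff[of n 0 0] by simp
  have R_add: "R n (a + b) = R n a + R n b" for n a b
    using R_diff[of n "a + b" b] by simp
  have \<rho>_add: "\<rho> n (a + b) = \<rho> n a + \<rho> n b" for n a b
    by (simp add: \<rho>_def R_add chain_boundary_add)
  have \<rho>E: "Poly_Mapping.keys (\<rho> n c) \<subseteq> E n" if "singular_chain n mtopology c" for n c
    using retractsD(7)[OF ret that] by (simp add: \<rho>_def)
  have \<rho>_boundary: "\<rho> n (chain_boundary (Suc n) c) = chain_boundary (Suc n) (\<rho> (Suc n) c)"
    if c: "singular_chain (Suc n) mtopology c" for n c
  proof -
    have "chain_boundary n (chain_boundary (Suc n) c) = 0"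
      "chain_boundary (Suc n) (chain_boundary (Suc (Suc n)) (R (Suc n) c)) = 0"
      using chain_boundary_boundary_alt[OF c] chain_boundary_boundary_alt[OF R_chain[OF c]] by auto
    then show ?thesis
      by (simp add: \<rho>_def R0 chain_boundary_diff)
  qed
  have \<rho>_near: "\<rho> n c = c" if c: "Poly_Mapping.keys c \<subseteq> near \<eta>1 n" for n c
  proof -
    have "R n c = 0"
      using retractsD(6)[OF ret order_trans[OF c retractsD(2)[OF ret]]] .
    moreover have "R (n - 1) (chain_boundary n c) = 0"
    proof (cases n)
      case 0
      then show ?thesis by (simp add: chain_boundary_def R0)
    next
      case (Suc m)
      have "Poly_Mapping.keys (frag_extend (\<lambda>h. chain_boundary (Suc m) (frag_of h)) c) \<subseteq> near \<eta>1 m"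
        by (rule keys_frag_extend_subset) (use near_boundary c Suc in blast)
      then have "Poly_Mapping.keys (chain_boundary n c) \<subseteq> near \<eta>1 m"
        using chain_boundary_extend[of n c] Suc by simp
      then show ?thesis
        using retractsD(6)[OF ret order_trans[OF _ retractsD(2)[OF ret]]] Suc by simp
    qed
    ultimately show ?thesis by (simp add: \<rho>_def)
  qed
  define g where "g = (\<lambda>c\<in>singular_chain_set p mtopology. ev G f (?\<theta> p (\<rho> p c)))"
  have gC: "g \<in> C p"
    unfolding g_def by (rule singular_cochain_restrict) (simp_all add: \<rho>_add frag_extend_add ev_add)
  have gcyc: "g (chain_boundary (Suc p) c) = \<one>" if c: "singular_chain (Suc p) mtopology c" for c
  proof -
    let ?e = "\<rho> (Suc p) c"
    have "g (chain_boundary (Suc p) c) = ev G f (?\<theta> p (chain_boundary (Suc p) ?e))"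
      using singular_chain_boundary_alt[OF c] by (simp add: g_def \<rho>_boundary[OF c])
    also have "\<dots> = ev G (\<lambda>h. ev G f (tuple_boundary (vtuple (Suc p) h))) ?e"
      unfolding chain_boundary_extend[of "Suc p" ?e]
      by (simp add: frag_extend_frag_extend vtuple_boundary ev_extend)
    also have "\<dots> = \<one>"
    proof (rule ev_trivial)
      fix h assume "h \<in> Poly_Mapping.keys ?e"
      then have "h \<in> near (\<eta>0/4) (Suc p)" using \<rho>E[OF c] E by blast
      from vtuple_small[OF this] show "trunc G (ev G f (tuple_boundary (vtuple (Suc p) h))) = \<one>"
        by (simp add: f_cyc)
    qed
    finally show ?thesis .
  qed
  have g: "g \<in> sing.complex.cocycles p"
    using gC gcyc by (simp add: sing.cocycles_iff)
  have \<delta>: "\<delta> > 0" using apx_pos[OF apx] by simp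
  \<comment> \<open>The four bounds ensure, in this order, that \<open>\<rho>\<close> fixes the
    chains \<open>\<tau>2 xs\<close>, that \<open>L\<close> is under control on them, that
    \<open>f\<close> is a cocycle on the tuples in \<open>T2 xs\<close>, and that
    \<open>\<tau>\<close> is under control on these tuples.\<close>
  define \<epsilon>2 where "\<epsilon>2 = min (min \<eta>1 (\<delta>/4)) (min (\<eta>0/5) (\<delta>/5))"
  have \<epsilon>2: "\<epsilon>2 > 0" "\<epsilon>2 \<le> \<eta>1" "\<epsilon>2 \<le> \<delta>/4" "5 * \<epsilon>2 \<le> \<eta>0" "5 * \<epsilon>2 \<le> \<delta>"
    using \<eta>0 \<delta> retractsD(1)[OF ret] by (auto simp: \<epsilon>2_def)
  obtain \<delta>2 \<tau>2 L2 T2 where apx2: "approximation (Suc p) \<epsilon>2 \<delta>2 \<tau>2 L2 T2"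
    using approximation_exists[OF \<epsilon>2(1)] by blast
  note \<delta>2 = apx_pos[OF apx2]
  have T2_keys: "Poly_Mapping.keys (T2 xs) \<subseteq> {ys \<in> small_tuples \<delta>. length ys = Suc (Suc n)}"
    "Poly_Mapping.keys (T2 xs) \<subseteq> {ys \<in> small_tuples \<eta>0. length ys = Suc (Suc n)}"
    if "xs \<in> small_tuples \<delta>2" "length xs = Suc n" "n \<le> Suc p" for xs n
    using apx_T(1)[OF apx2 that] small_tuples_mono[OF \<epsilon>2(4)] small_tuples_mono[OF \<epsilon>2(5)] by blast+
  have \<tau>2_near: "Poly_Mapping.keys (\<tau>2 xs) \<subseteq> near \<eta>1 n" "Poly_Mapping.keys (\<tau>2 xs) \<subseteq> near (\<delta>/4) n"
    if "xs \<in> small_tuples \<delta>2" "length xs = Suc n" "n \<le> Suc p" for xs n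
    using apx_near[OF apx2 that] near_mono[OF \<epsilon>2(2)] near_mono[OF \<epsilon>2(3)] by blast+
  \<comment> \<open>\<open>g\<close> is applied to both homotopies. Being a cocycle it ignores the
    boundaries, and the terms that remain depend on the boundary of \<open>xs\<close> only; they
    become the coboundary of \<open>u\<close> below.\<close>
  have key: "g (\<tau> xs) = f xs \<otimes> ev G f (frag_extend T2 (tuple_boundary xs)) \<otimes>
      g (frag_extend (L (p - 1)) (chain_boundary p (\<tau>2 xs)) - frag_extend \<tau> (frag_extend T2 (tuple_boundary xs)))"
    if xs: "xs \<in> small_tuples \<delta>2" "length xs = Suc p"
      and A: "singular_chain p mtopology (frag_extend (L (p - 1)) (chain_boundary p (\<tau>2 xs)))"
      and B: "singular_chain p mtopology (frag_extend \<tau> (frag_extend T2 (tuple_boundary xs)))" for xs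
  proof -
    let ?A = "frag_extend (L (p - 1)) (chain_boundary p (\<tau>2 xs))"
      and ?B = "frag_extend \<tau> (frag_extend T2 (tuple_boundary xs))"
    have p: "p \<le> Suc p" by simp
    note T2 = T2_keys[OF xs p] and T2b = apx_T(2)[OF apx2 xs p]
    note near = \<tau>2_near[OF xs p]
    have xs\<delta>: "xs \<in> small_tuples \<delta>"
      using xs(1) small_tuples_mono[of \<delta>2 \<delta>] \<delta>2 \<epsilon>2 \<delta> by auto
    have s\<tau>2: "singular_chain p mtopology (\<tau>2 xs)" by (rule near_chain[OF near(1)])
    have s\<tau>: "singular_chain p mtopology (\<tau> xs)" by (rule apx_chain[OF apx xs\<delta> xs(2) p])
    have sL: "singular_chain (Suc p) mtopology (frag_extend (L p) (\<tau>2 xs))"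
      by (rule apx_L_extend[OF apx near(2) p])
    have sT: "singular_chain (Suc p) mtopology (frag_extend \<tau> (T2 xs))"
      by (rule apx_extend_chain[OF apx T2(1)]) simp
    note bd = singular_chain_boundary_alt[OF sL] singular_chain_boundary_alt[OF sT]
    have "frag_extend \<tau> (?\<theta> p (\<tau>2 xs)) = \<tau>2 xs + chain_boundary (Suc p) (frag_extend (L p) (\<tau>2 xs)) + ?A"
      using apx_L[OF apx near(2) p] by (simp add: frag_extend_frag_extend)
    moreover have "frag_extend \<tau> (?\<theta> p (\<tau>2 xs)) = \<tau> xs + chain_boundary (Suc p) (frag_extend \<tau> (T2 xs)) + ?B"
      unfolding T2b using apx_extend_boundary[OF apx T2(1)] by (simp add: frag_extend_add)
    ultimately have "\<tau> xs + chain_boundary (Suc p) (frag_extend \<tau> (T2 xs)) =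
        \<tau>2 xs + chain_boundary (Suc p) (frag_extend (L p) (\<tau>2 xs)) + (?A - ?B)"
      by (simp add: algebra_simps)
    then have "g (\<tau> xs + chain_boundary (Suc p) (frag_extend \<tau> (T2 xs))) =
        g (\<tau>2 xs + chain_boundary (Suc p) (frag_extend (L p) (\<tau>2 xs)) + (?A - ?B))"
      by simp
    then have 1: "g (\<tau> xs) = g (\<tau>2 xs) \<otimes> g (?A - ?B)"
      using s\<tau> s\<tau>2 bd A B sing.cochain_closed[OF gC s\<tau>] sing.cochain_closed[OF gC s\<tau>2]
      by (simp add: sing.cochain_add[OF gC] singular_chain_add singular_chain_diff gcyc[OF sL] gcyc[OF sT])
    have "g (\<tau>2 xs) = ev G f (?\<theta> p (\<tau>2 xs))"
      using s\<tau>2 \<rho>_near[OF near(1)] by (simp add: g_def)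
    also have "\<dots> = f xs \<otimes> ev G f (frag_extend tuple_boundary (T2 xs)) \<otimes> ev G f (frag_extend T2 (tuple_boundary xs))"
      unfolding T2b using PiE_mem[OF fc small_tuple_point_tuple[OF xs]] by (simp add: ev_add)
    also have "ev G f (frag_extend tuple_boundary (T2 xs)) = \<one>"
      unfolding ev_extend
    proof (rule ev_trivial)
      fix ys assume "ys \<in> Poly_Mapping.keys (T2 xs)"
      then have "ys \<in> small_tuples \<eta>0" "length ys = Suc (Suc p)" using T2(2) by blast+
      then show "trunc G (ev G f (tuple_boundary ys)) = \<one>" by (simp add: f_cyc)
    qed
    finally show ?thesis
      using 1 PiE_mem[OF fc small_tuple_point_tuple[OF xs]] by simp
  qed
  have "AS.AS_class p (pull p \<delta> \<tau> g) = AS.AS_class p f"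
  proof (rule AS.AS_class_eqI[OF pull_cocycle[OF apx g] f])
    let ?c = "\<lambda>ys. frag_extend (L (p - 1)) (\<tau>2 ys) - frag_extend \<tau> (T2 ys)"
    \<comment> \<open>In degree 0 the boundary of \<open>xs\<close> is the empty tuple, where
      \<open>T2\<close> vanishes, and no correction remains; in higher degrees \<open>u\<close>
      collects the remaining terms of \<open>key\<close>.\<close>
    define u where "u = (if p = 0 then (\<lambda>_. \<one>) else (\<lambda>ys. ev G f (T2 ys) \<otimes> g (?c ys)))"
    show "u [] = \<one>" if "p = 0" using that by (simp add: u_def)
    have "pull p \<delta> \<tau> g xs = f xs \<otimes> ev G u (tuple_boundary xs)"
      if xs: "xs \<in> small_tuples \<delta>2" "length xs = Suc p" for xs
    proof -
      have xs\<delta>: "xs \<in> small_tuples \<delta>"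
        using xs(1) small_tuples_mono[of \<delta>2 \<delta>] \<delta>2 \<epsilon>2 \<delta> by auto
      have fx: "f xs \<in> carrier G"
        using PiE_mem[OF fc small_tuple_point_tuple[OF xs]] .
      show ?thesis
      proof (cases p)
        case 0
        then obtain x where x: "xs = [x]" using xs by (auto simp: length_Suc_conv)
        have tb: "tuple_boundary xs = frag_of []" by (simp add: x tuple_boundary_Cons tuple_cone_def)
        have T20: "T2 [] = 0" using apx2 by (simp add: approximation_def)
        have "g (\<tau> xs) = f xs"
          using key[OF xs] fx sing.cochain_0[OF gC] by (simp add: 0 tb T20 chain_boundary_def)
        then show ?thesis
          using fx by (simp add: pull_small[OF xs\<delta> xs(2)] tb) (simp add: u_def 0)
      next
        case (Suc q)
        note kb = keys_boundary_small_tuples[OF xs]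
        have ys: "singular_chain p mtopology (frag_extend (L (p - 1)) (\<tau>2 ys))"
          "singular_chain p mtopology (frag_extend \<tau> (T2 ys))"
          if "ys \<in> Poly_Mapping.keys (tuple_boundary xs)" for ys
        proof -
          have y: "ys \<in> small_tuples \<delta>2" "length ys = Suc q" using kb that Suc by blast+
          show "singular_chain p mtopology (frag_extend (L (p - 1)) (\<tau>2 ys))"
            using apx_L_extend[OF apx \<tau>2_near(2)[OF y]] Suc by simp
          show "singular_chain p mtopology (frag_extend \<tau> (T2 ys))"
            using apx_extend_chain[OF apx T2_keys(1)[OF y]] Suc by simp
        qed
        have eqA: "frag_extend (L (p - 1)) (chain_boundary p (\<tau>2 xs)) =
            frag_extend (\<lambda>ys. frag_extend (L (p - 1)) (\<tau>2 ys)) (tuple_boundary xs)"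
          using apx_boundary[OF apx2 xs(1), of q] xs(2) Suc by (simp add: frag_extend_frag_extend)
        have eqB: "frag_extend \<tau> (frag_extend T2 (tuple_boundary xs)) =
            frag_extend (\<lambda>ys. frag_extend \<tau> (T2 ys)) (tuple_boundary xs)"
          by (rule frag_extend_frag_extend)
        have A: "singular_chain p mtopology (frag_extend (L (p - 1)) (chain_boundary p (\<tau>2 xs)))"
          unfolding eqA by (rule singular_chain_extend[OF ys(1)])
        have B: "singular_chain p mtopology (frag_extend \<tau> (frag_extend T2 (tuple_boundary xs)))"
          unfolding eqB by (rule singular_chain_extend[OF ys(2)])
        have cc: "singular_chain p mtopology (?c ys)" if "ys \<in> Poly_Mapping.keys (tuple_boundary xs)" for ys
          by (rule singular_chain_diff[OF ys[OF that]])
        have "g (frag_extend (L (p - 1)) (chain_boundary p (\<tau>2 xs)) - frag_extend \<tau> (frag_extend T2 (tuple_boundary xs)))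
            = g (frag_extend ?c (tuple_boundary xs))"
          unfolding eqA eqB by (simp add: frag_extend_fun_diff)
        also have "\<dots> = ev G (\<lambda>ys. g (?c ys)) (tuple_boundary xs)"
          by (rule sing.cochain_extend[OF gC cc])
        finally have gAB: "g (frag_extend (L (p - 1)) (chain_boundary p (\<tau>2 xs)) -
            frag_extend \<tau> (frag_extend T2 (tuple_boundary xs))) = ev G (\<lambda>ys. g (?c ys)) (tuple_boundary xs)" .
        have "ev G u (tuple_boundary xs) = ev G (\<lambda>ys. ev G f (T2 ys) \<otimes> g (?c ys)) (tuple_boundary xs)"
          by (simp add: u_def Suc)
        also have "\<dots> = ev G (\<lambda>ys. ev G f (T2 ys)) (tuple_boundary xs) \<otimes> ev G (\<lambda>ys. g (?c ys)) (tuple_boundary xs)"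
          by (rule ev_mult) (use sing.cochain_closed[OF gC cc] in simp)
        finally have "ev G u (tuple_boundary xs) = ev G f (frag_extend T2 (tuple_boundary xs)) \<otimes>
            ev G (\<lambda>ys. g (?c ys)) (tuple_boundary xs)"
          by (simp add: ev_extend)
        then show ?thesis
          using key[OF xs A B, unfolded gAB] fx by (simp add: pull_small[OF xs\<delta> xs(2)] m_assoc)
      qed
    qed
    then show "\<exists>\<U>. open_cover XK \<U> \<and> (\<forall>U\<in>\<U>. \<forall>xs\<in>point_tuples XK p. set xs \<subseteq> U \<longrightarrow>
       pull p \<delta> \<tau> g xs = f xs \<otimes> ev G u (tuple_boundary xs))"
      unfolding locally_iff_small_tuples using \<delta>2(1) by blast
  qed simp
  with g show ?thesis by blast
qed

theorem singular_iso_AS: "singular_cohomology_group p mtopology G \<cong> AS_cohomology_group p XK G"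
proof -
  \<comment> \<open>Any positive radius would do. The degree bound is \<open>Suc p\<close> because
    the cocycle condition on degree \<open>p\<close> is tested on simplices of dimension
    \<open>Suc p\<close>.\<close>
  obtain \<delta> \<tau> L T where apx: "approximation (Suc p) 1 \<delta> \<tau> L T"
    using approximation_exists[of 1 "Suc p"] zero_less_one by metis
  let ?A = "sing.complex.cocycle_group p" and ?Q = "AS_cohomology_group p XK G"
  have pull: "pull p \<delta> \<tau> \<in> hom ?A (AS.AS_cocycle_group p)"
  proof (rule homI)
    fix g assume "g \<in> carrier ?A"
    then have g: "g \<in> sing.complex.cocycles p" by simp
    then show "pull p \<delta> \<tau> g \<in> carrier (AS.AS_cocycle_group p)"
      using pull_cocycle[OF apx g] by (simp add: AS.AS_cocycles_eq)
    fix h assume "h \<in> carrier ?A"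
    then have h: "h \<in> sing.complex.cocycles p" by simp
    have "g \<in> C p" "h \<in> C p" using g h by (simp_all add: sing.cocycles_iff)
    from pull_mult[OF apx this] show "pull p \<delta> \<tau> (g \<otimes>\<^bsub>?A\<^esub> h) = pull p \<delta> \<tau> g \<otimes>\<^bsub>AS.AS_cocycle_group p\<^esub> pull p \<delta> \<tau> h"
      by simp
  qed
  have "cohomology_group (singular_cochain_group mtopology G) (singular_coboundary mtopology) p \<cong> ?Q"
  proof (rule iso_of_common_kernel)
    show "group ?A" by (rule sing.complex.group_cocycle_group)
    show "group (cohomology_group (singular_cochain_group mtopology G) (singular_coboundary mtopology) p)"
      by (rule sing.complex.group_cohomology)
    show "group ?Q" by (rule AS.group_AS)
    show "sing.complex.cls p \<in> hom ?A (cohomology_group (singular_cochain_group mtopology G) (singular_coboundary mtopology) p)"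
      by (rule sing.complex.cls_hom)
    show "sing.complex.cls p ` carrier ?A = carrier (cohomology_group (singular_cochain_group mtopology G) (singular_coboundary mtopology) p)"
      by (simp add: sing.complex.cls_surj)
    show "AS.AS_class p \<circ> pull p \<delta> \<tau> \<in> hom ?A ?Q"
      by (rule Group.hom_compose[OF pull AS.AS_class_hom])
    show "(AS.AS_class p \<circ> pull p \<delta> \<tau>) ` carrier ?A = carrier ?Q"
    proof
      show "(AS.AS_class p \<circ> pull p \<delta> \<tau>) ` carrier ?A \<subseteq> carrier ?Q"
        using hom_in_carrier[OF Group.hom_compose[OF pull AS.AS_class_hom]] by blast
      show "carrier ?Q \<subseteq> (AS.AS_class p \<circ> pull p \<delta> \<tau>) ` carrier ?A"
      proof
        fix x assume "x \<in> carrier ?Q"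
        then obtain f where f: "f \<in> AS.AS_cocycles p" "x = AS.AS_class p f"
          unfolding AS.AS_class_surj[symmetric] by blast
        then obtain g where "g \<in> sing.complex.cocycles p" "AS.AS_class p (pull p \<delta> \<tau> g) = x"
          using pull_surjective[OF apx] by blast
        then show "x \<in> (AS.AS_class p \<circ> pull p \<delta> \<tau>) ` carrier ?A" by auto
      qed
    qed
    fix g assume "g \<in> carrier ?A"
    then have g: "g \<in> sing.complex.cocycles p" by simp
    then have gC: "g \<in> C p" by (simp add: sing.cocycles_iff)
    have "(\<exists>u. AS.cobounds p (pull p \<delta> \<tau> g) u) \<longleftrightarrow>
        g \<in> coboundaries (singular_cochain_group mtopology G) (singular_coboundary mtopology) p"
      using pull_injective[OF apx g] pull_coboundary[OF apx gC] by auto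
    then show "sing.complex.cls p g = \<one>\<^bsub>cohomology_group (singular_cochain_group mtopology G) (singular_coboundary mtopology) p\<^esub> \<longleftrightarrow>
        (AS.AS_class p \<circ> pull p \<delta> \<tau>) g = \<one>\<^bsub>?Q\<^esub>"
      using AS.AS_class_eq_one_iff[OF pull_cocycle[OF apx g]] by (simp add: sing.complex.cls_eq_one_iff[OF g])
  qed
  then show ?thesis
    by (simp add: singular_cohomology_group_def)
qed

end

theorem metrizable_singular_iso_AS:
  assumes "metrizable_space X" "compactin X K" "HLC X" "comm_group G"
    and "\<And>U. openin X U \<Longrightarrow> K \<subseteq> U \<Longrightarrow> \<exists>U'. openin X U' \<and> K \<subseteq> U' \<and> U' \<subseteq> U \<and>
      (\<forall>p c. singular_relcycle p X U' c \<longrightarrow> singular_relboundary p X U' c)"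
  shows "singular_cohomology_group p X G \<cong> AS_cohomology_group p (subtopology X K) G"
proof -
  obtain M d where "Metric_space M d" and X: "X = Metric_space.mtopology M d"
    using assms(1) by (auto simp: metrizable_space_def)
  then interpret AS_comparison M d K G
    by (intro AS_comparison.intro HLC_pair.intro compact_in_metric.intro compact_in_metric_axioms.intro
        HLC_pair_axioms.intro AS_comparison_axioms.intro) (use assms in \<open>auto simp: X\<close>)
  show ?thesis
    unfolding X by (rule singular_iso_AS)
qed

section \<open>Direct limits and Cech cohomology\<close>

locale direct_system =
  fixes I :: "'i set" and R :: "'i \<Rightarrow> 'i \<Rightarrow> bool" and D :: "'i \<Rightarrow> ('x, 'm) monoid_scheme"
    and f :: "'i \<Rightarrow> 'i \<Rightarrow> 'x \<Rightarrow> 'x"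
  assumes trans: "\<And>i j k. i \<in> I \<Longrightarrow> j \<in> I \<Longrightarrow> k \<in> I \<Longrightarrow> R i j \<Longrightarrow> R j k \<Longrightarrow> R i k"
    and directed: "\<And>i j. i \<in> I \<Longrightarrow> j \<in> I \<Longrightarrow> \<exists>k\<in>I. R i k \<and> R j k"
    and group: "\<And>i. i \<in> I \<Longrightarrow> group (D i)"
    and hom: "\<And>i j. i \<in> I \<Longrightarrow> j \<in> I \<Longrightarrow> R i j \<Longrightarrow> f i j \<in> hom (D i) (D j)"
    and comp: "\<And>i j k x. i \<in> I \<Longrightarrow> j \<in> I \<Longrightarrow> k \<in> I \<Longrightarrow> R i j \<Longrightarrow> R j k \<Longrightarrow> x \<in> carrier (D i) \<Longrightarrow>
       f j k (f i j x) = f i k x"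
begin

abbreviation rel where "rel \<equiv> direct_limit_rel I R D f"

definition dcls where "dcls i x = rel `` {(i, x)}"

lemma closed: "i \<in> I \<Longrightarrow> j \<in> I \<Longrightarrow> R i j \<Longrightarrow> x \<in> carrier (D i) \<Longrightarrow> f i j x \<in> carrier (D j)"
  using hom hom_in_carrier by metis

text \<open>Reflexivity comes from an upper bound of \<open>i\<close> with itself, transitivity from
  a common upper bound of the two witnesses.\<close>

lemma equiv: "equiv (Sigma I (\<lambda>i. carrier (D i))) rel"
proof (rule equivI)
  show "rel \<subseteq> Sigma I (\<lambda>i. carrier (D i)) \<times> Sigma I (\<lambda>i. carrier (D i))"
    by (auto simp: direct_limit_rel_def)
  show "refl_on (Sigma I (\<lambda>i. carrier (D i))) rel"
    using directed by (fastforce simp: refl_on_def direct_limit_rel_def)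
  show "sym rel"
    by (auto simp: sym_def direct_limit_rel_def)
  show "Relation.trans rel"
  proof (rule transI)
    fix a b c assume "(a, b) \<in> rel" "(b, c) \<in> rel"
    moreover obtain i x j y l z where eq: "a = (i, x)" "b = (j, y)" "c = (l, z)"
      by (metis surj_pair)
    ultimately obtain k m where 1: "i \<in> I" "j \<in> I" "l \<in> I" "x \<in> carrier (D i)" "y \<in> carrier (D j)" "z \<in> carrier (D l)"
      and k: "k \<in> I" "R i k" "R j k" "f i k x = f j k y"
      and m: "m \<in> I" "R j m" "R l m" "f j m y = f l m z"
      by (auto simp: direct_limit_rel_def)
    obtain n where n: "n \<in> I" "R k n" "R m n"
      using directed k m by blast
    have "f i n x = f k n (f i k x)" using comp[of i k n x] 1 k n by simp
    also have "\<dots> = f j n y" using comp[of j k n y] 1 k n by simp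
    also have "\<dots> = f m n (f j m y)" using comp[of j m n y] 1 m n by simp
    also have "\<dots> = f l n z" using comp[of l m n z] 1 m n by simp
    finally have "f i n x = f l n z" .
    moreover have "R i n" "R l n" using trans 1 k m n by blast+
    ultimately show "(a, c) \<in> rel"
      using 1 n by (auto simp: direct_limit_rel_def eq)
  qed
qed

lemma dcls_eq_iff:
  assumes "i \<in> I" "x \<in> carrier (D i)" "j \<in> I" "y \<in> carrier (D j)"
  shows "dcls i x = dcls j y \<longleftrightarrow> (\<exists>k\<in>I. R i k \<and> R j k \<and> f i k x = f j k y)"
proof -
  have "dcls i x = dcls j y \<longleftrightarrow> ((i, x), (j, y)) \<in> rel"
    unfolding dcls_def using assms by (intro eq_equiv_class_iff[OF equiv]) auto
  then show ?thesis using assms by (auto simp: direct_limit_rel_def)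
qed

lemma dcls_map:
  assumes "i \<in> I" "x \<in> carrier (D i)" "j \<in> I" "R i j"
  shows "dcls j (f i j x) = dcls i x"
proof -
  obtain k where k: "k \<in> I" "R j k" using directed[of j j] assms by blast
  then have "R i k" "f j k (f i j x) = f i k x" using trans[of i j k] comp[of i j k x] assms by auto
  then show ?thesis
    using dcls_eq_iff[of j "f i j x" i x] closed assms k by blast
qed

lemma carrier_direct_limit: "carrier (direct_limit I R D f) = {dcls i x | i x. i \<in> I \<and> x \<in> carrier (D i)}"
  by (auto simp: direct_limit_def quotient_def dcls_def)

lemma rel_dcls: "(i, x) \<in> dcls j y \<Longrightarrow> i \<in> I \<and> x \<in> carrier (D i) \<and> j \<in> I \<and> y \<in> carrier (D j) \<and> dcls i x = dcls j y"
  using equiv_class_eq[OF equiv, of "(j, y)" "(i, x)"] by (auto simp: dcls_def direct_limit_rel_def)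

lemma self_in_dcls: "i \<in> I \<Longrightarrow> x \<in> carrier (D i) \<Longrightarrow> (i, x) \<in> dcls i x"
  unfolding dcls_def using equiv_class_self[OF equiv, of "(i, x)"] by auto

text \<open>The product is formed from all representatives and all common indices at once. At least
  one choice exists, and any choice gives the same class, as is seen at a sufficiently large index
  \<open>n\<close>.\<close>

lemma dcls_mult:
  assumes x: "i \<in> I" "x \<in> carrier (D i)" and y: "i \<in> I" "y \<in> carrier (D i)"
  shows "dcls i x \<otimes>\<^bsub>direct_limit I R D f\<^esub> dcls i y = dcls i (x \<otimes>\<^bsub>D i\<^esub> y)"
proof -
  have xy: "x \<otimes>\<^bsub>D i\<^esub> y \<in> carrier (D i)"
    using group[OF x(1)] x y by (simp add: group.is_monoid monoid.m_closed)
  let ?P = "{(k, f a k u \<otimes>\<^bsub>D k\<^esub> f b k v) | a u b v k.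
      (a, u) \<in> dcls i x \<and> (b, v) \<in> dcls i y \<and> k \<in> I \<and> R a k \<and> R b k}"
  have P: "dcls k w = dcls i (x \<otimes>\<^bsub>D i\<^esub> y)" if kw: "(k, w) \<in> ?P" for k w
  proof -
    obtain a u b v where w: "w = f a k u \<otimes>\<^bsub>D k\<^esub> f b k v" and "(a, u) \<in> dcls i x" "(b, v) \<in> dcls i y"
      and k: "k \<in> I" "R a k" "R b k"
      using kw by blast
    then have a: "a \<in> I" "u \<in> carrier (D a)" "dcls a u = dcls i x"
      and b: "b \<in> I" "v \<in> carrier (D b)" "dcls b v = dcls i y"
      using rel_dcls by blast+
    obtain m1 where m1: "m1 \<in> I" "R a m1" "R i m1" "f a m1 u = f i m1 x"
      using a dcls_eq_iff[of a u i x] x by blast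
    obtain m2 where m2: "m2 \<in> I" "R b m2" "R i m2" "f b m2 v = f i m2 y"
      using b dcls_eq_iff[of b v i y] y by blast
    obtain n1 where n1: "n1 \<in> I" "R m1 n1" "R m2 n1" using directed m1 m2 by blast
    obtain n where n: "n \<in> I" "R n1 n" "R k n" using directed n1 k by blast
    have Rn: "R m1 n" "R m2 n" using trans[OF m1(1) n1(1) n(1)] trans[OF m2(1) n1(1) n(1)] n1 n by auto
    have Rin: "R i n" using trans[OF x(1) m1(1) n(1)] m1 Rn by blast
    have "f a n u = f i n x"
      using comp[OF a(1) m1(1) n(1) m1(2) Rn(1) a(2)] comp[OF x(1) m1(1) n(1) m1(3) Rn(1) x(2)] m1(4) by simp
    moreover have "f b n v = f i n y"
      using comp[OF b(1) m2(1) n(1) m2(2) Rn(2) b(2)] comp[OF y(1) m2(1) n(1) m2(3) Rn(2) y(2)] m2(4) by simp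
    moreover have "f k n w = f a n u \<otimes>\<^bsub>D n\<^esub> f b n v"
      unfolding w using hom_mult[OF hom[OF k(1) n(1) n(3)]] closed a b k n
        comp[OF a(1) k(1) n(1) k(2) n(3) a(2)] comp[OF b(1) k(1) n(1) k(3) n(3) b(2)] by simp
    moreover have "f i n (x \<otimes>\<^bsub>D i\<^esub> y) = f i n x \<otimes>\<^bsub>D n\<^esub> f i n y"
      using hom_mult[OF hom[OF x(1) n(1) Rin]] x y by simp
    ultimately have "f k n w = f i n (x \<otimes>\<^bsub>D i\<^esub> y)" by simp
    moreover have "w \<in> carrier (D k)"
      unfolding w using group[OF k(1)] closed a b k by (simp add: group.is_monoid monoid.m_closed)
    ultimately show ?thesis
      using dcls_eq_iff[of k w i "x \<otimes>\<^bsub>D i\<^esub> y"] k n Rin x xy by blast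
  qed
  obtain k where k: "k \<in> I" "R i k" using directed[of i i] x by blast
  have "(k, f i k x \<otimes>\<^bsub>D k\<^esub> f i k y) \<in> ?P"
    using k self_in_dcls[OF x] self_in_dcls[OF y] by blast
  then have ne: "?P \<noteq> {}" by blast
  have "rel `` ?P = (\<Union>a\<in>?P. dcls (fst a) (snd a))"
    unfolding dcls_def prod.collapse by (rule Image_eq_UN)
  also have "\<dots> = (\<Union>_\<in>?P. dcls i (x \<otimes>\<^bsub>D i\<^esub> y))"
  proof (rule SUP_cong[OF refl])
    show "dcls (fst a) (snd a) = dcls i (x \<otimes>\<^bsub>D i\<^esub> y)" if "a \<in> ?P" for a
      using P[of "fst a" "snd a"] that unfolding prod.collapse by blast
  qed
  also have "\<dots> = dcls i (x \<otimes>\<^bsub>D i\<^esub> y)"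
    using ne by blast
  finally show ?thesis
    by (simp add: direct_limit_def)
qed

lemma dcls_one:
  assumes "i \<in> I"
  shows "\<one>\<^bsub>direct_limit I R D f\<^esub> = dcls i \<one>\<^bsub>D i\<^esub>"
proof -
  have one: "\<one>\<^bsub>D j\<^esub> \<in> carrier (D j)" if "j \<in> I" for j
    using group[OF that] by (simp add: group.is_monoid monoid.one_closed)
  have "dcls j \<one>\<^bsub>D j\<^esub> = dcls i \<one>\<^bsub>D i\<^esub>" if j: "j \<in> I" for j
  proof -
    obtain k where k: "k \<in> I" "R i k" "R j k" using directed assms j by blast
    have "f i k \<one>\<^bsub>D i\<^esub> = \<one>\<^bsub>D k\<^esub>" "f j k \<one>\<^bsub>D j\<^esub> = \<one>\<^bsub>D k\<^esub>"
      using hom_one[OF hom group group] assms j k by auto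
    then show ?thesis
      using dcls_eq_iff[of j "\<one>\<^bsub>D j\<^esub>" i "\<one>\<^bsub>D i\<^esub>"] one assms j k by auto
  qed
  moreover have "rel `` {(i, \<one>\<^bsub>D i\<^esub>) | i. i \<in> I} = (\<Union>j\<in>I. dcls j \<one>\<^bsub>D j\<^esub>)"
    by (auto simp: dcls_def)
  ultimately have "rel `` {(i, \<one>\<^bsub>D i\<^esub>) | i. i \<in> I} = (\<Union>j\<in>I. dcls i \<one>\<^bsub>D i\<^esub>)"
    by simp
  also have "\<dots> = dcls i \<one>\<^bsub>D i\<^esub>"
    using assms by blast
  finally show ?thesis
    by (simp add: direct_limit_def)
qed

end

context tuple_complex
begin

lemma cocycles_iff:
  "f \<in> complex.cocycles p \<longleftrightarrow> f \<in> S p \<rightarrow>\<^sub>E carrier G \<and> (\<forall>xs\<in>S (Suc p). ev G f (tuple_boundary xs) = \<one>)"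
proof -
  have "tuple_coboundary S G p f = \<one>\<^bsub>tuple_cochain_group S G (Suc p)\<^esub> \<longleftrightarrow>
      (\<forall>xs\<in>S (Suc p). ev G f (tuple_boundary xs) = \<one>)"
    if f: "f \<in> carrier (tuple_cochain_group S G p)" for f
    unfolding coboundary_eq_ev[OF f] one_cochains by (auto simp: fun_eq_iff restrict_def)
  then show ?thesis by (auto simp: kernel_def carrier_cochains)
qed

lemma coboundaries_iff:
  assumes f: "f \<in> S p \<rightarrow>\<^sub>E carrier G"
  shows "f \<in> coboundaries (tuple_cochain_group S G) (tuple_coboundary S G) p \<longleftrightarrow>
    (\<exists>u. (p = 0 \<longrightarrow> u [] = \<one>) \<and> (\<forall>xs\<in>S p. f xs = ev G u (tuple_boundary xs)))" (is "?l \<longleftrightarrow> ?r")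
proof (cases p)
  case 0
  have tb: "tuple_boundary xs = frag_of []" if "xs \<in> S 0" for xs
    using S_length[OF that] by (cases xs) (auto simp: tuple_boundary_Cons tuple_cone_def)
  have "f = (\<lambda>xs\<in>S 0. \<one>) \<longleftrightarrow> (\<forall>xs\<in>S 0. f xs = \<one>)"
    using f 0 by (auto simp: fun_eq_iff restrict_def PiE_def extensional_def)
  moreover have "?r" if "\<forall>xs\<in>S 0. f xs = \<one>"
    using that tb by (intro exI[of _ "\<lambda>_. \<one>"]) (simp add: 0)
  ultimately show ?thesis
    using tb by (auto simp: 0 coboundaries_0 one_cochains)
next
  case (Suc q)
  show ?thesis
  proof
    assume ?l
    then obtain u where u: "u \<in> carrier (tuple_cochain_group S G q)" "f = tuple_coboundary S G q u"
      by (auto simp: Suc coboundaries_Suc)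
    then show ?r
      by (intro exI[of _ u]) (simp add: coboundary_eq_ev Suc)
  next
    assume ?r
    then obtain u where u: "\<And>xs. xs \<in> S p \<Longrightarrow> f xs = ev G u (tuple_boundary xs)" by blast
    define u' where "u' = (\<lambda>xs\<in>S q. trunc G (u xs))"
    have u': "u' \<in> carrier (tuple_cochain_group S G q)"
      by (simp add: u'_def carrier_cochains)
    have "f = tuple_coboundary S G q u'"
    proof
      fix xs show "f xs = tuple_coboundary S G q u' xs"
      proof (cases "xs \<in> S p")
        case True
        have "ev G u' (tuple_boundary xs) = ev G u (tuple_boundary xs)"
          using keys_boundary_S True Suc by (intro ev_cong) (auto simp: u'_def)
        then show ?thesis using True u by (simp add: coboundary_eq_ev[OF u'] Suc)
      next
        case False
        then show ?thesis using f by (simp add: coboundary_eq_ev[OF u'] Suc PiE_def extensional_def)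
      qed
    qed
    then show ?l
      using u' by (auto simp: Suc coboundaries_Suc)
  qed
qed

lemma cls_eqI:
  assumes f: "f \<in> complex.cocycles p" "f' \<in> complex.cocycles p" and u: "p = 0 \<Longrightarrow> u [] = \<one>"
    and eq: "\<And>xs. xs \<in> S p \<Longrightarrow> f xs = f' xs \<otimes> ev G u (tuple_boundary xs)"
  shows "complex.cls p f = complex.cls p f'"
proof -
  have fc: "f \<in> S p \<rightarrow>\<^sub>E carrier G" "f' \<in> S p \<rightarrow>\<^sub>E carrier G"
    using f by (simp_all add: cocycles_iff)
  let ?q = "f \<otimes>\<^bsub>tuple_cochain_group S G p\<^esub> inv\<^bsub>tuple_cochain_group S G p\<^esub> f'"
  have q: "?q = (\<lambda>xs\<in>S p. f xs \<otimes> inv (f' xs))"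
    unfolding inv_cochains[OF fc(2)] mult_cochains by (simp cong: restrict_cong)
  have "?q xs = ev G u (tuple_boundary xs)" if xs: "xs \<in> S p" for xs
    using PiE_mem[OF fc(2) xs] xs eq[OF xs]
    by (simp add: q m_comm[of "f' xs" "ev G u (tuple_boundary xs)"] m_assoc)
  moreover have "?q \<in> S p \<rightarrow>\<^sub>E carrier G"
    unfolding q using PiE_mem[OF fc(1)] PiE_mem[OF fc(2)] by auto
  ultimately have "?q \<in> coboundaries (tuple_cochain_group S G) (tuple_coboundary S G) p"
    using u by (subst coboundaries_iff) blast+
  then show ?thesis
    using complex.cls_eq_iff[OF f] by simp
qed

end

section \<open>Nerves of open covers and refinement\<close>

locale nerves = comm_group G for G :: "('g, 'm) monoid_scheme" (structure) +
  fixes X :: "'a topology"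
begin

sublocale nerve: tuple_complex G "nerve_simplices \<U>" for \<U> :: "'a set set"
proof
  fix p and Us :: "'a set list" and k assume Us: "Us \<in> nerve_simplices \<U> (Suc p)" and k: "k \<le> Suc p"
  have "set (omit k Us) \<subseteq> set Us" by (rule set_omit)
  then show "omit k Us \<in> nerve_simplices \<U> p"
    using Us k Inter_anti_mono[of "set (omit k Us)" "set Us"]
    by (auto simp: nerve_simplices_def length_omit)
qed (simp add: nerve_simplices_def)

abbreviation cocycles :: "'a set set \<Rightarrow> nat \<Rightarrow> ('a set list \<Rightarrow> 'g) set" where
  "cocycles \<U> p \<equiv> nerve.complex.cocycles \<U> p"

abbreviation cls :: "'a set set \<Rightarrow> nat \<Rightarrow> ('a set list \<Rightarrow> 'g) \<Rightarrow> _" where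
  "cls \<U> p \<equiv> nerve.complex.cls \<U> p"

abbreviation H :: "nat \<Rightarrow> 'a set set \<Rightarrow> ('a set list \<Rightarrow> 'g) set monoid" where "H p \<U> \<equiv> nerve_cohomology_group p G \<U>"

lemma H_eq: "H p \<U> = cohomology_group (tuple_cochain_group (nerve_simplices \<U>) G) (tuple_coboundary (nerve_simplices \<U>) G) p"
  by (simp add: nerve_cohomology_group_def)

lemma group_H: "group (H p \<U>)"
  unfolding H_eq by (rule nerve.complex.group_cohomology)

lemma carrier_H: "carrier (H p \<U>) = cls \<U> p ` cocycles \<U> p"
  unfolding H_eq by (rule nerve.complex.cls_surj[symmetric])

lemma cls_mult:
  assumes "a \<in> cocycles \<U> p" "b \<in> cocycles \<U> p"
  shows "cls \<U> p a \<otimes>\<^bsub>H p \<U>\<^esub> cls \<U> p b = cls \<U> p (a \<otimes>\<^bsub>tuple_cochain_group (nerve_simplices \<U>) G p\<^esub> b)"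
    "a \<otimes>\<^bsub>tuple_cochain_group (nerve_simplices \<U>) G p\<^esub> b \<in> cocycles \<U> p"
  using hom_mult[OF nerve.complex.cls_hom[of \<U> p]] assms
    subgroup.m_closed[OF nerve.complex.subgroup_cocycles] unfolding H_eq by auto

definition pullback :: "('a set \<Rightarrow> 'a set) \<Rightarrow> 'a set set \<Rightarrow> nat \<Rightarrow> ('a set list \<Rightarrow> 'g) \<Rightarrow> 'a set list \<Rightarrow> 'g" where
  "pullback r \<V> p a = (\<lambda>Vs\<in>nerve_simplices \<V> p. a (map r Vs))"

text \<open>Every member of \<open>Us\<close> contains a member of \<open>Vs\<close>, hence the
  intersection of \<open>Vs\<close>. Thus two refinement maps are contiguous as maps of
  nerves.\<close>

lemma nerve_simplices_contiguous:
  assumes "\<And>V. V \<in> \<V> \<Longrightarrow> r V \<in> \<U> \<and> V \<subseteq> r V \<and> r' V \<in> \<U> \<and> V \<subseteq> r' V"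
    and "set Vs \<subseteq> \<V>" "\<Inter>(set Vs) \<noteq> {}" "set Us \<subseteq> r ` set Vs \<union> r' ` set Vs" "length Us = Suc p"
  shows "Us \<in> nerve_simplices \<U> p"
proof -
  have sub: "\<Inter>(set Vs) \<subseteq> U" if U: "U \<in> set Us" for U
  proof -
    obtain V where V: "V \<in> set Vs" "U = r V \<or> U = r' V" using assms(4) U by blast
    then have "V \<subseteq> U" using assms(1)[of V] assms(2) by blast
    then show ?thesis using V(1) by blast
  qed
  have "U \<in> \<U>" if U: "U \<in> set Us" for U
  proof -
    obtain V where V: "V \<in> set Vs" "U = r V \<or> U = r' V" using assms(4) U by blast
    then show ?thesis using assms(1)[of V] assms(2) by blast
  qed
  then show ?thesis
    using sub assms(3,5) unfolding nerve_simplices_def by blast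
qed

lemma map_nerve:
  assumes "refinement_map \<U> \<V> r" "Vs \<in> nerve_simplices \<V> p"
  shows "map r Vs \<in> nerve_simplices \<U> p"
  by (rule nerve_simplices_contiguous[of \<V> r \<U> r Vs])
    (use assms in \<open>auto simp: refinement_map_def nerve_simplices_def\<close>)

lemma ev_pullback:
  assumes c: "Poly_Mapping.keys c \<subseteq> nerve_simplices \<V> p"
  shows "ev G (pullback r \<V> p a) c = ev G a (frag_extend (\<lambda>Vs. frag_of (map r Vs)) c)"
  unfolding ev_extend using c by (intro ev_cong) (auto simp: pullback_def subset_iff)

lemma pullback_cocycle:
  assumes r: "refinement_map \<U> \<V> r" and a: "a \<in> cocycles \<U> p"
  shows "pullback r \<V> p a \<in> cocycles \<V> p"
proof -
  have "a \<in> nerve_simplices \<U> p \<rightarrow>\<^sub>E carrier G" and acyc: "\<And>xs. xs \<in> nerve_simplices \<U> (Suc p) \<Longrightarrow> ev G a (tuple_boundary xs) = \<one>"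
    using a by (auto simp: nerve.cocycles_iff)
  then have "pullback r \<V> p a \<in> nerve_simplices \<V> p \<rightarrow>\<^sub>E carrier G"
    using map_nerve[OF r] by (auto simp: pullback_def)
  moreover have "ev G (pullback r \<V> p a) (tuple_boundary Vs) = \<one>" if Vs: "Vs \<in> nerve_simplices \<V> (Suc p)" for Vs
    unfolding ev_pullback[OF nerve.keys_boundary_S[OF Vs]] tuple_boundary_map
    by (rule acyc[OF map_nerve[OF r Vs]])
  ultimately show ?thesis by (simp add: nerve.cocycles_iff)
qed

lemma pullback_mult:
  assumes r: "refinement_map \<U> \<V> r"
  shows "pullback r \<V> p (a \<otimes>\<^bsub>tuple_cochain_group (nerve_simplices \<U>) G p\<^esub> b) =
     pullback r \<V> p a \<otimes>\<^bsub>tuple_cochain_group (nerve_simplices \<V>) G p\<^esub> pullback r \<V> p b"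
  using map_nerve[OF r] unfolding pullback_def nerve.mult_cochains by (intro restrict_ext) simp

lemma pullback_coboundary:
  assumes r: "refinement_map \<U> \<V> r"
    and a: "a \<in> coboundaries (tuple_cochain_group (nerve_simplices \<U>) G) (tuple_coboundary (nerve_simplices \<U>) G) p"
  shows "pullback r \<V> p a \<in> coboundaries (tuple_cochain_group (nerve_simplices \<V>) G) (tuple_coboundary (nerve_simplices \<V>) G) p"
proof -
  have "a \<in> cocycles \<U> p" using a nerve.complex.coboundaries_subset by blast
  from this pullback_cocycle[OF r this] have ac: "a \<in> nerve_simplices \<U> p \<rightarrow>\<^sub>E carrier G"
    "pullback r \<V> p a \<in> nerve_simplices \<V> p \<rightarrow>\<^sub>E carrier G"
    by (simp_all add: nerve.cocycles_iff)
  then obtain u where u: "p = 0 \<longrightarrow> u [] = \<one>" "\<And>Us. Us \<in> nerve_simplices \<U> p \<Longrightarrow> a Us = ev G u (tuple_boundary Us)"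
    using a[unfolded nerve.coboundaries_iff[OF ac(1)]] by blast
  have "pullback r \<V> p a Vs = ev G (\<lambda>Vs. ev G u (frag_of (map r Vs))) (tuple_boundary Vs)"
    if Vs: "Vs \<in> nerve_simplices \<V> p" for Vs
    using u(2)[OF map_nerve[OF r Vs]] Vs
    by (simp add: pullback_def tuple_boundary_map[symmetric] ev_extend)
  then show ?thesis
    using u(1) unfolding nerve.coboundaries_iff[OF ac(2)]
    by (intro exI[of _ "\<lambda>Vs. ev G u (frag_of (map r Vs))"]) simp
qed

text \<open>Both maps send a simplex into one common simplex of the coarser nerve, so
  \<open>contiguous_cochains\<close> applies. This justifies the choice made in
  \<open>refinement_induced\<close>.\<close>

lemma cls_pullback_unique:
  assumes r: "refinement_map \<U> \<V> r" and r': "refinement_map \<U> \<V> r'" and a: "a \<in> cocycles \<U> p"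
  shows "cls \<V> p (pullback r \<V> p a) = cls \<V> p (pullback r' \<V> p a)"
proof -
  let ?S = "{Vs. set Vs \<subseteq> \<V> \<and> \<Inter>(set Vs) \<noteq> {}}"
  have ac: "a \<in> nerve_simplices \<U> p \<rightarrow>\<^sub>E carrier G" and acyc: "\<And>xs. xs \<in> nerve_simplices \<U> (Suc p) \<Longrightarrow> ev G a (tuple_boundary xs) = \<one>"
    using a by (auto simp: nerve.cocycles_iff)
  have S: "omit_closed ?S"
    unfolding omit_closed_def
  proof (intro ballI allI impI)
    fix Vs :: "'a set list" and k assume Vs: "Vs \<in> ?S"
    have "\<Inter>(set Vs) \<subseteq> \<Inter>(set (omit k Vs))" by (rule Inter_anti_mono[OF set_omit])
    then show "omit k Vs \<in> ?S" using Vs set_omit[of k Vs] by blast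
  qed
  have "\<exists>u. u [] = \<one> \<and> u \<in> UNIV \<rightarrow> carrier G \<and> (\<forall>Vs\<in>?S. length Vs = Suc p \<longrightarrow>
      ev G a (frag_of (map r Vs)) = ev G a (frag_of (map r' Vs)) \<otimes> ev G u (tuple_boundary Vs))"
  proof (rule contiguous_cochains[OF S])
    fix Vs Us assume Vs: "Vs \<in> ?S" and Us: "length Us = Suc (Suc p)" "set Us \<subseteq> r ` set Vs \<union> r' ` set Vs"
    show "ev G a (tuple_boundary Us) = \<one>"
      by (rule acyc, rule nerve_simplices_contiguous[of \<V> r \<U> r' Vs])
        (use Vs Us r r' in \<open>auto simp: refinement_map_def\<close>)
  qed
  then obtain u where u: "u [] = \<one>" and eq: "\<And>Vs. Vs \<in> ?S \<Longrightarrow> length Vs = Suc p \<Longrightarrow>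
      ev G a (frag_of (map r Vs)) = ev G a (frag_of (map r' Vs)) \<otimes> ev G u (tuple_boundary Vs)"
    by blast
  show ?thesis
  proof (rule nerve.cls_eqI[OF pullback_cocycle[OF r a] pullback_cocycle[OF r' a]])
    show "u [] = \<one>" by (rule u)
    fix Vs assume Vs: "Vs \<in> nerve_simplices \<V> p"
    then have "Vs \<in> ?S" "length Vs = Suc p" by (auto simp: nerve_simplices_def)
    from eq[OF this] show "pullback r \<V> p a Vs = pullback r' \<V> p a Vs \<otimes> ev G u (tuple_boundary Vs)"
      using PiE_mem[OF ac map_nerve[OF r Vs]] PiE_mem[OF ac map_nerve[OF r' Vs]] Vs
      by (simp add: pullback_def)
  qed
qed

text \<open>Pullback preserves coboundaries, so the image of a coset lies in one coset, which
  multiplication by the coboundaries fills; by uniqueness the chosen refinement map may be exchanged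
  for \<open>r\<close>.\<close>

lemma refinement_induced_cls:
  assumes r: "refinement_map \<U> \<V> r" and a: "a \<in> cocycles \<U> p"
  shows "refinement_induced p G \<U> \<V> (cls \<U> p a) = cls \<V> p (pullback r \<V> p a)"
proof -
  define r0 where "r0 = (SOME r. refinement_map \<U> \<V> r)"
  have r0: "refinement_map \<U> \<V> r0" unfolding r0_def by (rule someI[of "refinement_map \<U> \<V>", OF r])
  let ?T = "tuple_cochain_group (nerve_simplices \<V>) G p"
  let ?B = "coboundaries (tuple_cochain_group (nerve_simplices \<V>) G) (tuple_coboundary (nerve_simplices \<V>) G) p"
  let ?BU = "coboundaries (tuple_cochain_group (nerve_simplices \<U>) G) (tuple_coboundary (nerve_simplices \<U>) G) p"
  interpret T: comm_group ?T by (rule nerve.complex.comm_group)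
  interpret B: subgroup ?B ?T by (rule nerve.complex.subgroup_coboundaries)
  have ac: "a \<in> carrier (tuple_cochain_group (nerve_simplices \<U>) G p)"
    using a by (simp add: kernel_def)
  have pa: "pullback r0 \<V> p a \<in> carrier ?T"
    using pullback_cocycle[OF r0 a] by (simp add: kernel_def)
  have "pullback r0 \<V> p ` cls \<U> p a <#>\<^bsub>?T\<^esub> ?B = ?B #>\<^bsub>?T\<^esub> pullback r0 \<V> p a"
  proof
    show "pullback r0 \<V> p ` cls \<U> p a <#>\<^bsub>?T\<^esub> ?B \<subseteq> ?B #>\<^bsub>?T\<^esub> pullback r0 \<V> p a"
    proof
      fix x assume "x \<in> pullback r0 \<V> p ` cls \<U> p a <#>\<^bsub>?T\<^esub> ?B"
      then obtain b b' where b: "b \<in> ?BU" and b': "b' \<in> ?B"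
        and "x = pullback r0 \<V> p (b \<otimes>\<^bsub>tuple_cochain_group (nerve_simplices \<U>) G p\<^esub> a) \<otimes>\<^bsub>?T\<^esub> b'"
        unfolding set_mult_def nerve.complex.cls_def r_coset_def by blast
      then have "x = (pullback r0 \<V> p b \<otimes>\<^bsub>?T\<^esub> pullback r0 \<V> p a) \<otimes>\<^bsub>?T\<^esub> b'"
        by (simp add: pullback_mult[OF r0])
      also have "\<dots> = (pullback r0 \<V> p b \<otimes>\<^bsub>?T\<^esub> b') \<otimes>\<^bsub>?T\<^esub> pullback r0 \<V> p a"
        using pullback_coboundary[OF r0 b] b' pa B.mem_carrier by (simp add: T.m_ac)
      finally show "x \<in> ?B #>\<^bsub>?T\<^esub> pullback r0 \<V> p a"
        using pullback_coboundary[OF r0 b] b' unfolding r_coset_def by blast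
    qed
    show "?B #>\<^bsub>?T\<^esub> pullback r0 \<V> p a \<subseteq> pullback r0 \<V> p ` cls \<U> p a <#>\<^bsub>?T\<^esub> ?B"
    proof
      fix x assume "x \<in> ?B #>\<^bsub>?T\<^esub> pullback r0 \<V> p a"
      then obtain b where b: "b \<in> ?B" "x = b \<otimes>\<^bsub>?T\<^esub> pullback r0 \<V> p a"
        unfolding r_coset_def by blast
      then have "x = pullback r0 \<V> p a \<otimes>\<^bsub>?T\<^esub> b"
        using pa by (simp add: T.m_comm)
      moreover have "a \<in> cls \<U> p a"
        unfolding nerve.complex.cls_def
        by (rule group.rcos_self[OF nerve.complex.group ac nerve.complex.subgroup_coboundaries])
      ultimately show "x \<in> pullback r0 \<V> p ` cls \<U> p a <#>\<^bsub>?T\<^esub> ?B"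
        using b unfolding set_mult_def by blast
    qed
  qed
  then have coset: "pullback r0 \<V> p ` cls \<U> p a <#>\<^bsub>?T\<^esub> ?B = cls \<V> p (pullback r0 \<V> p a)"
    by (simp only: nerve.complex.cls_def)
  have eq: "(\<lambda>a. \<lambda>Vs\<in>nerve_simplices \<V> p. a (map r0 Vs)) = pullback r0 \<V> p"
    by (rule ext) (simp add: pullback_def)
  have "refinement_induced p G \<U> \<V> (cls \<U> p a) = cls \<V> p (pullback r0 \<V> p a)"
    unfolding refinement_induced_def Let_def r0_def[symmetric] eq by (rule coset)
  then show ?thesis
    using cls_pullback_unique[OF r0 r a] by simp
qed

lemma pullback_comp:
  assumes "refinement_map \<V> \<W> s"
  shows "pullback s \<W> p (pullback r \<V> p a) = pullback (r \<circ> s) \<W> p a"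
  using map_nerve[OF assms] unfolding pullback_def by (intro restrict_ext) simp

lemma refinement_map_comp: "refinement_map \<U> \<V> r \<Longrightarrow> refinement_map \<V> \<W> s \<Longrightarrow> refinement_map \<U> \<W> (r \<circ> s)"
  by (fastforce simp: refinement_map_def)

sublocale system: direct_system "{\<U>. open_cover X \<U>}" refined_by "nerve_cohomology_group p G" "refinement_induced p G" for p
proof (rule direct_system.intro)
  fix \<U> \<V> \<W> :: "'a set set"
  show "refined_by \<U> \<W>" if "refined_by \<U> \<V>" "refined_by \<V> \<W>"
    using that refinement_map_comp unfolding refined_by_def by blast
  show "group (nerve_cohomology_group p G \<U>)" by (rule group_H)
  show "\<exists>\<W>\<in>{\<U>. open_cover X \<U>}. refined_by \<U> \<W> \<and> refined_by \<V> \<W>"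
    if UV: "\<U> \<in> {\<U>. open_cover X \<U>}" "\<V> \<in> {\<U>. open_cover X \<U>}"
  proof -
    obtain \<W> where W: "open_cover X \<W>" "\<And>W. W \<in> \<W> \<Longrightarrow> \<exists>U\<in>\<U>. W \<subseteq> U" "\<And>W. W \<in> \<W> \<Longrightarrow> \<exists>V\<in>\<V>. W \<subseteq> V"
      using open_cover_inter[of X \<U> \<V>] UV by (metis mem_Collect_eq)
    have "refined_by \<U> \<W>" "refined_by \<V> \<W>"
      unfolding refined_by_def refinement_map_def using W(2,3) by metis+
    then show ?thesis using W(1) by blast
  qed
  show "refinement_induced p G \<U> \<V> \<in> hom (nerve_cohomology_group p G \<U>) (nerve_cohomology_group p G \<V>)"
    if ref: "refined_by \<U> \<V>"
  proof -
    obtain r where r: "refinement_map \<U> \<V> r" using ref by (auto simp: refined_by_def)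
    show ?thesis
    proof (rule homI)
      fix x assume "x \<in> carrier (H p \<U>)"
      then obtain a where a: "a \<in> cocycles \<U> p" "x = cls \<U> p a" by (auto simp: carrier_H)
      show "refinement_induced p G \<U> \<V> x \<in> carrier (H p \<V>)"
        using pullback_cocycle[OF r a(1)] by (simp add: a refinement_induced_cls[OF r] carrier_H)
      fix y assume "y \<in> carrier (H p \<U>)"
      then obtain b where b: "b \<in> cocycles \<U> p" "y = cls \<U> p b" by (auto simp: carrier_H)
      show "refinement_induced p G \<U> \<V> (x \<otimes>\<^bsub>H p \<U>\<^esub> y) =
          refinement_induced p G \<U> \<V> x \<otimes>\<^bsub>H p \<V>\<^esub> refinement_induced p G \<U> \<V> y"
        using cls_mult[OF a(1) b(1)] cls_mult[OF pullback_cocycle[OF r a(1)] pullback_cocycle[OF r b(1)]]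
        by (simp add: a b refinement_induced_cls[OF r] pullback_mult[OF r])
    qed
  qed
  show "refinement_induced p G \<V> \<W> (refinement_induced p G \<U> \<V> x) = refinement_induced p G \<U> \<W> x"
    if ref: "refined_by \<U> \<V>" "refined_by \<V> \<W>" and x: "x \<in> carrier (nerve_cohomology_group p G \<U>)" for x
  proof -
    obtain r s where r: "refinement_map \<U> \<V> r" and s: "refinement_map \<V> \<W> s" using ref by (auto simp: refined_by_def)
    obtain a where a: "a \<in> cocycles \<U> p" "x = cls \<U> p a" using x by (auto simp: carrier_H)
    show ?thesis
      using refinement_induced_cls[OF s pullback_cocycle[OF r a(1)]] refinement_induced_cls[OF refinement_map_comp[OF r s] a(1)]
      by (simp add: a refinement_induced_cls[OF r] pullback_comp[OF s])
  qed
qed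

end

section \<open>Comparison of Alexander-Spanier and Cech cohomology\<close>

lemma (in comm_group) ev_boundary_map:
  "ev G a (tuple_boundary (map r xs)) = ev G (\<lambda>ys. ev G a (frag_of (map r ys))) (tuple_boundary xs)"
  by (simp only: tuple_boundary_map[symmetric] ev_extend)

locale Cech_comparison = compact_in_metric M d M + comm_group G
  for M :: "'a set" and d and G :: "('g, 'm) monoid_scheme" (structure)
begin

sublocale AS: AS_complex G mtopology ..

sublocale nerves G mtopology ..

lemma subtopology_M [simp]: "subtopology mtopology M = mtopology"
  by (metis subtopology_topspace topspace_mtopology)

lemma AS_cocycles_iff:
  "f \<in> AS.AS_cocycles p \<longleftrightarrow> f \<in> point_tuples mtopology p \<rightarrow>\<^sub>E carrier G \<and>
     (\<exists>\<eta>>0. \<forall>xs\<in>small_tuples \<eta>. length xs = Suc (Suc p) \<longrightarrow> ev G f (tuple_boundary xs) = \<one>)"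
  unfolding AS.AS_cocycles_def using locally_iff_small_tuples by simp

lemma cobounds_iff:
  "AS.cobounds p f u \<longleftrightarrow> (p = 0 \<longrightarrow> u [] = \<one>) \<and>
     (\<exists>\<eta>>0. \<forall>xs\<in>small_tuples \<eta>. length xs = Suc p \<longrightarrow> f xs = ev G u (tuple_boundary xs))"
  unfolding AS.cobounds_def using locally_iff_small_tuples by simp

lemma small_point_tuple: "xs \<in> small_tuples \<eta> \<Longrightarrow> length xs = Suc p \<Longrightarrow> xs \<in> point_tuples mtopology p"
  by (simp add: small_tuples_def point_tuples_def)

definition good where
  "good p f \<eta> \<longleftrightarrow> \<eta> > 0 \<and> (\<forall>xs\<in>small_tuples \<eta>. length xs = Suc (Suc p) \<longrightarrow> ev G f (tuple_boundary xs) = \<one>)"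

text \<open>The bound is half of \<eta> so that points taken from two members that meet are closer
  than \<eta>.\<close>

definition mesh where
  "mesh \<eta> \<V> \<longleftrightarrow> open_cover mtopology \<V> \<and> (\<forall>V\<in>\<V>. \<forall>x\<in>V. \<forall>y\<in>V. d x y < \<eta>/2)"

definition pt :: "'a set \<Rightarrow> 'a" where "pt V = (SOME x. x \<in> V)"

definition sample where "sample p \<V> f = (\<lambda>Vs\<in>nerve_simplices \<V> p. f (map pt Vs))"

definition Cech_class where "Cech_class p \<V> f = system.dcls p \<V> (cls \<V> p (sample p \<V> f))"

lemma good_mono: "good p f \<eta> \<Longrightarrow> 0 < \<eta>' \<Longrightarrow> \<eta>' \<le> \<eta> \<Longrightarrow> good p f \<eta>'"
  using small_tuples_mono unfolding good_def by blast

lemma mesh_exists: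
  assumes "\<eta> > 0"
  shows "mesh \<eta> {V. openin mtopology V \<and> (\<forall>x\<in>V. \<forall>y\<in>V. d x y < \<eta>/2)}" (is "mesh \<eta> ?V")
proof -
  have "x \<in> \<Union>{V. openin mtopology V \<and> (\<forall>x\<in>V. \<forall>y\<in>V. d x y < \<eta>/2)}" if x: "x \<in> M" for x
  proof (rule UnionI[of "mball x (\<eta>/4)"])
    have "d y z < \<eta>/2" if "y \<in> mball x (\<eta>/4)" "z \<in> mball x (\<eta>/4)" for y z
      using that triangle[of y x z] commute[of x y] by auto
    then show "mball x (\<eta>/4) \<in> {V. openin mtopology V \<and> (\<forall>x\<in>V. \<forall>y\<in>V. d x y < \<eta>/2)}"
      by simp
  qed (use x assms in simp)
  then have "M \<subseteq> \<Union>?V" by blast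
  moreover have "V \<subseteq> M" if "V \<in> ?V" for V
    using that openin_subset[of mtopology V] by simp
  then have "\<Union>?V \<subseteq> M" by (rule Union_least)
  ultimately have "\<Union>?V = M" by (rule equalityI[rotated])
  then have "open_cover mtopology ?V" by (simp add: open_cover_def)
  then show ?thesis by (simp add: mesh_def)
qed

lemma mesh_refine: "mesh \<eta> \<V> \<Longrightarrow> open_cover mtopology \<W> \<Longrightarrow> refinement_map \<V> \<W> r \<Longrightarrow> mesh \<eta> \<W>"
  unfolding mesh_def refinement_map_def by (meson subsetD)

lemma mesh_star:
  assumes \<V>: "mesh \<eta> \<V>" and Vs: "set Vs \<subseteq> \<V>" "\<Inter>(set Vs) \<noteq> {}"
    and ys: "\<And>y. y \<in> set ys \<Longrightarrow> \<exists>V\<in>set Vs. y \<in> V"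
  shows "ys \<in> small_tuples \<eta>"
proof -
  obtain z where z: "\<And>V. V \<in> set Vs \<Longrightarrow> z \<in> V" using Vs(2) by blast
  have VM: "V \<subseteq> M" if "V \<in> \<V>" for V
    using \<V> that openin_subset[of mtopology V] by (simp add: mesh_def open_cover_def)
  have *: "y \<in> M \<and> z \<in> M \<and> d y z < \<eta>/2 \<and> d z y < \<eta>/2" if y: "y \<in> set ys" for y
  proof -
    obtain V where V: "V \<in> set Vs" "y \<in> V" using ys[OF y] by blast
    then have "V \<in> \<V>" using Vs(1) by blast
    moreover have "z \<in> V" by (rule z[OF V(1)])
    moreover have "\<forall>V\<in>\<V>. \<forall>x\<in>V. \<forall>y\<in>V. d x y < \<eta>/2" using \<V> by (simp add: mesh_def)
    ultimately show ?thesis using V(2) VM[of V] by simp (meson subsetD)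
  qed
  have "d y y' < \<eta>" if "y \<in> set ys" "y' \<in> set ys" for y y'
    using *[OF that(1)] *[OF that(2)] triangle[of y z y'] by linarith
  then show ?thesis using * by (auto simp: small_tuples_def)
qed

lemma pt_in: "V \<noteq> {} \<Longrightarrow> pt V \<in> V"
  unfolding pt_def by (simp add: some_in_eq)

lemma sample_small:
  assumes \<V>: "mesh \<eta> \<V>" and Vs: "Vs \<in> nerve_simplices \<V> p"
  shows "map pt Vs \<in> small_tuples \<eta>" "length (map pt Vs) = Suc p"
proof -
  have "V \<noteq> {}" if "V \<in> set Vs" for V
    using Vs that by (auto simp: nerve_simplices_def)
  then show "map pt Vs \<in> small_tuples \<eta>"
    using Vs pt_in by (intro mesh_star[OF \<V>, of Vs]) (auto simp: nerve_simplices_def)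
  show "length (map pt Vs) = Suc p"
    using Vs by (simp add: nerve_simplices_def)
qed

lemma ev_sample:
  assumes "Poly_Mapping.keys c \<subseteq> nerve_simplices \<V> p"
  shows "ev G (sample p \<V> f) c = ev G f (frag_extend (\<lambda>Vs. frag_of (map pt Vs)) c)"
  unfolding ev_extend using assms by (intro ev_cong) (auto simp: sample_def subset_iff)

lemma sample_cocycle:
  assumes f: "f \<in> point_tuples mtopology p \<rightarrow>\<^sub>E carrier G" "good p f \<eta>" and \<V>: "mesh \<eta> \<V>"
  shows "sample p \<V> f \<in> cocycles \<V> p"
  unfolding nerve.cocycles_iff
proof (intro conjI ballI)
  have "f (map pt Vs) \<in> carrier G" if "Vs \<in> nerve_simplices \<V> p" for Vs
    using PiE_mem[OF f(1) small_point_tuple[OF sample_small[OF \<V> that]]] .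
  then show "sample p \<V> f \<in> nerve_simplices \<V> p \<rightarrow>\<^sub>E carrier G"
    by (simp add: sample_def)
  fix Vs assume Vs: "Vs \<in> nerve_simplices \<V> (Suc p)"
  show "ev G (sample p \<V> f) (tuple_boundary Vs) = \<one>"
    unfolding ev_sample[OF nerve.keys_boundary_S[OF Vs]] tuple_boundary_map
    using f(2) sample_small[OF \<V> Vs] by (simp add: good_def)
qed

text \<open>For a member \<open>W\<close> of the finer cover, \<open>pt (r W)\<close> and
  \<open>pt W\<close> both lie in \<open>r W\<close>. Hence the vertex maps
  \<open>pt \<circ> r\<close> and \<open>pt\<close> are contiguous, at a scale where
  \<open>f\<close> is a cocycle.\<close>

lemma refine_sample:
  assumes f: "f \<in> point_tuples mtopology p \<rightarrow>\<^sub>E carrier G" "good p f \<eta>" and \<V>: "mesh \<eta> \<V>"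
    and \<W>: "open_cover mtopology \<W>" and r: "refinement_map \<V> \<W> r"
  shows "refinement_induced p G \<V> \<W> (cls \<V> p (sample p \<V> f)) = cls \<W> p (sample p \<W> f)"
proof -
  let ?S = "{Ws. set Ws \<subseteq> \<W> \<and> \<Inter>(set Ws) \<noteq> {}}"
  note \<W>m = mesh_refine[OF \<V> \<W> r]
  have S: "omit_closed ?S"
    unfolding omit_closed_def
  proof (intro ballI allI impI)
    fix Vs :: "'a set list" and k assume Vs: "Vs \<in> ?S"
    have "\<Inter>(set Vs) \<subseteq> \<Inter>(set (omit k Vs))" by (rule Inter_anti_mono[OF set_omit])
    then show "omit k Vs \<in> ?S" using Vs set_omit[of k Vs] by blast
  qed
  have star: "ys \<in> small_tuples \<eta>" if Ws: "Ws \<in> ?S" and ys: "set ys \<subseteq> (pt \<circ> r) ` set Ws \<union> pt ` set Ws" for Ws ys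
  proof (rule mesh_star[OF \<V>, of "map r Ws"])
    show "set (map r Ws) \<subseteq> \<V>" using Ws r by (auto simp: refinement_map_def)
    have sub: "W \<subseteq> r W" "W \<noteq> {}" if "W \<in> set Ws" for W
      using that Ws r by (auto simp: refinement_map_def)
    have "\<Inter>(set Ws) \<subseteq> \<Inter>(set (map r Ws))" using sub by fastforce
    then show "\<Inter>(set (map r Ws)) \<noteq> {}" using Ws by blast
    fix y assume "y \<in> set ys"
    then obtain W where W: "W \<in> set Ws" "y = pt (r W) \<or> y = pt W" using ys by auto
    then have "y \<in> r W" using pt_in[of W] pt_in[of "r W"] sub[OF W(1)] by blast
    then show "\<exists>V\<in>set (map r Ws). y \<in> V" using W(1) by auto
  qed
  have "\<exists>u. u [] = \<one> \<and> u \<in> UNIV \<rightarrow> carrier G \<and> (\<forall>Ws\<in>?S. length Ws = Suc p \<longrightarrow>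
      ev G f (frag_of (map (pt \<circ> r) Ws)) = ev G f (frag_of (map pt Ws)) \<otimes> ev G u (tuple_boundary Ws))"
  proof (rule contiguous_cochains[OF S])
    fix Ws ys assume "Ws \<in> ?S" "length ys = Suc (Suc p)" "set ys \<subseteq> (pt \<circ> r) ` set Ws \<union> pt ` set Ws"
    then show "ev G f (tuple_boundary ys) = \<one>"
      using f(2) star unfolding good_def by blast
  qed
  then obtain u where u: "u [] = \<one>" and eq: "\<And>Ws. Ws \<in> ?S \<Longrightarrow> length Ws = Suc p \<Longrightarrow>
      ev G f (frag_of (map (pt \<circ> r) Ws)) = ev G f (frag_of (map pt Ws)) \<otimes> ev G u (tuple_boundary Ws)"
    by blast
  have "cls \<W> p (pullback r \<W> p (sample p \<V> f)) = cls \<W> p (sample p \<W> f)"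
  proof (rule nerve.cls_eqI[OF pullback_cocycle[OF r sample_cocycle[OF f \<V>]] sample_cocycle[OF f \<W>m]])
    show "u [] = \<one>" by (rule u)
    fix Ws assume Ws: "Ws \<in> nerve_simplices \<W> p"
    then have WS: "Ws \<in> ?S" "length Ws = Suc p" by (auto simp: nerve_simplices_def)
    have "map (pt \<circ> r) Ws \<in> small_tuples \<eta>" "map pt Ws \<in> small_tuples \<eta>"
      by (rule star[OF WS(1)]; auto)+
    then have "f (map (pt \<circ> r) Ws) \<in> carrier G" "f (map pt Ws) \<in> carrier G"
      using PiE_mem[OF f(1) small_point_tuple] WS(2) by auto
    then show "pullback r \<W> p (sample p \<V> f) Ws = sample p \<W> f Ws \<otimes> ev G u (tuple_boundary Ws)"
      using eq[OF WS] Ws map_nerve[OF r Ws] by (simp add: pullback_def sample_def)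
  qed
  then show ?thesis
    by (simp add: refinement_induced_cls[OF r sample_cocycle[OF f \<V>]])
qed

lemma cls_in_H: "a \<in> cocycles \<V> p \<Longrightarrow> cls \<V> p a \<in> carrier (H p \<V>)"
  by (simp add: carrier_H)

lemma mesh_cover: "mesh \<eta> \<V> \<Longrightarrow> \<V> \<in> {\<U>. open_cover mtopology \<U>}"
  by (simp add: mesh_def)

lemma Cech_class_refine:
  assumes f: "f \<in> point_tuples mtopology p \<rightarrow>\<^sub>E carrier G" "good p f \<eta>" and \<V>: "mesh \<eta> \<V>"
    and \<W>: "open_cover mtopology \<W>" and r: "refinement_map \<V> \<W> r"
  shows "Cech_class p \<W> f = Cech_class p \<V> f"
  unfolding Cech_class_def refine_sample[OF f \<V> \<W> r, symmetric]
  using mesh_cover[OF \<V>] cls_in_H[OF sample_cocycle[OF f \<V>]] \<W> r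
  by (intro system.dcls_map) (auto simp: refined_by_def)

lemma Cech_class_unique:
  assumes f: "f \<in> point_tuples mtopology p \<rightarrow>\<^sub>E carrier G"
    and g: "good p f \<eta>" "mesh \<eta> \<V>" and g': "good p f \<eta>'" "mesh \<eta>' \<V>'"
  shows "Cech_class p \<V> f = Cech_class p \<V>' f"
proof -
  have c: "open_cover mtopology \<V>" "open_cover mtopology \<V>'"
    using g g' by (auto simp: mesh_def)
  obtain \<W> where W: "open_cover mtopology \<W>" "\<And>W. W \<in> \<W> \<Longrightarrow> \<exists>U\<in>\<V>. W \<subseteq> U" "\<And>W. W \<in> \<W> \<Longrightarrow> \<exists>V\<in>\<V>'. W \<subseteq> V"
    using open_cover_inter[OF c] by metis
  obtain r r' where "refinement_map \<V> \<W> r" "refinement_map \<V>' \<W> r'"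
    unfolding refinement_map_def using W(2,3) by metis
  then show ?thesis
    using Cech_class_refine[OF f g W(1)] Cech_class_refine[OF f g' W(1)] by simp
qed

definition scale where "scale p f = (SOME \<eta>. good p f \<eta>)"

text \<open>A definite cover is fixed to obtain a function on cocycles; by
  \<open>Cech_map_eq\<close> every sufficiently fine cover gives the same class.\<close>

definition Cech_map where
  "Cech_map p f = Cech_class p {V. openin mtopology V \<and> (\<forall>x\<in>V. \<forall>y\<in>V. d x y < scale p f/2)} f"

lemma Cech_map_eq:
  assumes f: "f \<in> point_tuples mtopology p \<rightarrow>\<^sub>E carrier G" "good p f \<eta>" "mesh \<eta> \<V>"
  shows "Cech_map p f = Cech_class p \<V> f"
proof -
  have s: "good p f (scale p f)"
    unfolding scale_def by (rule someI[of "good p f", OF f(2)])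
  then have "scale p f > 0" by (simp add: good_def)
  from Cech_class_unique[OF f(1) s mesh_exists[OF this] f(2,3)] show ?thesis
    by (simp add: Cech_map_def)
qed

lemma cocycle_good:
  assumes "f \<in> AS.AS_cocycles p"
  obtains \<eta> where "f \<in> point_tuples mtopology p \<rightarrow>\<^sub>E carrier G" "good p f \<eta>" "\<eta> > 0"
  using assms unfolding AS_cocycles_iff good_def by blast

abbreviation Cech where "Cech p \<equiv> Cech_cohomology_group p mtopology G"

lemma Cech_eq: "Cech p = direct_limit {\<U>. open_cover mtopology \<U>} refined_by (nerve_cohomology_group p G) (refinement_induced p G)"
  by (simp add: Cech_cohomology_group_def)

lemma Cech_map_mult:
  assumes f: "f \<in> AS.AS_cocycles p" and f': "f' \<in> AS.AS_cocycles p"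
  shows "Cech_map p (f \<otimes>\<^bsub>tuple_cochain_group (point_tuples mtopology) G p\<^esub> f') = Cech_map p f \<otimes>\<^bsub>Cech p\<^esub> Cech_map p f'"
proof -
  let ?h = "f \<otimes>\<^bsub>tuple_cochain_group (point_tuples mtopology) G p\<^esub> f'"
  have h: "?h \<in> AS.AS_cocycles p"
    using f f' subgroup.m_closed[OF AS.pair.subgroup_rel_cocycles] by (simp add: AS.AS_cocycles_eq)
  obtain \<eta>1 where 1: "f \<in> point_tuples mtopology p \<rightarrow>\<^sub>E carrier G" "good p f \<eta>1" "\<eta>1 > 0" by (rule cocycle_good[OF f])
  obtain \<eta>2 where 2: "f' \<in> point_tuples mtopology p \<rightarrow>\<^sub>E carrier G" "good p f' \<eta>2" "\<eta>2 > 0" by (rule cocycle_good[OF f'])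
  obtain \<eta>3 where 3: "?h \<in> point_tuples mtopology p \<rightarrow>\<^sub>E carrier G" "good p ?h \<eta>3" "\<eta>3 > 0" by (rule cocycle_good[OF h])
  \<comment> \<open>One cover has to be fine enough for both cocycles and for their product.\<close>
  define \<eta> where "\<eta> = min \<eta>1 (min \<eta>2 \<eta>3)"
  have \<eta>: "\<eta> > 0" "good p f \<eta>" "good p f' \<eta>" "good p ?h \<eta>"
    using 1 2 3 good_mono by (auto simp: \<eta>_def)
  obtain \<V> where \<V>: "mesh \<eta> \<V>" using mesh_exists[OF \<eta>(1)] by blast
  have "sample p \<V> ?h = sample p \<V> f \<otimes>\<^bsub>tuple_cochain_group (nerve_simplices \<V>) G p\<^esub> sample p \<V> f'"
    unfolding sample_def nerve.mult_cochains AS.mult_cochains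
    using small_point_tuple[OF sample_small[OF \<V>]] by (intro restrict_ext) simp
  then have "cls \<V> p (sample p \<V> ?h) = cls \<V> p (sample p \<V> f) \<otimes>\<^bsub>H p \<V>\<^esub> cls \<V> p (sample p \<V> f')"
    using cls_mult(1)[OF sample_cocycle[OF 1(1) \<eta>(2) \<V>] sample_cocycle[OF 2(1) \<eta>(3) \<V>]] by simp
  then show ?thesis
    unfolding Cech_map_eq[OF 1(1) \<eta>(2) \<V>] Cech_map_eq[OF 2(1) \<eta>(3) \<V>] Cech_map_eq[OF 3(1) \<eta>(4) \<V>] Cech_class_def Cech_eq
    using system.dcls_mult[OF mesh_cover[OF \<V>] cls_in_H[OF sample_cocycle[OF 1(1) \<eta>(2) \<V>]]
        mesh_cover[OF \<V>] cls_in_H[OF sample_cocycle[OF 2(1) \<eta>(3) \<V>]]] by simp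
qed

lemma Cech_map_in: "f \<in> AS.AS_cocycles p \<Longrightarrow> Cech_map p f \<in> carrier (Cech p)"
proof -
  assume f: "f \<in> AS.AS_cocycles p"
  obtain \<eta> where 1: "f \<in> point_tuples mtopology p \<rightarrow>\<^sub>E carrier G" "good p f \<eta>" "\<eta> > 0" by (rule cocycle_good[OF f])
  obtain \<V> where \<V>: "mesh \<eta> \<V>" using mesh_exists[OF 1(3)] by blast
  show ?thesis
    unfolding Cech_map_eq[OF 1(1,2) \<V>] Cech_class_def Cech_eq system.carrier_direct_limit
    using mesh_cover[OF \<V>] cls_in_H[OF sample_cocycle[OF 1(1,2) \<V>]] by blast
qed

text \<open>A cocycle \<open>a\<close> of a nerve becomes a cochain on points by assigning to
  \<open>x\<close> a member of the cover that contains a whole ball about \<open>x\<close>. Sampling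
  this cochain on a fine cover gives the pullback of \<open>a\<close> along
  \<open>V \<mapsto> U (pt V)\<close>, a refinement map.\<close>

lemma Cech_map_surj:
  assumes x: "x \<in> carrier (Cech p)"
  shows "\<exists>f\<in>AS.AS_cocycles p. Cech_map p f = x"
proof -
  obtain \<U> a where \<U>: "open_cover mtopology \<U>" and a: "a \<in> cocycles \<U> p" and x: "x = system.dcls p \<U> (cls \<U> p a)"
    using x unfolding Cech_eq system.carrier_direct_limit by (auto simp: carrier_H)
  have ac: "a \<in> nerve_simplices \<U> p \<rightarrow>\<^sub>E carrier G" and acyc: "\<And>Us. Us \<in> nerve_simplices \<U> (Suc p) \<Longrightarrow> ev G a (tuple_boundary Us) = \<one>"
    using a by (auto simp: nerve.cocycles_iff)
  obtain l where l: "l > 0" "\<And>x. x \<in> M \<Longrightarrow> \<exists>U\<in>\<U>. M \<inter> mball x l \<subseteq> U"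
    using lebesgue_number_tuples[of \<U>] \<U> by (metis subtopology_M)
  define U where "U x = (SOME U. U \<in> \<U> \<and> M \<inter> mball x l \<subseteq> U)" for x
  have U: "U x \<in> \<U>" "M \<inter> mball x l \<subseteq> U x" if "x \<in> M" for x
    using someI_ex[OF l(2)[OF that, unfolded Bex_def]] by (simp_all add: U_def)
  have Un: "map U xs \<in> nerve_simplices \<U> q" if xs: "xs \<in> small_tuples l" "length xs = Suc q" for xs q
  proof -
    have ne: "xs \<noteq> []" using xs by auto
    have "hd xs \<in> U x" if "x \<in> set xs" for x
    proof -
      have "x \<in> M" "hd xs \<in> M" "d x (hd xs) < l"
        using that ne xs(1) hd_in_set[OF ne] by (auto simp: small_tuples_def subset_iff)
      then show ?thesis using U(2)[of x] by auto
    qed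
    then have "\<Inter>(set (map U xs)) \<noteq> {}" by auto
    then show ?thesis
      using xs U(1) by (auto simp: nerve_simplices_def small_tuples_def)
  qed
  define f where "f = (\<lambda>xs\<in>point_tuples mtopology p. trunc G (a (map U xs)))"
  have fc: "f \<in> point_tuples mtopology p \<rightarrow>\<^sub>E carrier G"
    by (simp add: f_def)
  have good: "good p f l"
    unfolding good_def
  proof (intro conjI ballI impI l(1))
    fix xs assume xs: "xs \<in> small_tuples l" "length xs = Suc (Suc p)"
    have "ev G f (tuple_boundary xs) = ev G (\<lambda>ys. ev G a (frag_of (map U ys))) (tuple_boundary xs)"
    proof (rule ev_cong)
      fix ys assume "ys \<in> Poly_Mapping.keys (tuple_boundary xs)"
      then have "ys \<in> point_tuples mtopology p"
        using keys_boundary_small_tuples[OF xs] small_point_tuple by blast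
      then show "trunc G (f ys) = trunc G (ev G a (frag_of (map U ys)))"
        by (simp add: f_def)
    qed
    also have "\<dots> = ev G a (tuple_boundary (map U xs))"
      by (rule ev_boundary_map[symmetric])
    also have "\<dots> = \<one>" by (rule acyc[OF Un[OF xs]])
    finally show "ev G f (tuple_boundary xs) = \<one>" .
  qed
  have f: "f \<in> AS.AS_cocycles p"
    unfolding AS_cocycles_iff using fc good by (auto simp: good_def)
  obtain \<V> where \<V>: "mesh l \<V>" using mesh_exists[OF l(1)] by blast
  have VM: "V \<subseteq> M" if "V \<in> \<V>" for V
    using \<V> that openin_subset[of mtopology V] by (simp add: mesh_def open_cover_def)
  \<comment> \<open>The fine cover may contain the empty set, which has no sample point; any member
    of the coarse cover can be assigned to it.\<close>
  have r: "refinement_map \<U> \<V> (\<lambda>V. if V = {} then SOME U. U \<in> \<U> else U (pt V))"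
    if ne: "\<U> \<noteq> {}"
    unfolding refinement_map_def
  proof
    fix V assume V: "V \<in> \<V>"
    show "(if V = {} then SOME U. U \<in> \<U> else U (pt V)) \<in> \<U> \<and> V \<subseteq> (if V = {} then SOME U. U \<in> \<U> else U (pt V))"
    proof (cases "V = {}")
      case True
      then show ?thesis using ne by (simp add: some_in_eq)
    next
      case False
      then have p: "pt V \<in> V" by (rule pt_in)
      then have "pt V \<in> M" using VM[OF V] by blast
      have "V \<subseteq> M \<inter> mball (pt V) l"
      proof
        fix y assume y: "y \<in> V"
        have "d (pt V) y < l/2" using \<V> V p y unfolding mesh_def by blast
        then show "y \<in> M \<inter> mball (pt V) l"
          using VM[OF V] y p l(1) by auto
      qed
      then show ?thesis
        using U[OF \<open>pt V \<in> M\<close>] False by auto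
    qed
  qed
  have "Cech_map p f = x"
  proof (cases "\<U> = {}")
    case False
    let ?r = "\<lambda>V. if V = {} then SOME U. U \<in> \<U> else U (pt V)"
    note r = r[OF False]
    have "sample p \<V> f = pullback ?r \<V> p a"
      unfolding sample_def pullback_def
    proof (rule restrict_ext)
      fix Vs assume Vs: "Vs \<in> nerve_simplices \<V> p"
      have "map U (map pt Vs) = map ?r Vs"
        using Vs by (auto simp: nerve_simplices_def)
      moreover have "f (map pt Vs) = trunc G (a (map U (map pt Vs)))"
        using small_point_tuple[OF sample_small[OF \<V> Vs]] by (simp add: f_def)
      ultimately show "f (map pt Vs) = a (map ?r Vs)"
        using PiE_mem[OF ac map_nerve[OF r Vs]] by (simp only: trunc_carrier)
    qed
    then have "cls \<V> p (sample p \<V> f) = refinement_induced p G \<U> \<V> (cls \<U> p a)"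
      by (simp add: refinement_induced_cls[OF r a])
    then show ?thesis
      unfolding Cech_map_eq[OF fc good \<V>] Cech_class_def x
      using system.dcls_map[of \<U> "cls \<U> p a" p \<V>] \<U> cls_in_H[OF a] mesh_cover[OF \<V>] r
      by (auto simp: refined_by_def)
  next
    case True
    \<comment> \<open>Only the empty space has the empty cover. A refinement map to it need not
      exist, but this cover is itself fine enough.\<close>
    then have M: "M = {}" using \<U> by (simp add: open_cover_def)
    have "mesh l \<U>" using \<U> True by (simp add: mesh_def)
    moreover have "sample p \<U> f = a"
      using ac by (auto simp: sample_def nerve_simplices_def True PiE_def extensional_def fun_eq_iff)
    ultimately show ?thesis
      using Cech_map_eq[OF fc good] by (simp add: Cech_class_def x)
  qed
  with f show ?thesis by blast
qed

lemma one_Cech: "mesh \<eta> \<V> \<Longrightarrow> \<one>\<^bsub>Cech p\<^esub> = system.dcls p \<V> \<one>\<^bsub>H p \<V>\<^esub>"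
  unfolding Cech_eq by (rule system.dcls_one[OF mesh_cover])

lemma sample_cls_one_iff:
  assumes f: "f \<in> point_tuples mtopology p \<rightarrow>\<^sub>E carrier G" "good p f \<eta>" and \<V>: "mesh \<eta> \<V>"
  shows "cls \<V> p (sample p \<V> f) = \<one>\<^bsub>H p \<V>\<^esub> \<longleftrightarrow>
    (\<exists>w. (p = 0 \<longrightarrow> w [] = \<one>) \<and> (\<forall>Vs\<in>nerve_simplices \<V> p. f (map pt Vs) = ev G w (tuple_boundary Vs)))"
proof -
  note s = sample_cocycle[OF f \<V>]
  have sc: "sample p \<V> f \<in> nerve_simplices \<V> p \<rightarrow>\<^sub>E carrier G"
    using s by (simp add: nerve.cocycles_iff)
  show ?thesis
    unfolding H_eq nerve.complex.cls_eq_one_iff[OF s] nerve.coboundaries_iff[OF sc]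
    by (simp add: sample_def)
qed

text \<open>If the sample on some cover is the coboundary of \<open>w\<close>, then \<open>f\<close>
  differs by a coboundary from its values on the points \<open>pt (U x)\<close>, since
  \<open>x\<close> and \<open>pt (U x)\<close> lie in a common member; on those points it is the
  coboundary of \<open>w\<close> composed with \<open>U\<close>. Conversely, a primitive of
  \<open>f\<close> can be sampled.\<close>

lemma Cech_map_one_iff:
  assumes f: "f \<in> AS.AS_cocycles p"
  shows "Cech_map p f = \<one>\<^bsub>Cech p\<^esub> \<longleftrightarrow> (\<exists>u. AS.cobounds p f u)"
proof
  obtain \<eta> where fc: "f \<in> point_tuples mtopology p \<rightarrow>\<^sub>E carrier G" and good: "good p f \<eta>" and "\<eta> > 0"
    by (rule cocycle_good[OF f])
  {
    assume one: "Cech_map p f = \<one>\<^bsub>Cech p\<^esub>"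
    obtain \<V> where \<V>: "mesh \<eta> \<V>" using mesh_exists[OF \<open>\<eta> > 0\<close>] by blast
    note V = mesh_cover[OF \<V>]
    have oneH: "\<one>\<^bsub>H p \<V>\<^esub> \<in> carrier (H p \<V>)"
      using group_H by (simp add: group.is_monoid monoid.one_closed)
    have "system.dcls p \<V> (cls \<V> p (sample p \<V> f)) = system.dcls p \<V> \<one>\<^bsub>H p \<V>\<^esub>"
      using one unfolding Cech_map_eq[OF fc good \<V>] Cech_class_def one_Cech[OF \<V>] .
    then obtain \<W> where W: "open_cover mtopology \<W>" "refined_by \<V> \<W>"
      and eq: "refinement_induced p G \<V> \<W> (cls \<V> p (sample p \<V> f)) = refinement_induced p G \<V> \<W> \<one>\<^bsub>H p \<V>\<^esub>"
      using system.dcls_eq_iff[OF V cls_in_H[OF sample_cocycle[OF fc good \<V>]] V oneH] by blast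
    obtain r where r: "refinement_map \<V> \<W> r" using W(2) by (auto simp: refined_by_def)
    note \<W> = mesh_refine[OF \<V> W(1) r]
    have "refinement_induced p G \<V> \<W> \<one>\<^bsub>H p \<V>\<^esub> = \<one>\<^bsub>H p \<W>\<^esub>"
      using system.hom[OF V, of \<W> p] W hom_one group_H by blast
    then have "cls \<W> p (sample p \<W> f) = \<one>\<^bsub>H p \<W>\<^esub>"
      using eq refine_sample[OF fc good \<V> W(1) r] by simp
    then obtain w where w0: "p = 0 \<longrightarrow> w [] = \<one>"
      and w: "\<And>Ws. Ws \<in> nerve_simplices \<W> p \<Longrightarrow> f (map pt Ws) = ev G w (tuple_boundary Ws)"
      unfolding sample_cls_one_iff[OF fc good \<W>] by blast
    obtain l where l: "l > 0" "\<And>x. x \<in> M \<Longrightarrow> \<exists>U\<in>\<W>. M \<inter> mball x l \<subseteq> U"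
      using lebesgue_number_tuples[of \<W>] W(1) by (metis subtopology_M)
    define U where "U x = (SOME U. U \<in> \<W> \<and> M \<inter> mball x l \<subseteq> U)" for x
    have U: "U x \<in> \<W>" "M \<inter> mball x l \<subseteq> U x" if "x \<in> M" for x
      using someI_ex[OF l(2)[OF that, unfolded Bex_def]] by (simp_all add: U_def)
    have xU: "x \<in> U x" if "x \<in> M" for x
      using U(2)[OF that] that l(1) by auto
    have inter: "hd xs \<in> \<Inter>(set (map U xs))" "set (map U xs) \<subseteq> \<W>" if xs: "xs \<in> small_tuples l" "xs \<noteq> []" for xs
    proof -
      have "hd xs \<in> U x" if "x \<in> set xs" for x
      proof -
        have "x \<in> M" "hd xs \<in> M" "d x (hd xs) < l"
          using that xs(1) hd_in_set[OF xs(2)] by (auto simp: small_tuples_def subset_iff)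
        then show ?thesis using U(2)[of x] by auto
      qed
      then show "hd xs \<in> \<Inter>(set (map U xs))" by auto
      show "set (map U xs) \<subseteq> \<W>" using xs U(1) by (auto simp: small_tuples_def)
    qed
    have "\<exists>u. u [] = \<one> \<and> u \<in> UNIV \<rightarrow> carrier G \<and> (\<forall>xs\<in>small_tuples l. length xs = Suc p \<longrightarrow>
        ev G f (frag_of (map id xs)) = ev G f (frag_of (map (pt \<circ> U) xs)) \<otimes> ev G u (tuple_boundary xs))"
    proof (rule contiguous_cochains)
      show "omit_closed (small_tuples l)"
        using omit_small_tuples by (auto simp: omit_closed_def)
      fix xs ys assume xs: "xs \<in> small_tuples l" "length xs = Suc p"
        and ys: "length ys = Suc (Suc p)" "set ys \<subseteq> id ` set xs \<union> (pt \<circ> U) ` set xs"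
      have ne: "xs \<noteq> []" using xs by auto
      have "ys \<in> small_tuples \<eta>"
      proof (rule mesh_star[OF \<W> inter(2)[OF xs(1) ne]])
        show "\<Inter>(set (map U xs)) \<noteq> {}" using inter(1)[OF xs(1) ne] by blast
        fix y assume "y \<in> set ys"
        then obtain x where x: "x \<in> set xs" "y = x \<or> y = pt (U x)" using ys(2) by auto
        then have "x \<in> M" using xs(1) by (auto simp: small_tuples_def)
        from xU[OF this] x pt_in[of "U x"] have "y \<in> U x" by auto
        then show "\<exists>V\<in>set (map U xs). y \<in> V" using x(1) by auto
      qed
      then show "ev G f (tuple_boundary ys) = \<one>"
        using good ys(1) by (simp add: good_def)
    qed
    then obtain u where u: "u [] = \<one>" "u \<in> UNIV \<rightarrow> carrier G"
      and ueq: "\<And>xs. xs \<in> small_tuples l \<Longrightarrow> length xs = Suc p \<Longrightarrow>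
        ev G f (frag_of (map id xs)) = ev G f (frag_of (map (pt \<circ> U) xs)) \<otimes> ev G u (tuple_boundary xs)"
      by blast
    let ?w = "\<lambda>ys. ev G w (frag_of (map U ys))"
    have "AS.cobounds p f (\<lambda>ys. ?w ys \<otimes> u ys)"
      unfolding cobounds_iff
    proof (intro conjI impI exI[of _ l] ballI l(1))
      show "?w [] \<otimes> u [] = \<one>" if "p = 0" using w0 that u by simp
      fix xs assume xs: "xs \<in> small_tuples l" "length xs = Suc p"
      have ne: "xs \<noteq> []" using xs by auto
      have n: "map U xs \<in> nerve_simplices \<W> p"
        using inter[OF xs(1) ne] xs(2) unfolding nerve_simplices_def by auto
      have fx: "f xs \<in> carrier G" using PiE_mem[OF fc small_point_tuple[OF xs]] .
      have eqw: "f (map (pt \<circ> U) xs) = ev G ?w (tuple_boundary xs)"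
        using w[OF n] unfolding ev_boundary_map by simp
      have "f xs = ev G ?w (tuple_boundary xs) \<otimes> ev G u (tuple_boundary xs)"
        using ueq[OF xs] fx by (simp add: eqw)
      also have "\<dots> = ev G (\<lambda>ys. ?w ys \<otimes> u ys) (tuple_boundary xs)"
        by (rule ev_mult[symmetric]) (use u(2) in auto)
      finally show "f xs = ev G (\<lambda>ys. ?w ys \<otimes> u ys) (tuple_boundary xs)" .
    qed
    then show "\<exists>u. AS.cobounds p f u" by blast
  next
    assume "\<exists>u. AS.cobounds p f u"
    then obtain u \<eta>' where u0: "p = 0 \<longrightarrow> u [] = \<one>" and "\<eta>' > 0"
      and u: "\<And>xs. xs \<in> small_tuples \<eta>' \<Longrightarrow> length xs = Suc p \<Longrightarrow> f xs = ev G u (tuple_boundary xs)"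
      unfolding cobounds_iff by blast
    define \<theta> where "\<theta> = min \<eta> \<eta>'"
    have \<theta>: "\<theta> > 0" "good p f \<theta>" "\<theta> \<le> \<eta>'"
      using good_mono[OF good] \<open>\<eta>' > 0\<close> \<open>\<eta> > 0\<close> by (auto simp: \<theta>_def)
    obtain \<V> where \<V>: "mesh \<theta> \<V>" using mesh_exists[OF \<theta>(1)] by blast
    have "f (map pt Vs) = ev G (\<lambda>Vs. ev G u (frag_of (map pt Vs))) (tuple_boundary Vs)"
      if Vs: "Vs \<in> nerve_simplices \<V> p" for Vs
      using u[OF subsetD[OF small_tuples_mono[OF \<theta>(3)] sample_small(1)[OF \<V> Vs]] sample_small(2)[OF \<V> Vs]]
      unfolding ev_boundary_map .
    then have "cls \<V> p (sample p \<V> f) = \<one>\<^bsub>H p \<V>\<^esub>"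
      unfolding sample_cls_one_iff[OF fc \<theta>(2) \<V>] using u0
      by (intro exI[of _ "\<lambda>Vs. ev G u (frag_of (map pt Vs))"]) simp
    then show "Cech_map p f = \<one>\<^bsub>Cech p\<^esub>"
      unfolding Cech_map_eq[OF fc \<theta>(2) \<V>] Cech_class_def one_Cech[OF \<V>] by simp
  }
qed

theorem AS_iso_Cech: "AS_cohomology_group p mtopology G \<cong> Cech p"
proof -
  let ?A = "AS.AS_cocycle_group p"
  have hom: "Cech_map p \<in> hom ?A (Cech p)"
    using Cech_map_in Cech_map_mult by (intro homI) (simp_all add: AS.AS_cocycles_eq)
  have img: "Cech_map p ` AS.AS_cocycles p = carrier (Cech p)"
    using Cech_map_in Cech_map_surj by blast
  have A: "group ?A"
    by (simp add: group.group_subgroup_generated AS.complex.group)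
  \<comment> \<open>That \<open>Cech p\<close> is a group is inherited from the cocycles through the
    surjection \<open>Cech_map p\<close>; for this the image of the unit must be the unit of the
    limit.\<close>
  have "Cech_map p \<one>\<^bsub>?A\<^esub> = \<one>\<^bsub>Cech p\<^esub>"
  proof -
    have one: "\<one>\<^bsub>?A\<^esub> \<in> AS.AS_cocycles p"
      using monoid.one_closed[OF group.is_monoid[OF A]] unfolding AS.AS_cocycles_eq AS.pair.carrier_rel_cocycle_group .
    have "AS.AS_class p \<one>\<^bsub>?A\<^esub> = \<one>\<^bsub>AS_cohomology_group p mtopology G\<^esub>"
      by (rule hom_one[OF AS.AS_class_hom A AS.group_AS])
    then show ?thesis
      unfolding Cech_map_one_iff[OF one] using AS.AS_class_eq_one_iff[OF one] by blast
  qed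
  moreover have "group (Cech p\<lparr>carrier := Cech_map p ` carrier ?A, one := Cech_map p \<one>\<^bsub>?A\<^esub>\<rparr>)"
    by (rule group.hom_imp_img_group[OF A hom])
  ultimately have grp: "group (Cech p)"
    using img by (simp add: AS.AS_cocycles_eq)
  show ?thesis
  proof (rule iso_of_common_kernel[OF A AS.group_AS grp AS.AS_class_hom _ hom])
    fix f assume "f \<in> carrier ?A"
    then have f: "f \<in> AS.AS_cocycles p" by (simp add: AS.AS_cocycles_eq)
    show "AS.AS_class p f = \<one>\<^bsub>AS_cohomology_group p mtopology G\<^esub> \<longleftrightarrow> Cech_map p f = \<one>\<^bsub>Cech p\<^esub>"
      unfolding Cech_map_one_iff[OF f] by (rule AS.AS_class_eq_one_iff[OF f])
  qed (use img AS.AS_class_surj in \<open>simp_all add: AS.AS_cocycles_eq\<close>)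
qed

end

theorem compact_metrizable_AS_iso_Cech:
  assumes "metrizable_space X" "compact_space X" "comm_group G"
  shows "AS_cohomology_group p X G \<cong> Cech_cohomology_group p X G"
proof -
  obtain M d where "Metric_space M d" and X: "X = Metric_space.mtopology M d"
    using assms(1) by (auto simp: metrizable_space_def)
  then have "topspace X = M"
    by (simp add: Metric_space.topspace_mtopology)
  then interpret Cech_comparison M d G
    using assms \<open>Metric_space M d\<close> unfolding compact_space_def
    by (intro Cech_comparison.intro compact_in_metric.intro compact_in_metric_axioms.intro)
      (simp_all add: X)
  show ?thesis
    unfolding X by (rule AS_iso_Cech)
qed

section \<open>Finite-dimensional normed spaces\<close>

locale finite_dim =
  fixes B :: "'e::real_normed_vector set"
  assumes finite: "finite B" and indep: "independent B" and span: "span B = UNIV"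
begin

definition coord :: "'e \<Rightarrow> 'e \<Rightarrow> real" where "coord v b = representation B v b"

lemma sum_coord: "(\<Sum>b\<in>B. coord v b *\<^sub>R b) = v"
  unfolding coord_def using real_vector.sum_representation_eq[OF indep _ finite order_refl, of v] span by simp

lemma linear_coord: "linear (\<lambda>v. coord v b)"
  unfolding coord_def
  by (rule linearI) (use span indep in \<open>simp_all add: real_vector.representation_add real_vector.representation_scale\<close>)

abbreviation comb :: "('e \<Rightarrow> real) \<Rightarrow> 'e" where "comb x \<equiv> \<Sum>b\<in>B. x b *\<^sub>R b"

lemma continuous_comb: "continuous_on UNIV comb"
  by (intro continuous_intros continuous_on_product_coordinates)

lemma compact_box: "compact {x::'e \<Rightarrow> real. \<forall>i. x i \<in> {-r..r}}"
proof -
  have "compactin (product_topology (\<lambda>i::'e. euclideanreal) UNIV) (PiE UNIV (\<lambda>i. {-r..r}))"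
    by (simp add: compactin_PiE)
  then show ?thesis
    by (simp add: euclidean_product_topology PiE_def Pi_def)
qed

text \<open>Equivalence of norms. On coordinate vectors of maximum norm 1 the norm of
  \<open>comb x\<close> is positive by independence and attains a minimum \<open>m\<close>;
  rescaling gives the bound \<open>1/m\<close>. Coordinates are indexed by the whole type, so
  compactness of the box is Tychonoff's theorem.\<close>

lemma coord_bound: "\<exists>C>0. \<forall>v. \<forall>b\<in>B. \<bar>coord v b\<bar> \<le> C * norm v"
proof (cases "B = {}")
  case False
  let ?S = "{x::'e \<Rightarrow> real. \<forall>i. x i \<in> {-1..1}} \<inter> (\<Union>b\<in>B. {x. \<bar>x b\<bar> = 1})"
  have "closed {x::'e \<Rightarrow> real. \<bar>x b\<bar> = 1}" for b
    by (intro closed_Collect_eq continuous_intros continuous_on_product_coordinates)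
  then have "compact ?S"
    using finite by (intro compact_Int_closed compact_box closed_UN) auto
  moreover have "(\<lambda>_. 1) \<in> ?S" using False by auto
  then have "?S \<noteq> {}" by (metis (no_types) empty_iff)
  moreover have "continuous_on ?S (\<lambda>x. norm (comb x))"
    by (intro continuous_intros continuous_on_subset[OF continuous_comb]) auto
  ultimately have "\<exists>x0\<in>?S. \<forall>x\<in>?S. norm (comb x0) \<le> norm (comb x)"
    by (rule continuous_attains_inf)
  then obtain x0 where x0: "x0 \<in> ?S" and x0_min: "\<forall>x\<in>?S. norm (comb x0) \<le> norm (comb x)"
    by (rule bexE)
  note min = bspec[OF x0_min]
  define m where "m = norm (comb x0)"
  have "comb x0 \<noteq> 0"
  proof
    assume 0: "comb x0 = 0"
    have "x0 b = 0" if "b \<in> B" for b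
      using real_vector.independentD[OF indep finite order_refl 0 that] .
    then show False using x0 by auto
  qed
  then have m: "m > 0" by (simp add: m_def)
  have "\<bar>coord v b\<bar> \<le> (1/m) * norm v" if b: "b \<in> B" for v b
  proof (cases "v = 0")
    case True
    then show ?thesis by (simp add: linear_0[OF linear_coord])
  next
    case v: False
    define \<mu> where "\<mu> = Max ((\<lambda>b. \<bar>coord v b\<bar>) ` B)"
    have le: "\<bar>coord v b\<bar> \<le> \<mu>" if "b \<in> B" for b
      unfolding \<mu>_def using finite that by simp
    have "\<mu> \<in> (\<lambda>b. \<bar>coord v b\<bar>) ` B"
      unfolding \<mu>_def using finite False by (intro Max_in) auto
    then obtain b0 where b0: "b0 \<in> B" "\<mu> = \<bar>coord v b0\<bar>" by blast
    have "\<mu> > 0"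
    proof (rule ccontr)
      assume "\<not> \<mu> > 0"
      then have "coord v b = 0" if "b \<in> B" for b using le[OF that] by auto
      then show False using sum_coord[of v] v by simp
    qed
    define x where "x b = (if b \<in> B then coord v b / \<mu> else 0)" for b
    have "x \<in> ?S"
    proof (intro IntI CollectI allI UN_I[of b0])
      have "\<bar>x i\<bar> \<le> 1" for i
        using le[of i] \<open>\<mu> > 0\<close> by (simp add: x_def)
      then show "x i \<in> {-1..1}" for i by (simp add: abs_le_iff minus_le_iff)
      show "\<bar>x b0\<bar> = 1" using b0 \<open>\<mu> > 0\<close> by (simp add: x_def)
    qed (rule b0(1))
    from min[OF this] have "m \<le> norm (comb x)" by (simp add: m_def)
    also have "comb x = (1/\<mu>) *\<^sub>R v"
      by (subst (3) sum_coord[symmetric]) (simp add: x_def scaleR_sum_right)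
    finally have "m * \<mu> \<le> norm v"
      using \<open>\<mu> > 0\<close> by (simp add: field_simps)
    then have "\<mu> \<le> norm v / m" using m by (simp add: field_simps)
    then show ?thesis using le[OF b] by simp
  qed
  then show ?thesis using m by (intro exI[of _ "1/m"]) auto
qed (auto intro: exI[of _ 1])

lemma bounded_linear_coord: "b \<in> B \<Longrightarrow> bounded_linear (\<lambda>v. coord v b)"
proof -
  assume b: "b \<in> B"
  obtain C where "\<And>v. \<bar>coord v b\<bar> \<le> C * norm v" using coord_bound b by blast
  then show ?thesis
    using linear_coord[of b] by (intro bounded_linear_intro[of _ C]) (auto simp: linear_iff mult.commute)
qed

text \<open>The ball is a closed part of the image of a compact box of coordinates.\<close>

lemma compact_cball: "compact (cball (a::'e) r)"
proof -
  obtain C where C: "C > 0" "\<And>v b. b \<in> B \<Longrightarrow> \<bar>coord v b\<bar> \<le> C * norm v" using coord_bound by blast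
  let ?K = "comb ` {x::'e \<Rightarrow> real. \<forall>i. x i \<in> {-(C * r)..C * r}}"
  have K: "compact ?K"
    by (intro compact_continuous_image compact_box continuous_on_subset[OF continuous_comb]) auto
  have "cball 0 r \<subseteq> ?K"
  proof
    fix v :: 'e assume v: "v \<in> cball 0 r"
    have "r \<ge> 0" using v order_trans[OF norm_ge_zero[of v]] by (simp add: dist_norm)
    have "\<bar>coord v b\<bar> \<le> C * r" if "b \<in> B" for b
      using order_trans[OF C(2)[OF that, of v] mult_left_mono[of "norm v" r C]] v C(1) by simp
    then have "(if b \<in> B then coord v b else 0) \<in> {-(C * r)..C * r}" for b
      using C(1) \<open>r \<ge> 0\<close> by (simp add: abs_le_iff minus_le_iff)
    then have x: "(\<lambda>b. if b \<in> B then coord v b else 0) \<in> {x. \<forall>i. x i \<in> {-(C * r)..C * r}}"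
      by (intro CollectI allI)
    have "v = comb (\<lambda>b. if b \<in> B then coord v b else 0)"
      using sum_coord[of v] by simp
    then show "v \<in> ?K" using x by (rule image_eqI)
  qed
  then have "?K \<inter> cball 0 r = cball 0 r" by blast
  then have "compact (cball (0::'e) r)"
    using compact_Int_closed[OF K closed_cball[of 0 r]] by simp
  then have "compact ((+) a ` cball 0 r)" by (rule compact_translation)
  then show ?thesis by (simp add: image_add_cball)
qed

lemma linear_bound:
  fixes f :: "'e \<Rightarrow> 'f::real_normed_vector"
  assumes "linear f" and "\<And>b. b \<in> B \<Longrightarrow> norm (f b) \<le> C"
    and "\<And>v b. b \<in> B \<Longrightarrow> \<bar>coord v b\<bar> \<le> D * norm v"
  shows "norm (f v) \<le> (real (card B) * C * D) * norm v"
proof -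
  have "f v = (\<Sum>b\<in>B. coord v b *\<^sub>R f b)"
    by (subst sum_coord[of v, symmetric]) (simp add: linear_sum[OF assms(1)] linear_cmul[OF assms(1)])
  also have "norm \<dots> \<le> (\<Sum>b\<in>B. (D * norm v) * C)"
  proof (rule sum_norm_le)
    fix b assume b: "b \<in> B"
    have "0 \<le> D * norm v" using assms(3)[OF b, of v] by linarith
    then show "norm (coord v b *\<^sub>R f b) \<le> (D * norm v) * C"
      using assms(2,3)[OF b] by (simp add: mult_mono)
  qed
  finally show ?thesis by (simp add: algebra_simps)
qed

end

lemma finite_dim_exists:
  assumes "finite (B :: 'e::real_normed_vector set)" "span B = UNIV"
  shows "\<exists>B :: 'e set. finite_dim B"
proof -
  obtain B' where "B' \<subseteq> B" "independent B'" "B \<subseteq> span B'"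
    using real_vector.maximal_independent_subset[of B] by blast
  then have "finite_dim B'"
    using assms finite_subset[of B' B] real_vector.span_mono[of B "span B'"]
    by (intro finite_dim.intro) (auto simp: real_vector.span_span)
  then show ?thesis by blast
qed

section \<open>Topology of manifolds\<close>

text \<open>Separating functions for pairs of basic open sets embed the space into a countable power of
  the real line.\<close>

theorem regular_second_countable_metrizable:
  assumes "regular_space X" "Hausdorff_space X" "second_countable X"
  shows "metrizable_space X"
proof -
  obtain \<B> where \<B>: "countable \<B>" "\<And>V. V \<in> \<B> \<Longrightarrow> openin X V"
    and base: "\<And>U x. openin X U \<Longrightarrow> x \<in> U \<Longrightarrow> \<exists>V\<in>\<B>. x \<in> V \<and> V \<subseteq> U"
    using assms(3) unfolding second_countable_def by metis
  have normal: "normal_space X"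
    using regular_second_countable_imp_hereditarily_normal_space[of X] assms
    unfolding hereditarily by (metis order_refl subtopology_topspace)
  define P where "P = {(U, V). U \<in> \<B> \<and> V \<in> \<B> \<and> X closure_of U \<subseteq> V}"
  have "P \<subseteq> \<B> \<times> \<B>" by (auto simp: P_def)
  then have P: "countable P" by (rule countable_subset) (use \<B>(1) in simp)
  have "\<exists>f. continuous_map X euclideanreal f \<and> f ` (X closure_of fst q) \<subseteq> {0} \<and> f ` (topspace X - snd q) \<subseteq> {1}"
    if q: "q \<in> P" for q
  proof -
    have "closedin X (X closure_of fst q)" "closedin X (topspace X - snd q)"
      using q \<B>(2) by (auto simp: P_def)
    moreover have "disjnt (X closure_of fst q) (topspace X - snd q)"
      using q by (auto simp: P_def disjnt_def)
    ultimately show ?thesis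
      using normal unfolding normal_space_iff_Urysohn_alt by blast
  qed
  then obtain f where f: "\<And>q. q \<in> P \<Longrightarrow> continuous_map X euclideanreal (f q)"
    "\<And>q. q \<in> P \<Longrightarrow> f q ` (X closure_of fst q) \<subseteq> {0}" "\<And>q. q \<in> P \<Longrightarrow> f q ` (topspace X - snd q) \<subseteq> {1}"
    by metis
  let ?Y = "product_topology (\<lambda>_. euclideanreal) P"
  define e where "e x = (\<lambda>q\<in>P. f q x)" for x
  have cont: "continuous_map X ?Y e"
    using f(1) by (auto simp: continuous_map_componentwise e_def)
  have base_closed: "\<exists>U C. openin X U \<and> closedin X C \<and> x \<in> U \<and> U \<subseteq> C \<and> C \<subseteq> W" if "openin X W" "x \<in> W" for W x
    using assms(1) that unfolding neighbourhood_base_of_closedin[symmetric] by (simp add: neighbourhood_base_of)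
  \<comment> \<open>This is openness onto the image: a pair of basic sets around \<open>x\<close>
    inside \<open>W\<close> yields a coordinate that is 0 at \<open>x\<close> and 1 outside
    \<open>W\<close>.\<close>
  have sep: "\<exists>N. openin ?Y N \<and> e x \<in> N \<and> (\<forall>y\<in>topspace X. e y \<in> N \<longrightarrow> y \<in> W)" if W: "openin X W" "x \<in> W" for W x
  proof -
    obtain V where V: "V \<in> \<B>" "x \<in> V" "V \<subseteq> W" using base[OF W] by blast
    obtain U0 C where U0: "openin X U0" "closedin X C" "x \<in> U0" "U0 \<subseteq> C" "C \<subseteq> V"
      using base_closed \<B>(2)[OF V(1)] V(2) by metis
    obtain U where U: "U \<in> \<B>" "x \<in> U" "U \<subseteq> U0" using base[OF U0(1,3)] by blast
    have "X closure_of U \<subseteq> V"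
      using closure_of_minimal[of U C X] U U0 by blast
    then have q: "(U, V) \<in> P" using U V by (simp add: P_def)
    let ?N = "{z \<in> topspace ?Y. z (U, V) \<in> {..<1}}"
    have "openin ?Y ?N"
      by (rule openin_continuous_map_preimage[OF continuous_map_product_projection[OF q]]) simp
    moreover have "x \<in> topspace X" using W openin_subset by blast
    moreover have "x \<in> X closure_of U"
      using U(2) closure_of_subset[OF openin_subset[OF \<B>(2)[OF U(1)]]] by blast
    then have "f (U, V) x = 0" using f(2)[OF q] by auto
    then have "e x \<in> ?N" using q by (simp add: e_def)
    moreover have "y \<in> W" if "y \<in> topspace X" "e y \<in> ?N" for y
    proof (rule ccontr)
      assume "y \<notin> W"
      then have "f (U, V) y = 1" using f(3)[OF q] that(1) V(3) by auto
      then show False using that(2) q by (simp add: e_def)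
    qed
    ultimately show ?thesis by blast
  qed
  have inj: "inj_on e (topspace X)"
  proof (rule inj_onI, rule ccontr)
    fix x y assume xy: "x \<in> topspace X" "y \<in> topspace X" "e x = e y" "x \<noteq> y"
    then obtain W where "openin X W" "x \<in> W" "y \<notin> W"
      using assms(2) by (metis Hausdorff_space_def disjnt_iff)
    then show False using sep xy by metis
  qed
  have "open_map X (subtopology ?Y (e ` topspace X)) e"
    unfolding open_map_def
  proof (intro allI impI)
    fix W assume W: "openin X W"
    have "\<exists>T. openin (subtopology ?Y (e ` topspace X)) T \<and> z \<in> T \<and> T \<subseteq> e ` W" if z: "z \<in> e ` W" for z
    proof -
      obtain x where x: "x \<in> W" "z = e x" using z by (rule imageE)
      obtain N where N: "openin ?Y N" "e x \<in> N" "\<And>y. y \<in> topspace X \<Longrightarrow> e y \<in> N \<Longrightarrow> y \<in> W"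
        using sep[OF W x(1)] by blast
      have "x \<in> topspace X" using x W openin_subset by blast
      then show ?thesis
        using N x by (intro exI[of _ "N \<inter> e ` topspace X"]) (auto intro: openin_subtopology_Int)
    qed
    then show "openin (subtopology ?Y (e ` topspace X)) (e ` W)"
      by (subst openin_subopen) blast
  qed
  then have "homeomorphic_map X (subtopology ?Y (e ` topspace X)) e"
    using cont inj continuous_map_image_subset_topspace[OF cont]
    by (intro bijective_open_imp_homeomorphic_map) (auto simp: continuous_map_in_subtopology)
  moreover have "metrizable_space ?Y"
    unfolding metrizable_space_product_topology
    using countable_subset[OF _ P] by (auto intro!: metrizable_space_euclidean countable_subset[OF _ P])
  ultimately show ?thesis
    using homeomorphic_metrizable_space homeomorphic_map_imp_homeomorphic_space metrizable_space_subtopology by metis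
qed

section \<open>Charts, local compactness and HLC of manifolds\<close>

locale manifold =
  fixes X :: "'a topology" and A :: "('a, 'e::real_normed_vector) chart set"
  assumes manifold: "smooth_manifold X A"
begin

lemma chart:
  assumes "c \<in> A"
  shows "openin X (fst c)" "open (snd c ` fst c)"
    "homeomorphic_maps (subtopology X (fst c)) (top_of_set (snd c ` fst c)) (snd c) (chart_inv c)"
proof -
  show U: "openin X (fst c)" "open (snd c ` fst c)"
    using manifold assms by (auto simp: smooth_manifold_def)
  have top: "topspace (subtopology X (fst c)) = fst c"
    using openin_subset[OF U(1)] by auto
  have hom: "homeomorphic_map (subtopology X (fst c)) (top_of_set (snd c ` fst c)) (snd c)"
    using manifold assms by (auto simp: smooth_manifold_def)
  then obtain g where g: "homeomorphic_maps (subtopology X (fst c)) (top_of_set (snd c ` fst c)) (snd c) g"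
    by (auto simp: homeomorphic_map_maps)
  have inj: "inj_on (snd c) (fst c)"
    using hom top by (simp add: homeomorphic_eq_everything_map)
  have "g x = chart_inv c x" if x: "x \<in> snd c ` fst c" for x
  proof -
    obtain y where y: "y \<in> fst c" "x = snd c y" using x by blast
    then have "g x = y" using g top by (simp add: homeomorphic_maps_def)
    then show ?thesis using y inj by (simp add: chart_inv_def)
  qed
  then show "homeomorphic_maps (subtopology X (fst c)) (top_of_set (snd c ` fst c)) (snd c) (chart_inv c)"
    using homeomorphic_maps_eq[OF g, of "snd c" "chart_inv c"] by simp
qed

lemma topspace_chart: "c \<in> A \<Longrightarrow> topspace (subtopology X (fst c)) = fst c"
  by (rule topspace_subtopology_subset[OF openin_subset[OF chart(1)]])

lemma chart_inv_chart: "c \<in> A \<Longrightarrow> y \<in> fst c \<Longrightarrow> chart_inv c (snd c y) = y"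
  using chart(3)[of c] topspace_chart[of c] by (simp add: homeomorphic_maps_def)

lemma chart_chart_inv: "c \<in> A \<Longrightarrow> x \<in> snd c ` fst c \<Longrightarrow> snd c (chart_inv c x) = x"
  using chart_inv_chart by (metis imageE)

lemma chart_inv_in: "c \<in> A \<Longrightarrow> x \<in> snd c ` fst c \<Longrightarrow> chart_inv c x \<in> fst c"
  using chart_inv_chart by (metis imageE)

lemma continuous_chart: "c \<in> A \<Longrightarrow> continuous_map (subtopology X (fst c)) euclidean (snd c)"
  by (rule continuous_map_into_fulltopology[of _ _ "snd c ` fst c"])
    (use chart(3) in \<open>simp add: homeomorphic_maps_def\<close>)

lemma continuous_chart_inv: "c \<in> A \<Longrightarrow> continuous_map (top_of_set (snd c ` fst c)) X (chart_inv c)"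
  by (rule continuous_map_into_fulltopology[of _ _ "fst c"])
    (use chart(3) in \<open>simp add: homeomorphic_maps_def\<close>)

lemma openin_chart_preimage:
  assumes c: "c \<in> A" and "open T"
  shows "openin X {y \<in> fst c. snd c y \<in> T}"
proof -
  have "openin (subtopology X (fst c)) {y \<in> topspace (subtopology X (fst c)). snd c y \<in> T}"
    by (rule openin_continuous_map_preimage[OF continuous_chart[OF c]]) (simp add: assms)
  then show ?thesis
    using openin_trans_full[OF _ chart(1)[OF c]] by (simp only: topspace_chart[OF c])
qed

lemma open_chart_image:
  assumes c: "c \<in> A" and "openin X V"
  shows "open {x \<in> snd c ` fst c. chart_inv c x \<in> V}"
proof -
  have "openin (top_of_set (snd c ` fst c)) {x \<in> topspace (top_of_set (snd c ` fst c)). chart_inv c x \<in> V}"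
    by (rule openin_continuous_map_preimage[OF continuous_chart_inv[OF c] assms(2)])
  then show ?thesis
    using openin_open_trans[OF _ chart(2)[OF c]] by simp
qed

lemma chart_ball:
  assumes c: "c \<in> A" and y: "y \<in> fst c" and V: "openin X V" "y \<in> V"
  obtains r where "r > 0" "cball (snd c y) r \<subseteq> snd c ` fst c" "\<And>x. x \<in> cball (snd c y) r \<Longrightarrow> chart_inv c x \<in> V"
proof -
  have "open {x \<in> snd c ` fst c. chart_inv c x \<in> V}" by (rule open_chart_image[OF c V(1)])
  moreover have "snd c y \<in> {x \<in> snd c ` fst c. chart_inv c x \<in> V}"
    using y V(2) chart_inv_chart[OF c y] by simp
  ultimately obtain r where "r > 0" "cball (snd c y) r \<subseteq> {x \<in> snd c ` fst c. chart_inv c x \<in> V}"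
    using open_contains_cball by metis
  then show ?thesis using that[of r] by blast
qed

lemma chart_exists: "y \<in> topspace X \<Longrightarrow> \<exists>c\<in>A. y \<in> fst c"
  using manifold by (auto simp: smooth_manifold_def)

lemma basis_exists: "\<exists>B :: 'e set. finite_dim B"
  using manifold finite_dim_exists unfolding smooth_manifold_def by blast

lemma Hausdorff: "Hausdorff_space X" and second_countable: "second_countable X"
  using manifold by (simp_all add: smooth_manifold_def)

lemma locally_compact: "locally_compact_space X"
  unfolding locally_compact_space_def
proof
  fix y assume "y \<in> topspace X"
  then obtain c where c: "c \<in> A" "y \<in> fst c" using chart_exists by blast
  obtain B :: "'e set" where "finite_dim B" using basis_exists by blast
  then interpret finite_dim B .
  obtain r where r: "r > 0" "cball (snd c y) r \<subseteq> snd c ` fst c"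
    using chart_ball[OF c chart(1)[OF c(1)] c(2)] by metis
  have "compactin X (chart_inv c ` cball (snd c y) r)"
    by (rule image_compactin[OF _ continuous_chart_inv[OF c(1)]])
      (use r compact_cball in \<open>auto simp: compactin_subtopology\<close>)
  moreover have "{z \<in> fst c. snd c z \<in> ball (snd c y) r} \<subseteq> chart_inv c ` cball (snd c y) r"
  proof clarify
    fix z assume z: "z \<in> fst c" "snd c z \<in> ball (snd c y) r"
    then show "z \<in> chart_inv c ` cball (snd c y) r"
      using chart_inv_chart[OF c(1) z(1)] by (intro image_eqI[of _ _ "snd c z"]) auto
  qed
  moreover have "openin X {z \<in> fst c. snd c z \<in> ball (snd c y) r}"
    by (rule openin_chart_preimage[OF c(1) open_ball])
  ultimately show "\<exists>U K. openin X U \<and> compactin X K \<and> y \<in> U \<and> U \<subseteq> K"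
    using c(2) r(1) by (intro exI[of _ "{z \<in> fst c. snd c z \<in> ball (snd c y) r}"]
      exI[of _ "chart_inv c ` cball (snd c y) r"]) auto
qed

lemma metrizable: "metrizable_space X"
  using regular_second_countable_metrizable locally_compact_Hausdorff_imp_regular_space
    locally_compact Hausdorff second_countable by blast

text \<open>Preimages of small balls in a chart are contractible, so their reduced homology
  vanishes.\<close>

lemma HLC: "HLC X"
  unfolding HLC_iff_null_in
proof (intro ballI allI impI)
  fix y U assume y: "y \<in> topspace X" and "neighbourhood_of X {y} U"
  then obtain W where W: "openin X W" "y \<in> W" "W \<subseteq> U" by (auto simp: neighbourhood_of_def)
  obtain c where c: "c \<in> A" "y \<in> fst c" using chart_exists[OF y] by blast
  obtain r where r: "r > 0" "cball (snd c y) r \<subseteq> snd c ` fst c" "\<And>x. x \<in> cball (snd c y) r \<Longrightarrow> chart_inv c x \<in> W"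
    using chart_ball[OF c W(1,2)] by metis
  define V where "V = {z \<in> fst c. snd c z \<in> ball (snd c y) r}"
  have V: "openin X V" "y \<in> V"
    using openin_chart_preimage[OF c(1) open_ball] c(2) r(1) by (simp_all add: V_def)
  have VW: "V \<subseteq> W"
  proof
    fix z assume "z \<in> V"
    then show "z \<in> W" using r(3)[of "snd c z"] chart_inv_chart[OF c(1), of z] by (auto simp: V_def)
  qed
  have "homeomorphic_maps (subtopology X V) (top_of_set (ball (snd c y) r)) (snd c) (chart_inv c)"
  proof -
    have ball: "ball (snd c y) r \<subseteq> snd c ` fst c" using r(2) ball_subset_cball by blast
    have "homeomorphic_maps (subtopology (subtopology X (fst c)) V)
        (subtopology (top_of_set (snd c ` fst c)) (ball (snd c y) r)) (snd c) (chart_inv c)"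
    proof (rule homeomorphic_maps_subtopologies_alt[OF chart(3)[OF c(1)]])
      show "snd c ` (topspace (subtopology X (fst c)) \<inter> V) \<subseteq> ball (snd c y) r"
        by (auto simp: V_def)
      show "chart_inv c ` (topspace (top_of_set (snd c ` fst c)) \<inter> ball (snd c y) r) \<subseteq> V"
        using chart_inv_in[OF c(1)] chart_chart_inv[OF c(1)] by (auto simp: V_def chart_inv_chart[OF c(1)])
    qed
    moreover have "fst c \<inter> V = V" by (auto simp: V_def)
    moreover have "snd c ` fst c \<inter> ball (snd c y) r = ball (snd c y) r" using ball by blast
    ultimately show ?thesis
      by (simp add: subtopology_subtopology)
  qed
  then have "subtopology X V homeomorphic_space top_of_set (ball (snd c y) r)"
    by (auto simp: homeomorphic_space_def)
  then have "contractible_space (subtopology X V)"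
    using homeomorphic_space_contractibility convex_imp_contractible[OF convex_ball]
    by (metis contractible_space_top_of_set)
  then have "null_in X V V"
    unfolding trivial_homomorphism_iff_null_in[OF order_refl, symmetric] trivial_homomorphism_def
    using hom_induced_reduced_hom hom_induced_reduced trivial_reduced_homology_group_contractible_space
    by (metis group.trivial_group_alt group_reduced_homology_group singletonD subset_singletonD trivial_group_def)
  then show "\<exists>V. neighbourhood_of X {y} V \<and> V \<subseteq> U \<and> null_in X V U"
    using V VW W openin_subset[OF V(1)] null_in_mono[of X V V V U]
    by (intro exI[of _ V]) (auto simp: neighbourhood_of_def)
qed

end

section \<open>Smooth families of linear maps\<close>

lemma smooth_on_has_derivative:
  assumes "smooth_on S f" "x \<in> S"
  shows "(f has_derivative frechet_derivative f (at x)) (at x)"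
proof -
  have "Ck_on (Suc 0) S f" using assms(1) by (simp only: smooth_on_def)
  then show ?thesis using assms(2) by (simp add: frechet_derivative_works)
qed

lemma smooth_on_continuous_derivative:
  assumes "smooth_on S f"
  shows "continuous_on S (\<lambda>x. frechet_derivative f (at x) v)"
proof -
  have "Ck_on (Suc 0) S f" using assms(1) by (simp only: smooth_on_def)
  then show ?thesis by simp
qed

lemma smooth_on_imp_continuous_on: "smooth_on S f \<Longrightarrow> continuous_on S f"
  using Ck_on.simps(1) smooth_on_def by blast

context finite_dim
begin

lemma linear_expansion: "linear f \<Longrightarrow> f v = (\<Sum>b\<in>B. coord v b *\<^sub>R f b)"
  by (subst sum_coord[of v, symmetric]) (simp add: linear_sum linear_cmul)

lemma norm_le_coord:
  assumes "\<And>b. b \<in> B \<Longrightarrow> \<bar>coord v b\<bar> \<le> m"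
  shows "norm v \<le> (\<Sum>b\<in>B. norm b) * m"
proof -
  have "norm (\<Sum>b\<in>B. coord v b *\<^sub>R b) \<le> (\<Sum>b\<in>B. norm b * m)"
  proof (rule sum_norm_le)
    fix b assume "b \<in> B"
    from mult_right_mono[OF assms[OF this], of "norm b"]
    show "norm (coord v b *\<^sub>R b) \<le> norm b * m" by (simp add: mult.commute)
  qed
  then show ?thesis by (simp only: sum_coord sum_distrib_right)
qed

lemma continuous_on_coord: "continuous_on S f \<Longrightarrow> b \<in> B \<Longrightarrow> continuous_on S (\<lambda>x. coord (f x) b)"
  by (rule bounded_linear.continuous_on[OF bounded_linear_coord])

lemma bounded_linear_of_linear:
  fixes f :: "'e \<Rightarrow> 'f::real_normed_vector"
  assumes "linear f"
  shows "bounded_linear f"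
proof -
  obtain D where D: "\<And>v b. b \<in> B \<Longrightarrow> \<bar>coord v b\<bar> \<le> D * norm v" using coord_bound by blast
  have "norm (f v) \<le> (real (card B) * (\<Sum>b\<in>B. norm (f b)) * D) * norm v" for v
    by (rule linear_bound[OF assms _ D]) (use finite in \<open>auto intro: member_le_sum\<close>)
  then show ?thesis
    using assms by (intro bounded_linear_intro[of f "real (card B) * (\<Sum>b\<in>B. norm (f b)) * D"])
      (simp_all add: linear_iff mult.commute)
qed

text \<open>Expansion in the basis reduces the claim to continuity in the parameter for each fixed
  vector.\<close>

lemma continuous_on_linear_family:
  fixes T :: "'p::topological_space \<Rightarrow> 'e \<Rightarrow> 'f::real_normed_vector"
  assumes "\<And>v. continuous_on S (\<lambda>p. T p v)" "\<And>p. p \<in> S \<Longrightarrow> linear (T p)" "continuous_on S f"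
  shows "continuous_on S (\<lambda>p. T p (f p))"
proof -
  have "continuous_on S (\<lambda>p. \<Sum>b\<in>B. coord (f p) b *\<^sub>R T p b)"
    by (intro continuous_on_sum continuous_on_scaleR continuous_on_coord assms)
  then show ?thesis
    by (rule continuous_on_eq) (use assms(2) linear_expansion in metis)
qed

lemma bounded_linear_family:
  fixes T :: "'p::topological_space \<Rightarrow> 'e \<Rightarrow> 'f::real_normed_vector"
  assumes "\<And>v. continuous_on S (\<lambda>p. T p v)" "\<And>p. p \<in> S \<Longrightarrow> linear (T p)" "compact S"
  shows "\<exists>L\<ge>0. \<forall>p\<in>S. \<forall>v. norm (T p v) \<le> L * norm v"
proof -
  obtain D where D: "D > 0" "\<And>v b. b \<in> B \<Longrightarrow> \<bar>coord v b\<bar> \<le> D * norm v" using coord_bound by blast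
  have "\<exists>C. \<forall>p\<in>S. norm (T p b) \<le> C" for b
    using compact_imp_bounded[OF compact_continuous_image[OF assms(1,3)], of b] by (simp add: bounded_iff)
  then obtain C where C: "\<And>b p. p \<in> S \<Longrightarrow> norm (T p b) \<le> C b" by metis
  define M where "M = (\<Sum>b\<in>B. \<bar>C b\<bar>)"
  have M: "norm (T p b) \<le> M" if "p \<in> S" "b \<in> B" for p b
    using C[OF that(1), of b] member_le_sum[of b B "\<lambda>b. \<bar>C b\<bar>"] that finite by (simp add: M_def)
  have "M \<ge> 0" by (simp add: M_def sum_nonneg)
  show ?thesis
  proof (intro exI[of _ "real (card B) * M * D"] conjI ballI allI)
    show "0 \<le> real (card B) * M * D" using \<open>M \<ge> 0\<close> D(1) by simp
    fix p v assume "p \<in> S"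
    then show "norm (T p v) \<le> real (card B) * M * D * norm v"
      by (intro linear_bound assms M D(2))
  qed
qed

lemma Lipschitz_cball:
  fixes f :: "'e \<Rightarrow> 'f::real_normed_vector"
  assumes f: "smooth_on S f" and S: "cball a r \<subseteq> S"
  shows "\<exists>L\<ge>0. \<forall>x\<in>cball a r. \<forall>y\<in>cball a r. norm (f x - f y) \<le> L * norm (x - y)"
proof -
  have D: "(f has_derivative frechet_derivative f (at x)) (at x)" if "x \<in> cball a r" for x
    using smooth_on_has_derivative[OF f] that S by blast
  have "\<exists>L\<ge>0. \<forall>x\<in>cball a r. \<forall>v. norm (frechet_derivative f (at x) v) \<le> L * norm v"
    by (rule bounded_linear_family)
      (use continuous_on_subset[OF smooth_on_continuous_derivative[OF f] S] D compact_cball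
        in \<open>auto intro: has_derivative_linear\<close>)
  then obtain L where L: "L \<ge> 0" "\<And>x v. x \<in> cball a r \<Longrightarrow> norm (frechet_derivative f (at x) v) \<le> L * norm v"
    by blast
  have "norm (f x - f y) \<le> L * norm (x - y)" if "x \<in> cball a r" "y \<in> cball a r" for x y
  proof (rule differentiable_bound[OF convex_cball])
    show "(f has_derivative frechet_derivative f (at x)) (at x within cball a r)" if "x \<in> cball a r" for x
      by (rule has_derivative_at_withinI[OF D[OF that]])
    show "onorm (frechet_derivative f (at x)) \<le> L" if "x \<in> cball a r" for x
      by (rule onorm_bound[OF L(1) L(2)[OF that]])
  qed (use that in auto)
  then show ?thesis using L(1) by blast
qed

lemma Lipschitz_linear_family:
  fixes T :: "'e \<Rightarrow> 'e \<Rightarrow> 'f::real_normed_vector"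
  assumes "\<And>v. smooth_on S (\<lambda>x. T x v)" "\<And>x. x \<in> S \<Longrightarrow> linear (T x)" "cball a r \<subseteq> S"
  shows "\<exists>L\<ge>0. \<forall>x\<in>cball a r. \<forall>y\<in>cball a r. \<forall>v. norm (T x v - T y v) \<le> L * norm (x - y) * norm v"
proof -
  obtain D where D: "D > 0" "\<And>v b. b \<in> B \<Longrightarrow> \<bar>coord v b\<bar> \<le> D * norm v" using coord_bound by blast
  have "\<exists>L\<ge>0. \<forall>x\<in>cball a r. \<forall>y\<in>cball a r. norm (T x b - T y b) \<le> L * norm (x - y)" for b
    by (rule Lipschitz_cball[OF assms(1,3)])
  then obtain C where C: "\<And>b. C b \<ge> 0"
    "\<And>b x y. x \<in> cball a r \<Longrightarrow> y \<in> cball a r \<Longrightarrow> norm (T x b - T y b) \<le> C b * norm (x - y)"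
    by metis
  define M where "M = (\<Sum>b\<in>B. C b)"
  have M: "norm (T x b - T y b) \<le> M * norm (x - y)" if "x \<in> cball a r" "y \<in> cball a r" "b \<in> B" for x y b
  proof -
    have "C b \<le> M" using that(3) finite C(1) by (simp add: M_def member_le_sum)
    then have "C b * norm (x - y) \<le> M * norm (x - y)" by (simp add: mult_right_mono)
    then show ?thesis using C(2)[OF that(1,2), of b] by linarith
  qed
  have "M \<ge> 0" using C(1) by (simp add: M_def sum_nonneg)
  show ?thesis
  proof (intro exI[of _ "real (card B) * M * D"] conjI ballI allI)
    show "0 \<le> real (card B) * M * D" using \<open>M \<ge> 0\<close> D(1) by simp
    fix x y v assume xy: "x \<in> cball a r" "y \<in> cball a r"
    have "linear (\<lambda>v. T x v - T y v)"
      by (rule linear_compose_sub) (use assms xy in auto)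
    then have "norm (T x v - T y v) \<le> (real (card B) * (M * norm (x - y)) * D) * norm v"
      by (rule linear_bound) (use M xy D(2) in auto)
    then show "norm (T x v - T y v) \<le> real (card B) * M * D * norm (x - y) * norm v"
      by (simp add: mult_ac)
  qed
qed

end

section \<open>Orbits of the action\<close>

locale Cstar_manifold = manifold X A
  for X :: "'a topology" and A :: "('a, 'e::real_normed_vector) chart set" +
  fixes \<omega> :: "('a, 'e) two_form" and J :: "('a, 'e) endo_field" and act :: "'a Cstar_action"
  assumes Cstar: "symplectic_Cstar_manifold X A \<omega> J act"
begin

lemma action: "smooth_Cstar_action X A act" and acs: "almost_complex_structure A J"
  and hol: "pseudoholomorphic_action A J act" and comp: "compatible A \<omega> J"
  and form: "is_two_form A \<omega>" and moment: "\<exists>H. moment_map X A \<omega> act H"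
  using Cstar by (simp_all add: symplectic_Cstar_manifold_def symplectic_form_def)

lemma act_one: "y \<in> topspace X \<Longrightarrow> act 1 y = y"
  and act_act: "s \<noteq> 0 \<Longrightarrow> t \<noteq> 0 \<Longrightarrow> y \<in> topspace X \<Longrightarrow> act s (act t y) = act (s * t) y"
  and act_continuous: "continuous_map (prod_topology (top_of_set (- {0})) X) X (\<lambda>(t, y). act t y)"
  using action by (simp_all add: smooth_Cstar_action_def)

lemma continuous_map_act:
  assumes "continuous_map Z euclidean f" "\<And>z. z \<in> topspace Z \<Longrightarrow> f z \<noteq> 0" "continuous_map Z X g"
  shows "continuous_map Z X (\<lambda>z. act (f z) (g z))"
proof -
  have "continuous_map Z (prod_topology (top_of_set (- {0})) X) (\<lambda>z. (f z, g z))"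
    using assms by (auto simp: continuous_map_paired continuous_map_in_subtopology)
  from continuous_map_compose[OF this act_continuous] show ?thesis by (simp add: o_def)
qed

lemma act_in: "t \<noteq> 0 \<Longrightarrow> y \<in> topspace X \<Longrightarrow> act t y \<in> topspace X"
  using continuous_map_funspace[OF act_continuous] by (fastforce simp: Pi_iff)

lemma continuous_map_act_fixed: "t \<noteq> 0 \<Longrightarrow> continuous_map X X (act t)"
  using continuous_map_act[of X "\<lambda>_. t" "\<lambda>y. y"] by simp

lemma homeomorphic_maps_act: "t \<noteq> 0 \<Longrightarrow> homeomorphic_maps X X (act t) (act (inverse t))"
  by (simp add: homeomorphic_maps_def continuous_map_act_fixed act_act act_one)

lemma continuous_map_orbit: "y \<in> topspace X \<Longrightarrow> continuous_map (top_of_set (- {0})) X (\<lambda>t. act t y)"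
  by (rule continuous_map_act) auto

lemma open_orbit_preimage:
  assumes "y \<in> topspace X" "openin X W"
  shows "open {t. t \<noteq> 0 \<and> act t y \<in> W}"
proof -
  have "openin (top_of_set (- {0})) {t \<in> topspace (top_of_set (- {0})). act t y \<in> W}"
    by (rule openin_continuous_map_preimage[OF continuous_map_orbit]) (use assms in auto)
  moreover have "{t \<in> topspace (top_of_set (- {0})). act t y \<in> W} = {t. t \<noteq> 0 \<and> act t y \<in> W}" by auto
  ultimately show ?thesis
    using openin_open_trans[of "- {0}" "{t. t \<noteq> 0 \<and> act t y \<in> W}"] by (simp add: open_Compl)
qed

section \<open>Derivatives of orbits and the two vector fields\<close>

abbreviation orbit_derivative :: "('a, 'e) chart \<Rightarrow> 'a \<Rightarrow> complex \<Rightarrow> complex \<Rightarrow> 'e" where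
  "orbit_derivative c y t \<equiv> frechet_derivative (\<lambda>t. snd c (act t y)) (at t)"

lemma action_chart_derivative:
  assumes "c \<in> A" "d \<in> A" "y \<in> fst c" "t \<noteq> 0" "act t y \<in> fst d"
  shows "(t, snd c y) \<in> action_chart_dom act c d"
    "(action_chart act c d has_derivative frechet_derivative (action_chart act c d) (at (t, snd c y)))
      (at (t, snd c y))"
proof -
  show dom: "(t, snd c y) \<in> action_chart_dom act c d"
    using assms chart_inv_chart[of c y] by (simp add: action_chart_dom_def)
  show "(action_chart act c d has_derivative frechet_derivative (action_chart act c d) (at (t, snd c y)))
      (at (t, snd c y))"
    by (rule smooth_on_has_derivative[OF _ dom]) (use action assms in \<open>auto simp: smooth_Cstar_action_def\<close>)
qed

lemma orbit_derivative_eq: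
  assumes "c \<in> A" "d \<in> A" "y \<in> fst c" "t \<noteq> 0" "act t y \<in> fst d"
  shows "((\<lambda>t. snd d (act t y)) has_derivative
      (\<lambda>\<tau>. frechet_derivative (action_chart act c d) (at (t, snd c y)) (\<tau>, 0))) (at t)"
    "orbit_derivative d y t = (\<lambda>\<tau>. frechet_derivative (action_chart act c d) (at (t, snd c y)) (\<tau>, 0))"
proof -
  let ?D = "frechet_derivative (action_chart act c d) (at (t, snd c y))"
  have "((\<lambda>t. (t, snd c y)) has_derivative (\<lambda>\<tau>. (\<tau>, 0))) (at t)"
    by (auto intro!: derivative_eq_intros)
  then have "((action_chart act c d \<circ> (\<lambda>t. (t, snd c y))) has_derivative (?D \<circ> (\<lambda>\<tau>. (\<tau>, 0)))) (at t)"
    by (rule diff_chain_at) (use action_chart_derivative(2)[OF assms] in simp)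
  moreover have "action_chart act c d \<circ> (\<lambda>t. (t, snd c y)) = (\<lambda>t. snd d (act t y))"
    using chart_inv_chart[OF assms(1,3)] by (auto simp: action_chart_def)
  ultimately show *: "((\<lambda>t. snd d (act t y)) has_derivative (\<lambda>\<tau>. ?D (\<tau>, 0))) (at t)"
    by (simp add: o_def)
  from frechet_derivative_at[OF *] show "orbit_derivative d y t = (\<lambda>\<tau>. ?D (\<tau>, 0))" by simp
qed

lemma orbit_has_derivative:
  assumes "d \<in> A" "y \<in> topspace X" "t \<noteq> 0" "act t y \<in> fst d"
  shows "((\<lambda>t. snd d (act t y)) has_derivative orbit_derivative d y t) (at t)"
proof -
  obtain c where "c \<in> A" "y \<in> fst c" using chart_exists assms(2) by blast
  then show ?thesis using orbit_derivative_eq[of c d y t] assms by simp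
qed

lemma linear_orbit_derivative:
  assumes "d \<in> A" "y \<in> topspace X" "t \<noteq> 0" "act t y \<in> fst d"
  shows "linear (orbit_derivative d y t)"
  using has_derivative_linear[OF orbit_has_derivative[OF assms]] .

lemma J_linear: "c \<in> A \<Longrightarrow> y \<in> fst c \<Longrightarrow> linear (J c y)"
  and J_J: "c \<in> A \<Longrightarrow> y \<in> fst c \<Longrightarrow> J c y (J c y v) = - v"
  using acs by (simp_all add: almost_complex_structure_def)

text \<open>Pseudoholomorphy of the action map, tested on vectors tangent to the group
  factor.\<close>

lemma orbit_derivative_holomorphic:
  assumes "d \<in> A" "y \<in> topspace X" "t \<noteq> 0" "act t y \<in> fst d"
  shows "orbit_derivative d y t (\<i> * \<tau>) = J d (act t y) (orbit_derivative d y t \<tau>)"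
proof -
  obtain c where c: "c \<in> A" "y \<in> fst c" using chart_exists assms(2) by blast
  let ?D = "frechet_derivative (action_chart act c d) (at (t, snd c y))"
  have "?D (\<i> * \<tau>, J c (chart_inv c (snd c y)) 0) = J d (act t (chart_inv c (snd c y))) (?D (\<tau>, 0))"
    using hol c(1) assms(1) action_chart_derivative(1)[OF c(1) assms(1) c(2) assms(3,4)]
    unfolding pseudoholomorphic_action_def by fastforce
  then show ?thesis
    using orbit_derivative_eq(2)[OF c(1) assms(1) c(2) assms(3,4)] linear_0[OF J_linear[OF c]]
    by (simp add: chart_inv_chart[OF c])
qed

lemma continuous_orbit_derivative:
  assumes "d \<in> A" "y \<in> topspace X"
  shows "continuous_on {t. t \<noteq> 0 \<and> act t y \<in> fst d} (\<lambda>t. orbit_derivative d y t \<tau>)"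
proof -
  obtain c where c: "c \<in> A" "y \<in> fst c" using chart_exists assms(2) by blast
  let ?S = "{t. t \<noteq> 0 \<and> act t y \<in> fst d}"
  have "continuous_on (action_chart_dom act c d)
      (\<lambda>p. frechet_derivative (action_chart act c d) (at p) (\<tau>, 0))"
    by (rule smooth_on_continuous_derivative) (use action assms(1) c(1) in \<open>auto simp: smooth_Cstar_action_def\<close>)
  moreover have "continuous_on ?S (\<lambda>t. (t, snd c y))" by (intro continuous_intros)
  moreover have "(\<lambda>t. (t, snd c y)) ` ?S \<subseteq> action_chart_dom act c d"
    using action_chart_derivative(1)[OF c(1) assms(1) c(2)] by auto
  ultimately have "continuous_on ?S (\<lambda>t. frechet_derivative (action_chart act c d) (at (t, snd c y)) (\<tau>, 0))"
    using continuous_on_compose2 by fastforce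
  then show ?thesis
    by (rule continuous_on_eq) (use orbit_derivative_eq(2)[OF c(1) assms(1) c(2)] in auto)
qed

lemma vector_derivative_orbit:
  assumes "d \<in> A" "y \<in> topspace X" "t \<noteq> 0" "act t y \<in> fst d"
    and g: "(g has_vector_derivative g') (at s)" "g s = t"
  shows "((\<lambda>s. snd d (act (g s) y)) has_vector_derivative orbit_derivative d y t g') (at s)"
proof -
  have "(((\<lambda>t. snd d (act t y)) \<circ> g) has_derivative (orbit_derivative d y t \<circ> (\<lambda>h. h *\<^sub>R g'))) (at s)"
    by (rule diff_chain_at) (use g orbit_has_derivative[OF assms(1-4)] in \<open>auto simp: has_vector_derivative_def\<close>)
  then show ?thesis
    by (simp add: has_vector_derivative_def o_def linear_cmul[OF linear_orbit_derivative[OF assms(1-4)]])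
qed

lemma S1_field_orbit:
  assumes "d \<in> A" "y \<in> topspace X" "t \<noteq> 0" "act t y \<in> fst d"
  shows "S1_field act d (act t y) = orbit_derivative d y t (\<i> * t)"
proof -
  have "((\<lambda>\<theta>. cis \<theta> * t) has_vector_derivative (\<i> * t)) (at 0)"
    unfolding has_vector_derivative_def
    by (auto intro!: derivative_eq_intros simp: mult.commute scaleR_conv_of_real)
  from vector_derivative_orbit[OF assms this] have
    "((\<lambda>\<theta>. snd d (act (cis \<theta> * t) y)) has_vector_derivative orbit_derivative d y t (\<i> * t)) (at 0)"
    by simp
  then show ?thesis
    unfolding S1_field_def using assms(2,3) by (intro vector_derivative_at) (simp add: act_act)
qed

lemma Rplus_field_orbit:
  assumes "d \<in> A" "y \<in> topspace X" "t \<noteq> 0" "act t y \<in> fst d"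
  shows "Rplus_field act d (act t y) = orbit_derivative d y t t"
proof -
  have "((\<lambda>s. complex_of_real (exp s) * t) has_vector_derivative t) (at 0)"
    unfolding has_vector_derivative_def
    by (auto intro!: derivative_eq_intros simp: mult.commute scaleR_conv_of_real)
  from vector_derivative_orbit[OF assms this] have
    "((\<lambda>s. snd d (act (complex_of_real (exp s) * t) y)) has_vector_derivative orbit_derivative d y t t) (at 0)"
    by simp
  then show ?thesis
    unfolding Rplus_field_def using assms(2,3) by (intro vector_derivative_at) (simp add: act_act)
qed

lemma S1_field_J: "d \<in> A \<Longrightarrow> y \<in> fst d \<Longrightarrow> S1_field act d y = J d y (Rplus_field act d y)"
  using S1_field_orbit[of d y 1] Rplus_field_orbit[of d y 1] orbit_derivative_holomorphic[of d y 1 1]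
    openin_subset[OF chart(1)] act_one by (simp add: subset_iff)

text \<open>The group is commutative, so \<open>act t\<close> carries the circle through
  \<open>y\<close> to the circle through \<open>act t y\<close>; differentiation at angle 0 gives
  the formula.\<close>

lemma S1_field_transport:
  assumes "c \<in> A" "d \<in> A" "y \<in> fst c" "t \<noteq> 0" "act t y \<in> fst d"
  shows "S1_field act d (act t y) =
    frechet_derivative (action_chart act c d) (at (t, snd c y)) (0, S1_field act c y)"
proof -
  let ?D = "frechet_derivative (action_chart act c d) (at (t, snd c y))"
  have y: "y \<in> topspace X" using assms(1,3) openin_subset[OF chart(1)] by blast
  have "(cis has_vector_derivative \<i>) (at 0)"
    unfolding has_vector_derivative_def
    by (auto intro!: derivative_eq_intros simp: mult.commute scaleR_conv_of_real)
  then have S: "((\<lambda>\<theta>. snd c (act (cis \<theta>) y)) has_vector_derivative S1_field act c y) (at 0)"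
    using vector_derivative_orbit[OF assms(1) y, of 1 cis \<i> 0] S1_field_orbit[OF assms(1) y, of 1] assms(3) act_one[OF y]
    by simp
  have "((\<lambda>\<theta>. (t, snd c (act (cis \<theta>) y))) has_derivative (\<lambda>h. (0, h *\<^sub>R S1_field act c y))) (at 0)"
    using S by (auto intro!: derivative_eq_intros simp: has_vector_derivative_def)
  then have "((action_chart act c d \<circ> (\<lambda>\<theta>. (t, snd c (act (cis \<theta>) y)))) has_derivative
      (?D \<circ> (\<lambda>h. (0, h *\<^sub>R S1_field act c y)))) (at 0)"
    by (rule diff_chain_at) (use action_chart_derivative(2)[OF assms] act_one[OF y] in simp)
  moreover have "?D \<circ> (\<lambda>h. (0, h *\<^sub>R S1_field act c y)) = (\<lambda>h. h *\<^sub>R ?D (0, S1_field act c y))"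
  proof
    fix h :: real
    have "?D (h *\<^sub>R (0, S1_field act c y)) = h *\<^sub>R ?D (0, S1_field act c y)"
      by (rule linear_cmul[OF has_derivative_linear[OF action_chart_derivative(2)[OF assms]]])
    then show "(?D \<circ> (\<lambda>h. (0, h *\<^sub>R S1_field act c y))) h = h *\<^sub>R ?D (0, S1_field act c y)" by simp
  qed
  ultimately have D: "((\<lambda>\<theta>. snd d (act t (chart_inv c (snd c (act (cis \<theta>) y))))) has_derivative
      (\<lambda>h. h *\<^sub>R ?D (0, S1_field act c y))) (at 0)"
    by (simp add: o_def action_chart_def)
  have "\<forall>\<^sub>F \<theta> in nhds (0::real). cis \<theta> \<in> {t. t \<noteq> 0 \<and> act t y \<in> fst c}"
  proof (rule topological_tendstoD)
    show "(cis \<longlongrightarrow> cis 0) (nhds 0)" by (intro tendsto_intros filterlim_ident)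
    show "open {t. t \<noteq> 0 \<and> act t y \<in> fst c}" by (rule open_orbit_preimage[OF y chart(1)[OF assms(1)]])
  qed (use assms(3) act_one[OF y] in simp)
  then have ev: "\<forall>\<^sub>F \<theta> in nhds 0. snd d (act t (chart_inv c (snd c (act (cis \<theta>) y)))) = snd d (act (cis \<theta>) (act t y))"
    by (rule eventually_mono) (use assms(1,4) y chart_inv_chart in \<open>auto simp: act_act mult.commute\<close>)
  have "((\<lambda>\<theta>. snd d (act (cis \<theta>) (act t y))) has_derivative (\<lambda>h. h *\<^sub>R ?D (0, S1_field act c y))) (at 0)"
    by (rule has_derivative_transform_eventually[OF D])
      (use ev eventually_nhds_x_imp_x[OF ev] in \<open>auto simp: eventually_at_filter elim: eventually_mono\<close>)
  then show ?thesis
    unfolding S1_field_def by (intro vector_derivative_at) (simp add: has_vector_derivative_def)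
qed

text \<open>By the tube lemma. It is applied to the unit circle and to compact intervals of
  times.\<close>

lemma openin_act_compact:
  assumes T: "compact T" "0 \<notin> T" and W: "openin X W"
  shows "openin X {y \<in> topspace X. \<forall>t\<in>T. act t y \<in> W}"
proof (subst openin_subopen, clarify)
  fix y assume y: "y \<in> topspace X" and yW: "\<forall>t\<in>T. act t y \<in> W"
  let ?Z = "prod_topology (top_of_set (- {0::complex})) X"
  let ?W = "{p \<in> topspace ?Z. (case p of (t, y) \<Rightarrow> act t y) \<in> W}"
  have oW: "openin ?Z ?W" by (rule openin_continuous_map_preimage[OF act_continuous W])
  have T': "compactin (top_of_set (- {0})) T" using T by (auto simp: compactin_subtopology)
  have TW: "T \<times> {y} \<subseteq> ?W" using yW y T(2) by auto
  obtain U V where UV: "openin X V" "T \<subseteq> U" "y \<in> V" "U \<times> V \<subseteq> ?W"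
    using tube_lemma_left[OF oW T' y TW] by (elim exE conjE)
  have "V \<subseteq> {y \<in> topspace X. \<forall>t\<in>T. act t y \<in> W}"
  proof (intro subsetI CollectI conjI ballI)
    fix x assume x: "x \<in> V"
    then show "x \<in> topspace X" using UV(1) openin_subset by blast
    fix t assume "t \<in> T"
    then have "(t, x) \<in> ?W" using x UV(2,4) by blast
    then show "act t x \<in> W" by simp
  qed
  then show "\<exists>V. openin X V \<and> y \<in> V \<and> V \<subseteq> {y \<in> topspace X. \<forall>t\<in>T. act t y \<in> W}"
    using UV by blast
qed

text \<open>The derivative intertwines \<open>\<i>\<close> with \<open>J\<close> and vanishes on
  \<open>\<i> * t\<close>, which spans the complex line.\<close>

lemma orbit_derivative_zero:
  assumes "d \<in> A" "y \<in> topspace X" "t \<noteq> 0" "act t y \<in> fst d" and S: "S1_field act d (act t y) = 0"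
  shows "orbit_derivative d y t \<tau> = 0"
proof -
  let ?D = "orbit_derivative d y t"
  have lin: "linear ?D" by (rule linear_orbit_derivative[OF assms(1-4)])
  have it: "?D (\<i> * t) = 0" using S1_field_orbit[OF assms(1-4)] S by simp
  have "?D (\<i> * (\<i> * t)) = 0"
    using orbit_derivative_holomorphic[OF assms(1-4), of "\<i> * t"] it linear_0[OF J_linear[OF assms(1,4)]]
    by (simp only:)
  moreover have "\<i> * (\<i> * t) = - t" by (simp flip: mult.assoc)
  ultimately have "?D (- t) = 0" by (simp only:)
  then have t: "?D t = 0" by (simp add: linear_neg[OF lin])
  have "\<tau> = (\<tau> / t) * t" using assms(3) by simp
  also have "\<dots> = Re (\<tau> / t) *\<^sub>R t + Im (\<tau> / t) *\<^sub>R (\<i> * t)"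
    by (subst complex_eq[of "\<tau> / t"]) (simp add: scaleR_conv_of_real algebra_simps)
  finally have "\<tau> = Re (\<tau> / t) *\<^sub>R t + Im (\<tau> / t) *\<^sub>R (\<i> * t)" .
  then have "?D \<tau> = Re (\<tau> / t) *\<^sub>R ?D t + Im (\<tau> / t) *\<^sub>R ?D (\<i> * t)"
    using linear_add[OF lin] linear_cmul[OF lin] by metis
  then show ?thesis by (simp add: t it)
qed

text \<open>The stabiliser of \<open>z\<close> is closed in the punctured plane, and it is open
  because the orbit map has derivative 0 near each of its points; the punctured plane is
  connected.\<close>

lemma S1_field_zero_imp_fixed:
  assumes c: "c \<in> A" "z \<in> fst c" and S: "S1_field act c z = 0" and "t \<noteq> 0"
  shows "act t z = z"
proof -
  have z: "z \<in> topspace X" using c openin_subset[OF chart(1)] by blast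
  define T where "T = {t. t \<noteq> 0 \<and> act t z = z}"
  \<comment> \<open>The zero of the field spreads along the orbit, so the derivative vanishes at all
    group elements that keep \<open>z\<close> in the chart, not only on the stabiliser.\<close>
  have S0: "S1_field act c (act t z) = 0" if "t \<noteq> 0" "act t z \<in> fst c" for t
    using S1_field_transport[OF c(1,1,2) that] S
      linear_0[OF has_derivative_linear[OF action_chart_derivative(2)[OF c(1,1,2) that]]]
    by (simp add: zero_prod_def)
  have "open T"
    unfolding open_contains_ball
  proof
    fix t assume t: "t \<in> T"
    let ?O = "{t. t \<noteq> 0 \<and> act t z \<in> fst c}"
    have "open ?O" by (rule open_orbit_preimage[OF z chart(1)[OF c(1)]])
    moreover have "t \<in> ?O" using t c(2) by (simp add: T_def)
    ultimately obtain e where e: "e > 0" "ball t e \<subseteq> ?O" using open_contains_ball by blast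
    have "\<exists>k. \<forall>t\<in>ball t e. snd c (act t z) = k"
    proof (rule has_derivative_zero_constant[OF convex_ball])
      fix s assume s: "s \<in> ball t e"
      from subsetD[OF e(2) this] have sO: "s \<noteq> 0" "act s z \<in> fst c" by simp_all
      have "orbit_derivative c z s = (\<lambda>h. 0)"
        using orbit_derivative_zero[OF c(1) z sO S0[OF sO]] by auto
      then show "((\<lambda>t. snd c (act t z)) has_derivative (\<lambda>h. 0)) (at s within ball t e)"
        using has_derivative_at_withinI[OF orbit_has_derivative[OF c(1) z sO], of "ball t e"] by simp
    qed
    then obtain k where k: "\<And>s. s \<in> ball t e \<Longrightarrow> snd c (act s z) = k" by blast
    have "ball t e \<subseteq> T"
    proof
      fix s assume s: "s \<in> ball t e"
      from subsetD[OF e(2) this] have sO: "s \<noteq> 0" "act s z \<in> fst c" by simp_all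
      have "snd c (act s z) = snd c z" using k[OF s] k[of t] e(1) t by (simp add: T_def)
      then have "act s z = z"
        using chart_inv_chart[OF c] chart_inv_chart[OF c(1) sO(2)] by simp
      then show "s \<in> T" using sO(1) by (simp add: T_def)
    qed
    then show "\<exists>e>0. ball t e \<subseteq> T" using e(1) by blast
  qed
  then have "openin (top_of_set (- {0})) T" by (auto simp: openin_open T_def)
  moreover have "closedin (top_of_set (- {0})) T"
  proof -
    have "closedin X {z}" using Hausdorff z by (simp add: closedin_Hausdorff_singleton)
    from closedin_continuous_map_preimage[OF continuous_map_orbit[OF z] this]
    show ?thesis by (simp add: T_def)
  qed
  moreover have "1 \<in> T" using act_one[OF z] by (simp add: T_def)
  moreover have "connected (- {0::complex})" by (rule connected_punctured_universe) simp
  ultimately have "T = - {0}" unfolding connected_clopen by blast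
  then show ?thesis using \<open>t \<noteq> 0\<close> by (auto simp: T_def)
qed

section \<open>The moment map along the flow\<close>

lemma g_pos: "c \<in> A \<Longrightarrow> y \<in> fst c \<Longrightarrow> v \<noteq> 0 \<Longrightarrow> compatible_metric \<omega> J c y v v > 0"
  using comp by (simp add: compatible_def)

lemma form_bilinear: "c \<in> A \<Longrightarrow> y \<in> fst c \<Longrightarrow> bilinear (\<omega> c y)"
  using form by (simp add: is_two_form_def)

lemma g_nonneg: "c \<in> A \<Longrightarrow> y \<in> fst c \<Longrightarrow> compatible_metric \<omega> J c y v v \<ge> 0"
  using g_pos[of c y v] bilinear_lzero[OF form_bilinear, of c y]
  by (cases "v = 0") (simp_all add: compatible_metric_def less_imp_le)

definition H :: "'a \<Rightarrow> real" where "H = (SOME H. moment_map X A \<omega> act H)"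

lemma H: "moment_map X A \<omega> act H"
  unfolding H_def using moment by (rule someI_ex)

lemma H_has_derivative:
  assumes c: "c \<in> A" "y \<in> fst c"
  shows "((H \<circ> chart_inv c) has_derivative differential H c y) (at (snd c y))"
proof -
  have "smooth_on (snd c ` (fst c \<inter> topspace X)) (H \<circ> chart_inv c)"
    using H c(1) by (simp add: moment_map_def smooth_function_on_def)
  moreover have "snd c y \<in> snd c ` (fst c \<inter> topspace X)"
    using c openin_subset[OF chart(1)] by blast
  ultimately show ?thesis
    unfolding differential_def by (rule smooth_on_has_derivative)
qed

lemma H_continuous: "continuous_map X euclideanreal H"
  unfolding continuous_map_def
proof (intro conjI allI impI)
  show "H \<in> topspace X \<rightarrow> topspace euclideanreal" by simp
  fix T :: "real set" assume T: "openin euclideanreal T"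
  show "openin X {y \<in> topspace X. H y \<in> T}"
  proof (subst openin_subopen, clarify)
    fix y assume y: "y \<in> topspace X" "H y \<in> T"
    then obtain c where c: "c \<in> A" "y \<in> fst c" using chart_exists by blast
    have "continuous_on (snd c ` fst c) (H \<circ> chart_inv c)"
    proof (rule continuous_at_imp_continuous_on, clarify)
      fix x assume x: "x \<in> fst c"
      show "isCont (H \<circ> chart_inv c) (snd c x)"
        by (rule has_derivative_continuous[OF H_has_derivative[OF c(1) x]])
    qed
    then have "continuous_map (subtopology X (fst c)) euclideanreal ((H \<circ> chart_inv c) \<circ> snd c)"
      using chart(3)[OF c(1)] by (intro continuous_map_compose[of _ "top_of_set (snd c ` fst c)"])
        (auto simp: homeomorphic_maps_def)
    then have "openin (subtopology X (fst c)) {x \<in> topspace (subtopology X (fst c)). ((H \<circ> chart_inv c) \<circ> snd c) x \<in> T}"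
      using T by (rule openin_continuous_map_preimage)
    then have "openin X {x \<in> fst c. ((H \<circ> chart_inv c) \<circ> snd c) x \<in> T}" (is "openin X ?N")
      using openin_trans_full[OF _ chart(1)[OF c(1)]] by (simp only: topspace_chart[OF c(1)])
    moreover have "?N = {x \<in> fst c. H x \<in> T}"
      by (rule Collect_cong) (simp add: chart_inv_chart[OF c(1)] cong: conj_cong)
    ultimately have "openin X {x \<in> fst c. H x \<in> T}" by (simp only:)
    moreover have "{x \<in> fst c. H x \<in> T} \<subseteq> {y \<in> topspace X. H y \<in> T}"
      using openin_subset[OF chart(1)[OF c(1)]] by (simp add: subset_iff)
    ultimately show "\<exists>N. openin X N \<and> y \<in> N \<and> N \<subseteq> {y \<in> topspace X. H y \<in> T}"
      using c(2) y(2) by (intro exI[of _ "{x \<in> fst c. H x \<in> T}"]) simp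
  qed
qed

text \<open>The flow is that of the gradient of \<open>H\<close>, so the derivative is the squared
  length of the gradient.\<close>

lemma H_flow_derivative:
  assumes y: "y \<in> topspace X" and c: "c \<in> A" "act (of_real (exp s)) y \<in> fst c"
  defines "R \<equiv> Rplus_field act c (act (of_real (exp s)) y)"
  shows "((\<lambda>s. H (act (of_real (exp s)) y)) has_real_derivative
    compatible_metric \<omega> J c (act (of_real (exp s)) y) R R) (at s)"
proof -
  let ?w = "act (of_real (exp s)) y"
  have exp: "((\<lambda>s. complex_of_real (exp s)) has_vector_derivative of_real (exp s)) (at s)"
    unfolding has_vector_derivative_def
    by (auto intro!: derivative_eq_intros simp: scaleR_conv_of_real mult.commute)
  have "((\<lambda>s. snd c (act (of_real (exp s)) y)) has_vector_derivative R) (at s)"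
    using vector_derivative_orbit[OF c(1) y _ c(2) exp] Rplus_field_orbit[OF c(1) y _ c(2)] by (simp add: R_def)
  then have "(((H \<circ> chart_inv c) \<circ> (\<lambda>s. snd c (act (of_real (exp s)) y))) has_derivative
      (differential H c ?w \<circ> (\<lambda>h. h *\<^sub>R R))) (at s)"
    by (intro diff_chain_at H_has_derivative c) (simp add: has_vector_derivative_def)
  moreover have "differential H c ?w \<circ> (\<lambda>h. h *\<^sub>R R) = (\<lambda>h. h * compatible_metric \<omega> J c ?w R R)"
    using Rplus_field_gradient[OF Cstar H c] linear_cmul[OF has_derivative_linear[OF H_has_derivative[OF c]]]
    by (auto simp: R_def)
  ultimately have D: "((\<lambda>s. H (chart_inv c (snd c (act (of_real (exp s)) y)))) has_derivative
      (\<lambda>h. h * compatible_metric \<omega> J c ?w R R)) (at s)"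
    by (simp add: o_def)
  have "\<forall>\<^sub>F r in nhds s. complex_of_real (exp r) \<in> {t. t \<noteq> 0 \<and> act t y \<in> fst c}"
  proof (rule topological_tendstoD)
    show "((\<lambda>r. complex_of_real (exp r)) \<longlongrightarrow> of_real (exp s)) (nhds s)" by (intro tendsto_intros filterlim_ident)
    show "open {t. t \<noteq> 0 \<and> act t y \<in> fst c}" by (rule open_orbit_preimage[OF y chart(1)[OF c(1)]])
  qed (use c in simp)
  then have ev: "\<forall>\<^sub>F r in nhds s. H (chart_inv c (snd c (act (of_real (exp r)) y))) = H (act (of_real (exp r)) y)"
    by (rule eventually_mono) (simp add: chart_inv_chart[OF c(1)])
  have "((\<lambda>s. H (act (of_real (exp s)) y)) has_derivative (\<lambda>h. h * compatible_metric \<omega> J c ?w R R)) (at s)"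
  proof (rule has_derivative_transform_eventually[OF D])
    show "\<forall>\<^sub>F r in at s. H (chart_inv c (snd c (act (of_real (exp r)) y))) = H (act (of_real (exp r)) y)"
      unfolding eventually_at_filter using ev by (rule eventually_mono) (intro impI)
  qed (use eventually_nhds_x_imp_x[OF ev] in simp_all)
  moreover have "(\<lambda>h. h * compatible_metric \<omega> J c ?w R R) = (*) (compatible_metric \<omega> J c ?w R R)"
    by (rule ext) (rule mult.commute)
  ultimately show ?thesis unfolding has_field_derivative_def by (simp only:)
qed

lemma H_flow_mono:
  assumes y: "y \<in> topspace X" and "r \<le> s"
  shows "H (act (of_real (exp r)) y) \<le> H (act (of_real (exp s)) y)"
proof (rule DERIV_nonneg_imp_nondecreasing[OF \<open>r \<le> s\<close>])
  fix x :: real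
  have "act (of_real (exp x)) y \<in> topspace X" using y by (simp add: act_in)
  then obtain c where c: "c \<in> A" "act (of_real (exp x)) y \<in> fst c" using chart_exists by blast
  then show "\<exists>D. ((\<lambda>s. H (act (of_real (exp s)) y)) has_real_derivative D) (at x) \<and> 0 \<le> D"
    using H_flow_derivative[OF y c] g_nonneg[OF c] by blast
qed

text \<open>The squared gradient vanishes at \<open>z\<close>; hence so does the circle field, which
  is \<open>J\<close> of the gradient.\<close>

lemma H_constant_imp_fixed:
  assumes z: "z \<in> topspace X" and const: "\<And>s. H (act (of_real (exp s)) z) = k" and "t \<noteq> 0"
  shows "act t z = z"
proof -
  obtain c where c: "c \<in> A" "z \<in> fst c" using chart_exists z by blast
  have "((\<lambda>s. H (act (of_real (exp s)) z)) has_real_derivative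
    compatible_metric \<omega> J c z (Rplus_field act c z) (Rplus_field act c z)) (at 0)"
    using H_flow_derivative[OF z c(1), of 0] c(2) act_one[OF z] by simp
  moreover have "((\<lambda>s. H (act (of_real (exp s)) z)) has_real_derivative 0) (at 0)"
    by (simp add: const)
  ultimately have "compatible_metric \<omega> J c z (Rplus_field act c z) (Rplus_field act c z) = 0"
    using DERIV_unique by blast
  then have "Rplus_field act c z = 0" using g_pos[OF c, of "Rplus_field act c z"] by auto
  then have "S1_field act c z = 0" using S1_field_J[OF c] linear_0[OF J_linear[OF c]] by simp
  then show ?thesis using S1_field_zero_imp_fixed[OF c] \<open>t \<noteq> 0\<close> by blast
qed

lemma continuous_on_orbit_derivative:
  assumes "d \<in> A" "y \<in> topspace X" and f: "continuous_on {t. t \<noteq> 0 \<and> act t y \<in> fst d} f"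
  shows "continuous_on {t. t \<noteq> 0 \<and> act t y \<in> fst d} (\<lambda>t. orbit_derivative d y t (f t))"
proof -
  have "continuous_on {t. t \<noteq> 0 \<and> act t y \<in> fst d}
      (\<lambda>t. Re (f t) *\<^sub>R orbit_derivative d y t 1 + Im (f t) *\<^sub>R orbit_derivative d y t \<i>)"
    by (intro continuous_intros continuous_orbit_derivative assms)
  then show ?thesis
  proof (rule continuous_on_eq)
    fix t assume t: "t \<in> {t. t \<noteq> 0 \<and> act t y \<in> fst d}"
    then have lin: "linear (orbit_derivative d y t)"
      by (intro linear_orbit_derivative assms) simp_all
    have "f t = Re (f t) *\<^sub>R 1 + Im (f t) *\<^sub>R \<i>" by (simp add: complex_eq_iff)
    then show "Re (f t) *\<^sub>R orbit_derivative d y t 1 + Im (f t) *\<^sub>R orbit_derivative d y t \<i> = orbit_derivative d y t (f t)"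
      using linear_add[OF lin] linear_cmul[OF lin] by metis
  qed
qed

end

locale Cstar_manifold_basis = Cstar_manifold X A \<omega> J act + finite_dim B
  for X :: "'a topology" and A :: "('a, 'e::real_normed_vector) chart set" and \<omega> J act and B :: "'e set"
begin

lemma continuous_on_J:
  assumes "c \<in> A" shows "continuous_on (snd c ` fst c) (\<lambda>x. J c (chart_inv c x) v)"
  using acs assms by (intro smooth_on_imp_continuous_on) (simp add: almost_complex_structure_def)

lemma continuous_on_form:
  assumes "c \<in> A" shows "continuous_on (snd c ` fst c) (\<lambda>x. \<omega> c (chart_inv c x) v w)"
  using form assms by (intro smooth_on_imp_continuous_on) (simp add: is_two_form_def)

text \<open>The metric attains a positive minimum on the unit vectors over the ball, a compact set;
  homogeneity does the rest.\<close>

lemma metric_elliptic: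
  assumes c: "c \<in> A" and sub: "cball a r \<subseteq> snd c ` fst c"
  shows "\<exists>E\<ge>0. \<forall>x\<in>cball a r. \<forall>v. (norm v)\<^sup>2 \<le> E * compatible_metric \<omega> J c (chart_inv c x) v v"
proof -
  let ?S = "cball a r \<times> sphere (0::'e) 1"
  let ?g = "\<lambda>p. compatible_metric \<omega> J c (chart_inv c (fst p)) (snd p) (snd p)"
  have in_c: "chart_inv c x \<in> fst c" if "x \<in> cball a r" for x
    using chart_inv_in[OF c] that sub by blast
  have contJ: "continuous_on ?S (\<lambda>p. J c (chart_inv c (fst p)) (snd p))"
  proof (rule continuous_on_linear_family[where T = "\<lambda>p. J c (chart_inv c (fst p))"])
    show "continuous_on ?S (\<lambda>p. J c (chart_inv c (fst p)) v)" for v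
      by (rule continuous_on_compose2[OF continuous_on_J[OF c] continuous_on_fst]) (use sub in auto)
  qed (use in_c J_linear[OF c] in \<open>auto intro!: continuous_intros\<close>)
  have contg: "continuous_on ?S ?g"
    unfolding compatible_metric_def
  proof (rule continuous_on_linear_family[where T = "\<lambda>p v. \<omega> c (chart_inv c (fst p)) v (J c (chart_inv c (fst p)) (snd p))"])
    fix v
    show "continuous_on ?S (\<lambda>p. \<omega> c (chart_inv c (fst p)) v (J c (chart_inv c (fst p)) (snd p)))"
    proof (rule continuous_on_linear_family[where T = "\<lambda>p w. \<omega> c (chart_inv c (fst p)) v w", OF _ _ contJ])
      show "continuous_on ?S (\<lambda>p. \<omega> c (chart_inv c (fst p)) v w)" for w
        by (rule continuous_on_compose2[OF continuous_on_form[OF c] continuous_on_fst]) (use sub in auto)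
    qed (use in_c form_bilinear[OF c] in \<open>auto simp: bilinear_def\<close>)
  qed (use in_c form_bilinear[OF c] in \<open>auto simp: bilinear_def intro!: continuous_intros\<close>)
  have "compact (sphere (0::'e) 1)"
  proof -
    have "closed {v::'e. norm v = 1}" by (intro closed_Collect_eq continuous_intros)
    from compact_Int_closed[OF compact_cball[of 0 1] this] show ?thesis
      by (rule back_subst[of compact]) auto
  qed
  then have cS: "compact ?S" by (intro compact_Times compact_cball)
  show ?thesis
  proof (cases "?S = {}")
    \<comment> \<open>Besides an empty ball this covers dimension 0, where there are no unit
      vectors.\<close>
    case True
    have "(norm v)\<^sup>2 \<le> 0 * compatible_metric \<omega> J c (chart_inv c x) v v" if "x \<in> cball a r" for x v
    proof -
      have "v = 0"
      proof (rule ccontr)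
        assume "v \<noteq> 0"
        then have "(x, (1 / norm v) *\<^sub>R v) \<in> ?S" using that by simp
        then show False using True by blast
      qed
      then show ?thesis by simp
    qed
    then show ?thesis by blast
  next
    case False
    then have "\<exists>p0\<in>?S. \<forall>p\<in>?S. ?g p0 \<le> ?g p"
      using continuous_attains_inf[OF cS _ contg] by blast
    then obtain p0 where p0: "p0 \<in> ?S" "\<forall>p\<in>?S. ?g p0 \<le> ?g p" by (rule bexE)
    define m where "m = ?g p0"
    have "snd p0 \<noteq> 0" using p0(1) by (auto simp: mem_Times_iff)
    then have m: "m > 0"
      unfolding m_def using p0(1) by (intro g_pos[OF c in_c]) (auto simp: mem_Times_iff)
    have "(norm v)\<^sup>2 \<le> (1 / m) * compatible_metric \<omega> J c (chart_inv c x) v v" if x: "x \<in> cball a r" for x v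
    proof (cases "v = 0")
      case True
      then show ?thesis using g_nonneg[OF c in_c[OF x], of v] m by simp
    next
      case v: False
      define u where "u = (1 / norm v) *\<^sub>R v"
      have vu: "v = norm v *\<^sub>R u" using v by (simp add: u_def)
      have "(x, u) \<in> ?S" using x v by (simp add: u_def)
      then have "m \<le> ?g (x, u)" using p0(2) by (simp add: m_def)
      moreover have "compatible_metric \<omega> J c (chart_inv c x) v v = (norm v)\<^sup>2 * ?g (x, u)"
        by (subst (1 2) vu) (simp add: compatible_metric_def linear_cmul[OF J_linear[OF c in_c[OF x]]]
          bilinear_lmul[OF form_bilinear[OF c in_c[OF x]]] bilinear_rmul[OF form_bilinear[OF c in_c[OF x]]] power2_eq_square)
      ultimately have "(norm v)\<^sup>2 * m \<le> compatible_metric \<omega> J c (chart_inv c x) v v"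
        by (simp add: mult_left_mono)
      then show ?thesis using m by (simp add: field_simps)
    qed
    then show ?thesis using m by (intro exI[of _ "1 / m"]) simp
  qed
qed

end

section \<open>Orbits near a fixed point\<close>

text \<open>\<open>R'\<close> is so small that the circle through any point of the inner ball stays
  in the outer one. There \<open>K\<close> bounds \<open>J\<close>, \<open>L\<close> its
  oscillation, and \<open>E\<close> bounds lengths by the metric. \<open>D\<close> compares the
  speed of a circle at different angles, and \<open>Q\<close> bounds coordinates.\<close>

locale fixed_point_chart = Cstar_manifold_basis X A \<omega> J act B
  for X :: "'a topology" and A :: "('a, 'e::real_normed_vector) chart set" and \<omega> J act and B :: "'e set" +
  fixes c :: "('a, 'e) chart" and z :: 'a and R R' K L E D Q :: real
  assumes c: "c \<in> A" "z \<in> fst c"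
    and sub: "cball (snd c z) R \<subseteq> snd c ` fst c"
    and R': "0 < R'" "R' \<le> R"
    and rotation: "\<And>w \<theta>. w \<in> fst c \<Longrightarrow> snd c w \<in> cball (snd c z) R' \<Longrightarrow>
      act (cis \<theta>) w \<in> fst c \<and> snd c (act (cis \<theta>) w) \<in> cball (snd c z) R"
    and nonneg: "K \<ge> 0" "L \<ge> 0" "E \<ge> 0" "D \<ge> 0" "Q \<ge> 0"
    and J_bound: "\<And>w v. w \<in> fst c \<Longrightarrow> snd c w \<in> cball (snd c z) R \<Longrightarrow> norm (J c w v) \<le> K * norm v"
    and J_Lipschitz: "\<And>w w' v. w \<in> fst c \<Longrightarrow> snd c w \<in> cball (snd c z) R \<Longrightarrow>
      w' \<in> fst c \<Longrightarrow> snd c w' \<in> cball (snd c z) R \<Longrightarrow>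
      norm (J c w v - J c w' v) \<le> L * norm (snd c w - snd c w') * norm v"
    and elliptic: "\<And>w v. w \<in> fst c \<Longrightarrow> snd c w \<in> cball (snd c z) R \<Longrightarrow>
      (norm v)\<^sup>2 \<le> E * compatible_metric \<omega> J c w v v"
    and rotation_bound: "\<And>w \<theta>. w \<in> fst c \<Longrightarrow> snd c w \<in> cball (snd c z) R' \<Longrightarrow>
      norm (S1_field act c (act (cis \<theta>) w)) \<le> D * norm (S1_field act c w)"
    and coord_le: "\<And>v b. b \<in> B \<Longrightarrow> \<bar>coord v b\<bar> \<le> Q * norm v"

text \<open>The unit circle fixes \<open>z\<close>, so the tube lemma provides the inner ball; the
  constants come from compactness of the balls, and for \<open>D\<close> of the product of the
  circle with the inner ball.\<close>

lemma (in Cstar_manifold_basis) fixed_point_chart_exists: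
  assumes c: "c \<in> A" "z \<in> fst c" and fixed: "\<And>t. t \<noteq> 0 \<Longrightarrow> act t z = z"
  shows "\<exists>R R' K L E D Q. fixed_point_chart X A \<omega> J act B c z R R' K L E D Q"
proof -
  let ?x = "snd c z"
  have z: "z \<in> topspace X" using c openin_subset[OF chart(1)] by blast
  obtain R where R: "R > 0" "cball ?x R \<subseteq> snd c ` fst c"
    using chart_ball[OF c chart(1)[OF c(1)] c(2)] by metis
  define W where "W = {w \<in> fst c. snd c w \<in> ball ?x R}"
  have W: "openin X W" unfolding W_def by (rule openin_chart_preimage[OF c(1) open_ball])
  define N where "N = {y \<in> topspace X. \<forall>t\<in>sphere 0 1. act t y \<in> W}"
  have N: "openin X N" unfolding N_def by (rule openin_act_compact[OF _ _ W]) auto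
  have "z \<in> N"
    unfolding N_def
  proof (intro CollectI conjI ballI z)
    fix t :: complex assume "t \<in> sphere 0 1"
    then have "t \<noteq> 0" by auto
    then show "act t z \<in> W" using fixed c(2) R(1) by (simp add: W_def)
  qed
  then obtain R1 where R1: "R1 > 0" "cball ?x R1 \<subseteq> snd c ` fst c" "\<And>x. x \<in> cball ?x R1 \<Longrightarrow> chart_inv c x \<in> N"
    using chart_ball[OF c N] by metis
  define R' where "R' = min R R1"
  have rot: "act t w \<in> fst c \<and> snd c (act t w) \<in> cball ?x R"
    if "w \<in> fst c" "snd c w \<in> cball ?x R'" "t \<in> sphere 0 1" for w t
  proof -
    have "w \<in> N" using R1(3)[of "snd c w"] that(1,2) chart_inv_chart[OF c(1)] by (simp add: R'_def)
    then have "act t w \<in> W" using that(3) by (simp add: N_def)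
    then show ?thesis by (simp add: W_def)
  qed
  have in_c: "chart_inv c x \<in> fst c" if "x \<in> cball ?x R" for x
    using chart_inv_in[OF c(1)] that R(2) by blast
  have "\<exists>K\<ge>0. \<forall>x\<in>cball ?x R. \<forall>v. norm (J c (chart_inv c x) v) \<le> K * norm v"
    by (rule bounded_linear_family)
      (use continuous_on_subset[OF continuous_on_J[OF c(1)] R(2)] J_linear[OF c(1) in_c] compact_cball in auto)
  then obtain K where K: "K \<ge> 0" "\<And>x v. x \<in> cball ?x R \<Longrightarrow> norm (J c (chart_inv c x) v) \<le> K * norm v"
    by blast
  have "\<exists>L\<ge>0. \<forall>x\<in>cball ?x R. \<forall>y\<in>cball ?x R. \<forall>v.
      norm (J c (chart_inv c x) v - J c (chart_inv c y) v) \<le> L * norm (x - y) * norm v"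
    by (rule Lipschitz_linear_family[OF _ _ R(2)])
      (use acs c(1) J_linear[OF c(1)] chart_inv_in[OF c(1)] in \<open>auto simp: almost_complex_structure_def\<close>)
  then obtain L where L: "L \<ge> 0" "\<And>x y v. x \<in> cball ?x R \<Longrightarrow> y \<in> cball ?x R \<Longrightarrow>
      norm (J c (chart_inv c x) v - J c (chart_inv c y) v) \<le> L * norm (x - y) * norm v"
    by blast
  obtain E where E: "E \<ge> 0" "\<And>x v. x \<in> cball ?x R \<Longrightarrow>
      (norm v)\<^sup>2 \<le> E * compatible_metric \<omega> J c (chart_inv c x) v v"
    using metric_elliptic[OF c(1) R(2)] by blast
  let ?S = "sphere (0::complex) 1 \<times> cball ?x R'"
  have dom: "(fst p, snd p) \<in> action_chart_dom act c c \<and>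
    linear (frechet_derivative (action_chart act c c) (at p))" if p: "p \<in> ?S" for p
  proof -
    have x: "snd p \<in> cball ?x R" using p by (auto simp: R'_def)
    let ?w = "chart_inv c (snd p)"
    have w: "snd c ?w = snd p" using chart_chart_inv[OF c(1)] x R(2) by blast
    have t: "fst p \<noteq> 0" "act (fst p) ?w \<in> fst c"
      using p rot[OF in_c[OF x], of "fst p"] w by (auto simp: mem_Times_iff)
    show ?thesis
      using action_chart_derivative[OF c(1,1) in_c[OF x] t] w has_derivative_linear by (auto simp: prod.collapse)
  qed
  have "\<exists>D\<ge>0. \<forall>p\<in>?S. \<forall>v. norm (frechet_derivative (action_chart act c c) (at p) (0, v)) \<le> D * norm v"
  proof (rule bounded_linear_family)
    show "continuous_on ?S (\<lambda>p. frechet_derivative (action_chart act c c) (at p) (0, v))" for v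
    proof (rule continuous_on_subset[OF smooth_on_continuous_derivative])
      show "smooth_on (action_chart_dom act c c) (action_chart act c c)"
        using action c(1) by (simp add: smooth_Cstar_action_def)
      show "?S \<subseteq> action_chart_dom act c c" using dom by auto
    qed
    show "linear (\<lambda>v. frechet_derivative (action_chart act c c) (at p) (0, v))" if "p \<in> ?S" for p
    proof -
      have "linear (\<lambda>v::'e. (0::complex, v))" by (rule linearI) auto
      from linear_compose[OF this, of "frechet_derivative (action_chart act c c) (at p)"]
      show ?thesis using dom[OF that] by (simp add: o_def)
    qed
    show "compact ?S" by (intro compact_Times compact_cball compact_sphere)
  qed
  then obtain D where D: "D \<ge> 0" "\<And>p v. p \<in> ?S \<Longrightarrow>
      norm (frechet_derivative (action_chart act c c) (at p) (0, v)) \<le> D * norm v"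
    by blast
  obtain Q where Q: "Q > 0" "\<And>v b. b \<in> B \<Longrightarrow> \<bar>coord v b\<bar> \<le> Q * norm v" using coord_bound by blast
  have "fixed_point_chart X A \<omega> J act B c z R R' K L E D Q"
  proof (rule fixed_point_chart.intro[OF Cstar_manifold_basis_axioms], unfold_locales)
    fix w \<theta> assume w: "w \<in> fst c" "snd c w \<in> cball ?x R'"
    have cis: "cis \<theta> \<in> sphere 0 1" by simp
    show "act (cis \<theta>) w \<in> fst c \<and> snd c (act (cis \<theta>) w) \<in> cball ?x R"
      by (rule rot[OF w cis])
    then show "norm (S1_field act c (act (cis \<theta>) w)) \<le> D * norm (S1_field act c w)"
      using S1_field_transport[OF c(1,1) w(1), of "cis \<theta>"] D(2)[of "(cis \<theta>, snd c w)" "S1_field act c w"] w(2) by simp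
  qed (use c R R1(1) K L E D Q chart_inv_chart[OF c(1)] in \<open>auto simp: R'_def\<close>,
      (metis mem_cball chart_inv_chart[OF c(1)])+)
  then show ?thesis by blast
qed

context fixed_point_chart
begin

definition near :: "real \<Rightarrow> 'a set" where "near r = {w \<in> fst c. snd c w \<in> cball (snd c z) r}"

end

context Cstar_manifold
begin

abbreviation flow :: "real \<Rightarrow> 'a \<Rightarrow> 'a" where "flow s y \<equiv> act (of_real (exp s)) y"

end

context fixed_point_chart
begin

lemma nearD: "w \<in> near r \<Longrightarrow> w \<in> fst c" "w \<in> near r \<Longrightarrow> snd c w \<in> cball (snd c z) r"
  by (simp_all add: near_def)

lemma near_mono: "r \<le> s \<Longrightarrow> near r \<subseteq> near s"
  by (auto simp: near_def)

lemma near_compact: "r \<le> R \<Longrightarrow> compactin X (near r)"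
proof -
  assume r: "r \<le> R"
  have sub': "cball (snd c z) r \<subseteq> snd c ` fst c" using sub r by (meson order_trans subset_cball)
  have "compactin X (chart_inv c ` cball (snd c z) r)"
    by (rule image_compactin[OF _ continuous_chart_inv[OF c(1)]])
      (use sub' compact_cball in \<open>simp add: compactin_subtopology\<close>)
  moreover have "chart_inv c ` cball (snd c z) r = near r"
  proof (intro equalityI subsetI)
    fix w assume "w \<in> chart_inv c ` cball (snd c z) r"
    then obtain x where x: "x \<in> cball (snd c z) r" "w = chart_inv c x" by (rule imageE)
    then have "x \<in> snd c ` fst c" using sub' by blast
    then show "w \<in> near r" using x chart_inv_in[OF c(1)] chart_chart_inv[OF c(1)] by (simp add: near_def)
  next
    fix w assume "w \<in> near r"
    then show "w \<in> chart_inv c ` cball (snd c z) r"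
      using chart_inv_chart[OF c(1)] by (intro image_eqI[of _ _ "snd c w"]) (auto simp: near_def)
  qed
  ultimately show ?thesis by simp
qed

lemma rotation_near: "w \<in> near R' \<Longrightarrow> act (cis \<theta>) w \<in> near R"
  using rotation by (simp add: near_def)

section \<open>Circles through an orbit near the fixed point\<close>

abbreviation turn :: "real \<Rightarrow> real \<Rightarrow> 'a \<Rightarrow> 'a" where "turn s \<theta> y \<equiv> act (exp (Complex s \<theta>)) y"

lemma turn_eq:
  assumes "y \<in> topspace X" shows "turn s \<theta> y = act (cis \<theta>) (flow s y)" "turn s 0 y = flow s y"
    "turn s (2 * pi) y = flow s y"
proof -
  have "exp (Complex s \<theta>) = cis \<theta> * of_real (exp s)" for \<theta>
    by (simp add: exp_eq_polar)
  then show "turn s \<theta> y = act (cis \<theta>) (flow s y)" "turn s 0 y = flow s y" "turn s (2 * pi) y = flow s y"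
    using assms by (simp_all add: act_act)
qed

lemma turn_near: "y \<in> topspace X \<Longrightarrow> flow s y \<in> near R' \<Longrightarrow> turn s \<theta> y \<in> near R"
  by (simp add: turn_eq(1) rotation_near)

lemma turn_derivative:
  assumes y: "y \<in> topspace X" and "turn s \<theta> y \<in> fst c"
  shows "((\<lambda>\<theta>. snd c (turn s \<theta> y)) has_vector_derivative S1_field act c (turn s \<theta> y)) (at \<theta>)"
    "((\<lambda>s. snd c (turn s \<theta> y)) has_vector_derivative Rplus_field act c (turn s \<theta> y)) (at s)"
proof -
  have eq: "exp (Complex s \<theta>) = exp (of_real s + \<i> * of_real \<theta>)" for s \<theta>
    by (simp only: Complex_eq)
  have "((\<lambda>\<theta>. of_real s + \<i> * of_real \<theta> :: complex) has_vector_derivative \<i>) (at \<theta>)"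
    unfolding has_vector_derivative_def
    by (auto intro!: derivative_eq_intros simp: scaleR_conv_of_real)
  from field_vector_diff_chain_at[OF this DERIV_exp]
  have "((\<lambda>\<theta>. exp (Complex s \<theta>)) has_vector_derivative \<i> * exp (Complex s \<theta>)) (at \<theta>)"
    by (simp add: eq o_def)
  from vector_derivative_orbit[OF c(1) y _ assms(2) this]
  show "((\<lambda>\<theta>. snd c (turn s \<theta> y)) has_vector_derivative S1_field act c (turn s \<theta> y)) (at \<theta>)"
    using S1_field_orbit[OF c(1) y _ assms(2)] by simp
  have "((\<lambda>s. of_real s + \<i> * of_real \<theta> :: complex) has_vector_derivative 1) (at s)"
    unfolding has_vector_derivative_def
    by (auto intro!: derivative_eq_intros simp: scaleR_conv_of_real)
  from field_vector_diff_chain_at[OF this DERIV_exp]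
  have "((\<lambda>s. exp (Complex s \<theta>)) has_vector_derivative exp (Complex s \<theta>)) (at s)"
    by (simp add: eq o_def)
  from vector_derivative_orbit[OF c(1) y _ assms(2) this]
  show "((\<lambda>s. snd c (turn s \<theta> y)) has_vector_derivative Rplus_field act c (turn s \<theta> y)) (at s)"
    using Rplus_field_orbit[OF c(1) y _ assms(2)] by simp
qed

text \<open>Continuity jointly in time and angle is required for differentiating the mean under the
  integral sign.\<close>

lemma turn_continuous:
  assumes y: "y \<in> topspace X" and S: "\<And>p. p \<in> S \<Longrightarrow> turn (fst p) (snd p) y \<in> fst c"
  shows "continuous_on S (\<lambda>p. snd c (turn (fst p) (snd p) y))"
    "continuous_on S (\<lambda>p. Rplus_field act c (turn (fst p) (snd p) y))"
    "continuous_on S (\<lambda>p. S1_field act c (turn (fst p) (snd p) y))"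
proof -
  let ?O = "{t. t \<noteq> 0 \<and> act t y \<in> fst c}"
  have e: "continuous_on S (\<lambda>p. exp (Complex (fst p) (snd p)))"
    unfolding Complex_eq by (intro continuous_intros)
  have O: "(\<lambda>p. exp (Complex (fst p) (snd p))) ` S \<subseteq> ?O" using S by auto
  have "continuous_on ?O (\<lambda>t. snd c (act t y))"
    by (rule continuous_at_imp_continuous_on)
      (use has_derivative_continuous[OF orbit_has_derivative[OF c(1) y]] in auto)
  from continuous_on_compose2[OF this e O]
  show "continuous_on S (\<lambda>p. snd c (turn (fst p) (snd p) y))" .
  have "continuous_on ?O (\<lambda>t. orbit_derivative c y t t)"
    by (intro continuous_on_orbit_derivative c y continuous_on_id)
  then have "continuous_on ?O (\<lambda>t. Rplus_field act c (act t y))"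
    by (rule continuous_on_eq) (simp add: Rplus_field_orbit[OF c(1) y])
  from continuous_on_compose2[OF this e O]
  show "continuous_on S (\<lambda>p. Rplus_field act c (turn (fst p) (snd p) y))" .
  have "continuous_on ?O (\<lambda>t. orbit_derivative c y t (\<i> * t))"
    by (intro continuous_on_orbit_derivative c y continuous_intros)
  then have "continuous_on ?O (\<lambda>t. S1_field act c (act t y))"
    by (rule continuous_on_eq) (simp add: S1_field_orbit[OF c(1) y])
  from continuous_on_compose2[OF this e O]
  show "continuous_on S (\<lambda>p. S1_field act c (turn (fst p) (snd p) y))" .
qed

lemma turn_continuous_angle:
  assumes y: "y \<in> topspace X" and near: "flow s y \<in> near R'"
  shows "continuous_on S (\<lambda>\<theta>. snd c (turn s \<theta> y))"
    "continuous_on S (\<lambda>\<theta>. Rplus_field act c (turn s \<theta> y))"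
    "continuous_on S (\<lambda>\<theta>. S1_field act c (turn s \<theta> y))"
proof -
  have in_c: "turn s \<theta> y \<in> fst c" for \<theta> using nearD(1)[OF turn_near[OF y near]] .
  note * = turn_continuous[OF y, of "{s} \<times> S"]
  have e: "continuous_on S (\<lambda>\<theta>. (s, \<theta>))" by (intro continuous_intros)
  show "continuous_on S (\<lambda>\<theta>. snd c (turn s \<theta> y))"
    using continuous_on_compose2[OF *(1) e] in_c by fastforce
  show "continuous_on S (\<lambda>\<theta>. Rplus_field act c (turn s \<theta> y))"
    using continuous_on_compose2[OF *(2) e] in_c by fastforce
  show "continuous_on S (\<lambda>\<theta>. S1_field act c (turn s \<theta> y))"
    using continuous_on_compose2[OF *(3) e] in_c by fastforce
qed

lemma S1_turn_bound:
  assumes "y \<in> topspace X" "flow s y \<in> near R'"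
  shows "norm (S1_field act c (turn s \<theta> y)) \<le> D * norm (S1_field act c (flow s y))"
  using rotation_bound[OF nearD[OF assms(2)]] by (simp add: turn_eq(1)[OF assms(1)])

text \<open>The circle is traversed with at most \<open>D\<close> times the speed at its base point,
  over an angle of at most \<open>2 * pi\<close>.\<close>

lemma circle_oscillation:
  assumes y: "y \<in> topspace X" and near: "flow s y \<in> near R'" and \<theta>: "\<theta> \<in> {0..2 * pi}"
  shows "norm (snd c (flow s y) - snd c (turn s \<theta> y)) \<le> 2 * pi * D * norm (S1_field act c (flow s y))"
proof -
  let ?\<sigma> = "D * norm (S1_field act c (flow s y))"
  have \<sigma>: "?\<sigma> \<ge> 0" using nonneg by simp
  have "norm (snd c (turn s \<theta> y) - snd c (turn s 0 y)) \<le> ?\<sigma> * norm (\<theta> - 0)"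
  proof (rule differentiable_bound[where S = "{0..2 * pi}" and f' = "\<lambda>\<theta> h. h *\<^sub>R S1_field act c (turn s \<theta> y)"])
    fix x :: real
    have "turn s x y \<in> fst c" using nearD(1)[OF turn_near[OF y near]] .
    from turn_derivative(1)[OF y this]
    show "((\<lambda>\<theta>. snd c (turn s \<theta> y)) has_derivative (\<lambda>h. h *\<^sub>R S1_field act c (turn s x y))) (at x within {0..2 * pi})"
      by (simp add: has_vector_derivative_def has_derivative_at_withinI)
    show "onorm (\<lambda>h. h *\<^sub>R S1_field act c (turn s x y)) \<le> ?\<sigma>"
      using mult_left_mono[OF S1_turn_bound[OF y near, of x] abs_ge_zero] \<sigma>
      by (intro onorm_bound) (simp_all add: mult.commute)
  qed (use \<theta> in auto)
  also have "\<dots> \<le> ?\<sigma> * (2 * pi)" by (rule mult_left_mono[OF _ \<sigma>]) (use \<theta> in simp)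
  finally show ?thesis by (simp add: turn_eq(2)[OF y] norm_minus_commute mult_ac)
qed

text \<open>\<open>2 * pi\<close> times a coordinate of the centre of mass of the circle through the
  orbit at time \<open>s\<close>.\<close>

definition mean :: "'e \<Rightarrow> 'a \<Rightarrow> real \<Rightarrow> real" where
  "mean b y s = integral {0..2 * pi} (\<lambda>\<theta>. coord (snd c (turn s \<theta> y)) b)"

lemma coord_diff: "coord (v - w) b = coord v b - coord w b"
  using linear_diff[OF linear_coord] .

text \<open>One factor \<open>2 * pi\<close> is the length of the interval of integration, the other
  comes from the oscillation of the circle.\<close>

lemma mean_close:
  assumes y: "y \<in> topspace X" and near: "flow s y \<in> near R'" and b: "b \<in> B"
  shows "\<bar>2 * pi * coord (snd c (flow s y)) b - mean b y s\<bar> \<le>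
    4 * pi\<^sup>2 * Q * D * norm (S1_field act c (flow s y))"
proof -
  let ?f = "\<lambda>\<theta>. coord (snd c (flow s y)) b - coord (snd c (turn s \<theta> y)) b"
  have cont: "continuous_on {0..2 * pi} (\<lambda>\<theta>. coord (snd c (turn s \<theta> y)) b)"
    by (intro continuous_on_coord turn_continuous_angle b y near)
  have "norm (integral {0..2 * pi} ?f) \<le> (Q * (2 * pi * D * norm (S1_field act c (flow s y)))) * (2 * pi - 0)"
  proof (rule integral_bound)
    show "continuous_on {0..2 * pi} ?f" by (intro continuous_intros cont)
    fix \<theta> assume \<theta>: "\<theta> \<in> {0..2 * pi}"
    have "\<bar>coord (snd c (flow s y) - snd c (turn s \<theta> y)) b\<bar> \<le>
        Q * norm (snd c (flow s y) - snd c (turn s \<theta> y))"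
      by (rule coord_le[OF b])
    also have "\<dots> \<le> Q * (2 * pi * D * norm (S1_field act c (flow s y)))"
      by (intro mult_left_mono circle_oscillation y near \<theta> nonneg)
    finally show "norm (?f \<theta>) \<le> Q * (2 * pi * D * norm (S1_field act c (flow s y)))"
      by (simp add: coord_diff)
  qed simp
  moreover have "integral {0..2 * pi} ?f = 2 * pi * coord (snd c (flow s y)) b - mean b y s"
    unfolding mean_def using integrable_continuous_real[OF cont] by (subst integral_diff) auto
  ultimately show ?thesis by (simp add: power2_eq_square mult_ac)
qed

text \<open>The angular derivative of the circle has mean zero, so in
  \<open>\<integral> u\<^sub>s = - \<integral> J(u) u\<^sub>\<theta>\<close> the structure \<open>J(u)\<close> may be replaced by its oscillation along the circle;
  hence the drift of the mean is quadratic in the angular derivative.\<close>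

lemma mean_drift_rate:
  assumes y: "y \<in> topspace X" and near: "flow s y \<in> near R'" and b: "b \<in> B"
  shows "\<bar>integral {0..2 * pi} (\<lambda>\<theta>. coord (Rplus_field act c (turn s \<theta> y)) b)\<bar> \<le>
    4 * pi\<^sup>2 * Q * L * D\<^sup>2 * (norm (S1_field act c (flow s y)))\<^sup>2"
proof -
  let ?w = "flow s y" and ?\<sigma> = "norm (S1_field act c (flow s y))"
  let ?T = "\<lambda>v. coord (J c (flow s y) v) b"
  have w: "?w \<in> fst c" using nearD(1)[OF near] .
  have in_c: "turn s \<theta> y \<in> fst c" for \<theta> using nearD(1)[OF turn_near[OF y near]] .
  have "linear ?T" using linear_compose[OF J_linear[OF c(1) w] linear_coord[of b]] by (simp add: o_def)
  then have T: "bounded_linear ?T" by (rule bounded_linear_of_linear)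
  have "((\<lambda>\<theta>. ?T (S1_field act c (turn s \<theta> y))) has_integral
      (?T (snd c (turn s (2 * pi) y)) - ?T (snd c (turn s 0 y)))) {0..2 * pi}"
    by (rule fundamental_theorem_of_calculus, simp, rule bounded_linear.has_vector_derivative[OF T],
      rule has_vector_derivative_at_within, rule turn_derivative(1)[OF y in_c])
  then have zero: "((\<lambda>\<theta>. ?T (S1_field act c (turn s \<theta> y))) has_integral 0) {0..2 * pi}"
    by (simp only: turn_eq(2,3)[OF y] diff_self)
  have contR: "continuous_on {0..2 * pi} (\<lambda>\<theta>. coord (Rplus_field act c (turn s \<theta> y)) b)"
    by (intro continuous_on_coord turn_continuous_angle b y near)
  have contS: "continuous_on {0..2 * pi} (\<lambda>\<theta>. ?T (S1_field act c (turn s \<theta> y)))"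
    by (intro bounded_linear.continuous_on[OF T] turn_continuous_angle y near)
  let ?f = "\<lambda>\<theta>. coord (Rplus_field act c (turn s \<theta> y)) b + ?T (S1_field act c (turn s \<theta> y))"
  have "integral {0..2 * pi} (\<lambda>\<theta>. coord (Rplus_field act c (turn s \<theta> y)) b) = integral {0..2 * pi} ?f"
    using integral_unique[OF zero] integrable_continuous_real[OF contR] integrable_continuous_real[OF contS]
    by (subst integral_add) auto
  moreover have "norm (integral {0..2 * pi} ?f) \<le> (Q * (L * (2 * pi * D * ?\<sigma>) * (D * ?\<sigma>))) * (2 * pi - 0)"
  proof (rule integral_bound)
    show "continuous_on {0..2 * pi} ?f" by (intro continuous_intros contR contS)
    fix \<theta> assume \<theta>: "\<theta> \<in> {0..2 * pi}"
    let ?S = "S1_field act c (turn s \<theta> y)"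
    have "Rplus_field act c (turn s \<theta> y) = - J c (turn s \<theta> y) ?S"
      by (simp add: S1_field_J[OF c(1) in_c] J_J[OF c(1) in_c])
    then have "?f \<theta> = coord (J c ?w ?S - J c (turn s \<theta> y) ?S) b"
      by (simp add: coord_diff linear_neg[OF linear_coord])
    then have "norm (?f \<theta>) \<le> Q * norm (J c ?w ?S - J c (turn s \<theta> y) ?S)"
      using coord_le[OF b] by simp
    also have "norm (J c ?w ?S - J c (turn s \<theta> y) ?S) \<le> L * norm (snd c ?w - snd c (turn s \<theta> y)) * norm ?S"
      using subsetD[OF near_mono[OF R'(2)] near] turn_near[OF y near, of \<theta>] by (intro J_Lipschitz nearD)
    also have "\<dots> \<le> L * (2 * pi * D * ?\<sigma>) * (D * ?\<sigma>)"
      by (intro mult_mono mult_left_mono circle_oscillation S1_turn_bound y near \<theta>) (simp_all add: nonneg)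
    finally show "norm (?f \<theta>) \<le> Q * (L * (2 * pi * D * ?\<sigma>) * (D * ?\<sigma>))"
      using nonneg by (simp add: mult_left_mono)
  qed simp
  ultimately show ?thesis by (simp add: power2_eq_square mult_ac)
qed

text \<open>The circle field is \<open>J\<close> of the gradient, whose squared length is the rate
  of growth of \<open>H\<close> along the flow.\<close>

lemma S1_le_energy:
  assumes "w \<in> near R"
  shows "(norm (S1_field act c w))\<^sup>2 \<le>
    K\<^sup>2 * E * compatible_metric \<omega> J c w (Rplus_field act c w) (Rplus_field act c w)"
proof -
  have "norm (S1_field act c w) \<le> K * norm (Rplus_field act c w)"
    using J_bound[OF nearD[OF assms]] S1_field_J[OF c(1) nearD(1)[OF assms]] by simp
  then have "(norm (S1_field act c w))\<^sup>2 \<le> K\<^sup>2 * (norm (Rplus_field act c w))\<^sup>2"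
    using power_mono[of "norm (S1_field act c w)" "K * norm (Rplus_field act c w)" 2]
    by (simp add: power_mult_distrib)
  also have "\<dots> \<le> K\<^sup>2 * (E * compatible_metric \<omega> J c w (Rplus_field act c w) (Rplus_field act c w))"
    by (intro mult_left_mono elliptic nearD[OF assms]) simp
  finally show ?thesis by (simp add: mult.assoc)
qed

definition drift_const :: real where "drift_const = 4 * pi\<^sup>2 * Q * L * D\<^sup>2 * (K\<^sup>2 * E)"

text \<open>Differentiation under the integral sign bounds the speed of the mean by
  \<open>drift_const\<close> times the derivative of \<open>H\<close>; integrate over time.\<close>

lemma mean_drift:
  assumes y: "y \<in> topspace X" and b: "b \<in> B" and rs: "r < s" and near: "\<And>q. q \<in> {r..s} \<Longrightarrow> flow q y \<in> near R'"
  shows "\<bar>mean b y s - mean b y r\<bar> \<le> drift_const * (H (flow s y) - H (flow r y))"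
proof -
  let ?m = "\<lambda>q. integral {0..2 * pi} (\<lambda>\<theta>. coord (Rplus_field act c (turn q \<theta> y)) b)"
  let ?e = "\<lambda>q. compatible_metric \<omega> J c (flow q y) (Rplus_field act c (flow q y)) (Rplus_field act c (flow q y))"
  have in_c: "turn q \<theta> y \<in> fst c" if "q \<in> {r..s}" for q \<theta> using nearD(1)[OF turn_near[OF y near[OF that]]] .
  have mean: "(mean b y has_vector_derivative ?m q) (at q within {r..s})" if q: "q \<in> {r..s}" for q
  proof -
    have "((\<lambda>q. integral (cbox 0 (2 * pi)) (\<lambda>\<theta>. coord (snd c (turn q \<theta> y)) b)) has_vector_derivative
        integral (cbox 0 (2 * pi)) (\<lambda>\<theta>. coord (Rplus_field act c (turn q \<theta> y)) b)) (at q within {r..s})"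
    proof (rule leibniz_rule_vector_derivative)
      fix p \<theta> assume "p \<in> {r..s}"
      then show "((\<lambda>q. coord (snd c (turn q \<theta> y)) b) has_vector_derivative
          coord (Rplus_field act c (turn p \<theta> y)) b) (at p within {r..s})"
        by - (rule bounded_linear.has_vector_derivative[OF bounded_linear_coord[OF b]],
          rule has_vector_derivative_at_within, rule turn_derivative(2)[OF y in_c])
    next
      fix p assume "p \<in> {r..s}"
      then show "(\<lambda>\<theta>. coord (snd c (turn p \<theta> y)) b) integrable_on cbox 0 (2 * pi)"
        by (intro integrable_continuous continuous_on_coord turn_continuous_angle y near b)
    next
      have "continuous_on ({r..s} \<times> cbox 0 (2 * pi)) (\<lambda>p. coord (Rplus_field act c (turn (fst p) (snd p) y)) b)"
        by (intro continuous_on_coord turn_continuous(2) y b) (simp add: mem_Times_iff in_c)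
      then show "continuous_on ({r..s} \<times> cbox 0 (2 * pi)) (\<lambda>(q, \<theta>). coord (Rplus_field act c (turn q \<theta> y)) b)"
        by (simp add: case_prod_beta)
    qed (use q in auto)
    then show ?thesis by (simp add: mean_def[abs_def])
  qed
  have H: "((\<lambda>s. H (flow s y)) has_real_derivative ?e q) (at q)" if "q \<in> {r..s}" for q
    by (rule H_flow_derivative[OF y c(1) nearD(1)[OF near[OF that]]])
  have "norm (mean b y s - mean b y r) \<le> drift_const * H (flow s y) - drift_const * H (flow r y)"
  proof (rule differentiable_bound_general[OF rs, where f' = ?m and \<phi>' = "\<lambda>q. drift_const * ?e q"])
    show "continuous_on {r..s} (\<lambda>s. drift_const * H (flow s y))"
      by (intro continuous_intros continuous_at_imp_continuous_on ballI DERIV_isCont[OF H])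
    show "continuous_on {r..s} (mean b y)"
      using mean by (meson continuous_on_eq_continuous_within has_vector_derivative_continuous)
    fix q assume q: "r < q" "q < s"
    then have q': "q \<in> {r..s}" by simp
    have "at q within {r..s} = at q" by (rule at_within_interior) (use q in simp)
    then show "(mean b y has_vector_derivative ?m q) (at q)" using mean[OF q'] by simp
    show "((\<lambda>s. drift_const * H (flow s y)) has_vector_derivative drift_const * ?e q) (at q)"
      using DERIV_cmult[OF H[OF q'], of drift_const] by (simp add: has_real_derivative_iff_has_vector_derivative)
    have "norm (?m q) \<le> 4 * pi\<^sup>2 * Q * L * D\<^sup>2 * (norm (S1_field act c (flow q y)))\<^sup>2"
      using mean_drift_rate[OF y near[OF q'] b] by simp
    also have "\<dots> \<le> 4 * pi\<^sup>2 * Q * L * D\<^sup>2 * (K\<^sup>2 * E * ?e q)"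
      by (intro mult_left_mono S1_le_energy subsetD[OF near_mono[OF R'(2)] near[OF q']]) (simp add: nonneg)
    finally show "norm (?m q) \<le> drift_const * ?e q" by (simp add: drift_const_def mult_ac)
  qed
  then show ?thesis by (simp add: algebra_simps)
qed

text \<open>The division by \<open>2 * pi\<close> undoes the missing normalisation of
  \<open>mean\<close>, and the sum over the basis passes from coordinates to vectors.\<close>

definition slow_const :: real where "slow_const = (\<Sum>b\<in>B. norm b) * ((4 * pi\<^sup>2 * Q * D + drift_const) / (2 * pi))"

text \<open>Pass from the orbit to the mean at time \<open>r\<close>, follow the mean, and pass back
  at time \<open>s\<close>.\<close>

lemma orbit_drift:
  assumes y: "y \<in> topspace X" and rs: "r < s" and near: "\<And>q. q \<in> {r..s} \<Longrightarrow> flow q y \<in> near R'"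
  shows "norm (snd c (flow s y) - snd c (flow r y)) \<le> slow_const *
    (norm (S1_field act c (flow s y)) + norm (S1_field act c (flow r y)) + (H (flow s y) - H (flow r y)))"
    (is "_ \<le> _ * ?\<epsilon>")
proof -
  let ?M = "4 * pi\<^sup>2 * Q * D"
  have mono: "H (flow r y) \<le> H (flow s y)" using H_flow_mono[OF y] rs by simp
  have nn: "?M \<ge> 0" "drift_const \<ge> 0" using nonneg by (simp_all add: drift_const_def)
  have "\<bar>coord (snd c (flow s y) - snd c (flow r y)) b\<bar> \<le> (?M + drift_const) * ?\<epsilon> / (2 * pi)" if b: "b \<in> B" for b
  proof -
    have "2 * pi * \<bar>coord (snd c (flow s y) - snd c (flow r y)) b\<bar> =
        \<bar>2 * pi * coord (snd c (flow s y)) b - 2 * pi * coord (snd c (flow r y)) b\<bar>"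
      by (simp add: coord_diff abs_mult flip: right_diff_distrib)
    also have "\<dots> \<le> ?M * norm (S1_field act c (flow s y)) + ?M * norm (S1_field act c (flow r y))
        + drift_const * (H (flow s y) - H (flow r y))"
      using mean_close[OF y near b, of s] mean_close[OF y near b, of r] mean_drift[OF y b rs near] rs by simp
    also have "\<dots> \<le> (?M + drift_const) * ?\<epsilon>"
    proof -
      have "0 \<le> ?M * (H (flow s y) - H (flow r y))" "0 \<le> drift_const * norm (S1_field act c (flow s y))"
        "0 \<le> drift_const * norm (S1_field act c (flow r y))"
        using nn mono by (simp_all only: mult_nonneg_nonneg norm_ge_zero diff_ge_0_iff_ge)
      then show ?thesis by (simp only: distrib_left distrib_right)
    qed
    finally show ?thesis by (simp add: field_simps)
  qed
  from norm_le_coord[OF this] show ?thesis by (simp add: slow_const_def mult_ac)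
qed

end

section \<open>Cluster points of bounded orbits\<close>

context Cstar_manifold
begin

lemma flow_in: "y \<in> topspace X \<Longrightarrow> flow s y \<in> topspace X"
  by (rule act_in) simp_all

lemma flow_flow: "y \<in> topspace X \<Longrightarrow> flow r (flow s y) = flow (r + s) y"
  by (simp add: act_act exp_add)

lemma flow_zero: "y \<in> topspace X \<Longrightarrow> flow 0 y = y"
  by (simp add: act_one)

lemma continuous_map_flow_time: "y \<in> topspace X \<Longrightarrow> continuous_map euclideanreal X (\<lambda>s. flow s y)"
  by (rule continuous_map_act) (auto intro!: continuous_intros)

lemma continuous_map_flow: "continuous_map X X (flow s)"
  by (rule continuous_map_act_fixed) simp

lemma fixed_imp_S1_field_zero:
  assumes "\<And>t. t \<noteq> 0 \<Longrightarrow> act t z = z" shows "S1_field act c z = 0"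
  by (simp add: S1_field_def assms)

definition clusters :: "'a \<Rightarrow> 'a \<Rightarrow> bool" where
  "clusters y z \<longleftrightarrow> z \<in> topspace X \<and> (\<forall>N. openin X N \<longrightarrow> z \<in> N \<longrightarrow> (\<exists>\<^sub>F s in at_top. flow s y \<in> N))"

lemma cluster_point_exists:
  assumes Q: "compactin X Q" and freq: "\<exists>\<^sub>F s in at_top. flow s y \<in> Q"
  shows "\<exists>z\<in>Q. clusters y z"
proof (rule ccontr)
  assume none: "\<not> ?thesis"
  have QX: "Q \<subseteq> topspace X" using Q by (rule compactin_subset_topspace)
  have "\<forall>z\<in>Q. \<exists>N. openin X N \<and> z \<in> N \<and> (\<forall>\<^sub>F s in at_top. flow s y \<notin> N)"
  proof
    fix z assume z: "z \<in> Q"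
    then have "z \<in> topspace X" "\<not> clusters y z" using none QX by blast+
    then show "\<exists>N. openin X N \<and> z \<in> N \<and> (\<forall>\<^sub>F s in at_top. flow s y \<notin> N)"
      by (simp add: clusters_def not_frequently)
  qed
  then obtain N where N: "\<And>z. z \<in> Q \<Longrightarrow> openin X (N z)" "\<And>z. z \<in> Q \<Longrightarrow> z \<in> N z"
    "\<And>z. z \<in> Q \<Longrightarrow> \<forall>\<^sub>F s in at_top. flow s y \<notin> N z"
    by metis
  have "\<exists>\<F>. finite \<F> \<and> \<F> \<subseteq> N ` Q \<and> Q \<subseteq> \<Union>\<F>"
    using Q N(1,2) unfolding compactin_def by (metis (no_types, lifting) UN_iff imageE subsetI)
  then obtain \<F> where \<F>: "finite \<F>" "\<F> \<subseteq> N ` Q" "Q \<subseteq> \<Union>\<F>" by blast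
  have "\<forall>\<^sub>F s in at_top. \<forall>V\<in>\<F>. flow s y \<notin> V"
    using \<F>(2) N(3) by (intro eventually_ball_finite[OF \<F>(1)] ballI) blast
  then have "\<forall>\<^sub>F s in at_top. flow s y \<notin> Q"
    by (rule eventually_mono) (use \<F>(3) in blast)
  then show False using freq by (simp add: frequently_def)
qed

lemma cluster_value:
  assumes z: "clusters y z" and k: "continuous_map X euclideanreal k"
    and lim: "((\<lambda>s. k (flow s y)) \<longlongrightarrow> l) at_top"
  shows "k z = l"
proof (rule ccontr)
  assume ne: "k z \<noteq> l"
  define \<delta> where "\<delta> = \<bar>k z - l\<bar> / 2"
  have \<delta>: "\<delta> > 0" using ne by (simp add: \<delta>_def)
  let ?N = "{w \<in> topspace X. k w \<in> ball (k z) \<delta>}"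
  have "openin X ?N" by (rule openin_continuous_map_preimage[OF k]) simp
  moreover have "z \<in> ?N" using z \<delta> by (simp add: clusters_def)
  ultimately have "\<exists>\<^sub>F s in at_top. flow s y \<in> ?N" using z unfolding clusters_def by blast
  moreover have "\<forall>\<^sub>F s in at_top. dist (k (flow s y)) l < \<delta>" using lim \<delta> by (rule tendstoD)
  ultimately have "\<exists>\<^sub>F s in at_top. flow s y \<in> ?N \<and> dist (k (flow s y)) l < \<delta>"
    by (rule frequently_eventually_frequently)
  then obtain s where "flow s y \<in> ?N" "dist (k (flow s y)) l < \<delta>" using frequently_ex by blast
  then show False by (simp add: \<delta>_def dist_real_def abs_if split: if_splits)
qed

lemma H_flow_converges:
  assumes y: "y \<in> topspace X" and Q: "compactin X Q" "\<And>s. s \<ge> 0 \<Longrightarrow> flow s y \<in> Q"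
  shows "\<exists>l. ((\<lambda>s. H (flow s y)) \<longlongrightarrow> l) at_top \<and> (\<forall>s. H (flow s y) \<le> l)"
proof -
  have "compact (H ` Q)"
    using image_compactin[OF Q(1) H_continuous] by simp
  then have "bounded (H ` Q)" by (rule compact_imp_bounded)
  then obtain M where M: "\<And>w. w \<in> Q \<Longrightarrow> \<bar>H w\<bar> \<le> M" by (auto simp: bounded_iff)
  have le: "H (flow s y) \<le> M" for s
    using H_flow_mono[OF y, of s "max s 0"] M[OF Q(2), of "max s 0"] by simp
  define l where "l = (SUP s. H (flow s y))"
  have bdd: "bdd_above (range (\<lambda>s. H (flow s y)))" by (rule bdd_aboveI2) (rule le)
  have up: "H (flow s y) \<le> l" for s unfolding l_def by (rule cSUP_upper[OF UNIV_I bdd])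
  have "((\<lambda>s. H (flow s y)) \<longlongrightarrow> l) at_top"
  proof (rule increasing_tendsto)
    show "\<forall>\<^sub>F s in at_top. H (flow s y) \<le> l" using up by simp
    fix x assume "x < l"
    then obtain s0 where s0: "x < H (flow s0 y)"
      unfolding l_def using less_cSUP_iff[OF _ bdd, of x] by auto
    show "\<forall>\<^sub>F s in at_top. x < H (flow s y)"
      using eventually_ge_at_top[of s0] by (rule eventually_mono) (use s0 H_flow_mono[OF y, of s0] in fastforce)
  qed
  then show ?thesis using up by blast
qed

text \<open>On the whole orbit of \<open>z\<close> the moment map equals its limit along the orbit
  of \<open>y\<close>, because \<open>flow r\<close> only shifts time.\<close>

lemma cluster_point_fixed:
  assumes y: "y \<in> topspace X" and Q: "compactin X Q" "\<And>s. s \<ge> 0 \<Longrightarrow> flow s y \<in> Q"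
    and z: "clusters y z" and "t \<noteq> 0"
  shows "act t z = z"
proof -
  obtain l where l: "((\<lambda>s. H (flow s y)) \<longlongrightarrow> l) at_top" using H_flow_converges[OF y Q] by blast
  have "H (flow r z) = l" for r
  proof (rule cluster_value[OF z, of "\<lambda>w. H (flow r w)"])
    show "continuous_map X euclideanreal (\<lambda>w. H (flow r w))"
      using continuous_map_compose[OF continuous_map_flow H_continuous] by (simp add: o_def)
    have "filterlim (\<lambda>s. r + s) at_top at_top" by (intro filterlim_tendsto_add_at_top[OF tendsto_const] filterlim_ident)
    from filterlim_compose[OF l this] show "((\<lambda>s. H (flow r (flow s y))) \<longlongrightarrow> l) at_top"
      by (simp only: flow_flow[OF y])
  qed
  then show ?thesis using z \<open>t \<noteq> 0\<close> by (intro H_constant_imp_fixed) (auto simp: clusters_def)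
qed

end

section \<open>Convergence of bounded orbits\<close>

context fixed_point_chart
begin

lemma slow_const_nonneg: "slow_const \<ge> 0"
  using nonneg by (simp add: slow_const_def drift_const_def sum_nonneg)

text \<open>An orbit that comes close to the fixed point late enough cannot leave the chart again: on the
  way to the boundary it would have to drift by more than its remaining energy allows.\<close>

lemma orbit_trapped:
  assumes y: "y \<in> topspace X" and \<epsilon>: "0 < \<epsilon>" "\<epsilon> \<le> R'"
    and \<eta>: "slow_const * (3 * \<eta>) < \<epsilon> / 2"
    and energy: "\<And>r s. S \<le> r \<Longrightarrow> r \<le> s \<Longrightarrow> H (flow s y) - H (flow r y) \<le> \<eta>"
    and speed: "\<And>s. S \<le> s \<Longrightarrow> flow s y \<in> near R' \<Longrightarrow> norm (S1_field act c (flow s y)) \<le> \<eta>"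
    and s0: "S \<le> s0" "flow s0 y \<in> fst c" "snd c (flow s0 y) \<in> ball (snd c z) (\<epsilon> / 2)" and "s0 \<le> s2"
  shows "flow s2 y \<in> near \<epsilon>"
proof (rule ccontr)
  define U where "U = {w \<in> fst c. snd c w \<in> ball (snd c z) \<epsilon>}"
  have U_near: "U \<subseteq> near \<epsilon>" by (auto simp: U_def near_def)
  assume "flow s2 y \<notin> near \<epsilon>"
  then have out: "flow s2 y \<notin> U" using U_near by blast
  have "openin X U" unfolding U_def by (rule openin_chart_preimage[OF c(1) open_ball])
  from openin_continuous_map_preimage[OF continuous_map_flow_time[OF y] this]
  have O: "open {q. flow q y \<in> U}" by simp
  \<comment> \<open>\<open>s1\<close> will be the first time outside the open ball. Up to and
    including that time the orbit is in the closed ball, so the drift estimate reaches it.\<close>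
  define Z where "Z = {s0..s2} - {q. flow q y \<in> U}"
  have "compact Z" unfolding Z_def by (rule compact_diff[OF compact_Icc O])
  moreover have "Z \<noteq> {}" using out \<open>s0 \<le> s2\<close> by (auto simp: Z_def)
  ultimately obtain s1 where s1: "s1 \<in> Z" "\<And>q. q \<in> Z \<Longrightarrow> s1 \<le> q"
    using compact_attains_inf[of Z] by blast
  have "flow s0 y \<in> U" using s0 \<epsilon>(1) by (simp add: U_def)
  then have s01: "s0 < s1" using s1(1) by (auto simp: Z_def less_le)
  have before: "flow q y \<in> near \<epsilon>" if "q \<in> {s0..<s1}" for q
  proof -
    have "q \<notin> Z" using s1(2)[of q] that by auto
    then have "flow q y \<in> U" using that s1(1) by (auto simp: Z_def)
    then show ?thesis using U_near by blast
  qed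
  have "closedin X (near \<epsilon>)"
    using near_compact \<epsilon>(2) R'(2) Hausdorff by (intro compactin_imp_closedin) auto
  from closedin_continuous_map_preimage[OF continuous_map_flow_time[OF y] this]
  have "closed {q. flow q y \<in> near \<epsilon>}" by simp
  moreover have "{s0..<s1} \<subseteq> {q. flow q y \<in> near \<epsilon>}" using before by blast
  ultimately have "closure {s0..<s1} \<subseteq> {q. flow q y \<in> near \<epsilon>}" by (rule closure_minimal[rotated])
  then have near: "flow q y \<in> near \<epsilon>" if "q \<in> {s0..s1}" for q
    using that s01 by (auto simp: closure_atLeastLessThan)
  then have near': "flow q y \<in> near R'" if "q \<in> {s0..s1}" for q
    using that near_mono[OF \<epsilon>(2)] by blast
  have "norm (snd c (flow s1 y) - snd c (flow s0 y)) \<le> slow_const *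
    (norm (S1_field act c (flow s1 y)) + norm (S1_field act c (flow s0 y)) + (H (flow s1 y) - H (flow s0 y)))"
    by (rule orbit_drift[OF y s01 near'])
  also have "\<dots> \<le> slow_const * (3 * \<eta>)"
    using speed[OF s0(1) near'] speed[OF _ near', of s1] energy[OF s0(1), of s1] s01 s0(1)
    by (intro mult_left_mono[OF _ slow_const_nonneg]) auto
  finally have "dist (snd c (flow s0 y)) (snd c (flow s1 y)) < \<epsilon> / 2"
    using \<eta> by (simp add: dist_norm norm_minus_commute)
  then have "dist (snd c z) (snd c (flow s1 y)) < \<epsilon>"
    using s0(3) dist_triangle[of "snd c z" "snd c (flow s1 y)" "snd c (flow s0 y)"] by simp
  then have "flow s1 y \<in> U" using nearD(1)[OF near[of s1]] s01 by (simp add: U_def)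
  then show False using s1(1) by (simp add: Z_def)
qed

lemma orbit_converges:
  assumes y: "y \<in> topspace X" and P: "compactin X P" "\<And>s. s \<ge> 0 \<Longrightarrow> flow s y \<in> P"
    and z: "clusters y z"
  shows "limitin X (\<lambda>s. flow s y) z at_top"
  unfolding limitin_def
proof (intro conjI allI impI)
  show "z \<in> topspace X" using z by (simp add: clusters_def)
  fix W assume W: "openin X W \<and> z \<in> W"
  then obtain r where r: "r > 0" "\<And>x. x \<in> cball (snd c z) r \<Longrightarrow> chart_inv c x \<in> W"
    using chart_ball[OF c, of W] by metis
  define \<epsilon> where "\<epsilon> = min r R'"
  have \<epsilon>: "0 < \<epsilon>" "\<epsilon> \<le> R'" using r(1) R'(1) by (auto simp: \<epsilon>_def)
  have near_W: "near \<epsilon> \<subseteq> W"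
  proof
    fix w assume "w \<in> near \<epsilon>"
    then have "w \<in> fst c" "snd c w \<in> cball (snd c z) r" by (auto simp: near_def \<epsilon>_def)
    then show "w \<in> W" using r(2)[of "snd c w"] chart_inv_chart[OF c(1)] by simp
  qed
  \<comment> \<open>Three terms of size \<eta> enter the drift estimate, which must stay below half
    the radius; adding 1 keeps the denominator positive.\<close>
  define \<eta> where "\<eta> = \<epsilon> / (6 * (slow_const + 1))"
  have \<eta>: "\<eta> > 0" using \<epsilon>(1) slow_const_nonneg by (simp add: \<eta>_def)
  have "slow_const * (3 * \<eta>) < \<epsilon> / 2"
    using \<epsilon>(1) slow_const_nonneg by (simp add: \<eta>_def field_simps)
  obtain l where l: "((\<lambda>s. H (flow s y)) \<longlongrightarrow> l) at_top" "\<And>s. H (flow s y) \<le> l"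
    using H_flow_converges[OF y P] by blast
  have energy: "\<forall>\<^sub>F s in at_top. l - \<eta> < H (flow s y)"
    using order_tendstoD(1)[OF l(1)] \<eta> by simp
  \<comment> \<open>Otherwise the orbit clusters at a point of the chart where the circle field has
    length at least \<eta>, whereas cluster points are fixed and the field vanishes there.\<close>
  have speed: "\<forall>\<^sub>F s in at_top. flow s y \<in> near R' \<longrightarrow> norm (S1_field act c (flow s y)) \<le> \<eta>"
  proof (rule ccontr)
    let ?V = "\<lambda>x. frechet_derivative (action_chart act c c) (at (1, x)) (\<i>, 0)"
    \<comment> \<open>In chart coordinates the circle field is read off from the derivative of the
      action at 1, which depends continuously on the point.\<close>
    have S1: "S1_field act c w = ?V (snd c w)" if "w \<in> fst c" for w
    proof -
      have w: "w \<in> topspace X" using that openin_subset[OF chart(1)[OF c(1)]] by blast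
      show ?thesis
        using S1_field_orbit[OF c(1) w, of 1] orbit_derivative_eq(2)[OF c(1,1) that, of 1] act_one[OF w] that by simp
    qed
    let ?C = "{x \<in> cball (snd c z) R'. \<eta> \<le> norm (?V x)}"
    have sub': "cball (snd c z) R' \<subseteq> snd c ` fst c"
      using sub R'(2) by (meson order_trans subset_cball)
    have "(1, x) \<in> action_chart_dom act c c" if "x \<in> cball (snd c z) R'" for x
    proof -
      have "x \<in> snd c ` fst c" by (rule subsetD[OF sub' that])
      then obtain w where w: "x = snd c w" "w \<in> fst c" by (rule imageE)
      then have "act 1 w = w" using openin_subset[OF chart(1)[OF c(1)]] act_one by blast
      then show ?thesis using w chart_inv_chart[OF c(1)] by (simp add: action_chart_dom_def)
    qed
    then have sub1: "Pair 1 ` cball (snd c z) R' \<subseteq> action_chart_dom act c c" by (rule image_subsetI)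
    have "smooth_on (action_chart_dom act c c) (action_chart act c c)"
      using action c(1) by (simp add: smooth_Cstar_action_def)
    from continuous_on_compose2[OF smooth_on_continuous_derivative[OF this] _ sub1]
    have "continuous_on (cball (snd c z) R') ?V" by (simp add: continuous_intros)
    then have "closed ?C" by (intro continuous_on_closed_Collect_le continuous_intros) auto
    then have "compact (cball (snd c z) R' \<inter> ?C)" by (rule compact_Int_closed[OF compact_cball])
    then have "compact ?C" by (rule back_subst[of compact]) blast
    then have cQ: "compactin X (chart_inv c ` ?C)"
      by (intro image_compactin[OF _ continuous_chart_inv[OF c(1)]]) (use sub' in \<open>auto simp: compactin_subtopology\<close>)
    assume "\<not> (\<forall>\<^sub>F s in at_top. flow s y \<in> near R' \<longrightarrow> norm (S1_field act c (flow s y)) \<le> \<eta>)"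
    then have "\<exists>\<^sub>F s in at_top. flow s y \<in> near R' \<and> \<eta> < norm (S1_field act c (flow s y))"
      by (simp add: not_eventually not_le)
    then have "\<exists>\<^sub>F s in at_top. flow s y \<in> chart_inv c ` ?C"
    proof (rule frequently_elim1)
      fix s assume s: "flow s y \<in> near R' \<and> \<eta> < norm (S1_field act c (flow s y))"
      then have "flow s y = chart_inv c (snd c (flow s y))"
        using nearD(1)[of "flow s y" R'] chart_inv_chart[OF c(1), of "flow s y"] by simp
      moreover have "snd c (flow s y) \<in> ?C" using s nearD[of "flow s y" R'] S1[of "flow s y"] by simp
      ultimately show "flow s y \<in> chart_inv c ` ?C" by (rule image_eqI)
    qed
    from cluster_point_exists[OF cQ this] obtain w where w: "w \<in> chart_inv c ` ?C" "clusters y w" by blast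
    from w(1) obtain x where x: "x \<in> ?C" "w = chart_inv c x" by (rule imageE)
    then have "x \<in> snd c ` fst c" using sub' by blast
    then have "w \<in> fst c" "snd c w = x" using x chart_inv_in[OF c(1)] chart_chart_inv[OF c(1)] by simp_all
    then have "\<eta> \<le> norm (S1_field act c w)" using x(1) S1 by simp
    moreover have "S1_field act c w = 0"
      by (rule fixed_imp_S1_field_zero) (rule cluster_point_fixed[OF y P w(2)])
    ultimately show False using \<eta> by simp
  qed
  from energy speed have "\<forall>\<^sub>F s in at_top. l - \<eta> < H (flow s y) \<and>
      (flow s y \<in> near R' \<longrightarrow> norm (S1_field act c (flow s y)) \<le> \<eta>)"
    by (rule eventually_conj)
  then obtain S where S: "\<And>s. S \<le> s \<Longrightarrow> l - \<eta> < H (flow s y)"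
    "\<And>s. S \<le> s \<Longrightarrow> flow s y \<in> near R' \<Longrightarrow> norm (S1_field act c (flow s y)) \<le> \<eta>"
    by (auto simp: eventually_at_top_linorder)
  let ?N = "{w \<in> fst c. snd c w \<in> ball (snd c z) (\<epsilon> / 2)}"
  have "openin X ?N" by (rule openin_chart_preimage[OF c(1) open_ball])
  moreover have "z \<in> ?N" using c(2) \<epsilon>(1) by simp
  ultimately have "\<exists>\<^sub>F s in at_top. flow s y \<in> ?N" using z unfolding clusters_def by blast
  then have "\<exists>\<^sub>F s in at_top. flow s y \<in> ?N \<and> S \<le> s"
    by (rule frequently_eventually_frequently) (rule eventually_ge_at_top)
  then obtain s0 where s0: "flow s0 y \<in> ?N" "S \<le> s0" using frequently_ex by blast
  have "flow s y \<in> W" if "s0 \<le> s" for s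
  proof -
    have "H (flow s y) - H (flow r y) \<le> \<eta>" if "S \<le> r" "r \<le> s" for r s
      using S(1)[OF that(1)] l(2)[of s] by simp
    then have "flow s y \<in> near \<epsilon>"
      using orbit_trapped[OF y \<epsilon> \<open>slow_const * (3 * \<eta>) < \<epsilon> / 2\<close> _ S(2) s0(2) _ _ that] s0(1) by simp
    then show ?thesis using near_W by blast
  qed
  then show "\<forall>\<^sub>F s in at_top. flow s y \<in> W"
    by (auto simp: eventually_at_top_linorder)
qed

end

context Cstar_manifold
begin

text \<open>The limit along the positive reals is fixed, so a neighbourhood of it stays in a given
  one under all rotations; writing \<open>t\<close> as a rotation times a positive real gives the
  limit over all complex \<open>t\<close>.\<close>

theorem bounded_orbit_converges:
  assumes y: "y \<in> topspace X" and Q: "compactin X Q" "\<And>s. s \<ge> 0 \<Longrightarrow> flow s y \<in> Q"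
  shows "\<exists>z. limitin X (\<lambda>t. act t y) z at_infinity"
proof -
  obtain B :: "'e set" where "finite_dim B" using basis_exists by blast
  then interpret Cstar_manifold_basis X A \<omega> J act B
    by (intro Cstar_manifold_basis.intro Cstar_manifold_axioms)
  have "\<forall>\<^sub>F s in at_top. flow s y \<in> Q" using Q(2) by (auto simp: eventually_at_top_linorder)
  then have "\<exists>\<^sub>F s in at_top. flow s y \<in> Q" by (rule eventually_frequently[rotated]) simp
  from cluster_point_exists[OF Q(1) this] obtain z where z: "clusters y z" by blast
  then have zX: "z \<in> topspace X" by (simp add: clusters_def)
  have fixed: "act t z = z" if "t \<noteq> 0" for t
    by (rule cluster_point_fixed[OF y Q z that])
  obtain c where c: "c \<in> A" "z \<in> fst c" using chart_exists zX by blast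
  obtain R R' K L E D Qc where "fixed_point_chart X A \<omega> J act B c z R R' K L E D Qc"
    using fixed_point_chart_exists[OF c fixed] by blast
  then interpret fixed_point_chart X A \<omega> J act B c z R R' K L E D Qc .
  have lim: "limitin X (\<lambda>s. flow s y) z at_top" by (rule orbit_converges[OF y Q z])
  have "limitin X (\<lambda>t. act t y) z at_infinity"
    unfolding limitin_def
  proof (intro conjI allI impI zX)
    fix W assume W: "openin X W \<and> z \<in> W"
    let ?N = "{w \<in> topspace X. \<forall>t\<in>sphere 0 1. act t w \<in> W}"
    have "openin X ?N" by (rule openin_act_compact) (use W in auto)
    moreover have "z \<in> ?N"
    proof (intro CollectI conjI ballI zX)
      fix t :: complex assume "t \<in> sphere 0 1"
      then have "t \<noteq> 0" by auto
      then show "act t z \<in> W" using fixed W by simp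
    qed
    ultimately have "\<forall>\<^sub>F s in at_top. flow s y \<in> ?N" using lim unfolding limitin_def by blast
    then obtain S where S: "\<And>s. S \<le> s \<Longrightarrow> flow s y \<in> ?N" by (auto simp: eventually_at_top_linorder)
    show "\<forall>\<^sub>F t in at_infinity. act t y \<in> W"
      unfolding eventually_at_infinity
    proof (intro exI allI impI)
      fix t :: complex assume t: "exp S \<le> norm t"
      then have nt: "norm t > 0" using exp_gt_zero[of S] by linarith
      then have t0: "t \<noteq> 0" by auto
      have "S \<le> ln (norm t)" using t nt by (simp add: ln_ge_iff)
      from S[OF this] have "act (sgn t) (flow (ln (norm t)) y) \<in> W"
        using t0 by (simp add: norm_sgn)
      moreover have "sgn t * of_real (exp (ln (norm t))) = t"
        using nt by (simp add: sgn_eq)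
      ultimately show "act t y \<in> W" using t0 y by (simp add: act_act sgn_zero_iff)
    qed
  qed
  then show ?thesis by blast
qed

end

section \<open>Dynamics of a contracting action\<close>

text \<open>Finitely many times serve a whole compact set, which bounds hitting times and exit times
  uniformly.\<close>

lemma compactin_finite_choice:
  assumes K: "compactin X K" and N: "\<And>y. y \<in> K \<Longrightarrow> \<exists>s N. openin X N \<and> y \<in> N \<and> (\<forall>x\<in>N. P s x)"
  shows "\<exists>F. finite F \<and> (\<forall>y\<in>K. \<exists>s\<in>F. P s y)"
proof -
  obtain s N where sN: "\<And>y. y \<in> K \<Longrightarrow> openin X (N y)" "\<And>y. y \<in> K \<Longrightarrow> y \<in> N y"
    "\<And>x y. y \<in> K \<Longrightarrow> x \<in> N y \<Longrightarrow> P (s y) x"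
    using N by metis
  have "K \<subseteq> \<Union>(N ` K)" using sN(2) by blast
  moreover have "\<And>V. V \<in> N ` K \<Longrightarrow> openin X V" using sN(1) by blast
  ultimately have "\<exists>\<F>. finite \<F> \<and> \<F> \<subseteq> N ` K \<and> K \<subseteq> \<Union>\<F>"
    using compactinD[OF K, of "N ` K"] by blast
  then obtain \<F> where \<F>: "finite \<F>" "\<F> \<subseteq> N ` K" "K \<subseteq> \<Union>\<F>" by blast
  obtain K' where K': "K' \<subseteq> K" "finite K'" "\<F> = N ` K'"
    using finite_subset_image[OF \<F>(1,2)] by blast
  have "\<exists>t\<in>s ` K'. P t y" if y: "y \<in> K" for y
  proof -
    obtain k where k: "k \<in> K'" "y \<in> N k" using \<F>(3) K'(3) y by blast
    then have "P (s k) y" using sN(3) K'(1) by blast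
    then show ?thesis using k(1) by blast
  qed
  then show ?thesis using K'(2) by blast
qed

locale contracting_manifold = Cstar_manifold X A \<omega> J act
  for X :: "'a topology" and A :: "('a, 'e::real_normed_vector) chart set" and \<omega> J act +
  assumes contracting: "contracting X A act"
begin

lemma openin_flow_preimage: "openin X U \<Longrightarrow> openin X {y \<in> topspace X. flow s y \<in> U}"
  by (rule openin_continuous_map_preimage[OF continuous_map_flow])

lemma flow_box_compact:
  assumes "compactin X K"
  shows "compactin X {flow s y | s y. s \<in> {a..b} \<and> y \<in> K}"
proof -
  have "continuous_map (prod_topology euclideanreal X) X (\<lambda>p. flow (fst p) (snd p))"
  proof (rule continuous_map_act)
    have "continuous_map (prod_topology euclideanreal X) euclidean ((\<lambda>s. complex_of_real (exp s)) \<circ> fst)"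
      by (rule continuous_map_compose[OF continuous_map_fst]) (auto intro!: continuous_intros)
    then show "continuous_map (prod_topology euclideanreal X) euclidean (\<lambda>p. complex_of_real (exp (fst p)))"
      by (simp add: o_def)
  qed (auto intro: continuous_map_snd)
  moreover have "compactin (prod_topology euclideanreal X) ({a..b} \<times> K)"
    using assms by (simp add: compactin_Times)
  ultimately have "compactin X ((\<lambda>p. flow (fst p) (snd p)) ` ({a..b} \<times> K))"
    by (rule image_compactin[rotated])
  moreover have "(\<lambda>p. flow (fst p) (snd p)) ` ({a..b} \<times> K) = {flow s y | s y. s \<in> {a..b} \<and> y \<in> K}"
    by force
  ultimately show ?thesis by simp
qed

text \<open>Reversed orbits reach a compact neighbourhood \<open>L\<close> of the given subdomain,
  and starting in \<open>L\<close> they return to it within a uniform time \<open>T\<close>. The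
  pieces of length \<open>T\<close> that start in \<open>L\<close> therefore sweep out a compact set
  \<open>P\<close> that is never left.\<close>

lemma absorbing_exists:
  "\<exists>P. compactin X P \<and> (\<forall>y\<in>P. \<forall>s\<ge>0. flow (- s) y \<in> P) \<and>
     (\<forall>K. compactin X K \<longrightarrow> (\<exists>S. \<forall>s\<ge>S. \<forall>y\<in>K. flow (- s) y \<in> P))"
proof -
  obtain D where D: "compactin X D" "\<And>y. y \<in> topspace X \<Longrightarrow> \<forall>\<^sub>F s in at_top. flow (- s) y \<in> D"
    using contracting unfolding contracting_def compact_subdomain_def by blast
  obtain U L where U: "openin X U" "compactin X L" "D \<subseteq> U" "U \<subseteq> L"
    using locally_compact_space_compact_closed_compact[of X] Hausdorff locally_compact D(1) by blast
  have LX: "L \<subseteq> topspace X" using U(2) by (rule compactin_subset_topspace)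
  have hit: "\<exists>T\<ge>1. \<forall>y\<in>K. \<exists>s\<in>{1..T}. flow (- s) y \<in> L" if K: "compactin X K" for K
  proof -
    \<comment> \<open>Waiting times are taken to be at least 1, so that successive visits to
      \<open>L\<close> cannot accumulate; the induction for \<open>stay\<close> uses up one unit of
      time per visit.\<close>
    have "\<exists>F. finite F \<and> (\<forall>y\<in>K. \<exists>s\<in>F. s \<ge> 1 \<and> flow (- s) y \<in> L)"
    proof (rule compactin_finite_choice[OF K])
      fix y assume "y \<in> K"
      then have y: "y \<in> topspace X" using compactin_subset_topspace[OF K] by blast
      have "\<forall>\<^sub>F s in at_top. flow (- s) y \<in> D \<and> s \<ge> 1"
        by (intro eventually_conj D(2) y eventually_ge_at_top)
      then obtain s where s: "flow (- s) y \<in> D" "s \<ge> 1"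
        using eventually_happens[of _ "at_top :: real filter"] by (metis (no_types, lifting) trivial_limit_at_top_linorder)
      show "\<exists>s N. openin X N \<and> y \<in> N \<and> (\<forall>x\<in>N. s \<ge> 1 \<and> flow (- s) x \<in> L)"
        using openin_flow_preimage[OF U(1), of "- s"] y s U(3,4)
        by (intro exI[of _ s] exI[of _ "{y \<in> topspace X. flow (- s) y \<in> U}"]) blast
    qed
    then obtain F where F: "finite F" "\<And>y. y \<in> K \<Longrightarrow> \<exists>s\<in>F. s \<ge> 1 \<and> flow (- s) y \<in> L" by blast
    define T where "T = Max (insert 1 F)"
    have "T \<ge> 1" "\<And>s. s \<in> F \<Longrightarrow> s \<le> T" using F(1) by (simp_all add: T_def)
    then show ?thesis using F(2) by (intro exI[of _ T]) (meson atLeastAtMost_iff)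
  qed
  obtain T where T: "T \<ge> 1" "\<And>y. y \<in> L \<Longrightarrow> \<exists>s\<in>{1..T}. flow (- s) y \<in> L" using hit[OF U(2)] by blast
  define P where "P = {flow s y | s y. s \<in> {- T..0} \<and> y \<in> L}"
  have P: "compactin X P" unfolding P_def by (rule flow_box_compact[OF U(2)])
  have stay: "flow (- r) y \<in> P" if "y \<in> L" "0 \<le> r" "r \<le> real n" for r y n
    using that
  proof (induction n arbitrary: r y)
    case 0
    then have "r = 0" by simp
    then show ?case using 0(1) T(1) unfolding P_def by (intro CollectI exI[of _ "- r"] exI[of _ y]) simp
  next
    case (Suc n)
    show ?case
    proof (cases "r \<le> T")
      case True
      then show ?thesis using Suc.prems unfolding P_def by (intro CollectI exI[of _ "- r"] exI[of _ y]) simp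
    next
      case False
      obtain s where s: "s \<in> {1..T}" "flow (- s) y \<in> L" using T(2)[OF Suc.prems(1)] by blast
      have "flow (- (r - s)) (flow (- s) y) \<in> P"
        using s Suc.prems False by (intro Suc.IH) auto
      then show ?thesis using Suc.prems(1) LX by (subst (asm) flow_flow) auto
    qed
  qed
  then have stay: "flow (- r) y \<in> P" if "y \<in> L" "0 \<le> r" for r y
    using that real_arch_simple[of r] by blast
  have "flow (- s) y \<in> P" if y: "y \<in> P" and s: "s \<ge> 0" for y s
  proof -
    obtain r x where r: "y = flow r x" "r \<in> {- T..0}" "x \<in> L" using y unfolding P_def by blast
    have "flow (- (s - r)) x \<in> P" using r s by (intro stay) auto
    moreover have "flow (- s) y = flow (- (s - r)) x"
      using r LX by (simp only: flow_flow subsetD[OF LX r(3)]) (simp add: algebra_simps)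
    ultimately show ?thesis by simp
  qed
  moreover have "\<exists>S. \<forall>s\<ge>S. \<forall>y\<in>K. flow (- s) y \<in> P" if K: "compactin X K" for K
  proof -
    obtain S where S: "\<And>y. y \<in> K \<Longrightarrow> \<exists>s\<in>{1..S}. flow (- s) y \<in> L" using hit[OF K] by blast
    have "flow (- s) y \<in> P" if s: "S \<le> s" and y: "y \<in> K" for s y
    proof -
      obtain r where r: "r \<in> {1..S}" "flow (- r) y \<in> L" using S[OF y] by blast
      have "flow (- (s - r)) (flow (- r) y) \<in> P" using r s by (intro stay) auto
      moreover have "y \<in> topspace X" using compactin_subset_topspace[OF K] y by blast
      ultimately show ?thesis by (subst (asm) flow_flow) auto
    qed
    then show ?thesis by blast
  qed
  ultimately show ?thesis using P by blast
qed

section \<open>The core as a compact attractor of the reversed flow\<close>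

definition trap :: "'a set" where
  "trap = (SOME P. compactin X P \<and> (\<forall>y\<in>P. \<forall>s\<ge>0. flow (- s) y \<in> P) \<and>
     (\<forall>K. compactin X K \<longrightarrow> (\<exists>S. \<forall>s\<ge>S. \<forall>y\<in>K. flow (- s) y \<in> P)))"

lemma trap_compact: "compactin X trap"
  and trap_forward: "\<And>y s. y \<in> trap \<Longrightarrow> s \<ge> 0 \<Longrightarrow> flow (- s) y \<in> trap"
  and trap_absorbing: "\<And>K. compactin X K \<Longrightarrow> \<exists>S. \<forall>s\<ge>S. \<forall>y\<in>K. flow (- s) y \<in> trap"
  using someI_ex[OF absorbing_exists, folded trap_def] by blast+

lemma core_limit: "y \<in> core X act \<Longrightarrow> y \<in> topspace X \<and> (\<exists>z. limitin X (\<lambda>t. act t y) z at_infinity)"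
  by (simp add: core_def)

lemma flow_limit:
  assumes "limitin X (\<lambda>t. act t y) z at_infinity"
  shows "limitin X (\<lambda>s. flow s y) z at_top"
  unfolding limitin_def
proof (intro conjI allI impI)
  show "z \<in> topspace X" using assms by (simp add: limitin_def)
  fix U assume "openin X U \<and> z \<in> U"
  then have "\<forall>\<^sub>F t in at_infinity. act t y \<in> U" using assms by (simp add: limitin_def)
  moreover have "filterlim (\<lambda>s. complex_of_real (exp s)) at_infinity at_top"
    by (rule filterlim_norm_at_top_imp_at_infinity) (simp add: exp_at_top)
  ultimately show "\<forall>\<^sub>F s in at_top. flow s y \<in> U" by (rule eventually_compose_filterlim)
qed

text \<open>A convergent orbit lies in a compact set, which the reversed flow carries into
  \<open>trap\<close> after some time; going ahead on the orbit by that time and back again shows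
  that the orbit itself is in \<open>trap\<close>. Conversely, bounded orbits converge.\<close>

lemma core_eq: "core X act = {y \<in> topspace X. \<forall>s\<ge>0. flow s y \<in> trap}"
proof (intro equalityI subsetI CollectI conjI allI impI)
  fix y assume "y \<in> core X act"
  then show y: "y \<in> topspace X" using core_limit by blast
  fix s :: real assume "s \<ge> 0"
  obtain z where z: "limitin X (\<lambda>s. flow s y) z at_top"
    using core_limit[OF \<open>y \<in> core X act\<close>] flow_limit by blast
  then have "z \<in> topspace X" by (simp add: limitin_def)
  then obtain W Kz where W: "openin X W" "compactin X Kz" "z \<in> W" "W \<subseteq> Kz"
    using locally_compact unfolding locally_compact_space_def by blast
  then have "\<forall>\<^sub>F s in at_top. flow s y \<in> W" using z by (simp add: limitin_def)
  then obtain S where S: "\<And>s. S \<le> s \<Longrightarrow> flow s y \<in> W" by (auto simp: eventually_at_top_linorder)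
  let ?K = "Kz \<union> {flow r x | r x. r \<in> {0..S} \<and> x \<in> {y}}"
  have K: "compactin X ?K" by (intro compactin_Un W(2) flow_box_compact) (simp add: y)
  have orbit: "flow r y \<in> ?K" if "r \<ge> 0" for r
  proof (cases "S \<le> r")
    case True
    then show ?thesis using S[OF True] W(4) by blast
  next
    case False
    then have "r \<in> {0..S}" using that by simp
    then show ?thesis by blast
  qed
  obtain S' where S': "\<forall>r\<ge>S'. \<forall>y\<in>?K. flow (- r) y \<in> trap" using trap_absorbing[OF K] by blast
  have "flow (- max S' 0) (flow (max S' 0 + s) y) \<in> trap"
    using S' orbit[of "max S' 0 + s"] \<open>s \<ge> 0\<close> by simp
  then show "flow s y \<in> trap" by (simp only: flow_flow[OF y] minus_add_cancel)
next
  fix y assume "y \<in> {y \<in> topspace X. \<forall>s\<ge>0. flow s y \<in> trap}"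
  then show "y \<in> core X act"
    unfolding core_def using bounded_orbit_converges[OF _ trap_compact, of y] by blast
qed

lemma core_subset: "core X act \<subseteq> topspace X"
  by (auto simp: core_def)

lemma trap_closed: "closedin X trap"
  using trap_compact Hausdorff by (intro compactin_imp_closedin)

lemma core_compact: "compactin X (core X act)"
proof (rule closed_compactin[OF trap_compact])
  show "core X act \<subseteq> trap"
  proof
    fix y assume "y \<in> core X act"
    then have "y \<in> topspace X" "flow 0 y \<in> trap" by (simp_all only: core_eq mem_Collect_eq order_refl)
    then show "y \<in> trap" by (simp only: flow_zero)
  qed
  have "core X act = (\<Inter>s\<in>{0..}. {y \<in> topspace X. flow s y \<in> trap})"
    unfolding core_eq by auto
  moreover have "closedin X (\<Inter>s\<in>{0..}. {y \<in> topspace X. flow s y \<in> trap})"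
    by (intro closedin_INT closedin_continuous_map_preimage[OF continuous_map_flow trap_closed]) auto
  ultimately show "closedin X (core X act)" by simp
qed

lemma core_invariant:
  assumes y: "y \<in> core X act" and t: "t \<noteq> 0"
  shows "act t y \<in> core X act"
proof -
  obtain z where z: "limitin X (\<lambda>t. act t y) z at_infinity" and yX: "y \<in> topspace X"
    using core_limit[OF y] by blast
  have "limitin X (\<lambda>u. act u (act t y)) z at_infinity"
    unfolding limitin_def
  proof (intro conjI allI impI)
    show "z \<in> topspace X" using z by (simp add: limitin_def)
    fix U assume "openin X U \<and> z \<in> U"
    then have "\<forall>\<^sub>F t in at_infinity. act t y \<in> U" using z by (simp add: limitin_def)
    then obtain b where b: "\<And>u. b \<le> norm u \<Longrightarrow> act u y \<in> U" by (auto simp: eventually_at_infinity)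
    show "\<forall>\<^sub>F u in at_infinity. act u (act t y) \<in> U"
      unfolding eventually_at_infinity
    proof (intro exI allI impI)
      fix u :: complex assume u: "max (b / norm t) 1 \<le> norm u"
      then have "b \<le> norm (u * t)" using t by (simp add: norm_mult field_simps)
      moreover have "u \<noteq> 0" using u by auto
      ultimately show "act u (act t y) \<in> U" using b t yX by (simp add: act_act)
    qed
  qed
  then show ?thesis unfolding core_def using act_in[OF t yX] by blast
qed

text \<open>Points of the trap outside \<open>U\<close> leave the trap along the flow within a
  bounded time \<open>T\<close>. A point that the reversed flow has brought there from the trap in
  time at least \<open>T\<close> was in the trap all the while, a contradiction.\<close>

lemma attracting:
  assumes U: "openin X U" "core X act \<subseteq> U" and K: "compactin X K"
  shows "\<exists>S\<ge>0. \<forall>s\<ge>S. \<forall>y\<in>K. flow (- s) y \<in> U"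
proof -
  have cmp: "compactin X (trap - U)"
  proof -
    have "compactin X (trap \<inter> (topspace X - U))"
      by (rule compact_Int_closedin[OF trap_compact]) (use U(1) in blast)
    moreover have "trap \<inter> (topspace X - U) = trap - U"
      using compactin_subset_topspace[OF trap_compact] by blast
    ultimately show ?thesis by simp
  qed
  have "\<exists>F. finite F \<and> (\<forall>y\<in>trap - U. \<exists>s\<in>F. s \<ge> 0 \<and> flow s y \<notin> trap)"
  proof (rule compactin_finite_choice[OF cmp])
    fix y assume y: "y \<in> trap - U"
    then have yX: "y \<in> topspace X" using compactin_subset_topspace[OF trap_compact] by blast
    moreover have "y \<notin> core X act" using y U(2) by blast
    ultimately obtain s where s: "s \<ge> 0" "flow s y \<notin> trap" unfolding core_eq by blast
    have "openin X {x \<in> topspace X. flow s x \<in> topspace X - trap}"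
      by (rule openin_flow_preimage) (use trap_closed in blast)
    moreover have "y \<in> {x \<in> topspace X. flow s x \<in> topspace X - trap}"
      using yX s flow_in by simp
    ultimately show "\<exists>s N. openin X N \<and> y \<in> N \<and> (\<forall>x\<in>N. 0 \<le> s \<and> flow s x \<notin> trap)"
      using s(1) by (intro exI[of _ s] exI[of _ "{x \<in> topspace X. flow s x \<in> topspace X - trap}"]) simp
  qed
  then obtain F where F: "finite F" "\<And>y. y \<in> trap - U \<Longrightarrow> \<exists>s\<in>F. s \<ge> 0 \<and> flow s y \<notin> trap" by blast
  define T where "T = Max (insert 0 F)"
  have T: "T \<ge> 0" "\<And>s. s \<in> F \<Longrightarrow> s \<le> T" using F(1) by (simp_all add: T_def)
  have trap_U: "flow (- s) y \<in> U" if s: "s \<ge> T" and y: "y \<in> trap" for s y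
  proof (rule ccontr)
    assume "flow (- s) y \<notin> U"
    then have "flow (- s) y \<in> trap - U" using trap_forward[OF y, of s] s T(1) by simp
    then obtain r where r: "r \<in> F" "r \<ge> 0" "flow r (flow (- s) y) \<notin> trap" using F(2) by blast
    have "y \<in> topspace X" using y compactin_subset_topspace[OF trap_compact] by blast
    then have "flow r (flow (- s) y) = flow (- (s - r)) y" by (simp only: flow_flow) simp
    moreover have "flow (- (s - r)) y \<in> trap" using T(2)[OF r(1)] s by (intro trap_forward[OF y]) simp
    ultimately show False using r(3) by simp
  qed
  obtain S where S: "\<forall>s\<ge>S. \<forall>y\<in>K. flow (- s) y \<in> trap" using trap_absorbing[OF K] by blast
  have "flow (- s) y \<in> U" if s: "s \<ge> T + max S 0" and y: "y \<in> K" for s y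
  proof -
    have "flow (- (s - max S 0)) (flow (- max S 0) y) \<in> U"
      using S y s by (intro trap_U) auto
    moreover have "y \<in> topspace X" using y compactin_subset_topspace[OF K] by blast
    ultimately show ?thesis by (simp only: flow_flow) simp
  qed
  then show ?thesis using T(1) by (intro exI[of _ "T + max S 0"]) simp
qed

section \<open>Neighbourhoods of the core preserved by the reversed flow\<close>

definition forward_kernel :: "'a set \<Rightarrow> 'a set" where
  "forward_kernel U = {y \<in> topspace X. \<forall>s\<ge>0. flow (- s) y \<in> U}"

lemma forward_kernel_subset: "forward_kernel U \<subseteq> U"
proof
  fix y assume "y \<in> forward_kernel U"
  then have "y \<in> topspace X" "flow (- 0) y \<in> U" unfolding forward_kernel_def by (blast, blast)
  then show "y \<in> U" by (simp only: flow_zero minus_zero)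
qed

lemma forward_kernel_flow:
  assumes "y \<in> forward_kernel U" "s \<ge> 0" shows "flow (- s) y \<in> forward_kernel U"
proof -
  have y: "y \<in> topspace X" "\<And>s. s \<ge> 0 \<Longrightarrow> flow (- s) y \<in> U" using assms(1) by (simp_all add: forward_kernel_def)
  have "flow (- r) (flow (- s) y) \<in> U" if "r \<ge> 0" for r
    using y(2)[of "r + s"] assms(2) that by (simp only: flow_flow[OF y(1)]) simp
  then show ?thesis using flow_in[OF y(1)] by (simp add: forward_kernel_def)
qed

lemma core_subset_forward_kernel: "core X act \<subseteq> U \<Longrightarrow> core X act \<subseteq> forward_kernel U"
  using core_invariant core_subset by (fastforce simp: forward_kernel_def)

text \<open>From time \<open>S\<close> on a whole compact neighbourhood of \<open>y\<close> has been
  carried into \<open>U\<close>, so near \<open>y\<close> membership is a condition on a compact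
  interval of times, and such a condition is open.\<close>

lemma openin_forward_kernel:
  assumes U: "openin X U" "core X act \<subseteq> U"
  shows "openin X (forward_kernel U)"
proof (subst openin_subopen, intro ballI)
  fix y assume y: "y \<in> forward_kernel U"
  then have "y \<in> topspace X" by (simp add: forward_kernel_def)
  then obtain V K where V: "openin X V" "compactin X K" "y \<in> V" "V \<subseteq> K"
    using locally_compact unfolding locally_compact_space_def by blast
  obtain S where S: "S \<ge> 0" "\<forall>s\<ge>S. \<forall>y\<in>K. flow (- s) y \<in> U" using attracting[OF U V(2)] by blast
  let ?T = "(\<lambda>s. complex_of_real (exp (- s))) ` {0..S}"
  let ?N = "V \<inter> {x \<in> topspace X. \<forall>t\<in>?T. act t x \<in> U}"
  have "openin X {x \<in> topspace X. \<forall>t\<in>?T. act t x \<in> U}"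
    by (intro openin_act_compact compact_continuous_image continuous_intros U(1)) auto
  then have "openin X ?N" using V(1) by blast
  moreover have "y \<in> ?N" using V(3) y by (auto simp: forward_kernel_def)
  moreover have "?N \<subseteq> forward_kernel U"
  proof
    fix x assume x: "x \<in> ?N"
    have "flow (- s) x \<in> U" if "s \<ge> 0" for s
    proof (cases "S \<le> s")
      case True
      then show ?thesis using S(2) x V(4) by blast
    next
      case False
      then have "s \<in> {0..S}" using that by simp
      then show ?thesis using x by blast
    qed
    then show "x \<in> forward_kernel U" using x by (simp add: forward_kernel_def)
  qed
  ultimately show "\<exists>N. openin X N \<and> y \<in> N \<and> N \<subseteq> forward_kernel U" by blast
qed

text \<open>The support of a chain is compact, so a single time \<open>S\<close> moves all of it
  into the kernel. The homotopy preserves the kernel, so the relative class does not change.\<close>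

lemma forward_kernel_acyclic:
  assumes U: "openin X U" "core X act \<subseteq> U" and c: "singular_relcycle p X (forward_kernel U) c"
  shows "singular_relboundary p X (forward_kernel U) c"
proof -
  let ?U = "forward_kernel U"
  have chain: "singular_chain p X c" using c by (simp add: singular_relcycle)
  define K where "K = (\<Union>f\<in>Poly_Mapping.keys c. f ` standard_simplex p)"
  have "compactin X (f ` standard_simplex p)" if f: "f \<in> Poly_Mapping.keys c" for f
  proof -
    have "singular_simplex p X f" using chain f unfolding singular_chain_def by (auto dest: subsetD)
    then have "continuous_map (subtopology (powertop_real UNIV) (standard_simplex p)) X f"
      by (simp add: singular_simplex_def)
    moreover have "compactin (subtopology (powertop_real UNIV) (standard_simplex p)) (standard_simplex p)"
      using compactin_standard_simplex by (simp add: compactin_subtopology)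
    ultimately show ?thesis by (rule image_compactin[rotated])
  qed
  then have K: "compactin X K" unfolding K_def by (intro compactin_Union) auto
  obtain S where S: "S \<ge> 0" "\<forall>s\<ge>S. \<forall>y\<in>K. flow (- s) y \<in> ?U"
    using attracting[OF openin_forward_kernel[OF U] core_subset_forward_kernel[OF U(2)] K] by blast
  \<comment> \<open>The homotopy starts at \<open>act 1\<close>, which is the identity only on
    points of \<open>X\<close>; this is why \<open>chain_map_id_gen\<close> is used
    afterwards.\<close>
  have hom: "homotopic_with (\<lambda>h. h \<in> ?U \<rightarrow> ?U) X X (act 1) (flow (- S))"
    unfolding homotopic_with_def
  proof (intro exI conjI ballI allI)
    let ?h = "\<lambda>p. flow (- (fst p * S)) (snd p)"
    show "continuous_map (prod_topology (top_of_set {0..1}) X) X ?h"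
    proof (rule continuous_map_act)
      have "continuous_map (prod_topology (top_of_set {0..1::real}) X) euclidean ((\<lambda>s. complex_of_real (exp (- (s * S)))) \<circ> fst)"
        by (rule continuous_map_compose[OF continuous_map_fst]) (auto intro!: continuous_intros)
      then show "continuous_map (prod_topology (top_of_set {0..1}) X) euclidean (\<lambda>p. complex_of_real (exp (- (fst p * S))))"
        by (simp add: o_def)
    qed (auto intro: continuous_map_snd)
  qed (use S(1) forward_kernel_flow in auto)
  have "homologous_rel p X ?U (chain_map p (act 1) c) (chain_map p (flow (- S)) c)"
    by (rule homotopic_imp_homologous_rel_chain_maps[OF hom c])
  moreover have "chain_map p (act 1) c = c" using chain by (rule chain_map_id_gen) (rule act_one)
  moreover have "singular_chain p (subtopology X ?U) (chain_map p (flow (- S)) c)"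
  proof (rule singular_chain_chain_map[of _ "subtopology X K"])
    show "singular_chain p (subtopology X K) c"
      using chain by (auto simp: singular_chain_subtopology K_def)
    show "continuous_map (subtopology X K) (subtopology X ?U) (flow (- S))"
      using S(2) by (auto simp: continuous_map_in_subtopology continuous_map_from_subtopology continuous_map_flow)
  qed
  then have "singular_relboundary p X ?U (chain_map p (flow (- S)) c)"
    by (rule singular_chain_imp_relboundary)
  ultimately show ?thesis
    unfolding homologous_rel_def by (metis diff_add_cancel singular_relboundary_add)
qed

end

section \<open>Local homology of the core\<close>

lemma null_in_subtopology:
  "V \<subseteq> N \<Longrightarrow> U \<subseteq> N \<Longrightarrow> null_in (subtopology X N) V U \<longleftrightarrow> null_in X V U"
  by (simp only: null_in_def subtopology_subtopology Int_absorb1)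

lemma null_in_homeomorphic:
  assumes fg: "homeomorphic_maps X Y f g" and V: "V \<subseteq> topspace X" "U \<subseteq> topspace X" and null: "null_in X V U"
  shows "null_in Y (f ` V) (f ` U)"
  unfolding null_in_def
proof (intro allI impI)
  fix p c assume c: "reduced_cycle p (subtopology Y (f ` V)) c"
  have gf: "g (f x) = x" if "x \<in> topspace X" for x using fg that by (simp add: homeomorphic_maps_def)
  have cont: "continuous_map X Y f" "continuous_map Y X g" using fg by (simp_all add: homeomorphic_maps_def)
  have g: "continuous_map (subtopology Y (f ` V)) (subtopology X V) g"
    using cont(2) gf V(1) by (auto simp: continuous_map_in_subtopology continuous_map_from_subtopology subset_iff)
  have f: "continuous_map (subtopology X U) (subtopology Y (f ` U)) f"
    using cont(1) by (auto simp: continuous_map_in_subtopology continuous_map_from_subtopology)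
  have chain: "singular_chain p (subtopology Y (f ` V)) c" using c by (simp add: reduced_cycle_def)
  have "reduced_cycle p (subtopology X V) (chain_map p g c)"
    unfolding reduced_cycle_def
  proof (intro conjI)
    show "singular_chain p (subtopology X V) (chain_map p g c)"
      by (rule singular_chain_chain_map[OF chain g])
    show "if p = 0 then frag_extend (\<lambda>_. frag_of ()) (chain_map p g c) = 0 else chain_boundary p (chain_map p g c) = 0"
    proof (cases "p = 0")
      case True
      then have "frag_extend (\<lambda>_. frag_of ()) c = 0" using c by (simp add: reduced_cycle_def)
      then show ?thesis using True by (simp add: chain_map_def frag_extend_frag_extend o_def)
    next
      case False
      then have "chain_boundary p c = 0" using c by (simp add: reduced_cycle_def)
      then show ?thesis using False by (simp add: chain_boundary_chain_map[OF chain])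
    qed
  qed
  then obtain d where d: "singular_chain (Suc p) (subtopology X U) d" "chain_boundary (Suc p) d = chain_map p g c"
    using null unfolding null_in_def by blast
  have "chain_boundary (Suc p) (chain_map (Suc p) f d) = chain_map p f (chain_map p g c)"
    using chain_boundary_chain_map[OF d(1)] d(2) by simp
  also have "\<dots> = chain_map p (f \<circ> g) c" by (simp add: chain_map_compose)
  also have "\<dots> = c"
    by (rule chain_map_id_gen[OF chain]) (use gf V(1) in \<open>auto simp: subset_iff\<close>)
  finally show "\<exists>d. singular_chain (Suc p) (subtopology Y (f ` U)) d \<and> chain_boundary (Suc p) d = c"
    using singular_chain_chain_map[OF d(1) f] by blast
qed

context contracting_manifold
begin

abbreviation C :: "'a topology" where "C \<equiv> subtopology X (core X act)"

lemma topspace_core: "topspace C = core X act"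
  using core_subset by (rule topspace_subtopology_subset)

lemma fixed_locus_subset_core: "fixed_locus X act \<subseteq> core X act"
proof
  fix y assume y: "y \<in> fixed_locus X act"
  have "limitin X (\<lambda>t. act t y) y at_infinity"
    unfolding limitin_def
  proof (intro conjI allI impI)
    show "y \<in> topspace X" using y by (simp add: fixed_locus_def)
    fix U assume "openin X U \<and> y \<in> U"
    moreover have "act t y = y" if "1 \<le> norm t" for t
    proof -
      have "t \<noteq> 0" using that by auto
      then show ?thesis using y by (simp add: fixed_locus_def)
    qed
    ultimately have "act t y \<in> U" if "1 \<le> norm t" for t using that by simp
    then show "\<forall>\<^sub>F t in at_infinity. act t y \<in> U" by (auto simp: eventually_at_infinity)
  qed
  then show "y \<in> core X act" using y by (auto simp: core_def fixed_locus_def)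
qed

lemma core_homeomorphic_maps:
  assumes "t \<noteq> 0" shows "homeomorphic_maps C C (act t) (act (inverse t))"
proof -
  have "homeomorphic_maps (subtopology X (core X act)) (subtopology X (core X act)) (act t) (act (inverse t))"
    by (rule homeomorphic_maps_subtopologies_alt[OF homeomorphic_maps_act[OF assms]])
      (use assms core_invariant in auto)
  then show ?thesis .
qed

text \<open>\<open>act u\<close> of the limit is the limit of \<open>act (u * t) y\<close>, which is
  the same limit reparametrised; limits in a Hausdorff space are unique.\<close>

lemma limit_fixed:
  assumes y: "y \<in> topspace X" and z: "limitin X (\<lambda>t. act t y) z at_infinity"
  shows "z \<in> fixed_locus X act"
proof -
  have zX: "z \<in> topspace X" using z by (simp add: limitin_def)
  have "act u z = z" if u: "u \<noteq> 0" for u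
  proof (rule ccontr)
    assume "act u z \<noteq> z"
    then obtain U V where UV: "openin X U" "openin X V" "act u z \<in> U" "z \<in> V" "disjnt U V"
      using Hausdorff act_in[OF u zX] zX unfolding Hausdorff_space_def by blast
    have "limitin X (act u \<circ> (\<lambda>t. act t y)) (act u z) at_infinity"
      by (rule continuous_map_limit[OF continuous_map_act_fixed[OF u] z])
    then have "\<forall>\<^sub>F t in at_infinity. act u (act t y) \<in> U"
      using UV(1,3) by (simp add: limitin_def)
    moreover have "\<forall>\<^sub>F t in at_infinity. act (u * t) y \<in> V"
    proof -
      have "\<forall>\<^sub>F t in at_infinity. act t y \<in> V" using z UV(2,4) by (simp add: limitin_def)
      moreover have "filterlim (\<lambda>t. u * t) at_infinity at_infinity"
        by (rule tendsto_mult_filterlim_at_infinity[OF tendsto_const u filterlim_ident])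
      ultimately show ?thesis by (rule eventually_compose_filterlim)
    qed
    moreover have "\<forall>\<^sub>F t in at_infinity. t \<noteq> (0::complex)" by (rule eventually_not_equal_at_infinity)
    ultimately have "\<forall>\<^sub>F t in at_infinity. act u (act t y) \<in> U \<and> act (u * t) y \<in> V \<and> t \<noteq> 0"
      by (simp only: eventually_conj_iff simp_thms)
    from eventually_happens'[OF trivial_limit_at_infinity this]
    obtain t where "act u (act t y) \<in> U" "act (u * t) y \<in> V" "t \<noteq> 0" by (elim exE conjE)
    then show False using u y UV(5) by (simp add: act_act disjnt_iff)
  qed
  then show ?thesis using zX by (simp add: fixed_locus_def)
qed

lemma HLC_core_iff:
  "HLC C \<longleftrightarrow> (\<forall>F\<in>connected_components_of (subtopology X (fixed_locus X act)).
     \<exists>N. neighbourhood_of C F N \<and> HLC (subtopology C N))"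
proof (intro iffI ballI)
  fix F assume "HLC C" and "F \<in> connected_components_of (subtopology X (fixed_locus X act))"
  then have "F \<subseteq> core X act"
    using connected_components_of_subset fixed_locus_subset_core by fastforce
  then have "neighbourhood_of C F (topspace C)"
    unfolding neighbourhood_of_def using openin_topspace[of C] topspace_core by blast
  moreover have "HLC (subtopology C (topspace C))"
    using \<open>HLC C\<close> by (simp only: subtopology_topspace)
  ultimately show "\<exists>N. neighbourhood_of C F N \<and> HLC (subtopology C N)" by blast
next
  assume local: "\<forall>F\<in>connected_components_of (subtopology X (fixed_locus X act)).
     \<exists>N. neighbourhood_of C F N \<and> HLC (subtopology C N)"
  show "HLC C"
    unfolding HLC_iff_null_in
  proof (intro ballI allI impI)
    fix y U assume yC: "y \<in> topspace C" and "neighbourhood_of C {y} U"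
    then obtain W0 where W0: "openin C W0" "y \<in> W0" "W0 \<subseteq> U" and U: "U \<subseteq> topspace C"
      by (auto simp: neighbourhood_of_def)
    have y: "y \<in> core X act" using yC topspace_core by simp
    obtain z where yX: "y \<in> topspace X" and z: "limitin X (\<lambda>t. act t y) z at_infinity"
      using core_limit[OF y] by blast
    have "z \<in> topspace (subtopology X (fixed_locus X act))"
      using limit_fixed[OF yX z] by (auto simp: fixed_locus_def)
    then obtain F where F: "F \<in> connected_components_of (subtopology X (fixed_locus X act))" "z \<in> F"
      by (metis Union_connected_components_of UnionE)
    obtain N W where N: "N \<subseteq> topspace C" "openin C W" "F \<subseteq> W" "W \<subseteq> N" "HLC (subtopology C N)"
      using bspec[OF local F(1)] by (auto simp: neighbourhood_of_def)
    obtain W' where W': "openin X W'" "W = W' \<inter> core X act" using N(2) by (auto simp: openin_subtopology)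
    have "z \<in> W'" using F(2) N(3) W'(2) by blast
    then have "\<forall>\<^sub>F t in at_infinity. act t y \<in> W'" using z W'(1) by (simp add: limitin_def)
    then have "\<forall>\<^sub>F t in at_infinity. act t y \<in> W' \<and> t \<noteq> 0"
      using eventually_not_equal_at_infinity by (rule eventually_conj)
    from eventually_happens'[OF trivial_limit_at_infinity this]
    obtain t where t: "act t y \<in> W'" "t \<noteq> 0" by (elim exE conjE)
    note hom = core_homeomorphic_maps[OF t(2)]
    have inv: "act (inverse t) (act t x) = x" if "x \<in> topspace C" for x
      using hom that by (simp add: homeomorphic_maps_def)
    \<comment> \<open>Intersecting with the image of \<open>W0\<close> ensures that moving back by
      \<open>act (inverse t)\<close> ends in \<open>U\<close>.\<close>
    let ?a = "act t y" and ?O = "W \<inter> act t ` W0"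
    have "openin C (act t ` W0)"
      using homeomorphic_map_openness[of C C "act t" W0] openin_subset[OF W0(1)] W0(1) hom
      by (meson homeomorphic_maps_map)
    then have O: "openin C ?O" using N(2) by blast
    have a: "?a \<in> ?O" using t W'(2) core_invariant[OF y] W0(2) by blast
    have "?O \<inter> N = ?O" using N(4) by blast
    then have "openin (subtopology C N) ?O" using openin_subtopology_Int[OF O, of N] by (simp only:)
    moreover have aN: "?a \<in> topspace (subtopology C N)" using a N(1,4) by auto
    ultimately have "neighbourhood_of (subtopology C N) {?a} ?O"
      unfolding neighbourhood_of_def using a openin_subset[of "subtopology C N" ?O] by blast
    then obtain V where V: "neighbourhood_of (subtopology C N) {?a} V" "V \<subseteq> ?O" "null_in (subtopology C N) V ?O"
      using N(5) aN unfolding HLC_iff_null_in by meson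
    obtain V1 where V1: "openin (subtopology C N) V1" "?a \<in> V1" "V1 \<subseteq> V"
      using V(1) by (auto simp: neighbourhood_of_def)
    \<comment> \<open>\<open>V1\<close> is open in \<open>N\<close>, which need not be open itself;
      it is open in the core because it lies in the open set \<open>W\<close> inside
      \<open>N\<close>.\<close>
    have "openin C V1"
    proof -
      obtain T where T: "openin C T" "V1 = T \<inter> N" using V1(1) by (auto simp: openin_subtopology)
      then have "V1 = T \<inter> W" using V1(3) V(2) N(4) by blast
      then show ?thesis using T(1) N(2) by blast
    qed
    have sub: "V \<subseteq> N" "?O \<subseteq> N" using V(2) N(4) by blast+
    have "null_in C V ?O"
      using V(3) sub by (simp only: null_in_subtopology)
    from null_in_homeomorphic[OF hom[THEN homeomorphic_maps_sym[THEN iffD1]] _ _ this]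
    have null: "null_in C (act (inverse t) ` V) (act (inverse t) ` ?O)"
      using sub N(1) by blast
    have OU: "act (inverse t) ` ?O \<subseteq> U"
    proof
      fix x assume "x \<in> act (inverse t) ` ?O"
      then obtain w where "w \<in> W0" "x = act (inverse t) (act t w)" by blast
      then show "x \<in> U" using inv W0(3) openin_subset[OF W0(1)] by (simp add: subset_iff)
    qed
    let ?V = "act (inverse t) ` V"
    have VU: "?V \<subseteq> U" by (rule order_trans[OF image_mono[OF V(2)] OU])
    have "openin C (act (inverse t) ` V1)"
      using homeomorphic_map_openness[of C C "act (inverse t)" V1] openin_subset[OF \<open>openin C V1\<close>] \<open>openin C V1\<close> hom
      by (meson homeomorphic_maps_map)
    moreover have "y \<in> act (inverse t) ` V1" using inv[OF yC] V1(2) by (metis imageI)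
    ultimately have "neighbourhood_of C {y} ?V"
      unfolding neighbourhood_of_def
      using order_trans[OF VU U] image_mono[OF V1(3), of "act (inverse t)"]
      by (intro conjI exI[of _ "act (inverse t) ` V1"]) simp_all
    then show "\<exists>V. neighbourhood_of C {y} V \<and> V \<subseteq> U \<and> null_in C V U"
      using VU null_in_mono[OF null order_refl OU] by (intro exI[of _ ?V]) simp
  qed
qed

end

theorem proposition3p17:
  fixes X :: "'a topology" and A :: "('a, 'e::real_normed_vector) chart set"
    and \<omega> :: "('a, 'e) two_form" and J :: "('a, 'e) endo_field" and act :: "'a Cstar_action"
    and G :: "('g, 'm) monoid_scheme"
  assumes "symplectic_Cstar_manifold X A \<omega> J act"
    and "contracting X A act"
    and "comm_group G"
  shows "let C = subtopology X (core X act) in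
     (\<forall>p. singular_cohomology_group p X G \<cong> AS_cohomology_group p C G \<and>
          AS_cohomology_group p C G \<cong> Cech_cohomology_group p C G) \<and>
     (HLC C \<longrightarrow>
        (\<forall>p. singular_cohomology_group p X G \<cong> singular_cohomology_group p C G \<and>
             AS_cohomology_group p C G \<cong> singular_cohomology_group p C G \<and>
             Cech_cohomology_group p C G \<cong> singular_cohomology_group p C G)) \<and>
     (HLC C \<longleftrightarrow>
        (\<forall>F\<in>connected_components_of (subtopology X (fixed_locus X act)).
           \<exists>N. neighbourhood_of C F N \<and> HLC (subtopology C N)))"
proof -
  interpret manifold X A
    using assms(1) by (intro manifold.intro) (simp add: symplectic_Cstar_manifold_def)
  interpret contracting_manifold X A \<omega> J act
    by unfold_locales (rule assms)+
  have X_AS: "singular_cohomology_group p X G \<cong> AS_cohomology_group p C G" for p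
  proof (rule metrizable_singular_iso_AS[OF metrizable core_compact HLC assms(3)])
    fix U assume U: "openin X U" "core X act \<subseteq> U"
    show "\<exists>U'. openin X U' \<and> core X act \<subseteq> U' \<and> U' \<subseteq> U \<and>
        (\<forall>p c. singular_relcycle p X U' c \<longrightarrow> singular_relboundary p X U' c)"
      using openin_forward_kernel[OF U] core_subset_forward_kernel[OF U(2)] forward_kernel_subset
        forward_kernel_acyclic[OF U] by blast
  qed
  have metC: "metrizable_space C" by (rule metrizable_space_subtopology[OF metrizable])
  have cmpC: "compact_space C" by (rule compact_space_subtopology[OF core_compact])
  have AS_Cech: "AS_cohomology_group p C G \<cong> Cech_cohomology_group p C G" for p
    by (rule compact_metrizable_AS_iso_Cech[OF metC cmpC assms(3)])
  \<comment> \<open>The comparison with the core both as ambient space and as compact subset: a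
    space has no homology relative to itself.\<close>
  have C_AS: "singular_cohomology_group p C G \<cong> AS_cohomology_group p C G" if "HLC C" for p
  proof -
    have "singular_cohomology_group p C G \<cong> AS_cohomology_group p (subtopology C (topspace C)) G"
    proof (rule metrizable_singular_iso_AS[OF metC _ that assms(3)])
      show "compactin C (topspace C)" using cmpC by (simp only: compact_space_def)
      fix U assume U: "openin C U" "topspace C \<subseteq> U"
      have "singular_relboundary p C (topspace C) c" if "singular_relcycle p C (topspace C) c" for p c
        using that by (intro singular_chain_imp_relboundary) (simp only: subtopology_topspace singular_relcycle)
      then show "\<exists>U'. openin C U' \<and> topspace C \<subseteq> U' \<and> U' \<subseteq> U \<and>
          (\<forall>p c. singular_relcycle p C U' c \<longrightarrow> singular_relboundary p C U' c)"
        using U(2) by (intro exI[of _ "topspace C"]) blast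
    qed
    then show ?thesis by (simp only: subtopology_topspace)
  qed
  interpret comm_group G by (rule assms(3))
  interpret sing: singular_cochains G C ..
  have "group (singular_cohomology_group p C G)" for p
    unfolding singular_cohomology_group_def by (rule sing.complex.group_cohomology)
  then have AS_C: "AS_cohomology_group p C G \<cong> singular_cohomology_group p C G"
    and Cech_C: "Cech_cohomology_group p C G \<cong> singular_cohomology_group p C G" if "HLC C" for p
    using group.iso_sym C_AS[OF that] iso_trans[OF C_AS[OF that] AS_Cech] by blast+
  show ?thesis
    unfolding Let_def
    using X_AS AS_Cech AS_C Cech_C iso_trans[OF X_AS AS_C] HLC_core_iff by blast
qed

end
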